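(* Let $\mathcal X=[0,1]^d$ and $M>0$. The neural estimator $\hat{\mathsf H}^2_{\mathcal G_n}(X^n,Y^n)$ of the squared Hellinger distance is minimax rate-optimal over the class $\mathcal P^2_{\mathsf H^2}(M,\mathcal X)$ with $\mathcal G_n=\tilde{\mathcal G}^{\mathsf R}_{n,M^{-1/2}}(M)$, and over the class $\mathcal P^2_{\mathsf H^2,\mathsf B}(M,\mathcal X)$ with $\mathcal G_n=\tilde{\mathcal G}^{\mathsf S}_{n,M^{-1/2}}(M)$, achieving in each case the $O(n^{-1/2})$ minimax risk. Further (relevant to the case when $M$ is unknown), the same neural estimator achieves $\tilde O(n^{-1/2})$ risk over the respective class when, in the network class, $M$ is replaced with $\log n$ and $M^{-1/2}$ with $(\log n)^{-1}$, i.e. with $\mathcal G_n=\tilde{\mathcal G}^{\mathsf R}_{n,(\log n)^{-1}}(\log n)$ for $\mathcal P^2_{\mathsf H^2}(M,\mathcal X)$ and $\mathcal G_n=\tilde{\mathcal G}^{\mathsf S}_{n,(\log n)^{-1}}(\log n)$ for $\mathcal P^2_{\mathsf H^2,\mathsf B}(M,\mathcal X)$.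
   Context: Distance and classes of distributions: for $\mu\ll\nu$, $\mathsf H^2(\mu,\nu)=\mathbb E_\nu\big[(\sqrt{d\mu/d\nu}-1)^2\big]$ (no factor $1/2$). $\mathcal P^2_{\mathsf H^2}(\mathcal X)$ is the set of pairs $(\mu,\nu)$ of Borel probability measures on $\mathcal X$ with $\mu\ll\nu$; $f_{\mathsf H^2}=1-(\frac{d\mu}{d\nu})^{-1/2}$. $\eta$ denotes a probability measure dominating $\mu$ and $\nu$, e.g. $(\mu+\nu)/2$, and $\|\cdot\|_{\infty,\eta}$ is the $\eta$-essential supremum norm. $\mathcal P^2_{\mathsf H^2}(M,\mathcal X)=\{(\mu,\nu)\in\mathcal P^2_{\mathsf H^2}(\mathcal X):c^\star_{\mathsf{KB}}(f_{\mathsf H^2},\mathcal X)\vee\|\frac{d\mu}{d\nu}\|_{\infty,\eta}\le M\}$; $\mathcal P^2_{\mathsf H^2,\mathsf B}(M,\mathcal X)$ is defined the same way with $c^\star_{\mathsf B}$ in place of $c^\star_{\mathsf{KB}}$. Coefficients: $\|\mathcal X\|:=\sup_{x\in\mathcal X}\|x\|_\infty$. For $\tilde f:\mathbb R^d\to\mathbb R$ with a Fourier representation $\tilde f(x)=\int_{\mathbb R^d}e^{i\omega\cdot x}F(d\omega)$, $F$ a complex Borel measure with magnitude $|F|$, let $S_m(\tilde f)=\int_{\mathbb R^d}\|\omega\|_1^m|F|(d\omega)$. For $f:\mathcal X\to\mathbb R$: $c^\star_{\mathsf{KB}}(f,\mathcal X)$ is the infimum of $c\ge0$ such that some such $\tilde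 f$ satisfies $\tilde f|_{\mathcal X}=f$, $\|\mathcal X\|S_2(\tilde f)\le c$, $|\tilde f(0)|\le c$, $\|\nabla\tilde f(0)\|_1\le c$; $c^\star_{\mathsf B}(f,\mathcal X)$ is the infimum of $c\ge 0$ such that some such $\tilde f$ satisfies $\tilde f|_{\mathcal X}=f$, $\|\mathcal X\|S_1(\tilde f)\le c$, $|\tilde f(0)|\le c$. Neural networks: $\mathcal G_k(a_1,a_2,a_3,a_4,\phi)$ is the set of $g(x)=\sum_{i=1}^k\beta_i\phi(w_i\cdot x+b_i)+w_0\cdot x+b_0$ on $\mathbb R^d$ with $\|w_i\|_1\vee|b_i|\le a_1$, $|\beta_i|\le a_2$ ($1\le i\le k$), $|b_0|\le a_3$, $\|w_0\|_1\le a_4$. $\phi_{\mathsf S}(z)=(1+e^{-z})^{-1}$, $\phi_{\mathsf R}(z)=\max\{z,0\}$. For $t>0$, $\tilde{\mathcal G}_{k,t}(\mathbf a,\phi)=\{x\mapsto\min\{1-t,\tilde g(x)\}:\tilde g\in\mathcal G_k(\mathbf a,\phi)\}$; $\tilde{\mathcal G}^{\mathsf R}_{k,t}(a)=\tilde{\mathcal G}_{k,t}(1,2k^{-1}a,a,a,\phi_{\mathsf R})$; $\tilde{\mathcal G}^{\mathsf S}_{k,t}(a)=\tilde{\mathcal G}_{k,t}(k^{1/2}\log k,2k^{-1}a,a,0,\phi_{\mathsf S})$. Estimator: $\hat{\mathsf H}^2_{\mathcal G}(X^n,Y^n)=\sup_{g\in\mathcal G}\frac1n\sum_{i=1}^n\Big[g(X_i)-\frac{g(Y_i)}{1-g(Y_i)}\Big]$,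 where $X^n=(X_1,\dots,X_n)$ is i.i.d. from $\mu$ and $Y^n=(Y_1,\dots,Y_n)$ is i.i.d. from $\nu$. Risk: the risk of an estimator $\hat{\mathsf D}$ over a class $\mathcal Q$ of pairs is $\sup_{(\mu,\nu)\in\mathcal Q}\mathbb E\big[|\hat{\mathsf D}(X^n,Y^n)-\mathsf H^2(\mu,\nu)|\big]$, and the minimax risk over $\mathcal Q$ is the infimum of this over all estimators based on $(X^n,Y^n)$. An estimator is minimax rate-optimal over $\mathcal Q$ if its risk over $\mathcal Q$ is of the same order in $n$ as the minimax risk over $\mathcal Q$ (here the order is $n^{-1/2}$). Constants implied by $O$ and $\tilde O$ may depend on $M$ and $d$; $\tilde O$ hides factors logarithmic in $n$.
   Formalization: Minimax rate-optimality is claimed for M ≠ 1 and the exact n^{-1/2} minimax order for M > 1: at M = 1 the class has only μ = ν, so the minimax risk is 0 while the neural estimator's risk is positive; for M < 1 the class is empty. The O and Õ risk bounds hold for all M > 0. *)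

theory Defs
  imports "HOL-Probability.Probability"
begin

section \<open>Complex Borel measures and Fourier representations\<close>

definition norm1 :: "real ^ 'd \<Rightarrow> real" where
  "norm1 w = (\<Sum>j\<in>UNIV. \<bar>w $ j\<bar>)"

definition set_norm :: "(real ^ 'd) set \<Rightarrow> real" where
  "set_norm X = (SUP x\<in>X. infnorm x)"

definition complex_borel_measure :: "('a::topological_space set \<Rightarrow> complex) \<Rightarrow> bool" where
  "complex_borel_measure F \<longleftrightarrow> F {} = 0 \<and>
     (\<forall>E. range E \<subseteq> sets borel \<longrightarrow> disjoint_family E \<longrightarrow>
        (\<lambda>i. F (E i)) sums F (\<Union>i::nat. E i))"

text \<open>The total variation, i.e. the magnitude \<open>|F|\<close>, as a supremum over countable Borel partitions.\<close>

definition variation :: "('a::topological_space set \<Rightarrow> complex) \<Rightarrow> 'a set \<Rightarrow> ennreal" where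
  "variation F A =
     (SUP E\<in>{E. range E \<subseteq> sets borel \<and> disjoint_family E \<and> (\<Union>i::nat. E i) = A}.
        \<Sum>i. ennreal (cmod (F (E i))))"

definition magnitude :: "('a::topological_space set \<Rightarrow> complex) \<Rightarrow> 'a measure" where
  "magnitude F = measure_of UNIV (sets borel) (variation F)"

text \<open>Polar decomposition \<open>dF = h d|F|\<close> with \<open>|h| = 1\<close>. Such an \<open>h\<close> exists for every complex
  measure \<open>F\<close> and is unique up to \<open>|F|\<close>-null sets; the integral of \<open>g\<close> with respect to \<open>F\<close> is by
  definition the integral of \<open>g h\<close> with respect to \<open>|F|\<close>.\<close>

definition polar_density :: "('a::topological_space set \<Rightarrow> complex) \<Rightarrow> ('a \<Rightarrow> complex) \<Rightarrow> bool" where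
  "polar_density F h \<longleftrightarrow> integrable (magnitude F) h \<and> (\<forall>w. cmod (h w) = 1) \<and>
     (\<forall>A\<in>sets borel. F A = (LINT w:A|magnitude F. h w))"

definition fourier_rep :: "(real ^ 'd \<Rightarrow> real) \<Rightarrow> ((real ^ 'd) set \<Rightarrow> complex) \<Rightarrow> bool" where
  "fourier_rep f F \<longleftrightarrow> complex_borel_measure F \<and>
     (\<exists>h. polar_density F h \<and>
        (\<forall>x. complex_of_real (f x) =
               (LINT w|magnitude F. exp (\<i> * complex_of_real (w \<bullet> x)) * h w)))"

text \<open>By uniqueness of the Fourier representation this depends only on the function represented
  by \<open>F\<close>.\<close>

definition fourier_moment :: "nat \<Rightarrow> ((real ^ 'd) set \<Rightarrow> complex) \<Rightarrow> ennreal" where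
  "fourier_moment m F = (\<integral>\<^sup>+ w. ennreal (norm1 w ^ m) \<partial>magnitude F)"

text \<open>Both coefficients are \<open>\<infinity>\<close> if no admissible extension exists.\<close>

definition c_KB :: "(real ^ 'd \<Rightarrow> real) \<Rightarrow> (real ^ 'd) set \<Rightarrow> ereal" where
  "c_KB f X = Inf (ereal ` {c. 0 \<le> c \<and>
     (\<exists>f' F G. fourier_rep f' F \<and> (\<forall>x\<in>X. f' x = f x) \<and>
        ennreal (set_norm X) * fourier_moment 2 F \<le> ennreal c \<and>
        \<bar>f' 0\<bar> \<le> c \<and> (GDERIV f' 0 :> G) \<and> norm1 G \<le> c)})"

definition c_B :: "(real ^ 'd \<Rightarrow> real) \<Rightarrow> (real ^ 'd) set \<Rightarrow> ereal" where
  "c_B f X = Inf (ereal ` {c. 0 \<le> c \<and>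
     (\<exists>f' F. fourier_rep f' F \<and> (\<forall>x\<in>X. f' x = f x) \<and>
        ennreal (set_norm X) * fourier_moment 1 F \<le> ennreal c \<and>
        \<bar>f' 0\<bar> \<le> c)})"


section \<open>Squared Hellinger distance and classes of distributions\<close>

definition hellinger2 :: "'a measure \<Rightarrow> 'a measure \<Rightarrow> real" where
  "hellinger2 \<mu> \<nu> = (LINT x|\<nu>. (sqrt (enn2real (RN_deriv \<nu> \<mu> x)) - 1)\<^sup>2)"

definition borel_prob_on :: "'a::topological_space set \<Rightarrow> 'a measure \<Rightarrow> bool" where
  "borel_prob_on X \<mu> \<longleftrightarrow> prob_space \<mu> \<and> sets \<mu> = sets (restrict_space borel X)"

text \<open>\<open>absolutely_continuous \<nu> \<mu>\<close> says that \<open>\<mu>\<close> is dominated by \<open>\<nu>\<close>.\<close>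

definition P2_H2 :: "'a::topological_space set \<Rightarrow> ('a measure \<times> 'a measure) set" where
  "P2_H2 X = {(\<mu>, \<nu>). borel_prob_on X \<mu> \<and> borel_prob_on X \<nu> \<and> absolutely_continuous \<nu> \<mu>}"

text \<open>The density of \<open>\<mu>\<close> with respect to \<open>\<nu>\<close> is determined only \<open>\<nu>\<close>-almost everywhere, whereas the
  coefficients refer to values on all of \<open>X\<close>; the classes therefore ask for some version of it.
  It must be positive on \<open>X\<close> for \<open>f_H2\<close> to be real-valued there.\<close>

definition density_version ::
  "'a::topological_space set \<Rightarrow> 'a measure \<Rightarrow> 'a measure \<Rightarrow> ('a \<Rightarrow> real) \<Rightarrow> bool" where
  "density_version X \<mu> \<nu> p \<longleftrightarrow> p \<in> borel_measurable (restrict_space borel X) \<and>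
     (\<forall>x\<in>X. 0 < p x) \<and> (AE x in \<nu>. RN_deriv \<nu> \<mu> x = ennreal (p x))"

definition f_H2 :: "('a \<Rightarrow> real) \<Rightarrow> 'a \<Rightarrow> real" where
  "f_H2 p x = 1 - p x powr (- 1 / 2)"

text \<open>On \<open>P2_H2 X\<close> the measure \<open>\<nu>\<close> dominates both \<open>\<mu>\<close> and \<open>\<nu>\<close> (and has the same null sets as
  \<open>(\<mu> + \<nu>) / 2\<close>), so the essential supremum is taken with respect to \<open>\<nu>\<close>.\<close>

definition P2_H2_KB :: "real \<Rightarrow> (real ^ 'd) set \<Rightarrow> ((real ^ 'd) measure \<times> (real ^ 'd) measure) set" where
  "P2_H2_KB M X = {(\<mu>, \<nu>) \<in> P2_H2 X. \<exists>p. density_version X \<mu> \<nu> p \<and>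
     max (c_KB (f_H2 p) X) (esssup \<nu> (\<lambda>x. ereal (p x))) \<le> ereal M}"

definition P2_H2_B :: "real \<Rightarrow> (real ^ 'd) set \<Rightarrow> ((real ^ 'd) measure \<times> (real ^ 'd) measure) set" where
  "P2_H2_B M X = {(\<mu>, \<nu>) \<in> P2_H2 X. \<exists>p. density_version X \<mu> \<nu> p \<and>
     max (c_B (f_H2 p) X) (esssup \<nu> (\<lambda>x. ereal (p x))) \<le> ereal M}"


section \<open>Neural networks\<close>

definition phi_S :: "real \<Rightarrow> real" where
  "phi_S z = inverse (1 + exp (- z))"

definition phi_R :: "real \<Rightarrow> real" where
  "phi_R z = max z 0"

definition net_class ::
  "nat \<Rightarrow> real \<Rightarrow> real \<Rightarrow> real \<Rightarrow> real \<Rightarrow> (real \<Rightarrow> real) \<Rightarrow> (real ^ 'd \<Rightarrow> real) set" where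
  "net_class k a1 a2 a3 a4 \<phi> =
     {g. \<exists>\<beta> w b w0 b0.
        (\<forall>i\<in>{1..k}. max (norm1 (w i)) \<bar>b i\<bar> \<le> a1 \<and> \<bar>\<beta> i\<bar> \<le> a2) \<and>
        \<bar>b0\<bar> \<le> a3 \<and> norm1 w0 \<le> a4 \<and>
        g = (\<lambda>x. (\<Sum>i=1..k. \<beta> i * \<phi> (w i \<bullet> x + b i)) + w0 \<bullet> x + b0)}"

definition trunc_class :: "real \<Rightarrow> ('a \<Rightarrow> real) set \<Rightarrow> ('a \<Rightarrow> real) set" where
  "trunc_class t G = (\<lambda>g x. min (1 - t) (g x)) ` G"

definition relu_class :: "nat \<Rightarrow> real \<Rightarrow> real \<Rightarrow> (real ^ 'd \<Rightarrow> real) set" where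
  "relu_class k t a = trunc_class t (net_class k 1 (2 * a / real k) a a phi_R)"

definition sigmoid_class :: "nat \<Rightarrow> real \<Rightarrow> real \<Rightarrow> (real ^ 'd \<Rightarrow> real) set" where
  "sigmoid_class k t a =
     trunc_class t (net_class k (sqrt (real k) * ln (real k)) (2 * a / real k) a 0 phi_S)"


section \<open>Estimators and risks\<close>

text \<open>An estimator acts on the pair of samples \<open>(X\<^sub>1,\<dots>,X\<^sub>n)\<close>, \<open>(Y\<^sub>1,\<dots>,Y\<^sub>n)\<close>, encoded as functions on
  \<open>{1..n}\<close>.\<close>

type_synonym 'a estimator = "(nat \<Rightarrow> 'a) \<times> (nat \<Rightarrow> 'a) \<Rightarrow> real"

definition neural_H2 :: "nat \<Rightarrow> ('a \<Rightarrow> real) set \<Rightarrow> 'a estimator" where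
  "neural_H2 n G = (\<lambda>(x, y). SUP g\<in>G.
     (1 / real n) * (\<Sum>i=1..n. g (x i) - g (y i) / (1 - g (y i))))"

definition estimators :: "'a::topological_space set \<Rightarrow> nat \<Rightarrow> 'a estimator set" where
  "estimators X n = borel_measurable
     ((\<Pi>\<^sub>M i\<in>{1..n}. restrict_space borel X) \<Otimes>\<^sub>M (\<Pi>\<^sub>M i\<in>{1..n}. restrict_space borel X))"

text \<open>The two samples are independent of each other.\<close>

definition sample_law ::
  "nat \<Rightarrow> 'a measure \<Rightarrow> 'a measure \<Rightarrow> ((nat \<Rightarrow> 'a) \<times> (nat \<Rightarrow> 'a)) measure" where
  "sample_law n \<mu> \<nu> = (\<Pi>\<^sub>M i\<in>{1..n}. \<mu>) \<Otimes>\<^sub>M (\<Pi>\<^sub>M i\<in>{1..n}. \<nu>)"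

definition risk :: "('a measure \<times> 'a measure) set \<Rightarrow> nat \<Rightarrow> 'a estimator \<Rightarrow> ennreal" where
  "risk Q n T =
     (SUP (\<mu>, \<nu>)\<in>Q. \<integral>\<^sup>+ z. ennreal \<bar>T z - hellinger2 \<mu> \<nu>\<bar> \<partial>sample_law n \<mu> \<nu>)"

definition minimax_risk ::
  "'a::topological_space set \<Rightarrow> ('a measure \<times> 'a measure) set \<Rightarrow> nat \<Rightarrow> ennreal" where
  "minimax_risk X Q n = (INF T\<in>estimators X n. risk Q n T)"

text \<open>Landau symbols for sequences with values in the extended nonnegative reals.\<close>

definition order_le :: "(nat \<Rightarrow> ennreal) \<Rightarrow> (nat \<Rightarrow> ennreal) \<Rightarrow> bool" where
  "order_le r s \<longleftrightarrow> (\<exists>C::real. \<forall>\<^sub>F n in sequentially. r n \<le> ennreal C * s n)"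

definition same_order :: "(nat \<Rightarrow> ennreal) \<Rightarrow> (nat \<Rightarrow> ennreal) \<Rightarrow> bool" where
  "same_order r s \<longleftrightarrow> order_le r s \<and> order_le s r"

definition order_le_log :: "(nat \<Rightarrow> ennreal) \<Rightarrow> (nat \<Rightarrow> ennreal) \<Rightarrow> bool" where
  "order_le_log r s \<longleftrightarrow>
     (\<exists>(C::real) (q::nat). \<forall>\<^sub>F n in sequentially. r n \<le> ennreal (C * ln (real n) ^ q) * s n)"

text \<open>Measurability of the estimators is part of the following notions; without it the expectation
  defining the risk would not be meaningful.\<close>

definition achieves_O ::
  "'a::topological_space set \<Rightarrow> ('a measure \<times> 'a measure) set \<Rightarrow> (nat \<Rightarrow> 'a estimator) \<Rightarrow>
     (nat \<Rightarrow> ennreal) \<Rightarrow> bool" where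
  "achieves_O X Q T r \<longleftrightarrow>
     (\<forall>\<^sub>F n in sequentially. T n \<in> estimators X n) \<and> order_le (\<lambda>n. risk Q n (T n)) r"

definition achieves_O_log ::
  "'a::topological_space set \<Rightarrow> ('a measure \<times> 'a measure) set \<Rightarrow> (nat \<Rightarrow> 'a estimator) \<Rightarrow>
     (nat \<Rightarrow> ennreal) \<Rightarrow> bool" where
  "achieves_O_log X Q T r \<longleftrightarrow>
     (\<forall>\<^sub>F n in sequentially. T n \<in> estimators X n) \<and> order_le_log (\<lambda>n. risk Q n (T n)) r"

definition minimax_rate_optimal ::
  "'a::topological_space set \<Rightarrow> ('a measure \<times> 'a measure) set \<Rightarrow> (nat \<Rightarrow> 'a estimator) \<Rightarrow> bool" where
  "minimax_rate_optimal X Q T \<longleftrightarrow>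
     (\<forall>\<^sub>F n in sequentially. T n \<in> estimators X n) \<and>
     same_order (\<lambda>n. risk Q n (T n)) (minimax_risk X Q)"

definition root_rate :: "nat \<Rightarrow> ennreal" where
  "root_rate n = ennreal (real n powr (- 1 / 2))"

end

theory Submission
  imports Defs
begin

text \<open>Upper bound. The population objective at a network \<open>g\<close> lies below the squared Hellinger distance by
  \<open>\<integral> p (f - g)\<^sup>2 / (1 - g) d\<nu>\<close> with \<open>f = 1 - p\<^sup>-\<^sup>1\<^sup>/\<^sup>2\<close>, hence by a quantity quadratic in the \<open>L\<^sup>2(\<mu>)\<close>
  approximation error, which is of order \<open>n\<^sup>-\<^sup>1\<^sup>/\<^sup>2\<close> in the Barron classes. The stochastic error is bounded
  by symmetrization, contraction and the Rademacher complexity of a single neuron. A monotone activation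
  is an average of indicators of half-spaces, so the size of the inner weights, which grows with
  \<open>n\<close> for the sigmoid, plays no role, and chaining over half-spaces gives \<open>n\<^sup>-\<^sup>1\<^sup>/\<^sup>2\<close> without a logarithm.

  Lower bound. Two pairs of three-point distributions with the same density \<open>p\<close> but slightly different
  mass where \<open>p = 1\<close> cannot be told apart, while their distances differ by the order \<open>n\<^sup>-\<^sup>1\<^sup>/\<^sup>2\<close>.\<close>

section \<open>Sign averages and the Rademacher complexity of half-spaces\<close>

text \<open>Expected suprema over uncountable network classes raise measurability questions. They
  are met by bounding maxima over finite subfamilies, with a constant independent of the subfamily,
  and passing to a dense sequence of parameters by monotone convergence. Random signs are not random
  variables here either: \<open>sign_avg\<close> is a finite recursion, so contraction and
  symmetrization are inductions that peel off one sign.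

  For each fixed sign pattern, every neuron, coordinate and constant is dominated by a multiple of
  one quantity, \<open>halfspace_max\<close>, and only this one is averaged. The rate without
  logarithm rests on a packing bound for half-space traces that does not involve the sample size.

  The coefficients are infima, so a representation with a slightly larger constant is approximated
  and the network is then shrunk by the factor 1 / (1 + 1 / n).

  All upper bounds keep the truncation level \<open>t\<close> and the size \<open>a\<close> free and
  are polynomial in \<open>a\<close> and 1 / t; the variant with ln n is then the same estimate. The
  lower bound uses a cosine, whose Fourier measure has two atoms, so that both coefficients can be
  bounded explicitly.\<close>

primrec sign_avg :: "nat \<Rightarrow> ((nat \<Rightarrow> real) \<Rightarrow> real) \<Rightarrow> real" where
  "sign_avg 0 \<Phi> = \<Phi> (\<lambda>_. 0)"
| "sign_avg (Suc n) \<Phi> =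
     (sign_avg n (\<lambda>s. \<Phi> (s(Suc n := 1))) + sign_avg n (\<lambda>s. \<Phi> (s(Suc n := -1)))) / 2"

lemma sign_avg_mono: "(\<And>s. \<Phi> s \<le> \<Psi> s) \<Longrightarrow> sign_avg n \<Phi> \<le> sign_avg n \<Psi>"
proof (induction n arbitrary: \<Phi> \<Psi>)
  case (Suc n)
  have "sign_avg n (\<lambda>s. \<Phi> (s(Suc n := 1))) \<le> sign_avg n (\<lambda>s. \<Psi> (s(Suc n := 1)))"
       "sign_avg n (\<lambda>s. \<Phi> (s(Suc n := -1))) \<le> sign_avg n (\<lambda>s. \<Psi> (s(Suc n := -1)))"
    by (rule Suc.IH, rule Suc.prems)+
  then show ?case by simp
qed simp

lemma sign_avg_add: "sign_avg n (\<lambda>s. \<Phi> s + \<Psi> s) = sign_avg n \<Phi> + sign_avg n \<Psi>"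
proof (induction n arbitrary: \<Phi> \<Psi>)
  case (Suc n)
  show ?case by (simp add: Suc.IH add_divide_distrib)
qed simp

lemma sign_avg_cmult: "sign_avg n (\<lambda>s. c * \<Phi> s) = c * sign_avg n \<Phi>"
proof (induction n arbitrary: \<Phi>)
  case (Suc n)
  show ?case by (simp add: Suc.IH algebra_simps add_divide_distrib)
qed simp

lemma sign_avg_sum: "sign_avg n (\<lambda>s. \<Sum>k\<in>A. \<Phi> k s) = (\<Sum>k\<in>A. sign_avg n (\<Phi> k))"
proof (induction n arbitrary: \<Phi>)
  case (Suc n)
  show ?case by (simp add: Suc.IH sum.distrib sum_divide_distrib[symmetric])
qed simp

section \<open>Exponential moments of sign sums\<close>

lemma exp_sign_avg_le: "exp (sign_avg n \<Phi>) \<le> sign_avg n (\<lambda>s. exp (\<Phi> s))"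
proof (induction n arbitrary: \<Phi>)
  case (Suc n)
  \<comment> \<open>Midpoint convexity of exp; Jensen's inequality for \<open>sign_avg\<close> is
    its iteration over the signs.\<close>
  have conv: "exp ((a + b) / 2) \<le> (exp a + exp b) / 2" for a b :: real
  proof -
    have "0 \<le> (exp (a/2) - exp (b/2))\<^sup>2" by simp
    moreover have "exp (a/2) * exp (a/2) = exp a" "exp (b/2) * exp (b/2) = exp b"
      "exp (a/2) * exp (b/2) = exp ((a+b)/2)"
      by (simp_all flip: exp_add add: add_divide_distrib)
    ultimately show ?thesis by (simp add: power2_eq_square algebra_simps)
  qed
  show ?case
    using conv[of "sign_avg n (\<lambda>s. \<Phi> (s(Suc n := 1)))" "sign_avg n (\<lambda>s. \<Phi> (s(Suc n := -1)))"]
      Suc.IH[of "\<lambda>s. \<Phi> (s(Suc n := 1))"] Suc.IH[of "\<lambda>s. \<Phi> (s(Suc n := -1))"]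
    by simp
qed simp

text \<open>Weaker than the sharp exp (x^2 / 2), but elementary: up to 1 the quadratic estimates of
  the two exponentials average to 1 + x^2, and beyond 1 both exponentials are at most exp (x^2).
  Only constants are lost.\<close>

lemma cosh_le_exp_square: "(exp x + exp (- x)) / 2 \<le> exp (x\<^sup>2)" for x :: real
proof -
  have main: "(exp y + exp (- y)) / 2 \<le> exp (y\<^sup>2)" if y: "0 \<le> y" for y :: real
  proof (cases "y \<le> 1")
    case True
    have 1: "exp y \<le> 1 + y + y\<^sup>2" using exp_bound[OF y True] .
    have "exp (- y) = 1 / exp y" by (simp add: exp_minus divide_inverse)
    also have "\<dots> \<le> 1 / (1 + y)" using y by (intro divide_left_mono) (auto simp: add.commute)
    also have "\<dots> \<le> 1 - y + y\<^sup>2"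
    proof -
      have "(1 - y + y\<^sup>2) * (1 + y) = 1 + y ^ 3" by (simp add: power2_eq_square power3_eq_cube algebra_simps)
      then have "1 \<le> (1 - y + y\<^sup>2) * (1 + y)" using y by simp
      then show ?thesis using y by (simp add: divide_le_eq)
    qed
    finally have "(exp y + exp (- y)) / 2 \<le> 1 + y\<^sup>2" using 1 by simp
    also have "\<dots> \<le> exp (y\<^sup>2)" by (rule exp_ge_add_one_self)
    finally show ?thesis .
  next
    case False
    then have "exp (- y) \<le> exp y" "exp y \<le> exp (y\<^sup>2)" by (auto simp: power2_eq_square)
    then have "exp y + exp (- y) \<le> exp (y\<^sup>2) * 2" by linarith
    then show ?thesis by simp
  qed
  show ?thesis
    using main[of x] main[of "- x"] by (cases "0 \<le> x") (auto simp: add.commute)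
qed

text \<open>The sub-Gaussian exponential moment of a sign sum. The offset \<open>c\<close> serves
  the induction: fixing the last sign moves its term into \<open>c\<close>.\<close>

lemma sign_avg_exp_le:
  "sign_avg n (\<lambda>s. exp (c + (\<Sum>i=1..n. s i * v i))) \<le> exp (c + (\<Sum>i=1..n. (v i)\<^sup>2))"
proof (induction n arbitrary: c)
  case (Suc n)
  have "sign_avg (Suc n) (\<lambda>s. exp (c + (\<Sum>i=1..Suc n. s i * v i))) =
      (sign_avg n (\<lambda>s. exp ((c + v (Suc n)) + (\<Sum>i=1..n. s i * v i))) +
       sign_avg n (\<lambda>s. exp ((c - v (Suc n)) + (\<Sum>i=1..n. s i * v i)))) / 2"
    (is "_ = (sign_avg n ?A + sign_avg n ?B) / 2")
  proof -
    have upd: "(\<Sum>i=1..Suc n. (s(Suc n := e)) i * v i) = (\<Sum>i=1..n. s i * v i) + e * v (Suc n)" for s :: "nat \<Rightarrow> real" and e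
    proof -
      have "(\<Sum>i=1..n. (s(Suc n := e)) i * v i) = (\<Sum>i=1..n. s i * v i)" by (rule sum.cong) auto
      then show ?thesis by simp
    qed
    show ?thesis by (simp only: sign_avg.simps upd) (simp add: algebra_simps)
  qed
  also have "\<dots> \<le> (exp (c + v (Suc n) + (\<Sum>i=1..n. (v i)\<^sup>2)) + exp (c - v (Suc n) + (\<Sum>i=1..n. (v i)\<^sup>2))) / 2"
    using Suc.IH[of "c + v (Suc n)"] Suc.IH[of "c - v (Suc n)"] by simp
  also have "\<dots> = exp (c + (\<Sum>i=1..n. (v i)\<^sup>2)) * ((exp (v (Suc n)) + exp (- v (Suc n))) / 2)"
    by (simp add: exp_add exp_diff exp_minus field_simps)
  also have "\<dots> \<le> exp (c + (\<Sum>i=1..n. (v i)\<^sup>2)) * exp ((v (Suc n))\<^sup>2)"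
    by (intro mult_left_mono cosh_le_exp_square) simp
  finally show ?case by (simp add: exp_add algebra_simps)
qed simp

text \<open>Massart's finite class bound: Jensen moves the exponential inside, and the maximum of
  exponentials is at most their sum. The parameter \<open>l\<close> stays free because chaining
  balances it differently at each scale.\<close>

lemma sign_avg_Max_le:
  fixes v :: "'f \<Rightarrow> nat \<Rightarrow> real"
  assumes F: "finite F" "F \<noteq> {}" and l: "l > 0"
    and v: "\<And>f. f \<in> F \<Longrightarrow> (\<Sum>i=1..n. (v f i)\<^sup>2) \<le> B"
  shows "sign_avg n (\<lambda>s. Max ((\<lambda>f. \<Sum>i=1..n. s i * v f i) ` F)) \<le> ln (card F) / l + l * B"
proof -
  let ?\<Phi> = "\<lambda>s. Max ((\<lambda>f. \<Sum>i=1..n. s i * v f i) ` F)"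
  have "exp (l * sign_avg n ?\<Phi>) = exp (sign_avg n (\<lambda>s. l * ?\<Phi> s))"
    by (simp add: sign_avg_cmult)
  also have "\<dots> \<le> sign_avg n (\<lambda>s. exp (l * ?\<Phi> s))" by (rule exp_sign_avg_le)
  also have "\<dots> \<le> sign_avg n (\<lambda>s. \<Sum>f\<in>F. exp (0 + (\<Sum>i=1..n. s i * (l * v f i))))"
  proof (rule sign_avg_mono)
    fix s
    have "?\<Phi> s \<in> (\<lambda>f. \<Sum>i=1..n. s i * v f i) ` F" using F by (intro Max_in) auto
    then obtain f where f: "f \<in> F" "?\<Phi> s = (\<Sum>i=1..n. s i * v f i)" by auto
    have "exp (l * ?\<Phi> s) = exp (0 + (\<Sum>i=1..n. s i * (l * v f i)))"
      by (simp only: f sum_distrib_left) (simp add: algebra_simps)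
    also have "\<dots> \<le> (\<Sum>f\<in>F. exp (0 + (\<Sum>i=1..n. s i * (l * v f i))))"
      by (rule member_le_sum[OF f(1)]) (use F in auto)
    finally show "exp (l * ?\<Phi> s) \<le> (\<Sum>f\<in>F. exp (0 + (\<Sum>i=1..n. s i * (l * v f i))))" .
  qed
  also have "\<dots> \<le> (\<Sum>f\<in>F. exp (0 + (\<Sum>i=1..n. (l * v f i)\<^sup>2)))"
    unfolding sign_avg_sum by (intro sum_mono sign_avg_exp_le)
  also have "\<dots> \<le> (\<Sum>f\<in>F. exp (l\<^sup>2 * B))"
  proof (rule sum_mono)
    fix f assume f: "f \<in> F"
    have "(\<Sum>i=1..n. (l * v f i)\<^sup>2) = l\<^sup>2 * (\<Sum>i=1..n. (v f i)\<^sup>2)"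
      by (simp add: sum_distrib_left power_mult_distrib)
    also have "\<dots> \<le> l\<^sup>2 * B" using v[OF f] by (intro mult_left_mono) auto
    finally show "exp (0 + (\<Sum>i=1..n. (l * v f i)\<^sup>2)) \<le> exp (l\<^sup>2 * B)" by simp
  qed
  also have "\<dots> = exp (ln (card F) + l\<^sup>2 * B)" using F by (simp add: exp_add card_gt_0_iff)
  finally have "l * sign_avg n ?\<Phi> \<le> ln (card F) + l\<^sup>2 * B" by simp
  then have "sign_avg n ?\<Phi> \<le> (ln (card F) + l\<^sup>2 * B) / l"
    using l by (simp add: field_simps)
  also have "\<dots> = ln (card F) / l + l * B" using l by (simp add: field_simps power2_eq_square)
  finally show ?thesis .
qed

section \<open>Counting and packing the traces of half-spaces\<close>

text \<open>Homogeneous half-spaces; affine ones arise by appending a coordinate 1 to the points.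
  The restriction to \<open>W\<close> is there for the recursion on the dimension.\<close>

definition halfspace_traces :: "(nat \<Rightarrow> 'e::euclidean_space) \<Rightarrow> nat \<Rightarrow> 'e set \<Rightarrow> nat set set" where
  "halfspace_traces z m W = (\<lambda>w. {i\<in>{1..m}. w \<bullet> z i > 0}) ` W"

lemma halfspace_traces_Pow: "halfspace_traces z m W \<subseteq> Pow {1..m}"
  unfolding halfspace_traces_def by auto

lemma finite_halfspace_traces [simp]: "finite (halfspace_traces z m W)"
  by (rule finite_subset[OF halfspace_traces_Pow]) simp

text \<open>Cover's recursion: if a trace on the first \<open>m\<close> points extends in both ways to the next point,
  then interpolating between two witnesses gives a witness orthogonal to that point.\<close>

lemma card_halfspace_traces:
  fixes z :: "nat \<Rightarrow> 'e::euclidean_space"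
  assumes "subspace W"
  shows "card (halfspace_traces z m W) \<le> (m + 1) ^ dim W"
  using assms
proof (induction m arbitrary: W)
  case 0
  have "halfspace_traces z 0 W \<subseteq> {{}}" unfolding halfspace_traces_def by auto
  then have "card (halfspace_traces z 0 W) \<le> card {{}::nat set}" by (intro card_mono) auto
  then show ?case by simp
next
  case (Suc m)
  define W0 where "W0 = {w\<in>W. w \<bullet> z (Suc m) = 0}"
  define P where "P = halfspace_traces z m W"
  define P' where "P' = halfspace_traces z (Suc m) W"
  define Q where "Q = {S\<in>P. S \<in> P' \<and> insert (Suc m) S \<in> P'}"
  have finP: "finite P" unfolding P_def by simp
  have S: "{i\<in>{1..Suc m}. w \<bullet> z i > 0} =
      (if w \<bullet> z (Suc m) > 0 then insert (Suc m) {i\<in>{1..m}. w \<bullet> z i > 0} else {i\<in>{1..m}. w \<bullet> z i > 0})" for w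
    by (auto simp: le_Suc_eq)
  have notin: "Suc m \<notin> S" if "S \<in> P" for S using that unfolding P_def halfspace_traces_def by auto
  \<comment> \<open>Removing the index \<open>Suc m\<close> maps \<open>P'\<close> into
    \<open>P\<close>, and exactly the traces in \<open>Q\<close> have two preimages.\<close>
  have card1: "card P' \<le> card P + card Q"
  proof -
    have "P' \<subseteq> {S\<in>P. S \<in> P'} \<union> insert (Suc m) ` {S\<in>P. insert (Suc m) S \<in> P'}"
      unfolding P_def P'_def halfspace_traces_def S by (auto simp: image_iff)
    then have "card P' \<le> card ({S\<in>P. S \<in> P'} \<union> insert (Suc m) ` {S\<in>P. insert (Suc m) S \<in> P'})"
      using finP by (intro card_mono) auto
    also have "\<dots> \<le> card {S\<in>P. S \<in> P'} + card (insert (Suc m) ` {S\<in>P. insert (Suc m) S \<in> P'})"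
      by (rule card_Un_le)
    also have "\<dots> \<le> card {S\<in>P. S \<in> P'} + card {S\<in>P. insert (Suc m) S \<in> P'}"
      using finP by (intro add_left_mono card_image_le) auto
    also have "\<dots> = card ({S\<in>P. S \<in> P'} \<union> {S\<in>P. insert (Suc m) S \<in> P'}) +
        card ({S\<in>P. S \<in> P'} \<inter> {S\<in>P. insert (Suc m) S \<in> P'})"
      using finP by (intro card_Un_Int) auto
    also have "{S\<in>P. S \<in> P'} \<inter> {S\<in>P. insert (Suc m) S \<in> P'} = Q" unfolding Q_def by auto
    also have "card ({S\<in>P. S \<in> P'} \<union> {S\<in>P. insert (Suc m) S \<in> P'}) \<le> card P"
      using finP by (intro card_mono) auto
    finally show ?thesis by simp
  qed
  have Q: "Q \<subseteq> halfspace_traces z m W0"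
  proof
    fix T assume T: "T \<in> Q"
    then have nT: "Suc m \<notin> T" using notin unfolding Q_def by auto
    from T obtain u where u: "u \<in> W" "T = {i\<in>{1..Suc m}. u \<bullet> z i > 0}"
      unfolding Q_def P'_def halfspace_traces_def by auto
    from T obtain w where w: "w \<in> W" "insert (Suc m) T = {i\<in>{1..Suc m}. w \<bullet> z i > 0}"
      unfolding Q_def P'_def halfspace_traces_def by auto
    define a where "a = w \<bullet> z (Suc m)"
    \<comment> \<open>\<open>b\<close> may vanish, since traces record only strict positivity;
      \<open>a\<close> cannot. This suffices for \<open>y\<close> to have the trace of
      \<open>u\<close> on the first \<open>m\<close> points, where \<open>u\<close> and
      \<open>w\<close> are positive at the same indices.\<close>
    define b where "b = - (u \<bullet> z (Suc m))"
    have a: "a > 0" using w(2) unfolding a_def by auto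
    have b: "b \<ge> 0" using nT u(2) unfolding b_def by force
    define y where "y = a *\<^sub>R u + b *\<^sub>R w"
    have "y \<in> W" unfolding y_def
      by (intro subspace_add subspace_scale Suc.prems u w)
    moreover have "y \<bullet> z (Suc m) = 0"
      unfolding y_def a_def b_def by (simp add: inner_add_left inner_diff_left)
    ultimately have yW: "y \<in> W0" unfolding W0_def by simp
    have "u \<bullet> z i > 0 \<longleftrightarrow> y \<bullet> z i > 0" if i: "i \<in> {1..m}" for i
    proof -
      have iff: "u \<bullet> z i > 0 \<longleftrightarrow> w \<bullet> z i > 0"
      proof -
        have "i \<in> {1..Suc m}" "i \<noteq> Suc m" using i by auto
        then have "u \<bullet> z i > 0 \<longleftrightarrow> i \<in> T" "w \<bullet> z i > 0 \<longleftrightarrow> i \<in> insert (Suc m) T"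
          by (simp_all only: w(2), simp_all add: u(2))
        then show ?thesis using \<open>i \<noteq> Suc m\<close> by simp
      qed
      have "y \<bullet> z i = a * (u \<bullet> z i) + b * (w \<bullet> z i)" unfolding y_def by (simp add: inner_add_left)
      then show ?thesis
        using a b iff by (smt (verit) mult_nonneg_nonneg mult_nonneg_nonpos mult_pos_pos)
    qed
    then have "T = {i\<in>{1..m}. y \<bullet> z i > 0}" using u(2) nT S[of u] by (auto split: if_splits)
    then show "T \<in> halfspace_traces z m W0" unfolding halfspace_traces_def using yW by auto
  qed
  have sub0: "subspace W0" using Suc.prems unfolding W0_def subspace_def by (auto simp: inner_add_left)
  show ?case
  proof (cases "W0 = W")
    \<comment> \<open>If \<open>W\<close> is orthogonal to the new point, no trace contains
      \<open>Suc m\<close>; nothing splits, and the old exponent still works.\<close>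
    case True
    have "Q = {}"
    proof (rule ccontr)
      assume "Q \<noteq> {}"
      then obtain T where "insert (Suc m) T \<in> P'" unfolding Q_def by auto
      then obtain w where "w \<in> W" "insert (Suc m) T = {i\<in>{1..Suc m}. w \<bullet> z i > 0}"
        unfolding P'_def halfspace_traces_def by auto
      then have "w \<in> W0" "w \<bullet> z (Suc m) > 0" using True by auto
      then show False unfolding W0_def by auto
    qed
    then have "card P' \<le> (m + 1) ^ dim W" using card1 Suc.IH[OF Suc.prems] unfolding P_def by simp
    also have "\<dots> \<le> (Suc m + 1) ^ dim W" by (intro power_mono) auto
    finally show ?thesis unfolding P'_def .
  next
    case False
    then have "W0 \<subset> W" unfolding W0_def by auto
    then have "dim W0 < dim W"
      using dim_psubset[of W0 W] sub0 Suc.prems by (simp add: span_eq_iff[THEN iffD2])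
    then obtain D where D: "dim W = Suc D" "dim W0 \<le> D" by (metis less_Suc_eq_le not0_implies_Suc not_less0)
    have "card Q \<le> card (halfspace_traces z m W0)" by (intro card_mono Q) simp
    also have "\<dots> \<le> (m + 1) ^ dim W0" by (rule Suc.IH[OF sub0])
    also have "\<dots> \<le> (m + 1) ^ D" using D by (intro power_increasing) auto
    finally have "card P' \<le> (m + 1) ^ Suc D + (m + 1) ^ D"
      using card1 Suc.IH[OF Suc.prems] D unfolding P_def by simp
    also have "\<dots> = (m + 1) ^ D * (m + 2)" by (simp add: algebra_simps)
    also have "\<dots> \<le> (m + 2) ^ D * (m + 2)" by (intro mult_right_mono power_mono) auto
    finally show ?thesis unfolding P'_def using D by (simp add: mult.commute)
  qed
qed


text \<open>Probabilistic method as a count: of the n^m ways to draw \<open>m\<close> indices with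
  replacement, at most ((1 - e) n)^m miss the symmetric difference of a given pair. By
  \<open>small\<close>, the union over all pairs does not exhaust the draws, so some draw separates
  every pair.\<close>

lemma separating_sample:
  assumes T: "finite \<T>" "\<T> \<subseteq> Pow {1..n}" and n: "n \<ge> 1" and e: "0 < e" "e \<le> 1"
    and sep: "\<And>S T. S \<in> \<T> \<Longrightarrow> T \<in> \<T> \<Longrightarrow> S \<noteq> T \<Longrightarrow> e * real n \<le> card (sym_diff S T)"
    and small: "(real (card \<T>))\<^sup>2 * (1 - e) ^ m < 1"
  obtains \<tau> where "\<tau> \<in> {1..m} \<rightarrow> {1..n}" "inj_on (\<lambda>S. {k\<in>{1..m}. \<tau> k \<in> S}) \<T>"
proof (rule ccontr)
  assume "\<not> thesis"
  with that have no: "\<not> inj_on (\<lambda>S. {k\<in>{1..m}. \<tau> k \<in> S}) \<T>" if "\<tau> \<in> {1..m} \<rightarrow> {1..n}" for \<tau>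
    using \<open>\<tau> \<in> {1..m} \<rightarrow> {1..n}\<close> by blast
  define \<Omega> where "\<Omega> = {1..m} \<rightarrow>\<^sub>E {1..n}"
  define bad where "bad = (\<lambda>p. {1..m} \<rightarrow>\<^sub>E ({1..n} - sym_diff (fst p) (snd p)))"
  define I where "I = {p\<in>\<T> \<times> \<T>. fst p \<noteq> snd p}"
  have finI: "finite I" unfolding I_def using T by auto
  have finbad: "finite (bad p)" for p unfolding bad_def by (intro finite_PiE) auto
  have "\<Omega> \<subseteq> (\<Union>p\<in>I. bad p)"
  proof
    fix \<tau> assume \<tau>: "\<tau> \<in> \<Omega>"
    then have "\<tau> \<in> {1..m} \<rightarrow> {1..n}" unfolding \<Omega>_def by auto
    from no[OF this] obtain S T where ST: "S \<in> \<T>" "T \<in> \<T>" "S \<noteq> T"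
      "{k\<in>{1..m}. \<tau> k \<in> S} = {k\<in>{1..m}. \<tau> k \<in> T}" unfolding inj_on_def by blast
    have "\<tau> k \<notin> sym_diff S T" if "k \<in> {1..m}" for k using ST(4) that by blast
    then have "\<tau> \<in> bad (S, T)" using \<tau> unfolding bad_def \<Omega>_def by (auto simp: PiE_iff)
    then show "\<tau> \<in> (\<Union>p\<in>I. bad p)" using ST unfolding I_def by force
  qed
  then have "card \<Omega> \<le> card (\<Union>p\<in>I. bad p)" using finI finbad by (intro card_mono) auto
  also have "\<dots> \<le> (\<Sum>p\<in>I. card (bad p))" by (rule card_UN_le[OF finI])
  finally have "real (card \<Omega>) \<le> (\<Sum>p\<in>I. real (card (bad p)))" by (metis of_nat_le_iff of_nat_sum)
  also have "\<dots> \<le> (\<Sum>p\<in>I. ((1 - e) * n) ^ m)"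
  proof (rule sum_mono)
    fix p assume p: "p \<in> I"
    have "fst p \<in> \<T>" "snd p \<in> \<T>" using p unfolding I_def by auto
    then have "fst p \<subseteq> {1..n}" "snd p \<subseteq> {1..n}" using T(2) by auto
    then have sub: "sym_diff (fst p) (snd p) \<subseteq> {1..n}" by blast
    have "real (card ({1..n} - sym_diff (fst p) (snd p))) = real n - card (sym_diff (fst p) (snd p))"
      using card_Diff_subset[OF finite_subset[OF sub] sub] card_mono[OF _ sub] by (simp add: of_nat_diff)
    also have "\<dots> \<le> (1 - e) * n"
      using sep[of "fst p" "snd p"] p unfolding I_def by (auto simp: algebra_simps)
    finally have "real (card ({1..n} - sym_diff (fst p) (snd p))) ^ m \<le> ((1 - e) * n) ^ m"
      by (intro power_mono) auto
    then show "real (card (bad p)) \<le> ((1 - e) * n) ^ m"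
      unfolding bad_def by (simp add: card_PiE)
  qed
  also have "\<dots> = real (card I) * ((1 - e) * n) ^ m" by simp
  also have "\<dots> \<le> (real (card \<T>))\<^sup>2 * ((1 - e) * n) ^ m"
  proof (rule mult_right_mono)
    have "card I \<le> card (\<T> \<times> \<T>)" unfolding I_def using T by (intro card_mono) auto
    then have "real (card I) \<le> real (card (\<T> \<times> \<T>))" by (simp only: of_nat_le_iff)
    then show "real (card I) \<le> (real (card \<T>))\<^sup>2"
      by (simp add: card_cartesian_product power2_eq_square)
  qed (use e in auto)
  also have "\<dots> = (real (card \<T>))\<^sup>2 * (1 - e) ^ m * real n ^ m" by (simp add: power_mult_distrib)
  also have "\<dots> < 1 * real n ^ m" using n by (intro mult_strict_right_mono small) auto
  also have "\<dots> = real (card \<Omega>)" unfolding \<Omega>_def by (simp add: card_PiE)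
  finally show False by simp
qed

text \<open>The packing number is polynomial in 1 / e and free of \<open>n\<close>. A sample of
  about 2 ln N / e indices already tells the N members apart, so Cover's count is applied to that
  sample instead of to all \<open>n\<close> points; the resulting inequality for ln N bounds
  itself.\<close>

lemma ln_card_packing:
  fixes z :: "nat \<Rightarrow> 'e::euclidean_space"
  assumes T: "\<T> \<subseteq> halfspace_traces z n UNIV" "\<T> \<noteq> {}" and n: "n \<ge> 1" and e: "0 < e" "e \<le> 1"
    and sep: "\<And>S T. S \<in> \<T> \<Longrightarrow> T \<in> \<T> \<Longrightarrow> S \<noteq> T \<Longrightarrow> e * real n \<le> card (sym_diff S T)"
  shows "ln (card \<T>) \<le> 2 * real DIM('e) * (ln (1 / e) + ln (4 * real DIM('e)))"
proof -
  have fin: "finite \<T>" using T(1) by (rule finite_subset) simp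
  then have N: "card \<T> \<ge> 1" using T(2) by (simp add: Suc_leI card_gt_0_iff)
  define L where "L = ln (card \<T>)"
  define D where "D = real DIM('e)"
  have D: "D \<ge> 1" unfolding D_def by (simp add: Suc_leI)
  have L: "L \<ge> 0" unfolding L_def using N by simp
  \<comment> \<open>Just above 2 L / e, so that (1 - e)^m < exp (- 2 L), the inverse square of the
    cardinality.\<close>
  define m where "m = nat \<lfloor>2 * L / e\<rfloor> + 1"
  have m: "real m \<le> 2 * L / e + 1" "2 * L / e < real m"
    unfolding m_def using L e by (auto simp: of_nat_nat) linarith
  have "(1 - e) ^ m \<le> exp (- e) ^ m"
    using e exp_ge_add_one_self[of "- e"] by (intro power_mono) auto
  also have "\<dots> = exp (- (e * m))" by (simp add: exp_of_nat_mult[symmetric] mult.commute)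
  also have "\<dots> < exp (- (2 * L))" using m(2) e by (simp add: field_simps)
  also have "\<dots> = 1 / (real (card \<T>))\<^sup>2"
  proof -
    have "exp L = real (card \<T>)" unfolding L_def using N by simp
    then show ?thesis by (simp add: exp_minus exp_double divide_inverse)
  qed
  finally have "(real (card \<T>))\<^sup>2 * (1 - e) ^ m < 1" using N by (simp add: field_simps)
  moreover have "\<T> \<subseteq> Pow {1..n}" using T(1) halfspace_traces_Pow by (rule order_trans)
  ultimately obtain \<tau> where \<tau>: "\<tau> \<in> {1..m} \<rightarrow> {1..n}" "inj_on (\<lambda>S. {k\<in>{1..m}. \<tau> k \<in> S}) \<T>"
    using separating_sample[OF fin _ n e sep] by blast
  have "(\<lambda>S. {k\<in>{1..m}. \<tau> k \<in> S}) ` \<T> \<subseteq> halfspace_traces (z \<circ> \<tau>) m UNIV"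
  proof
    fix R assume "R \<in> (\<lambda>S. {k\<in>{1..m}. \<tau> k \<in> S}) ` \<T>"
    then obtain w where "R = {k\<in>{1..m}. \<tau> k \<in> {i\<in>{1..n}. w \<bullet> z i > 0}}"
      using T(1) unfolding halfspace_traces_def by blast
    then have "R = {k\<in>{1..m}. w \<bullet> (z \<circ> \<tau>) k > 0}" using \<tau>(1) by auto
    then show "R \<in> halfspace_traces (z \<circ> \<tau>) m UNIV" unfolding halfspace_traces_def by auto
  qed
  then have "card \<T> \<le> card (halfspace_traces (z \<circ> \<tau>) m UNIV)"
    using \<tau>(2) by (metis card_image card_mono finite_halfspace_traces)
  also have "\<dots> \<le> (m + 1) ^ dim (UNIV :: 'e set)" by (rule card_halfspace_traces) (rule subspace_UNIV)
  finally have "real (card \<T>) \<le> real (m + 1) ^ DIM('e)" by (simp only: dim_UNIV of_nat_le_iff flip: of_nat_power)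
  then have "L \<le> ln (real (m + 1) ^ DIM('e))" unfolding L_def using N by (subst ln_le_cancel_iff) auto
  also have "\<dots> = D * ln (real (m + 1))" unfolding D_def by (subst ln_realpow) auto
  also have "\<dots> \<le> D * ln ((2 * L + 2) / e)"
  proof -
    have "1 \<le> 1 / e" using e by simp
    then have "real (m + 1) \<le> (2 * L + 2) / e" using m(1) by (simp add: add_divide_distrib)
    then show ?thesis using D by (intro mult_left_mono) auto
  qed
  \<comment> \<open>The scale 4 D is chosen so that the last logarithm, once linearized and
    multiplied by \<open>D\<close>, costs only L / 2, which the left side absorbs.\<close>
  also have "ln ((2 * L + 2) / e) = ln (1 / e) + ln (4 * D) + ln ((2 * L + 2) / (4 * D))"
    using L e D by (simp add: ln_div ln_mult)
  also have "\<dots> \<le> ln (1 / e) + ln (4 * D) + ((2 * L + 2) / (4 * D) - 1)"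
    using L D by (intro add_left_mono ln_le_minus_one) auto
  finally have "L \<le> D * (ln (1 / e) + ln (4 * D) + ((2 * L + 2) / (4 * D) - 1))"
    using D by (simp add: mult_left_mono)
  also have "\<dots> = D * (ln (1 / e) + ln (4 * D)) + L / 2 + 1 / 2 - D" using D by (simp add: field_simps)
  finally have "L \<le> 2 * (D * (ln (1 / e) + ln (4 * D)))" using D by linarith
  then show ?thesis unfolding L_def D_def by (simp add: mult.assoc)
qed

text \<open>A separated subfamily that cannot be enlarged is also a net, and \<open>\<pi>\<close>
  picks a near member. The guard \<open>S \<noteq> \<pi> S\<close> covers members that are their own
  image, whatever the sign of \<open>r\<close>.\<close>

lemma maximal_packing:
  assumes "finite \<S>" "\<S> \<noteq> {}"
  obtains \<T> \<pi> where "\<T> \<subseteq> \<S>" "\<T> \<noteq> {}"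
    "\<And>S T. S \<in> \<T> \<Longrightarrow> T \<in> \<T> \<Longrightarrow> S \<noteq> T \<Longrightarrow> r \<le> real (card (sym_diff S T))"
    "\<And>S. S \<in> \<S> \<Longrightarrow> \<pi> S \<in> \<T>" "\<And>S. S \<in> \<S> \<Longrightarrow> S \<noteq> \<pi> S \<Longrightarrow> real (card (sym_diff S (\<pi> S))) < r"
proof -
  define Q where "Q = {\<T>. \<T> \<subseteq> \<S> \<and> (\<forall>S\<in>\<T>. \<forall>T\<in>\<T>. S \<noteq> T \<longrightarrow> r \<le> real (card (sym_diff S T)))}"
  have "finite Q" unfolding Q_def using assms(1) by auto
  moreover have "{} \<in> Q" unfolding Q_def by auto
  ultimately obtain \<T> where T: "\<T> \<in> Q" and mx: "\<And>U. U \<in> Q \<Longrightarrow> \<T> \<subseteq> U \<Longrightarrow> \<T> = U"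
    by (metis finite_has_maximal empty_iff)
  have "\<exists>T\<in>\<T>. S \<noteq> T \<longrightarrow> card (sym_diff S T) < r" if S: "S \<in> \<S>" for S
  proof (rule ccontr)
    assume "\<not> ?thesis"
    then have far: "\<And>T. T \<in> \<T> \<Longrightarrow> S \<noteq> T \<and> r \<le> card (sym_diff S T)" by force
    then have "insert S \<T> \<in> Q" using T S unfolding Q_def by (auto simp: Un_commute)
    then have "S \<in> \<T>" using mx by blast
    then show False using far by blast
  qed
  then obtain \<pi> where \<pi>: "\<And>S. S \<in> \<S> \<Longrightarrow> \<pi> S \<in> \<T> \<and> (S \<noteq> \<pi> S \<longrightarrow> card (sym_diff S (\<pi> S)) < r)"
    by metis
  then have "\<T> \<noteq> {}" using assms(2) by blast
  moreover have "\<T> \<subseteq> \<S>" "\<And>S T. S \<in> \<T> \<Longrightarrow> T \<in> \<T> \<Longrightarrow> S \<noteq> T \<Longrightarrow> r \<le> real (card (sym_diff S T))"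
    using T unfolding Q_def by auto
  ultimately show ?thesis using that[of \<T> \<pi>] \<pi> by simp
qed

section \<open>Chaining over half-spaces\<close>

text \<open>With A = 2 D (ln 4 + ln (4 D)) this is 11 A + 5: the coarsest scale contributes A + 1
  and all chaining links together 10 A + 4.\<close>

definition halfspace_const :: "nat \<Rightarrow> real" where
  "halfspace_const D = 22 * real D * (ln 4 + ln (4 * real D)) + 5"

text \<open>Turns the squared Euclidean length of a chaining increment into a number of differing
  indices. The sign \<open>\<sigma>\<close> allows two one-sided maxima to bound an absolute value
  later.\<close>

lemma sum_indicator_diff_squared:
  assumes "S \<subseteq> {1..n}" "T \<subseteq> {1..n::nat}" "\<bar>\<sigma>\<bar> = (1::real)"
  shows "(\<Sum>i=1..n. (\<sigma> * (indicator T i - indicator S i))\<^sup>2) = card (sym_diff S T)"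
proof -
  have "\<sigma>\<^sup>2 = 1" using assms(3) by (metis power2_abs one_power2)
  then have "(\<sigma> * (indicator T i - indicator S i))\<^sup>2 = (indicator (sym_diff S T) i :: real)" for i
    by (auto simp: power_mult_distrib indicator_def)
  then have "(\<Sum>i=1..n. (\<sigma> * (indicator T i - indicator S i))\<^sup>2) = (\<Sum>i=1..n. indicator (sym_diff S T) i)"
    by simp
  also have "\<dots> = (\<Sum>i\<in>sym_diff S T. 1)"
    using assms by (intro sum.mono_neutral_cong_right) (auto simp: indicator_def)
  finally show ?thesis by simp
qed

text \<open>Chaining along packings at the scales \<open>4\<^sup>-\<^sup>k n\<close>; a union bound over all traces at once would cost a
  factor \<open>sqrt (ln n)\<close>.\<close>

lemma sign_avg_halfspace_traces:
  fixes z :: "nat \<Rightarrow> 'e::euclidean_space"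
  assumes n: "n \<ge> 1" and \<sigma>: "\<bar>\<sigma>\<bar> = 1"
  shows "sign_avg n (\<lambda>s. Max ((\<lambda>S. \<Sum>i=1..n. s i * (\<sigma> * indicator S i)) ` halfspace_traces z n UNIV))
    \<le> halfspace_const DIM('e) * sqrt n"
proof -
  define \<S> where "\<S> = halfspace_traces z n UNIV"
  have \<S>: "finite \<S>" "\<S> \<noteq> {}" "\<S> \<subseteq> Pow {1..n}"
    unfolding \<S>_def by (simp, simp add: halfspace_traces_def, rule halfspace_traces_Pow)
  \<comment> \<open>With this \<open>A\<close> the packing at scale 4^-k has log-cardinality at most
    A (k + 1).\<close>
  define A where "A = 2 * real DIM('e) * (ln 4 + ln (4 * real DIM('e)))"
  have DIM1: "real DIM('e) \<ge> 1" by (simp add: Suc_leI)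
  have A: "A \<ge> 0" unfolding A_def using DIM1 by (intro mult_nonneg_nonneg add_nonneg_nonneg ln_ge_zero) linarith+
  have "\<exists>\<T> \<pi>. \<T> \<subseteq> \<S> \<and> \<T> \<noteq> {} \<and>
    (\<forall>S\<in>\<T>. \<forall>T\<in>\<T>. S \<noteq> T \<longrightarrow> (1/4)^k * real n \<le> real (card (sym_diff S T))) \<and>
    (\<forall>S\<in>\<S>. \<pi> S \<in> \<T>) \<and> (\<forall>S\<in>\<S>. S \<noteq> \<pi> S \<longrightarrow> real (card (sym_diff S (\<pi> S))) < (1/4)^k * real n)" for k
  proof -
    obtain \<T> \<pi> where "\<T> \<subseteq> \<S>" "\<T> \<noteq> {}"
      "\<And>S T. S \<in> \<T> \<Longrightarrow> T \<in> \<T> \<Longrightarrow> S \<noteq> T \<Longrightarrow> (1/4)^k * real n \<le> real (card (sym_diff S T))"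
      "\<And>S. S \<in> \<S> \<Longrightarrow> \<pi> S \<in> \<T>"
      "\<And>S. S \<in> \<S> \<Longrightarrow> S \<noteq> \<pi> S \<Longrightarrow> real (card (sym_diff S (\<pi> S))) < (1/4)^k * real n"
      using maximal_packing[OF \<S>(1,2), of "(1/4)^k * real n"] by metis
    then show ?thesis by (intro exI[of _ \<T>] exI[of _ \<pi>]) simp
  qed
  then obtain \<T> \<pi> where T: "\<And>k. \<T> k \<subseteq> \<S>" "\<And>k::nat. \<T> k \<noteq> {}"
    and sep: "\<And>k S T. S \<in> \<T> k \<Longrightarrow> T \<in> \<T> k \<Longrightarrow> S \<noteq> T \<Longrightarrow> (1/4)^k * real n \<le> real (card (sym_diff S T))"
    and \<pi>: "\<And>k S. S \<in> \<S> \<Longrightarrow> \<pi> k S \<in> \<T> k"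
    and near: "\<And>k S. S \<in> \<S> \<Longrightarrow> S \<noteq> \<pi> k S \<Longrightarrow> real (card (sym_diff S (\<pi> k S))) < (1/4)^k * real n"
    by metis
  have finT: "finite (\<T> k)" for k using T \<S>(1) finite_subset by blast
  have near': "real (card (sym_diff S (\<pi> k S))) \<le> (1/4)^k * real n" if "S \<in> \<S>" for k S
    using near[OF that, of k] by (cases "S = \<pi> k S") auto
  have lnT: "ln (card (\<T> k)) \<le> A * (real k + 1)" for k
  proof -
    have "ln (card (\<T> k)) \<le> 2 * real DIM('e) * (ln (1 / (1/4)^k) + ln (4 * real DIM('e)))"
      by (rule ln_card_packing[of "\<T> k" z n]) (use T n sep in \<open>auto simp: \<S>_def power_le_one\<close>)
    also have "ln (1 / (1/4)^k) = real k * ln 4" by (simp add: ln_realpow power_divide)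
    also have "2 * real DIM('e) * (real k * ln 4 + ln (4 * real DIM('e))) \<le> A * (real k + 1)"
    proof -
      have "ln (4 * real DIM('e)) \<ge> 0" using DIM1 by (intro ln_ge_zero) linarith
      then have "real k * ln 4 + ln (4 * real DIM('e)) \<le> (ln 4 + ln (4 * real DIM('e))) * (real k + 1)"
        by (simp add: algebra_simps)
      then show ?thesis unfolding A_def using DIM1 by (simp add: mult.assoc mult_left_mono)
    qed
    finally show ?thesis .
  qed
  \<comment> \<open>Once 4^-K n < 1, a trace and its near packing member coincide, so the chain has
    finitely many links and ends at the trace itself.\<close>
  obtain K where K: "real n < 4 ^ K" using real_arch_pow[of 4 "real n"] by auto
  have piK: "\<pi> K S = S" if "S \<in> \<S>" for S
  proof (rule ccontr)
    assume ne: "\<pi> K S \<noteq> S"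
    have "real (card (sym_diff S (\<pi> K S))) < (1/4)^K * real n" using near[OF that, of K] ne by auto
    also have "\<dots> < 1" using K by (simp add: power_divide)
    finally have "card (sym_diff S (\<pi> K S)) = 0" by simp
    moreover have "finite (sym_diff S (\<pi> K S))"
      using that \<pi>[OF that, of K] T(1)[of K] \<S>(3) by (meson PowD finite_Diff finite_UnI finite_atLeastAtMost rev_finite_subset subsetD)
    ultimately show False using ne by auto
  qed
  \<comment> \<open>The maximum at step k runs over the links, not over the traces: their number is
    bounded through pairs of consecutive packing members, independently of \<open>n\<close>.\<close>
  define E where "E k = (\<lambda>S. (\<pi> k S, \<pi> (Suc k) S)) ` \<S>" for k
  have E: "finite (E k)" "E k \<noteq> {}" for k unfolding E_def using \<S> by auto
  let ?v = "\<lambda>S i. \<sigma> * indicator S i :: real"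
  let ?u = "\<lambda>p i. \<sigma> * (indicator (snd p) i - indicator (fst p) i) :: real"
  have bound0: "sign_avg n (\<lambda>s. Max ((\<lambda>S. \<Sum>i=1..n. s i * ?v S i) ` \<T> 0)) \<le> (A + 1) * sqrt n"
  proof -
    have "sign_avg n (\<lambda>s. Max ((\<lambda>S. \<Sum>i=1..n. s i * ?v S i) ` \<T> 0))
      \<le> ln (card (\<T> 0)) / (1 / sqrt n) + (1 / sqrt n) * n"
    proof (rule sign_avg_Max_le[OF finT T(2)])
      fix S assume "S \<in> \<T> 0"
      then have S: "S \<subseteq> {1..n}" using T(1)[of 0] \<S>(3) by auto
      have "(\<Sum>i=1..n. (?v S i)\<^sup>2) = card (sym_diff {} S)"
        using sum_indicator_diff_squared[of "{}" n S \<sigma>] S \<sigma> by simp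
      also have "\<dots> \<le> real n" using card_mono[OF _ S] by simp
      finally show "(\<Sum>i=1..n. (?v S i)\<^sup>2) \<le> real n" .
    qed (use n in auto)
    also have "(1 / sqrt n) * n = sqrt n" by (simp add: real_div_sqrt)
    also have "ln (card (\<T> 0)) / (1 / sqrt n) \<le> A * sqrt n"
      using lnT[of 0] by (simp add: mult_right_mono)
    finally show ?thesis by (simp add: algebra_simps)
  qed
  have bound: "sign_avg n (\<lambda>s. Max ((\<lambda>p. \<Sum>i=1..n. s i * ?u p i) ` E k))
      \<le> sqrt n * ((A * (2 * real k + 3) + 2) / 2 ^ k)" for k
  proof -
    \<comment> \<open>The parameter 2^k / sqrt n balances the log-cardinality against increments of
      squared length at most 2 n / 4^k; link k then costs of order sqrt n (k + 1) / 2^k.\<close>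
    have "sign_avg n (\<lambda>s. Max ((\<lambda>p. \<Sum>i=1..n. s i * ?u p i) ` E k))
      \<le> ln (card (E k)) / (2 ^ k / sqrt n) + (2 ^ k / sqrt n) * (2 * (1/4)^k * n)"
    proof (rule sign_avg_Max_le[OF E])
      fix p assume "p \<in> E k"
      then obtain S where S: "S \<in> \<S>" "p = (\<pi> k S, \<pi> (Suc k) S)" unfolding E_def by auto
      have sub: "\<pi> j S \<subseteq> {1..n}" for j using \<pi>[OF S(1)] T(1) \<S>(3) by blast
      have subS: "S \<subseteq> {1..n}" using S(1) \<S>(3) by auto
      have "(\<Sum>i=1..n. (?u p i)\<^sup>2) = card (sym_diff (\<pi> k S) (\<pi> (Suc k) S))"
        unfolding S(2) by (simp only: fst_conv snd_conv sum_indicator_diff_squared[OF sub sub \<sigma>])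
      also have "\<dots> \<le> real (card (sym_diff S (\<pi> k S) \<union> sym_diff S (\<pi> (Suc k) S)))"
      proof -
        have "finite (sym_diff S (\<pi> k S) \<union> sym_diff S (\<pi> (Suc k) S))"
          by (rule finite_subset[of _ "{1..n}"]) (use sub subS in blast, simp)
        then show ?thesis by (simp only: of_nat_le_iff, intro card_mono) auto
      qed
      also have "\<dots> \<le> real (card (sym_diff S (\<pi> k S)) + card (sym_diff S (\<pi> (Suc k) S)))"
        by (simp only: of_nat_le_iff card_Un_le)
      also have "\<dots> \<le> (1/4)^k * n + (1/4)^(Suc k) * n"
        unfolding of_nat_add by (intro add_mono near' S)
      also have "\<dots> \<le> 2 * (1/4)^k * n" by (simp add: mult_right_mono)
      finally show "(\<Sum>i=1..n. (?u p i)\<^sup>2) \<le> 2 * (1/4)^k * n" .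
    qed (use n in auto)
    also have "(2 ^ k / sqrt n) * (2 * (1/4)^k * n) = sqrt n * (2 / 2 ^ k)"
    proof -
      have "(2 ^ k :: real) * (1/4)^k = 1 / 2 ^ k"
        by (simp add: power_mult_distrib[symmetric] power_one_over[symmetric])
      moreover have "real n / sqrt n = sqrt n" by (simp add: real_div_sqrt)
      moreover have "(2 ^ k / sqrt n) * (2 * (1/4)^k * n) = 2 * ((2 ^ k :: real) * (1/4)^k) * (real n / sqrt n)"
        by simp
      ultimately show ?thesis by simp
    qed
    also have "ln (card (E k)) \<le> A * (2 * real k + 3)"
    proof -
      have "E k \<subseteq> \<T> k \<times> \<T> (Suc k)" unfolding E_def using \<pi> by auto
      then have "card (E k) \<le> card (\<T> k \<times> \<T> (Suc k))" by (intro card_mono) (use finT in auto)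
      then have "real (card (E k)) \<le> real (card (\<T> k)) * real (card (\<T> (Suc k)))"
        by (simp only: card_cartesian_product of_nat_le_iff flip: of_nat_mult)
      moreover have pos: "real (card (E k)) > 0" "real (card (\<T> k)) > 0" "real (card (\<T> (Suc k))) > 0"
        using E finT T by (auto simp: card_gt_0_iff)
      ultimately have "ln (card (E k)) \<le> ln (card (\<T> k)) + ln (card (\<T> (Suc k)))"
        by (subst ln_mult_pos[symmetric]) auto
      also have "\<dots> \<le> A * (real k + 1) + A * (real (Suc k) + 1)" by (intro add_mono lnT)
      finally show ?thesis by (simp add: algebra_simps)
    qed
    then have "ln (card (E k)) / (2 ^ k / sqrt n) \<le> sqrt n * (A * (2 * real k + 3) / 2 ^ k)"
      using n by (simp add: divide_right_mono mult_left_mono mult.commute)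
    finally show ?thesis by (simp add: algebra_simps add_divide_distrib)
  qed
  have path: "Max ((\<lambda>S. \<Sum>i=1..n. s i * ?v S i) ` \<S>) \<le>
      Max ((\<lambda>S. \<Sum>i=1..n. s i * ?v S i) ` \<T> 0) + (\<Sum>k<K. Max ((\<lambda>p. \<Sum>i=1..n. s i * ?u p i) ` E k))" for s
  proof (rule Max.boundedI)
    fix a assume "a \<in> (\<lambda>S. \<Sum>i=1..n. s i * ?v S i) ` \<S>"
    then obtain S where S: "S \<in> \<S>" "a = (\<Sum>i=1..n. s i * ?v S i)" by auto
    define b where "b k = (\<Sum>i=1..n. s i * ?v (\<pi> k S) i)" for k
    have "a = b K" unfolding b_def S(2) using piK[OF S(1)] by simp
    also have "b K = b 0 + (\<Sum>k<K. b (Suc k) - b k)" by (simp add: sum_lessThan_telescope)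
    also have "\<dots> \<le> Max ((\<lambda>S. \<Sum>i=1..n. s i * ?v S i) ` \<T> 0) + (\<Sum>k<K. Max ((\<lambda>p. \<Sum>i=1..n. s i * ?u p i) ` E k))"
    proof (intro add_mono sum_mono)
      show "b 0 \<le> Max ((\<lambda>S. \<Sum>i=1..n. s i * ?v S i) ` \<T> 0)"
        unfolding b_def by (rule Max_ge) (use finT \<pi>[OF S(1)] in auto)
      fix k
      have "b (Suc k) - b k = (\<Sum>i=1..n. s i * ?u (\<pi> k S, \<pi> (Suc k) S) i)"
        unfolding b_def by (simp add: sum_subtractf[symmetric] algebra_simps)
      also have "\<dots> \<le> Max ((\<lambda>p. \<Sum>i=1..n. s i * ?u p i) ` E k)"
      proof (rule Max_ge)
        show "(\<Sum>i=1..n. s i * ?u (\<pi> k S, \<pi> (Suc k) S) i) \<in> (\<lambda>p. \<Sum>i=1..n. s i * ?u p i) ` E k"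
          by (rule imageI) (use S(1) in \<open>simp add: E_def\<close>)
      qed (use E in simp)
      finally show "b (Suc k) - b k \<le> Max ((\<lambda>p. \<Sum>i=1..n. s i * ?u p i) ` E k)" .
    qed
    finally show "a \<le> \<dots>" .
  qed (use \<S> in auto)
  have "sign_avg n (\<lambda>s. Max ((\<lambda>S. \<Sum>i=1..n. s i * ?v S i) ` \<S>)) \<le>
      sign_avg n (\<lambda>s. Max ((\<lambda>S. \<Sum>i=1..n. s i * ?v S i) ` \<T> 0)) +
      (\<Sum>k<K. sign_avg n (\<lambda>s. Max ((\<lambda>p. \<Sum>i=1..n. s i * ?u p i) ` E k)))"
    unfolding sign_avg_sum[symmetric] sign_avg_add[symmetric] by (rule sign_avg_mono) (rule path)
  also have "\<dots> \<le> (A + 1) * sqrt n + (\<Sum>k<K. sqrt n * ((A * (2 * real k + 3) + 2) / 2 ^ k))"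
    by (intro add_mono sum_mono bound0 bound)
  also have "(\<Sum>k<K. sqrt n * ((A * (2 * real k + 3) + 2) / 2 ^ k)) \<le> sqrt n * (10 * A + 4)"
  proof -
    \<comment> \<open>Partial sums in closed form: the remainder is explicit and nonnegative, so no
      infinite series has to be summed.\<close>
    have "(\<Sum>k<K. (A * (2 * real k + 3) + 2) / 2 ^ k) = 10 * A + 4 - (A * (4 * real K + 10) + 4) / 2 ^ K"
    proof (induction K)
      case (Suc K)
      have "10 * A + 4 - (A * (4 * real K + 10) + 4) / y + (A * (2 * real K + 3) + 2) / y =
          10 * A + 4 - (A * (4 * real (Suc K) + 10) + 4) / (2 * y)" if "y > 0" for y :: real
        using that by (simp add: field_simps)
      from this[of "2 ^ K"] show ?case by (simp only: sum.lessThan_Suc Suc.IH power_Suc) simp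
    qed simp
    also have "\<dots> \<le> 10 * A + 4" using A by simp
    finally show ?thesis unfolding sum_distrib_left[symmetric] by (intro mult_left_mono) auto
  qed
  also have "(A + 1) * sqrt n + sqrt n * (10 * A + 4) = halfspace_const DIM('e) * sqrt n"
    unfolding halfspace_const_def A_def by (simp add: algebra_simps)
  finally show ?thesis unfolding \<S>_def by simp
qed

section \<open>Contraction and symmetrization\<close>

text \<open>The offset \<open>c\<close> is the point of the encoding: fixing one sign leaves a
  quantity of the same kind with a changed offset (\<open>rademacher_Suc\<close>), on which both
  contraction and symmetrization induct.\<close>

definition rademacher :: "'f set \<Rightarrow> ('f \<Rightarrow> real) \<Rightarrow> ('f \<Rightarrow> nat \<Rightarrow> real) \<Rightarrow> nat \<Rightarrow> real" where
  "rademacher F c v n = sign_avg n (\<lambda>s. Max ((\<lambda>f. c f + (\<Sum>i=1..n. s i * v f i)) ` F))"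

lemma rademacher_0 [simp]: "rademacher F c v 0 = Max (c ` F)"
  unfolding rademacher_def by simp

lemma rademacher_Suc:
  "rademacher F c v (Suc n) =
     (rademacher F (\<lambda>f. c f + v f (Suc n)) v n + rademacher F (\<lambda>f. c f - v f (Suc n)) v n) / 2"
proof -
  have upd: "c f + (\<Sum>i=1..Suc n. (s(Suc n := e)) i * v f i) = (c f + e * v f (Suc n)) + (\<Sum>i=1..n. s i * v f i)"
    for s :: "nat \<Rightarrow> real" and e f
  proof -
    have "(\<Sum>i=1..n. (s(Suc n := e)) i * v f i) = (\<Sum>i=1..n. s i * v f i)" by (rule sum.cong) auto
    then show ?thesis by simp
  qed
  show ?thesis unfolding rademacher_def sign_avg.simps upd by simp
qed

lemma Max_add_Max_le:
  assumes F: "finite F" "F \<noteq> {}"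
    and le: "\<And>f g. f \<in> F \<Longrightarrow> g \<in> F \<Longrightarrow> a f + b g \<le> (K :: real)"
  shows "Max (a ` F) + Max (b ` F) \<le> K"
proof -
  have "Max (a ` F) \<in> a ` F" "Max (b ` F) \<in> b ` F" using F by (auto intro!: Max_in)
  then show ?thesis using le by fastforce
qed

lemma abs_Max_le:
  fixes a :: "'f \<Rightarrow> real"
  assumes F: "finite F" "F \<noteq> {}" and "\<And>f. f \<in> F \<Longrightarrow> \<bar>a f\<bar> \<le> B"
  shows "\<bar>Max (a ` F)\<bar> \<le> B"
proof -
  have "Max (a ` F) \<in> a ` F" using F by (intro Max_in) auto
  then show ?thesis using assms(3) by auto
qed

lemma rademacher_abs_le:
  assumes F: "finite F" "F \<noteq> {}" and c: "\<And>f. f \<in> F \<Longrightarrow> \<bar>c f\<bar> \<le> A"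
    and v: "\<And>f i. f \<in> F \<Longrightarrow> i \<in> {1..n} \<Longrightarrow> \<bar>v f i\<bar> \<le> K"
  shows "\<bar>rademacher F c v n\<bar> \<le> A + n * K"
  using c v
proof (induction n arbitrary: c A)
  case 0
  have "Max (c ` F) \<in> c ` F" using F by (intro Max_in) auto
  then show ?case using 0 by auto
next
  case (Suc n)
  have "\<bar>c f + v f (Suc n)\<bar> \<le> A + K" "\<bar>c f - v f (Suc n)\<bar> \<le> A + K" if "f \<in> F" for f
    using Suc.prems(1)[OF that] Suc.prems(2)[OF that, of "Suc n"] by auto
  then have "\<bar>rademacher F (\<lambda>f. c f + v f (Suc n)) v n\<bar> \<le> A + K + n * K"
    "\<bar>rademacher F (\<lambda>f. c f - v f (Suc n)) v n\<bar> \<le> A + K + n * K"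
    using Suc.prems(2) by (auto intro!: Suc.IH)
  then show ?case unfolding rademacher_Suc by (simp add: algebra_simps)
qed

text \<open>Contraction in a single coordinate. Only the sum over both signs can be compared: for
  maximizers \<open>f\<close> and \<open>g\<close> of the two terms on the left, a f - a g is at
  most b f - b g or at most b g - b f, and in the second case \<open>f\<close> and \<open>g\<close>
  trade places.\<close>

lemma rademacher_exchange:
  assumes F: "finite F" "F \<noteq> {}"
    and lip: "\<And>f g. f \<in> F \<Longrightarrow> g \<in> F \<Longrightarrow> \<bar>a f - a g\<bar> \<le> \<bar>b f - b g\<bar>"
  shows "rademacher F (\<lambda>f. c f + a f) v n + rademacher F (\<lambda>f. c f - a f) v n
    \<le> rademacher F (\<lambda>f. c f + b f) v n + rademacher F (\<lambda>f. c f - b f) v n"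
proof (induction n arbitrary: c)
  case 0
  have "Max ((\<lambda>f. c f + a f) ` F) + Max ((\<lambda>f. c f - a f) ` F)
    \<le> Max ((\<lambda>f. c f + b f) ` F) + Max ((\<lambda>f. c f - b f) ` F)"
  proof (rule Max_add_Max_le[OF F])
    fix f g assume fg: "f \<in> F" "g \<in> F"
    have "c f + b f \<le> Max ((\<lambda>f. c f + b f) ` F)" "c g + b g \<le> Max ((\<lambda>f. c f + b f) ` F)"
      "c f - b f \<le> Max ((\<lambda>f. c f - b f) ` F)" "c g - b g \<le> Max ((\<lambda>f. c f - b f) ` F)"
      using F fg by (auto intro!: Max_ge)
    then show "c f + a f + (c g - a g) \<le> Max ((\<lambda>f. c f + b f) ` F) + Max ((\<lambda>f. c f - b f) ` F)"
      using lip[OF fg] by linarith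
  qed
  then show ?case by simp
next
  case (Suc n)
  have 1: "(\<lambda>f. c f + d f + v f (Suc n)) = (\<lambda>f. (c f + v f (Suc n)) + d f)"
    "(\<lambda>f. c f + d f - v f (Suc n)) = (\<lambda>f. (c f - v f (Suc n)) + d f)"
    "(\<lambda>f. c f - d f + v f (Suc n)) = (\<lambda>f. (c f + v f (Suc n)) - d f)"
    "(\<lambda>f. c f - d f - v f (Suc n)) = (\<lambda>f. (c f - v f (Suc n)) - d f)" for d :: "'a \<Rightarrow> real"
    by auto
  show ?case unfolding rademacher_Suc 1
    using Suc.IH[of "\<lambda>f. c f + v f (Suc n)"] Suc.IH[of "\<lambda>f. c f - v f (Suc n)"] by argo
qed

text \<open>The induction replaces \<open>u\<close> by \<open>v\<close> in the first coordinates
  while the last one sits in the offset; \<open>rademacher_exchange\<close> then replaces that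
  one.\<close>

lemma rademacher_contraction:
  assumes F: "finite F" "F \<noteq> {}"
    and lip: "\<And>f g i. f \<in> F \<Longrightarrow> g \<in> F \<Longrightarrow> i \<in> {1..n} \<Longrightarrow> \<bar>u f i - u g i\<bar> \<le> \<bar>v f i - v g i\<bar>"
  shows "rademacher F c u n \<le> rademacher F c v n"
  using lip
proof (induction n arbitrary: c)
  case (Suc n)
  have "rademacher F d u n \<le> rademacher F d v n" for d
    by (rule Suc.IH) (use Suc.prems in auto)
  then have "rademacher F c u (Suc n) \<le>
    (rademacher F (\<lambda>f. c f + u f (Suc n)) v n + rademacher F (\<lambda>f. c f - u f (Suc n)) v n) / 2"
    unfolding rademacher_Suc by (simp add: add_mono divide_right_mono)
  also have "\<dots> \<le> rademacher F c v (Suc n)"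
    unfolding rademacher_Suc
    using rademacher_exchange[OF F, of "\<lambda>f. u f (Suc n)" "\<lambda>f. v f (Suc n)" c v n] Suc.prems by simp
  finally show ?case .
qed simp

section \<open>Measurability and symmetrization\<close>

lemma sign_avg_measurable [measurable (raw)]:
  assumes "\<And>s. (\<lambda>x. \<Phi> x s) \<in> borel_measurable M"
  shows "(\<lambda>x. sign_avg n (\<Phi> x)) \<in> borel_measurable M"
  using assms
proof (induction n arbitrary: \<Phi>)
  case (Suc n)
  have [measurable]: "(\<lambda>x. sign_avg n (\<lambda>s. \<Phi> x (s(Suc n := 1)))) \<in> borel_measurable M"
    "(\<lambda>x. sign_avg n (\<lambda>s. \<Phi> x (s(Suc n := -1)))) \<in> borel_measurable M"
    by (rule Suc.IH, rule Suc.prems)+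
  show ?case by simp
qed simp

lemma rademacher_measurable [measurable (raw)]:
  assumes F: "finite F" and [measurable]: "\<And>f. f \<in> F \<Longrightarrow> (\<lambda>x. c x f) \<in> borel_measurable M"
    "\<And>f i. f \<in> F \<Longrightarrow> i \<in> {1..n} \<Longrightarrow> (\<lambda>x. v x f i) \<in> borel_measurable M"
  shows "(\<lambda>x. rademacher F (c x) (v x) n) \<in> borel_measurable M"
  unfolding rademacher_def
  by (intro sign_avg_measurable borel_measurable_Max F borel_measurable_add borel_measurable_sum
      borel_measurable_times borel_measurable_const assms)

lemma (in prob_space) integrable_bounded:
  fixes f :: "'a \<Rightarrow> real"
  assumes "f \<in> borel_measurable M" "\<And>x. x \<in> space M \<Longrightarrow> \<bar>f x\<bar> \<le> B"
  shows "integrable M f"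
  by (rule integrable_const_bound[of _ B]) (use assms in auto)

lemma (in prob_space) abs_expectation_le:
  fixes f :: "'a \<Rightarrow> real"
  assumes "f \<in> borel_measurable M" "\<And>x. x \<in> space M \<Longrightarrow> \<bar>f x\<bar> \<le> B"
  shows "\<bar>\<integral>x. f x \<partial>M\<bar> \<le> B"
proof -
  have i: "integrable M f" by (rule integrable_bounded[OF assms])
  have "(\<integral>x. f x \<partial>M) \<le> (\<integral>x. B \<partial>M)" "(\<integral>x. - B \<partial>M) \<le> (\<integral>x. f x \<partial>M)"
    by (rule integral_mono; use assms i in \<open>force simp: abs_le_iff\<close>)+
  then show ?thesis by (simp add: prob_space)
qed

text \<open>The entry for \<open>f\<close> is half of c f + 2 h f y plus half of c f - 2 E (h f),
  and the latter is at most the mean of the maximum of c f - 2 h f. This is where the factor 2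
  enters.\<close>

lemma (in prob_space) centered_Max_le:
  fixes h :: "'f \<Rightarrow> 'a \<Rightarrow> real"
  assumes F: "finite F" "F \<noteq> {}"
    and h: "\<And>f. f \<in> F \<Longrightarrow> h f \<in> borel_measurable M"
    and K: "\<And>f x. f \<in> F \<Longrightarrow> x \<in> space M \<Longrightarrow> \<bar>h f x\<bar> \<le> K"
  shows "(\<integral>y. Max ((\<lambda>f. c f + (h f y - (\<integral>z. h f z \<partial>M))) ` F) \<partial>M)
    \<le> (\<integral>y. (Max ((\<lambda>f. c f + 2 * h f y) ` F) + Max ((\<lambda>f. c f - 2 * h f y) ` F)) / 2 \<partial>M)"
proof -
  note [measurable] = h borel_measurable_Max[OF F(1)]
  define A where "A = Max ((\<lambda>f. \<bar>c f\<bar>) ` F)"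
  have A: "\<bar>c f\<bar> \<le> A" if "f \<in> F" for f unfolding A_def using F that by (auto intro: Max_ge)
  note bd = abs_Max_le[OF F]
  have m: "\<bar>\<integral>z. h f z \<partial>M\<bar> \<le> K" if "f \<in> F" for f
    using that h K by (intro abs_expectation_le) auto
  have ih: "integrable M (h f)" if "f \<in> F" for f using that K by (intro integrable_bounded[of _ K]) auto
  have i1: "integrable M (\<lambda>y. Max ((\<lambda>f. c f + (h f y - (\<integral>z. h f z \<partial>M))) ` F))"
  proof (rule integrable_bounded)
    show "\<bar>Max ((\<lambda>f. c f + (h f y - (\<integral>z. h f z \<partial>M))) ` F)\<bar> \<le> A + 2 * K" if "y \<in> space M" for y
    proof (rule bd)
      fix f assume "f \<in> F"
      then show "\<bar>c f + (h f y - (\<integral>z. h f z \<partial>M))\<bar> \<le> A + 2 * K"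
        using A[of f] K[of f y] m[of f] that by linarith
    qed
  qed measurable
  have i2: "integrable M (\<lambda>y. Max ((\<lambda>f. c f + 2 * h f y) ` F))"
  proof (rule integrable_bounded)
    show "\<bar>Max ((\<lambda>f. c f + 2 * h f y) ` F)\<bar> \<le> A + 2 * K" if "y \<in> space M" for y
    proof (rule bd)
      fix f assume "f \<in> F"
      then show "\<bar>c f + 2 * h f y\<bar> \<le> A + 2 * K" using A[of f] K[of f y] that by linarith
    qed
  qed measurable
  have i3: "integrable M (\<lambda>y. Max ((\<lambda>f. c f - 2 * h f y) ` F))"
  proof (rule integrable_bounded)
    show "\<bar>Max ((\<lambda>f. c f - 2 * h f y) ` F)\<bar> \<le> A + 2 * K" if "y \<in> space M" for y
    proof (rule bd)
      fix f assume "f \<in> F"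
      then show "\<bar>c f - 2 * h f y\<bar> \<le> A + 2 * K" using A[of f] K[of f y] that by linarith
    qed
  qed measurable
  define J where "J = (\<integral>z. Max ((\<lambda>f. c f - 2 * h f z) ` F) \<partial>M)"
  have pt: "Max ((\<lambda>f. c f + (h f y - (\<integral>z. h f z \<partial>M))) ` F) \<le> (Max ((\<lambda>f. c f + 2 * h f y) ` F) + J) / 2" for y
  proof (rule Max.boundedI)
    fix a assume "a \<in> (\<lambda>f. c f + (h f y - (\<integral>z. h f z \<partial>M))) ` F"
    then obtain f where f: "f \<in> F" "a = c f + (h f y - (\<integral>z. h f z \<partial>M))" by auto
    have "(\<integral>z. c f - 2 * h f z \<partial>M) \<le> J" unfolding J_def
      using ih[OF f(1)] i3 F f by (intro integral_mono) (auto intro!: Max_ge)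
    then have "c f - 2 * (\<integral>z. h f z \<partial>M) \<le> J" using ih[OF f(1)] by (simp add: prob_space)
    moreover have "c f + 2 * h f y \<le> Max ((\<lambda>f. c f + 2 * h f y) ` F)" using F f by (auto intro!: Max_ge)
    ultimately show "a \<le> (Max ((\<lambda>f. c f + 2 * h f y) ` F) + J) / 2" unfolding f(2) by (simp add: field_simps)
  qed (use F in auto)
  have "(\<integral>y. Max ((\<lambda>f. c f + (h f y - (\<integral>z. h f z \<partial>M))) ` F) \<partial>M)
    \<le> (\<integral>y. (Max ((\<lambda>f. c f + 2 * h f y) ` F) + J) / 2 \<partial>M)"
    using i1 i2 pt by (intro integral_mono) auto
  also have "\<dots> = ((\<integral>y. Max ((\<lambda>f. c f + 2 * h f y) ` F) \<partial>M) + J) / 2" using i2 by (simp add: prob_space)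
  also have "\<dots> = (\<integral>y. (Max ((\<lambda>f. c f + 2 * h f y) ` F) + Max ((\<lambda>f. c f - 2 * h f y) ` F)) / 2 \<partial>M)"
    unfolding J_def using i2 i3 by simp
  finally show ?thesis .
qed

text \<open>Symmetrization without a ghost sample: coordinates are treated one at a time,
  each being absorbed into the offset \<open>c\<close>.\<close>

lemma (in prob_space) symmetrization:
  fixes h :: "'f \<Rightarrow> 'a \<Rightarrow> real"
  assumes F: "finite F" "F \<noteq> {}"
    and h: "\<And>f. f \<in> F \<Longrightarrow> h f \<in> borel_measurable M"
    and K: "\<And>f x. f \<in> F \<Longrightarrow> x \<in> space M \<Longrightarrow> \<bar>h f x\<bar> \<le> K"
  shows "(\<integral>x. Max ((\<lambda>f. c f + (\<Sum>i=1..n. h f (x i) - (\<integral>z. h f z \<partial>M))) ` F) \<partial>(\<Pi>\<^sub>M i\<in>{1..n}. M))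
    \<le> (\<integral>x. rademacher F c (\<lambda>f i. 2 * h f (x i)) n \<partial>(\<Pi>\<^sub>M i\<in>{1..n}. M))"
proof (induction n arbitrary: c)
  case 0
  show ?case by simp
next
  case (Suc n)
  note [measurable] = h borel_measurable_Max[OF F(1)]
  let ?Q = "\<Pi>\<^sub>M i\<in>insert (Suc n) {1..n}. M"
  define P where "P = (\<Pi>\<^sub>M i\<in>{1..n}. M)"
  define m where "m f = (\<integral>z. h f z \<partial>M)" for f
  interpret psf: product_sigma_finite "\<lambda>i::nat. M" by standard
  interpret P: prob_space P unfolding P_def by (rule prob_space_PiM) (rule prob_space_axioms)
  interpret PM: pair_prob_space P M ..
  have ins: "{1..Suc n} = insert (Suc n) {1..n}" by auto
  have comp [measurable]: "(\<lambda>x. x i) \<in> measurable P M" if "i \<in> {1..n}" for i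
    unfolding P_def using that by measurable
  have hx: "(\<lambda>p. h f (fst p i)) \<in> borel_measurable (P \<Otimes>\<^sub>M M)" if "i \<in> {1..n}" "f \<in> F" for i f
    using that by measurable
  have spc: "x i \<in> space M" if "x \<in> space P" "i \<in> {1..n}" for x i
    using that unfolding P_def by (auto simp: space_PiM)
  define A where "A = Max ((\<lambda>f. \<bar>c f\<bar>) ` F)"
  have A: "\<bar>c f\<bar> \<le> A" if "f \<in> F" for f unfolding A_def using F that by (auto intro: Max_ge)
  note bd = abs_Max_le[OF F]
  have m: "\<bar>m f\<bar> \<le> K" if "f \<in> F" for f
    unfolding m_def using that h K by (intro abs_expectation_le) auto
  have sumbd: "\<bar>\<Sum>i=1..n. h f (x i) - m f\<bar> \<le> n * (2 * K)" if "f \<in> F" "x \<in> space P" for f x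
  proof -
    have "\<bar>\<Sum>i=1..n. h f (x i) - m f\<bar> \<le> (\<Sum>i=1..n. \<bar>h f (x i) - m f\<bar>)" by (rule sum_abs)
    also have "\<dots> \<le> (\<Sum>i=1..n. 2 * K)"
    proof (rule sum_mono)
      fix i assume "i \<in> {1..n}"
      then show "\<bar>h f (x i) - m f\<bar> \<le> 2 * K" using K[OF that(1) spc[OF that(2)], of i] m[OF that(1)] by linarith
    qed
    finally show ?thesis by simp
  qed
  let ?S = "\<lambda>f x. (\<Sum>i=1..n. h f (x i) - m f)"
  let ?A = "\<lambda>x y. Max ((\<lambda>f. (c f + ?S f x) + (h f y - m f)) ` F)"
  let ?B = "\<lambda>x y. (Max ((\<lambda>f. (c f + ?S f x) + 2 * h f y) ` F) + Max ((\<lambda>f. (c f + ?S f x) - 2 * h f y) ` F)) / 2"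
  let ?R = "\<lambda>x y. (rademacher F (\<lambda>f. c f + 2 * h f y) (\<lambda>f i. 2 * h f (x i)) n +
       rademacher F (\<lambda>f. c f - 2 * h f y) (\<lambda>f i. 2 * h f (x i)) n) / 2"
  have upd: "(\<Sum>i=1..Suc n. h f ((x(Suc n := y)) i) - m f) = ?S f x + (h f y - m f)" for f x y
  proof -
    have "(\<Sum>i=1..n. h f ((x(Suc n := y)) i) - m f) = ?S f x" by (rule sum.cong) auto
    then show ?thesis by simp
  qed
  have A_bd: "\<bar>?A x y\<bar> \<le> A + n * (2 * K) + 2 * K" if "x \<in> space P" "y \<in> space M" for x y
  proof (rule bd)
    fix f assume f: "f \<in> F"
    then show "\<bar>(c f + ?S f x) + (h f y - m f)\<bar> \<le> A + n * (2 * K) + 2 * K"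
      using A[OF f] sumbd[OF f that(1)] K[OF f that(2)] m[OF f] by linarith
  qed
  have B_bd: "\<bar>?B x y\<bar> \<le> A + n * (2 * K) + 2 * K" if "x \<in> space P" "y \<in> space M" for x y
  proof -
    have "\<bar>Max ((\<lambda>f. (c f + ?S f x) + 2 * h f y) ` F)\<bar> \<le> A + n * (2 * K) + 2 * K"
      "\<bar>Max ((\<lambda>f. (c f + ?S f x) - 2 * h f y) ` F)\<bar> \<le> A + n * (2 * K) + 2 * K"
      using A sumbd[OF _ that(1)] K[OF _ that(2)] by (auto intro!: bd) (smt (verit))+
    then show ?thesis by (simp add: abs_le_iff)
  qed
  have R_bd: "\<bar>?R x y\<bar> \<le> A + 2 * K + n * (2 * K)" if "x \<in> space P" "y \<in> space M" for x y
  proof -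
    have "\<bar>rademacher F (\<lambda>f. c f + 2 * h f y) (\<lambda>f i. 2 * h f (x i)) n\<bar> \<le> (A + 2 * K) + n * (2 * K)"
    proof (rule rademacher_abs_le[OF F])
      fix f assume f: "f \<in> F"
      show "\<bar>c f + 2 * h f y\<bar> \<le> A + 2 * K" using A[OF f] K[OF f that(2)] by linarith
      fix i assume "i \<in> {1..n}"
      then show "\<bar>2 * h f (x i)\<bar> \<le> 2 * K" using K[OF f spc[OF that(1)], of i] by linarith
    qed
    moreover have "\<bar>rademacher F (\<lambda>f. c f - 2 * h f y) (\<lambda>f i. 2 * h f (x i)) n\<bar> \<le> (A + 2 * K) + n * (2 * K)"
    proof (rule rademacher_abs_le[OF F])
      fix f assume f: "f \<in> F"
      show "\<bar>c f - 2 * h f y\<bar> \<le> A + 2 * K" using A[OF f] K[OF f that(2)] by linarith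
      fix i assume "i \<in> {1..n}"
      then show "\<bar>2 * h f (x i)\<bar> \<le> 2 * K" using K[OF f spc[OF that(1)], of i] by linarith
    qed
    ultimately show ?thesis by (simp add: abs_le_iff)
  qed
  have A_meas: "(\<lambda>p. ?A (fst p) (snd p)) \<in> borel_measurable (P \<Otimes>\<^sub>M M)"
    by (intro borel_measurable_Max F borel_measurable_add borel_measurable_sum borel_measurable_diff hx) (auto intro: h)
  have B_meas: "(\<lambda>p. ?B (fst p) (snd p)) \<in> borel_measurable (P \<Otimes>\<^sub>M M)"
    by (intro borel_measurable_Max F borel_measurable_add borel_measurable_sum borel_measurable_diff hx
        borel_measurable_divide borel_measurable_times) (auto intro: h)
  have R_meas: "(\<lambda>p. ?R (fst p) (snd p)) \<in> borel_measurable (P \<Otimes>\<^sub>M M)"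
    by (intro rademacher_measurable F borel_measurable_add borel_measurable_diff hx
        borel_measurable_divide borel_measurable_times) (auto intro: h)
  have iA: "integrable (P \<Otimes>\<^sub>M M) (\<lambda>p. ?A (fst p) (snd p))"
    by (rule PM.P.integrable_bounded[OF A_meas, of "A + n * (2 * K) + 2 * K"])
      (simp only: space_pair_measure, erule SigmaE, simp only: fst_conv snd_conv, rule A_bd)
  have iB: "integrable (P \<Otimes>\<^sub>M M) (\<lambda>p. ?B (fst p) (snd p))"
    by (rule PM.P.integrable_bounded[OF B_meas, of "A + n * (2 * K) + 2 * K"])
      (simp only: space_pair_measure, erule SigmaE, simp only: fst_conv snd_conv, rule B_bd)
  have iR: "integrable (P \<Otimes>\<^sub>M M) (\<lambda>p. ?R (fst p) (snd p))"
    by (rule PM.P.integrable_bounded[OF R_meas, of "A + 2 * K + n * (2 * K)"])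
      (simp only: space_pair_measure, erule SigmaE, simp only: fst_conv snd_conv, rule R_bd)
  have radu: "rademacher F c (\<lambda>f i. 2 * h f ((x(Suc n := y)) i)) (Suc n) = ?R x y" for x y
  proof -
    have "rademacher F d (\<lambda>f i. 2 * h f ((x(Suc n := y)) i)) n = rademacher F d (\<lambda>f i. 2 * h f (x i)) n" for d
      unfolding rademacher_def by (intro arg_cong2[where f = sign_avg] refl ext arg_cong[where f = Max] image_cong) simp
    then show ?thesis unfolding rademacher_Suc by simp
  qed
  have P2: "(\<Pi>\<^sub>M i\<in>{1..Suc n}. M) = ?Q" unfolding ins ..
  have prob2: "prob_space ?Q"
    by (rule prob_space_PiM) (rule prob_space_axioms)
  interpret Q: prob_space "\<Pi>\<^sub>M i\<in>insert (Suc n) {1..n}. M" by (rule prob2)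
  have iMax: "integrable P (\<lambda>x. Max ((\<lambda>f. d f + ?S f x) ` F))" if d: "\<And>f. f \<in> F \<Longrightarrow> \<bar>d f\<bar> \<le> A'" for d A'
  proof (rule P.integrable_bounded)
    show "(\<lambda>x. Max ((\<lambda>f. d f + ?S f x) ` F)) \<in> borel_measurable P"
      by (intro borel_measurable_Max F borel_measurable_add borel_measurable_sum borel_measurable_diff) (auto intro: h)
    show "\<bar>Max ((\<lambda>f. d f + ?S f x) ` F)\<bar> \<le> A' + n * (2 * K)" if "x \<in> space P" for x
    proof (rule bd)
      fix f assume f: "f \<in> F"
      show "\<bar>d f + ?S f x\<bar> \<le> A' + n * (2 * K)" using d[OF f] sumbd[OF f that] by linarith
    qed
  qed
  have irad: "integrable P (\<lambda>x. rademacher F d (\<lambda>f i. 2 * h f (x i)) n)" if d: "\<And>f. f \<in> F \<Longrightarrow> \<bar>d f\<bar> \<le> A'" for d A'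
  proof (rule P.integrable_bounded)
    show "(\<lambda>x. rademacher F d (\<lambda>f i. 2 * h f (x i)) n) \<in> borel_measurable P"
      by (intro rademacher_measurable F borel_measurable_times) (auto intro: h)
    show "\<bar>rademacher F d (\<lambda>f i. 2 * h f (x i)) n\<bar> \<le> A' + n * (2 * K)" if "x \<in> space P" for x
    proof (rule rademacher_abs_le[OF F d])
      fix f i assume "f \<in> F" "i \<in> {1..n}"
      then show "\<bar>2 * h f (x i)\<bar> \<le> 2 * K" using K[OF _ spc[OF that], of f i] by simp
    qed
  qed
  have off: "\<bar>c f + 2 * h f y\<bar> \<le> A + 2 * K" "\<bar>c f - 2 * h f y\<bar> \<le> A + 2 * K" if "f \<in> F" "y \<in> space M" for f y
    using A[OF that(1)] K[OF that] by linarith+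
  have spcQ: "x i \<in> space M" if "x \<in> space ?Q" "i \<in> {1..Suc n}" for x i
    using that by (cases "i = Suc n") (auto simp: space_PiM PiE_iff)
  have iQ1: "integrable ?Q (\<lambda>x. Max ((\<lambda>f. c f + (\<Sum>i=1..Suc n. h f (x i) - m f)) ` F))"
  proof (rule Q.integrable_bounded)
    have "(\<lambda>x. h f (x i)) \<in> borel_measurable ?Q" if "f \<in> F" "i \<in> {1..Suc n}" for f i
    proof -
      have "(\<lambda>x. x i) \<in> measurable ?Q M"
        by (rule measurable_component_singleton) (use that in auto)
      then show ?thesis by (rule measurable_compose) (rule h[OF that(1)])
    qed
    then show "(\<lambda>x. Max ((\<lambda>f. c f + (\<Sum>i=1..Suc n. h f (x i) - m f)) ` F)) \<in> borel_measurable ?Q"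
      by (intro borel_measurable_Max F borel_measurable_add borel_measurable_sum borel_measurable_diff) auto
    show "\<bar>Max ((\<lambda>f. c f + (\<Sum>i=1..Suc n. h f (x i) - m f)) ` F)\<bar> \<le> A + Suc n * (2 * K)"
      if "x \<in> space ?Q" for x
    proof (rule bd)
      fix f assume f: "f \<in> F"
      have "\<bar>\<Sum>i=1..Suc n. h f (x i) - m f\<bar> \<le> (\<Sum>i=1..Suc n. \<bar>h f (x i) - m f\<bar>)" by (rule sum_abs)
      also have "\<dots> \<le> (\<Sum>i=1..Suc n. 2 * K)"
      proof (rule sum_mono)
        fix i assume "i \<in> {1..Suc n}"
        then show "\<bar>h f (x i) - m f\<bar> \<le> 2 * K" using K[OF f spcQ[OF that], of i] m[OF f] by linarith
      qed
      finally show "\<bar>c f + (\<Sum>i=1..Suc n. h f (x i) - m f)\<bar> \<le> A + Suc n * (2 * K)"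
        using A[OF f] by simp
    qed
  qed
  have iQ2: "integrable ?Q (\<lambda>x. rademacher F c (\<lambda>f i. 2 * h f (x i)) (Suc n))"
  proof (rule Q.integrable_bounded)
    have "(\<lambda>x. h f (x i)) \<in> borel_measurable ?Q" if "f \<in> F" "i \<in> {1..Suc n}" for f i
    proof -
      have "(\<lambda>x. x i) \<in> measurable ?Q M"
        by (rule measurable_component_singleton) (use that in auto)
      then show ?thesis by (rule measurable_compose) (rule h[OF that(1)])
    qed
    then show "(\<lambda>x. rademacher F c (\<lambda>f i. 2 * h f (x i)) (Suc n)) \<in> borel_measurable ?Q"
      by (intro rademacher_measurable F borel_measurable_times) auto
    show "\<bar>rademacher F c (\<lambda>f i. 2 * h f (x i)) (Suc n)\<bar> \<le> A + Suc n * (2 * K)"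
      if "x \<in> space ?Q" for x
    proof (rule rademacher_abs_le[OF F A])
      fix f i assume "f \<in> F" "i \<in> {1..Suc n}"
      then show "\<bar>2 * h f (x i)\<bar> \<le> 2 * K" using K[OF _ spcQ[OF that], of f i] by simp
    qed
  qed
  have "(\<integral>x. Max ((\<lambda>f. c f + (\<Sum>i=1..Suc n. h f (x i) - m f)) ` F) \<partial>(\<Pi>\<^sub>M i\<in>{1..Suc n}. M))
      = (\<integral>x. (\<integral>y. ?A x y \<partial>M) \<partial>P)"
    unfolding P2 by (subst psf.product_integral_insert[OF _ _ iQ1]) (simp_all only: upd add.assoc P_def finite_atLeastAtMost, auto)
  \<comment> \<open>For fixed \<open>x\<close> the centered sum over the first \<open>n\<close>
    coordinates is part of the offset in \<open>centered_Max_le\<close>.\<close>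
  also have "\<dots> \<le> (\<integral>x. (\<integral>y. ?B x y \<partial>M) \<partial>P)"
  proof (rule integral_mono)
    show "integrable P (\<lambda>x. \<integral>y. ?A x y \<partial>M)" "integrable P (\<lambda>x. \<integral>y. ?B x y \<partial>M)"
      using PM.integrable_fst[of ?A] PM.integrable_fst[of ?B] iA iB by (auto simp: case_prod_beta')
    show "(\<integral>y. ?A x y \<partial>M) \<le> (\<integral>y. ?B x y \<partial>M)" for x
      unfolding m_def by (rule centered_Max_le[OF F h K])
  qed
  \<comment> \<open>The integrals are exchanged because the induction hypothesis integrates over the
    first \<open>n\<close> coordinates, with the last one frozen in the offsets c f + 2 h f y and c
    f - 2 h f y.\<close>
  also have "\<dots> = (\<integral>y. (\<integral>x. ?B x y \<partial>P) \<partial>M)"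
    using PM.Fubini_integral[of ?B] iB by (auto simp: case_prod_beta')
  also have "\<dots> \<le> (\<integral>y. (\<integral>x. ?R x y \<partial>P) \<partial>M)"
  proof (rule integral_mono)
    show "integrable M (\<lambda>y. \<integral>x. ?B x y \<partial>P)" "integrable M (\<lambda>y. \<integral>x. ?R x y \<partial>P)"
      using PM.integrable_snd[of ?B] PM.integrable_snd[of ?R] iB iR by (auto simp: case_prod_beta')
    fix y assume y: "y \<in> space M"
    note o1 = off(1)[OF _ y] and o2 = off(2)[OF _ y]
    have eq: "(c f + ?S f x) + 2 * h f y = (c f + 2 * h f y) + ?S f x" "(c f + ?S f x) - 2 * h f y = (c f - 2 * h f y) + ?S f x" for f x
      by auto
    have "(\<integral>x. ?B x y \<partial>P) = ((\<integral>x. Max ((\<lambda>f. (c f + 2 * h f y) + ?S f x) ` F) \<partial>P) +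
        (\<integral>x. Max ((\<lambda>f. (c f - 2 * h f y) + ?S f x) ` F) \<partial>P)) / 2"
      unfolding eq using iMax[OF o1] iMax[OF o2] by simp
    also have "\<dots> \<le> ((\<integral>x. rademacher F (\<lambda>f. c f + 2 * h f y) (\<lambda>f i. 2 * h f (x i)) n \<partial>P) +
        (\<integral>x. rademacher F (\<lambda>f. c f - 2 * h f y) (\<lambda>f i. 2 * h f (x i)) n \<partial>P)) / 2"
      unfolding P_def m_def using Suc.IH[of "\<lambda>f. c f + 2 * h f y"] Suc.IH[of "\<lambda>f. c f - 2 * h f y"]
      by (intro divide_right_mono add_mono) auto
    also have "\<dots> = (\<integral>x. ?R x y \<partial>P)" using irad[OF o1] irad[OF o2] by simp
    finally show "(\<integral>x. ?B x y \<partial>P) \<le> (\<integral>x. ?R x y \<partial>P)" .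
  qed
  also have "\<dots> = (\<integral>x. (\<integral>y. ?R x y \<partial>M) \<partial>P)"
    using PM.Fubini_integral[of ?R] iR by (auto simp: case_prod_beta')
  also have "\<dots> = (\<integral>x. rademacher F c (\<lambda>f i. 2 * h f (x i)) (Suc n) \<partial>(\<Pi>\<^sub>M i\<in>{1..Suc n}. M))"
    unfolding P2 by (subst psf.product_integral_insert[OF _ _ iQ2]) (simp_all only: radu P_def finite_atLeastAtMost, auto)
  finally show ?case unfolding m_def .
qed

section \<open>Rademacher complexity of network classes\<close>

text \<open>Defined for a fixed sign pattern, so that neurons, coordinates and constants can be
  compared with it before any averaging. The appended coordinate 1 turns affine half-spaces into
  homogeneous ones in dimension d + 1.\<close>

definition halfspace_max :: "(nat \<Rightarrow> real ^ 'd) \<Rightarrow> nat \<Rightarrow> (nat \<Rightarrow> real) \<Rightarrow> real" where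
  "halfspace_max x n s =
     Max ((\<lambda>S. \<bar>\<Sum>i=1..n. s i * indicator S i\<bar>) ` halfspace_traces (\<lambda>i. (x i, 1 :: real)) n UNIV)"

lemma halfspace_max_ge:
  fixes x :: "nat \<Rightarrow> real ^ 'd"
  assumes "\<And>i. i \<in> {1..n} \<Longrightarrow> P i \<longleftrightarrow> w \<bullet> x i + b > 0"
  shows "\<bar>\<Sum>i=1..n. s i * (if P i then 1 else 0)\<bar> \<le> halfspace_max x n s"
proof -
  let ?S = "{i\<in>{1..n}. (w, b) \<bullet> (x i, 1) > 0}"
  have "(\<Sum>i=1..n. s i * (if P i then 1 else 0)) = (\<Sum>i=1..n. s i * indicator ?S i)"
    using assms by (intro sum.cong) auto
  moreover have "?S \<in> halfspace_traces (\<lambda>i. (x i, 1 :: real)) n UNIV"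
    unfolding halfspace_traces_def by blast
  ultimately show ?thesis unfolding halfspace_max_def
    by (simp only:) (rule Max_ge, rule finite_imageI, rule finite_halfspace_traces, rule imageI)
qed

lemma halfspace_max_nonneg: "0 \<le> halfspace_max x n s"
  using halfspace_max_ge[of n "\<lambda>_. False" 0 x 0 s] by simp

text \<open>The two signed maxima are nonnegative, because the empty trace contributes 0; hence
  their sum dominates the absolute value, at the price of a factor 2.\<close>

lemma sign_avg_halfspace_max:
  fixes x :: "nat \<Rightarrow> real ^ 'd"
  assumes n: "n \<ge> 1"
  shows "sign_avg n (halfspace_max x n) \<le> 2 * halfspace_const (CARD('d) + 1) * sqrt n"
proof -
  let ?\<S> = "halfspace_traces (\<lambda>i. (x i, 1 :: real)) n UNIV"
  let ?M = "\<lambda>(\<sigma>::real) (s :: nat \<Rightarrow> real). Max ((\<lambda>S. \<Sum>i=1..n. s i * (\<sigma> * indicator S i)) ` ?\<S>)"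
  have empty: "{} \<in> ?\<S>" unfolding halfspace_traces_def by (rule image_eqI[of _ _ 0]) auto
  have "sign_avg n (halfspace_max x n) \<le> sign_avg n (\<lambda>s. ?M 1 s + ?M (-1) s)"
  proof (rule sign_avg_mono)
    fix s :: "nat \<Rightarrow> real"
    have nonneg: "0 \<le> ?M \<sigma> s" for \<sigma>
    proof (rule Max_ge)
      show "0 \<in> (\<lambda>S. \<Sum>i=1..n. s i * (\<sigma> * indicator S i)) ` ?\<S>"
        by (rule image_eqI[OF _ empty]) simp
    qed simp
    show "halfspace_max x n s \<le> ?M 1 s + ?M (-1) s"
      unfolding halfspace_max_def
    proof (rule Max.boundedI)
      fix a assume "a \<in> (\<lambda>S. \<bar>\<Sum>i=1..n. s i * indicator S i\<bar>) ` ?\<S>"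
      then obtain S where S: "S \<in> ?\<S>" "a = \<bar>\<Sum>i=1..n. s i * indicator S i\<bar>" by auto
      have "(\<Sum>i=1..n. s i * (\<sigma> * indicator S i)) \<le> ?M \<sigma> s" for \<sigma>
        by (rule Max_ge) (use S in auto)
      from this[of 1] this[of "-1"] show "a \<le> ?M 1 s + ?M (-1) s"
        using nonneg[of 1] nonneg[of "-1"] unfolding S(2) by (simp add: sum_negf abs_le_iff)
    qed (use empty in auto)
  qed
  also have "\<dots> = sign_avg n (?M 1) + sign_avg n (?M (-1))" by (rule sign_avg_add)
  also have "\<dots> \<le> halfspace_const (DIM((real ^ 'd) \<times> real)) * sqrt n + halfspace_const (DIM((real ^ 'd) \<times> real)) * sqrt n"
    by (intro add_mono sign_avg_halfspace_traces n) auto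
  finally show ?thesis by (simp add: algebra_simps)
qed

section \<open>Layer-cake bounds for neurons and networks\<close>

lemma has_integral_layer:
  fixes u R :: real
  assumes "0 \<le> u" "u \<le> R"
  shows "((\<lambda>r. if r < u then 1 else 0) has_integral u) {0..R}"
proof -
  have "((\<lambda>r. 1) has_integral u) {0..u}" using has_integral_const_real[of "1::real" 0 u] assms by simp
  then have "((\<lambda>r. if r \<in> {0..u} then 1 else 0) has_integral u) {0..R}"
    using assms by (subst has_integral_restrict) auto
  then show ?thesis by (rule has_integral_spike_finite[of "{u}", rotated 2]) auto
qed

text \<open>A signed sum of numbers in [0, R] is the integral over the level \<open>r\<close> of
  signed sums over superlevel sets, so a bound for the latter is merely multiplied by the
  range.\<close>

lemma layer_cake_bound:
  fixes u :: "nat \<Rightarrow> real"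
  assumes R: "0 \<le> R" and u: "\<And>i. i \<in> {1..n} \<Longrightarrow> 0 \<le> u i \<and> u i \<le> R"
    and B: "\<And>r. 0 \<le> r \<Longrightarrow> r \<le> R \<Longrightarrow> \<bar>\<Sum>i=1..n. s i * (if r < u i then 1 else 0)\<bar> \<le> B"
  shows "\<bar>\<Sum>i=1..n. s i * u i\<bar> \<le> R * B"
proof -
  have I: "((\<lambda>r. \<Sum>i=1..n. s i * (if r < u i then 1 else 0)) has_integral (\<Sum>i=1..n. s i * u i)) {0..R}"
    using u by (intro has_integral_sum has_integral_mult_right has_integral_layer) auto
  have c: "((\<lambda>r. b) has_integral R * b) {0..R}" for b :: real
    using has_integral_const_real[of b 0 R] R by simp
  have "(\<Sum>i=1..n. s i * u i) \<le> R * B"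
    by (rule has_integral_le[OF I c]) (use B in \<open>auto simp: abs_le_iff\<close>)
  moreover have "R * (- B) \<le> (\<Sum>i=1..n. s i * u i)"
    by (rule has_integral_le[OF c I]) (use B in \<open>force simp: abs_le_iff\<close>)
  ultimately show ?thesis by simp
qed

abbreviation (input) unit_cube :: "(real ^ 'd) set" where
  "unit_cube \<equiv> {x. \<forall>j. 0 \<le> x $ j \<and> x $ j \<le> 1}"

lemma norm1_nonneg [simp]: "0 \<le> norm1 w"
  unfolding norm1_def by (simp add: sum_nonneg)

lemma inner_le_norm1:
  assumes "x \<in> unit_cube"
  shows "\<bar>w \<bullet> x\<bar> \<le> norm1 w"
proof -
  have "\<bar>w \<bullet> x\<bar> \<le> (\<Sum>j\<in>UNIV. \<bar>w $ j * x $ j\<bar>)" unfolding inner_vec_def by (simp add: sum_abs)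
  also have "\<dots> \<le> norm1 w" unfolding norm1_def
    using assms by (intro sum_mono) (auto simp: abs_mult intro: mult_right_le_one_le)
  finally show ?thesis .
qed

text \<open>At a level r \<ge> 0 the superlevel set of a ReLU neuron is the half-space w x + b - r >
  0. On the cube the activation is at most 2, whence the factor.\<close>

lemma relu_sum_bound:
  fixes x :: "nat \<Rightarrow> real ^ 'd"
  assumes x: "\<And>i. i \<in> {1..n} \<Longrightarrow> x i \<in> unit_cube" and w: "norm1 w \<le> 1" "\<bar>b\<bar> \<le> 1"
  shows "\<bar>\<Sum>i=1..n. s i * phi_R (w \<bullet> x i + b)\<bar> \<le> 2 * halfspace_max x n s"
proof (rule layer_cake_bound)
  fix i assume "i \<in> {1..n}"
  then have "\<bar>w \<bullet> x i\<bar> \<le> 1" using inner_le_norm1[OF x, of i w] w by simp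
  then show "0 \<le> phi_R (w \<bullet> x i + b) \<and> phi_R (w \<bullet> x i + b) \<le> 2" using w unfolding phi_R_def by auto
next
  fix r :: real assume "0 \<le> r"
  then show "\<bar>\<Sum>i=1..n. s i * (if r < phi_R (w \<bullet> x i + b) then 1 else 0)\<bar> \<le> halfspace_max x n s"
    by (intro halfspace_max_ge[of n _ w x "b - r"]) (auto simp: phi_R_def)
qed simp

lemma phi_S_bounds: "0 < phi_S z" "phi_S z < 1"
proof -
  have "1 + exp (- z) > 1" by simp
  then show "0 < phi_S z" "phi_S z < 1" unfolding phi_S_def by (auto simp: inverse_less_1_iff add_pos_pos)
qed

text \<open>Superlevel sets of the sigmoid are half-spaces whatever the slope: inverting it at level
  \<open>r\<close> only shifts the bias.\<close>

lemma phi_S_gt_iff: "r < phi_S z \<longleftrightarrow> 0 < z + ln (1 / r - 1)" if "0 < r" "r < 1"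
proof -
  have pos: "1 / r - 1 > 0" using that by simp
  have "r < phi_S z \<longleftrightarrow> exp (- z) < 1 / r - 1"
    unfolding phi_S_def using that by (simp add: field_simps add_pos_pos)
  also have "\<dots> \<longleftrightarrow> ln (exp (- z)) < ln (1 / r - 1)" using pos by (subst ln_less_cancel_iff) auto
  finally show ?thesis by simp linarith
qed

text \<open>Uniform in the inner weights, however large they are. The levels 0 and 1, at which the
  logit is infinite, give the full and the empty trace. The factor 1 keeps the shape required of a
  neuron bound.\<close>

lemma sigmoid_sum_bound:
  fixes x :: "nat \<Rightarrow> real ^ 'd"
  shows "\<bar>\<Sum>i=1..n. s i * phi_S (w \<bullet> x i + b)\<bar> \<le> 1 * halfspace_max x n s"
proof (rule layer_cake_bound)
  show "0 \<le> phi_S (w \<bullet> x i + b) \<and> phi_S (w \<bullet> x i + b) \<le> 1" for i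
    using phi_S_bounds[of "w \<bullet> x i + b"] by auto
  fix r :: real assume r: "0 \<le> r" "r \<le> 1"
  consider "r = 0" | "r = 1" | "0 < r" "r < 1" using r by linarith
  then show "\<bar>\<Sum>i=1..n. s i * (if r < phi_S (w \<bullet> x i + b) then 1 else 0)\<bar> \<le> halfspace_max x n s"
  proof cases
    case 1
    then show ?thesis using phi_S_bounds by (intro halfspace_max_ge[of n _ 0 x 1]) simp
  next
    case 2
    then show ?thesis using phi_S_bounds(2)
      by (intro halfspace_max_ge[of n _ 0 x 0]) (auto simp: not_less less_imp_le)
  next
    case 3
    then show ?thesis
      by (intro halfspace_max_ge[of n _ w x "b + ln (1 / r - 1)"]) (auto simp: phi_S_gt_iff algebra_simps)
  qed
qed simp

text \<open>Each coordinate of a point of the cube lies in [0, 1] and is a mixture of indicators of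
  axis-parallel half-spaces; the constant 1 is the full trace.\<close>

lemma linear_sum_bound:
  fixes x :: "nat \<Rightarrow> real ^ 'd"
  assumes x: "\<And>i. i \<in> {1..n} \<Longrightarrow> x i \<in> unit_cube"
  shows "\<bar>\<Sum>i=1..n. s i * (w \<bullet> x i + b)\<bar> \<le> (norm1 w + \<bar>b\<bar>) * halfspace_max x n s"
proof -
  have coord: "\<bar>\<Sum>i=1..n. s i * x i $ j\<bar> \<le> halfspace_max x n s" for j
  proof -
    have "\<bar>\<Sum>i=1..n. s i * x i $ j\<bar> \<le> 1 * halfspace_max x n s"
    proof (rule layer_cake_bound)
      show "\<bar>\<Sum>i=1..n. s i * (if r < x i $ j then 1 else 0)\<bar> \<le> halfspace_max x n s" for r
        by (rule halfspace_max_ge[of n _ "axis j 1" x "- r"]) (simp add: inner_axis')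
    qed (use x in auto)
    then show ?thesis by simp
  qed
  have const: "\<bar>\<Sum>i=1..n. s i\<bar> \<le> halfspace_max x n s"
    using halfspace_max_ge[of n "\<lambda>_. True" 0 x 1 s] by simp
  have "(\<Sum>i=1..n. s i * (w \<bullet> x i + b)) = (\<Sum>j\<in>UNIV. w $ j * (\<Sum>i=1..n. s i * x i $ j)) + b * (\<Sum>i=1..n. s i)"
    unfolding inner_vec_def inner_real_def sum_distrib_left
    by (subst sum.swap) (simp add: sum.distrib sum_distrib_left sum_distrib_right algebra_simps)
  also have "\<bar>\<dots>\<bar> \<le> (\<Sum>j\<in>UNIV. \<bar>w $ j\<bar> * \<bar>\<Sum>i=1..n. s i * x i $ j\<bar>) + \<bar>b\<bar> * \<bar>\<Sum>i=1..n. s i\<bar>"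
    unfolding abs_mult[symmetric] by (intro order_trans[OF abs_triangle_ineq] add_mono sum_abs order_refl)
  also have "\<dots> \<le> (\<Sum>j\<in>UNIV. \<bar>w $ j\<bar> * halfspace_max x n s) + \<bar>b\<bar> * halfspace_max x n s"
    by (intro add_mono sum_mono mult_left_mono coord const) auto
  also have "\<dots> = (norm1 w + \<bar>b\<bar>) * halfspace_max x n s"
    unfolding norm1_def by (simp add: sum_distrib_right distrib_right)
  finally show ?thesis .
qed

text \<open>The network is linear in its outer weights, so only their total size k a2 counts; the
  width cancels once \<open>a2\<close> is of order 1 / k.\<close>

lemma net_sum_bound:
  fixes x :: "nat \<Rightarrow> real ^ 'd"
  assumes x: "\<And>i. i \<in> {1..n} \<Longrightarrow> x i \<in> unit_cube"
    and neuron: "\<And>w b. norm1 w \<le> a1 \<Longrightarrow> \<bar>b\<bar> \<le> a1 \<Longrightarrow>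
      \<bar>\<Sum>i=1..n. s i * \<phi> (w \<bullet> x i + b)\<bar> \<le> R * halfspace_max x n s"
    and R: "0 \<le> R" and g: "g \<in> net_class k a1 a2 a3 a4 \<phi>"
  shows "(\<Sum>i=1..n. s i * g (x i)) \<le> (k * a2 * R + a3 + a4) * halfspace_max x n s"
proof -
  from g obtain \<beta> w b w0 b0 where "\<forall>j\<in>{1..k}. max (norm1 (w j)) \<bar>b j\<bar> \<le> a1 \<and> \<bar>\<beta> j\<bar> \<le> a2"
    and par': "\<bar>b0\<bar> \<le> a3" "norm1 w0 \<le> a4" and g_eq: "g = (\<lambda>x. (\<Sum>j=1..k. \<beta> j * \<phi> (w j \<bullet> x + b j)) + w0 \<bullet> x + b0)"
    unfolding net_class_def by blast
  then have par: "norm1 (w j) \<le> a1" "\<bar>b j\<bar> \<le> a1" "\<bar>\<beta> j\<bar> \<le> a2" if "j \<in> {1..k}" for j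
    using that by auto
  let ?K = "halfspace_max x n s"
  have "(\<Sum>i=1..n. s i * g (x i)) =
      (\<Sum>j=1..k. \<beta> j * (\<Sum>i=1..n. s i * \<phi> (w j \<bullet> x i + b j))) + (\<Sum>i=1..n. s i * (w0 \<bullet> x i + b0))"
    unfolding g_eq sum_distrib_left by (subst sum.swap) (simp add: sum.distrib sum_distrib_left algebra_simps)
  also have "\<dots> \<le> (\<Sum>j=1..k. a2 * (R * ?K)) + (norm1 w0 + \<bar>b0\<bar>) * ?K"
  proof (intro add_mono sum_mono)
    fix j assume j: "j \<in> {1..k}"
    have "\<beta> j * (\<Sum>i=1..n. s i * \<phi> (w j \<bullet> x i + b j)) \<le> \<bar>\<beta> j\<bar> * \<bar>\<Sum>i=1..n. s i * \<phi> (w j \<bullet> x i + b j)\<bar>"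
      by (simp flip: abs_mult)
    also have "\<dots> \<le> a2 * (R * ?K)"
      using par[OF j] neuron by (intro mult_mono) (auto intro: order_trans[OF abs_ge_zero])
    finally show "\<beta> j * (\<Sum>i=1..n. s i * \<phi> (w j \<bullet> x i + b j)) \<le> a2 * (R * ?K)" .
  next
    show "(\<Sum>i=1..n. s i * (w0 \<bullet> x i + b0)) \<le> (norm1 w0 + \<bar>b0\<bar>) * ?K"
      using linear_sum_bound[OF x, where s = s and w = w0 and b = b0] by (simp add: abs_le_iff)
  qed
  also have "\<dots> \<le> k * a2 * R * ?K + (a4 + a3) * ?K"
    using par' halfspace_max_nonneg[of x n s] by (intro add_mono mult_right_mono) auto
  finally show ?thesis by (simp add: algebra_simps)
qed

text \<open>Contraction removes the loss \<open>\<psi>\<close> at the cost \<open>L\<close>. The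
  constant 4 is the 2 of symmetrization times the 2 of
  \<open>sign_avg_halfspace_max\<close>.\<close>

lemma net_rademacher_bound:
  fixes x :: "nat \<Rightarrow> real ^ 'd"
  assumes x: "\<And>i. i \<in> {1..n} \<Longrightarrow> x i \<in> unit_cube" and n: "n \<ge> 1"
    and neuron: "\<And>s w b. norm1 w \<le> a1 \<Longrightarrow> \<bar>b\<bar> \<le> a1 \<Longrightarrow>
      \<bar>\<Sum>i=1..n. s i * \<phi> (w \<bullet> x i + b)\<bar> \<le> R * halfspace_max x n s"
    and R: "0 \<le> R" and a: "0 \<le> a2" "0 \<le> a3" "0 \<le> a4"
    and F: "finite F" "F \<noteq> {}" "F \<subseteq> net_class k a1 a2 a3 a4 \<phi>"
    and \<psi>: "\<And>u v. \<bar>\<psi> u - \<psi> v\<bar> \<le> L * \<bar>u - v\<bar>" and L: "0 \<le> L"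
  shows "rademacher F (\<lambda>_. 0) (\<lambda>g i. 2 * \<psi> (g (x i))) n
    \<le> 4 * L * (k * a2 * R + a3 + a4) * halfspace_const (CARD('d) + 1) * sqrt n"
proof -
  have "rademacher F (\<lambda>_. 0) (\<lambda>g i. 2 * \<psi> (g (x i))) n \<le> rademacher F (\<lambda>_. 0) (\<lambda>g i. 2 * L * g (x i)) n"
  proof (rule rademacher_contraction[OF F(1,2)])
    fix f g i
    have "\<bar>2 * \<psi> (f (x i)) - 2 * \<psi> (g (x i))\<bar> \<le> 2 * (L * \<bar>f (x i) - g (x i)\<bar>)"
      using \<psi>[of "f (x i)" "g (x i)"] by linarith
    also have "\<dots> = \<bar>2 * L * f (x i) - 2 * L * g (x i)\<bar>"
      using L by (simp add: abs_mult flip: right_diff_distrib)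
    finally show "\<bar>2 * \<psi> (f (x i)) - 2 * \<psi> (g (x i))\<bar> \<le> \<bar>2 * L * f (x i) - 2 * L * g (x i)\<bar>" .
  qed
  also have "\<dots> \<le> sign_avg n (\<lambda>s. 2 * L * (k * a2 * R + a3 + a4) * halfspace_max x n s)"
    unfolding rademacher_def
  proof (rule sign_avg_mono)
    fix s :: "nat \<Rightarrow> real"
    show "Max ((\<lambda>f. 0 + (\<Sum>i=1..n. s i * (2 * L * f (x i)))) ` F)
      \<le> 2 * L * (k * a2 * R + a3 + a4) * halfspace_max x n s"
    proof (rule Max.boundedI)
      fix c assume "c \<in> (\<lambda>f. 0 + (\<Sum>i=1..n. s i * (2 * L * f (x i)))) ` F"
      then obtain f where f: "f \<in> F" "c = (\<Sum>i=1..n. s i * (2 * L * f (x i)))" by auto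
      have "c = 2 * L * (\<Sum>i=1..n. s i * f (x i))" unfolding f(2) sum_distrib_left by (simp add: algebra_simps)
      also have "\<dots> \<le> 2 * L * ((k * a2 * R + a3 + a4) * halfspace_max x n s)"
        by (rule mult_left_mono[OF net_sum_bound[OF x neuron R]]) (use F f L in auto)
      finally show "c \<le> 2 * L * (k * a2 * R + a3 + a4) * halfspace_max x n s" by (simp add: mult.assoc)
    qed (use F in auto)
  qed
  also have "\<dots> \<le> 2 * L * (k * a2 * R + a3 + a4) * (2 * halfspace_const (CARD('d) + 1) * sqrt n)"
    unfolding sign_avg_cmult using L R a n by (intro mult_left_mono sign_avg_halfspace_max) auto
  finally show ?thesis by (simp add: algebra_simps)
qed

section \<open>Laws on the cube and the clipped losses\<close>

definition cube_law :: "(real ^ 'd) measure \<Rightarrow> bool" where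
  "cube_law \<mu> \<longleftrightarrow> borel_prob_on unit_cube \<mu>"

lemma cube_lawD:
  assumes "cube_law \<mu>"
  shows "prob_space \<mu>" "sets \<mu> = sets (restrict_space borel unit_cube)" "space \<mu> = unit_cube"
  using assms unfolding cube_law_def borel_prob_on_def
  by (auto dest: sets_eq_imp_space_eq simp: space_restrict_space)

lemma cube_law_measurable:
  assumes "cube_law \<mu>" "g \<in> borel_measurable borel"
  shows "g \<in> borel_measurable \<mu>"
  unfolding measurable_cong_sets[OF cube_lawD(2)[OF assms(1)] refl]
  by (rule measurable_restrict_space1) (rule assms(2))

definition clip :: "real \<Rightarrow> real \<Rightarrow> real" where
  "clip t u = min (1 - t) u"

text \<open>The term - u / (1 - u) of the estimator at the clipped value, in a form that shows its
  range and its Lipschitz constant.\<close>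

definition dual_loss :: "real \<Rightarrow> real \<Rightarrow> real" where
  "dual_loss t u = 1 - 1 / (1 - clip t u)"

lemma clip_le: "1 - clip t u \<ge> t"
  unfolding clip_def by auto

lemma dual_loss_eq: "0 < t \<Longrightarrow> - (clip t u / (1 - clip t u)) = dual_loss t u"
  using clip_le[of t u] unfolding dual_loss_def by (simp add: field_simps)

lemma clip_lipschitz: "\<bar>clip t u - clip t v\<bar> \<le> 1 * \<bar>u - v\<bar>"
  unfolding clip_def by auto

text \<open>The derivative of 1 / (1 - u) is at most 1 / t^2 for u \<le> 1 - t. This is one of the
  two places where the truncation level enters the risk; the other is the variational gap.\<close>

lemma dual_loss_lipschitz:
  assumes t: "0 < t"
  shows "\<bar>dual_loss t u - dual_loss t v\<bar> \<le> 1 / t\<^sup>2 * \<bar>u - v\<bar>"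
proof -
  let ?a = "1 - clip t u" and ?b = "1 - clip t v"
  have ab: "?a \<ge> t" "?b \<ge> t" by (rule clip_le)+
  have "dual_loss t u - dual_loss t v = (?a - ?b) / (?a * ?b)"
    unfolding dual_loss_def using ab t by (simp add: field_simps)
  then have "\<bar>dual_loss t u - dual_loss t v\<bar> = \<bar>?a - ?b\<bar> / (?a * ?b)"
    using ab t by (simp add: abs_mult)
  also have "\<dots> \<le> \<bar>u - v\<bar> / t\<^sup>2"
    using ab t clip_lipschitz[of t u v] unfolding power2_eq_square
    by (intro frac_le mult_mono) auto
  finally show ?thesis by simp
qed

lemma dual_loss_bounds:
  assumes t: "0 < t"
  shows "1 - 1 / t \<le> dual_loss t u" "dual_loss t u \<le> 1"
proof -
  have "1 / (1 - clip t u) \<le> 1 / t" using t clip_le[of t u] by (intro divide_left_mono) auto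
  then show "1 - 1 / t \<le> dual_loss t u" unfolding dual_loss_def by simp
  show "dual_loss t u \<le> 1" unfolding dual_loss_def using t clip_le[of t u] by simp
qed

lemma continuous_clip [continuous_intros]: "continuous_on A f \<Longrightarrow> continuous_on A (\<lambda>x. clip t (f x))"
  unfolding clip_def by (intro continuous_intros)

lemma continuous_dual_loss [continuous_intros]:
  "0 < t \<Longrightarrow> continuous_on A f \<Longrightarrow> continuous_on A (\<lambda>x. dual_loss t (f x))"
  unfolding dual_loss_def using clip_le[of t]
  by (intro continuous_intros) (auto simp: clip_def min_def)

section \<open>Parametrized networks and countable suprema\<close>

text \<open>Under the product topology this space is second countable, which provides countable
  dense sets of parameters.\<close>

type_synonym 'd params =
  "(nat \<Rightarrow> real) \<times> (nat \<Rightarrow> real ^ 'd) \<times> (nat \<Rightarrow> real) \<times> (real ^ 'd) \<times> real"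

definition net_fun :: "nat \<Rightarrow> (real \<Rightarrow> real) \<Rightarrow> ('d::finite) params \<Rightarrow> real ^ 'd \<Rightarrow> real" where
  "net_fun k \<phi> = (\<lambda>(\<beta>, w, b, w0, b0) x. (\<Sum>i=1..k. \<beta> i * \<phi> (w i \<bullet> x + b i)) + w0 \<bullet> x + b0)"

definition net_params :: "nat \<Rightarrow> real \<Rightarrow> real \<Rightarrow> real \<Rightarrow> real \<Rightarrow> ('d::finite) params set" where
  "net_params k a1 a2 a3 a4 = {(\<beta>, w, b, w0, b0).
     (\<forall>i\<in>{1..k}. max (norm1 (w i)) \<bar>b i\<bar> \<le> a1 \<and> \<bar>\<beta> i\<bar> \<le> a2) \<and> \<bar>b0\<bar> \<le> a3 \<and> norm1 w0 \<le> a4}"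

lemma net_class_image: "net_class k a1 a2 a3 a4 \<phi> = net_fun k \<phi> ` net_params k a1 a2 a3 a4"
  unfolding net_class_def net_params_def net_fun_def by (force simp: image_iff)

lemma net_fun_continuous_params:
  assumes "continuous_on UNIV \<phi>"
  shows "continuous_on UNIV (\<lambda>p. net_fun k \<phi> p x)"
proof -
  note \<phi> = continuous_on_compose2[OF assms]
  show ?thesis unfolding net_fun_def case_prod_beta
    by (intro continuous_intros \<phi> continuous_on_product_then_coordinatewise) auto
qed

lemma net_fun_continuous:
  assumes "continuous_on UNIV \<phi>"
  shows "continuous_on UNIV (net_fun k \<phi> p)"
proof -
  note \<phi> = continuous_on_compose2[OF assms]
  show ?thesis unfolding net_fun_def case_prod_beta by (intro continuous_intros \<phi>) auto
qed

lemma net_class_borel: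
  assumes "continuous_on UNIV \<phi>" "g \<in> net_class k a1 a2 a3 a4 \<phi>"
  shows "g \<in> borel_measurable borel" "continuous_on UNIV g"
proof -
  obtain p where "g = net_fun k \<phi> p" using assms(2) unfolding net_class_image by auto
  then show "continuous_on UNIV g" using net_fun_continuous[OF assms(1)] by simp
  then show "g \<in> borel_measurable borel" by (rule borel_measurable_continuous_onI)
qed

lemma net_zero:
  assumes "0 \<le> a1" "0 \<le> a2" "0 \<le> a3" "0 \<le> a4"
  shows "(\<lambda>_. 0) \<in> net_class k a1 a2 a3 a4 \<phi>"
  unfolding net_class_def mem_Collect_eq using assms
  by (intro exI[of _ "\<lambda>_. 0"] exI[of _ 0]) (auto simp: norm1_def)

definition objective :: "nat \<Rightarrow> real \<Rightarrow> ('a \<Rightarrow> real) \<Rightarrow> (nat \<Rightarrow> 'a) \<times> (nat \<Rightarrow> 'a) \<Rightarrow> real" where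
  "objective n t g = (\<lambda>(x, y). 1 / n * (\<Sum>i=1..n. clip t (g (x i)) + dual_loss t (g (y i))))"

lemma neural_H2_eq:
  assumes "0 < t"
  shows "neural_H2 n (trunc_class t G) z = (SUP g\<in>G. objective n t g z)"
proof -
  have "(\<Sum>i=1..n. clip t (g (x i)) - clip t (g (y i)) / (1 - clip t (g (y i)))) =
    (\<Sum>i=1..n. clip t (g (x i)) + dual_loss t (g (y i)))" for g x and y :: "nat \<Rightarrow> 'a"
    by (intro sum.cong refl) (simp flip: dual_loss_eq[OF assms])
  then show ?thesis
    unfolding neural_H2_def trunc_class_def objective_def clip_def[symmetric]
    by (simp add: image_image case_prod_beta)
qed

lemma objective_le:
  assumes "0 < t" "n \<ge> 1"
  shows "objective n t g z \<le> 2 - t"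
proof -
  have "(\<Sum>i=1..n. clip t (g (fst z i)) + dual_loss t (g (snd z i))) \<le> (\<Sum>i=1..n. 2 - t)"
    using dual_loss_bounds(2)[OF assms(1)] clip_le[of t]
    by (intro sum_mono) (smt (verit))
  then show ?thesis using assms unfolding objective_def by (simp add: case_prod_beta field_simps)
qed

text \<open>At a fixed sample the objective is continuous in the parameters, so a countable dense
  set of them gives the same supremum. This makes the estimator measurable and reduces its deviation
  to finite families. The zero network comes first in order to keep finite maxima nonnegative
  later.\<close>

lemma net_class_countable_sup:
  assumes t: "0 < t" and n: "n \<ge> 1" and \<phi>: "continuous_on UNIV \<phi>"
    and a: "0 \<le> a1" "0 \<le> a2" "0 \<le> a3" "0 \<le> a4"
  obtains e :: "nat \<Rightarrow> real ^ 'd \<Rightarrow> real" where "range e \<subseteq> net_class k a1 a2 a3 a4 \<phi>" "e 0 = (\<lambda>_. 0)"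
    "\<And>z. neural_H2 n (trunc_class t (net_class k a1 a2 a3 a4 \<phi>)) z = (SUP i. objective n t (e i) z)"
proof -
  let ?P = "net_params k a1 a2 a3 a4 :: 'd params set"
  obtain D where D: "countable D" "D \<subseteq> ?P" "?P \<subseteq> closure D" by (rule separable)
  define z0 where "z0 = ((\<lambda>_. 0, \<lambda>_. 0, \<lambda>_. 0, 0, 0) :: 'd params)"
  have z0: "z0 \<in> ?P" using a unfolding z0_def net_params_def by (auto simp: norm1_def)
  have netz0: "net_fun k \<phi> z0 = (\<lambda>_. 0)" unfolding net_fun_def z0_def by auto
  define p where "p i = (case i of 0 \<Rightarrow> z0 | Suc j \<Rightarrow> from_nat_into (insert z0 D) j)" for i
  have rng: "range p = insert z0 D"
  proof -
    have "range (from_nat_into (insert z0 D)) = insert z0 D" using D(1) by (intro range_from_nat_into) auto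
    moreover have "range p = insert z0 (range (from_nat_into (insert z0 D)))"
    proof
      show "range p \<subseteq> insert z0 (range (from_nat_into (insert z0 D)))" unfolding p_def by (auto split: nat.splits)
      have "p 0 = z0" "p (Suc j) = from_nat_into (insert z0 D) j" for j unfolding p_def by auto
      then show "insert z0 (range (from_nat_into (insert z0 D))) \<subseteq> range p" by (metis insert_subset rangeI image_subsetI)
    qed
    ultimately show ?thesis by simp
  qed
  show ?thesis
  proof (rule that[of "\<lambda>i. net_fun k \<phi> (p i)"])
    show "range (\<lambda>i. net_fun k \<phi> (p i)) \<subseteq> net_class k a1 a2 a3 a4 \<phi>"
    proof -
      have "range p \<subseteq> ?P" using rng D(2) z0 by auto
      then show ?thesis unfolding net_class_image by blast
    qed
    show "net_fun k \<phi> (p 0) = (\<lambda>_. 0)" unfolding p_def by (simp add: netz0)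
    fix z :: "(nat \<Rightarrow> real ^ 'd) \<times> (nat \<Rightarrow> real ^ 'd)"
    let ?O = "\<lambda>q. objective n t (net_fun k \<phi> q) z"
    have cont: "continuous_on UNIV ?O"
      unfolding objective_def case_prod_beta
      by (intro continuous_intros net_fun_continuous_params \<phi> t)
    have bdd: "bdd_above (?O ` A)" for A
      using objective_le[OF t n] by (intro bdd_aboveI2)
    have "(SUP q\<in>?P. ?O q) = (SUP q\<in>insert z0 D. ?O q)"
    proof (rule antisym)
      show "(SUP q\<in>?P. ?O q) \<le> (SUP q\<in>insert z0 D. ?O q)"
      proof (rule cSUP_least)
        show "?P \<noteq> {}" using z0 by auto
        fix q assume "q \<in> ?P"
        then have q: "q \<in> closure (insert z0 D)" using D(3) closure_mono[of D "insert z0 D"] by auto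
        show "?O q \<le> (SUP q\<in>insert z0 D. ?O q)"
          by (rule continuous_le_on_closure[OF continuous_on_subset[OF cont subset_UNIV] q])
            (rule cSUP_upper[OF _ bdd])
      qed
      show "(SUP q\<in>insert z0 D. ?O q) \<le> (SUP q\<in>?P. ?O q)"
        by (rule cSUP_subset_mono[OF _ bdd]) (use D(2) z0 in auto)
    qed
    also have "\<dots> = (SUP i. ?O (p i))" unfolding rng[symmetric] image_image ..
    finally show "neural_H2 n (trunc_class t (net_class k a1 a2 a3 a4 \<phi>)) z = (SUP i. ?O (p i))"
      unfolding neural_H2_eq[OF t] net_class_image image_image .
  qed
qed

lemma objective_measurable:
  assumes t: "0 < t" and g: "continuous_on UNIV (g :: real ^ 'd \<Rightarrow> real)"
    and s: "sets A = sets (restrict_space borel X)" "sets B = sets (restrict_space borel X)"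
  shows "objective n t g \<in> borel_measurable ((\<Pi>\<^sub>M i\<in>{1..n}. A) \<Otimes>\<^sub>M (\<Pi>\<^sub>M i\<in>{1..n}. B))"
proof -
  have "(\<lambda>x. clip t (g x)) \<in> borel_measurable borel" "(\<lambda>x. dual_loss t (g x)) \<in> borel_measurable borel"
    by (intro borel_measurable_continuous_onI continuous_intros g t)+
  then have [measurable]: "(\<lambda>x. clip t (g x)) \<in> borel_measurable A" "(\<lambda>x. dual_loss t (g x)) \<in> borel_measurable B"
    unfolding measurable_cong_sets[OF s(1) refl] measurable_cong_sets[OF s(2) refl]
    by (auto intro: measurable_restrict_space1)
  show ?thesis unfolding objective_def case_prod_beta by measurable
qed

lemma neural_H2_measurable:
  assumes t: "0 < t" and n: "n \<ge> 1" and \<phi>: "continuous_on UNIV \<phi>"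
    and a: "0 \<le> a1" "0 \<le> a2" "0 \<le> a3" "0 \<le> a4"
    and s: "sets A = sets (restrict_space borel (X :: (real ^ 'd) set))" "sets B = sets (restrict_space borel X)"
  shows "neural_H2 n (trunc_class t (net_class k a1 a2 a3 a4 \<phi>))
    \<in> borel_measurable ((\<Pi>\<^sub>M i\<in>{1..n}. A) \<Otimes>\<^sub>M (\<Pi>\<^sub>M i\<in>{1..n}. B))"
proof -
  obtain e :: "nat \<Rightarrow> real ^ 'd \<Rightarrow> real" where e: "range e \<subseteq> net_class k a1 a2 a3 a4 \<phi>"
    "e 0 = (\<lambda>_. 0)" "\<And>z. neural_H2 n (trunc_class t (net_class k a1 a2 a3 a4 \<phi>)) z = (SUP i. objective n t (e i) z)"
    by (rule net_class_countable_sup[OF t n \<phi> a, where k = k]) (rule that)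
  have "(\<lambda>z. SUP i. objective n t (e i) z) \<in> borel_measurable ((\<Pi>\<^sub>M i\<in>{1..n}. A) \<Otimes>\<^sub>M (\<Pi>\<^sub>M i\<in>{1..n}. B))"
  proof (rule borel_measurable_cSUP)
    show "objective n t (e i) \<in> borel_measurable ((\<Pi>\<^sub>M i\<in>{1..n}. A) \<Otimes>\<^sub>M (\<Pi>\<^sub>M i\<in>{1..n}. B))" for i
      using e(1) by (intro objective_measurable[OF t _ s] net_class_borel[OF \<phi>]) auto
    show "bdd_above (range (\<lambda>i. objective n t (e i) z))" for z
      using objective_le[OF t n] by (intro bdd_aboveI2)
  qed simp
  then show ?thesis unfolding e(3)[symmetric] by simp
qed

lemma continuous_bounded_cube:
  assumes "continuous_on UNIV (g :: real ^ 'd \<Rightarrow> real)"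
  obtains K where "\<And>x. x \<in> unit_cube \<Longrightarrow> \<bar>g x\<bar> \<le> K"
proof -
  have "unit_cube = cbox (0 :: real ^ 'd) 1" by (auto simp: mem_box_cart)
  then have "compact (unit_cube :: (real ^ 'd) set)" by simp
  then have "bounded (g ` unit_cube)"
    by (intro compact_imp_bounded compact_continuous_image continuous_on_subset[OF assms]) simp
  then show ?thesis using that unfolding bounded_iff by auto
qed

text \<open>The bound does not depend on the finite family \<open>F\<close>, so it survives the
  limit over increasing families.\<close>

lemma uniform_deviation:
  assumes \<mu>: "cube_law (\<mu> :: (real ^ 'd) measure)" and n: "n \<ge> 1"
    and \<phi>: "continuous_on UNIV \<phi>"
    and neuron: "\<And>(x :: nat \<Rightarrow> real ^ 'd) s w b. (\<And>i. i \<in> {1..n} \<Longrightarrow> x i \<in> unit_cube) \<Longrightarrow>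
      norm1 w \<le> a1 \<Longrightarrow> \<bar>b\<bar> \<le> a1 \<Longrightarrow>
      \<bar>\<Sum>i=1..n. s i * \<phi> (w \<bullet> x i + b)\<bar> \<le> R * halfspace_max x n s"
    and R: "0 \<le> R" and a: "0 \<le> a2" "0 \<le> a3" "0 \<le> a4"
    and F: "finite F" "F \<noteq> {}" "F \<subseteq> net_class k a1 a2 a3 a4 \<phi>"
    and \<psi>: "\<And>u v. \<bar>\<psi> u - \<psi> v\<bar> \<le> L * \<bar>u - v\<bar>" and L: "0 \<le> L"
  shows "(\<integral>x. Max ((\<lambda>g. \<Sum>i=1..n. \<psi> (g (x i)) - (\<integral>z. \<psi> (g z) \<partial>\<mu>)) ` F) \<partial>(\<Pi>\<^sub>M i\<in>{1..n}. \<mu>))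
    \<le> 4 * L * (k * a2 * R + a3 + a4) * halfspace_const (CARD('d) + 1) * sqrt n"
proof -
  interpret prob_space \<mu> by (rule cube_lawD[OF \<mu>])
  let ?B = "4 * L * (k * a2 * R + a3 + a4) * halfspace_const (CARD('d) + 1) * sqrt n"
  interpret P: prob_space "\<Pi>\<^sub>M i\<in>{1..n}. \<mu>" by (rule prob_space_PiM) (rule prob_space_axioms)
  have \<psi>c: "continuous_on UNIV \<psi>"
  proof (rule lipschitz_on_continuous_on)
    show "L-lipschitz_on UNIV \<psi>"
      by (rule lipschitz_onI) (use \<psi> L in \<open>auto simp: dist_real_def\<close>)
  qed
  have gc: "continuous_on UNIV (\<lambda>z. \<psi> (g z))" if "g \<in> F" for g
  proof -
    have "g \<in> net_class k a1 a2 a3 a4 \<phi>" using that F(3) by auto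
    then show ?thesis by (intro continuous_on_compose2[OF \<psi>c net_class_borel(2)[OF \<phi>]]) auto
  qed
  have meas: "(\<lambda>z. \<psi> (g z)) \<in> borel_measurable \<mu>" if "g \<in> F" for g
    by (rule cube_law_measurable[OF \<mu> borel_measurable_continuous_onI]) (rule gc[OF that])
  have "\<forall>g\<in>F. \<exists>K. \<forall>z\<in>unit_cube. \<bar>\<psi> (g z)\<bar> \<le> K"
  proof
    fix g assume g: "g \<in> F"
    obtain K where "\<And>z. z \<in> unit_cube \<Longrightarrow> \<bar>\<psi> (g z)\<bar> \<le> K"
      by (rule continuous_bounded_cube[OF gc[OF g]]) (rule that)
    then show "\<exists>K. \<forall>z\<in>unit_cube. \<bar>\<psi> (g z)\<bar> \<le> K" by (intro exI[of _ K] ballI)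
  qed
  from bchoice[OF this] obtain K where "\<forall>g\<in>F. \<forall>z\<in>unit_cube. \<bar>\<psi> (g z)\<bar> \<le> K g" ..
  then have K: "\<bar>\<psi> (g z)\<bar> \<le> K g" if "g \<in> F" "z \<in> unit_cube" for g z using that by (elim ballE) auto
  have bd: "\<bar>\<psi> (g z)\<bar> \<le> Max (K ` F)" if "g \<in> F" "z \<in> space \<mu>" for g z
  proof -
    have "\<bar>\<psi> (g z)\<bar> \<le> K g" using K that cube_lawD(3)[OF \<mu>] by auto
    also have "\<dots> \<le> Max (K ` F)" using F that by auto
    finally show ?thesis .
  qed
  have "(\<integral>x. Max ((\<lambda>g. 0 + (\<Sum>i=1..n. \<psi> (g (x i)) - (\<integral>z. \<psi> (g z) \<partial>\<mu>))) ` F) \<partial>(\<Pi>\<^sub>M i\<in>{1..n}. \<mu>))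
    \<le> (\<integral>x. rademacher F (\<lambda>_. 0) (\<lambda>g i. 2 * \<psi> (g (x i))) n \<partial>(\<Pi>\<^sub>M i\<in>{1..n}. \<mu>))"
    by (rule symmetrization[OF F(1,2) meas bd])
  also have "\<dots> \<le> (\<integral>x. ?B \<partial>(\<Pi>\<^sub>M i\<in>{1..n}. \<mu>))"
  proof (rule integral_mono)
    have spc: "x i \<in> unit_cube" if "x \<in> space (\<Pi>\<^sub>M i\<in>{1..n}. \<mu>)" "i \<in> {1..n}" for x i
      using that cube_lawD(3)[OF \<mu>] by (auto simp: space_PiM PiE_iff)
    show "integrable (\<Pi>\<^sub>M i\<in>{1..n}. \<mu>) (\<lambda>x. rademacher F (\<lambda>_. 0) (\<lambda>g i. 2 * \<psi> (g (x i))) n)"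
    proof (rule P.integrable_bounded)
      have "(\<lambda>x. \<psi> (g (x i))) \<in> borel_measurable (\<Pi>\<^sub>M i\<in>{1..n}. \<mu>)" if "g \<in> F" "i \<in> {1..n}" for g i
        using measurable_compose[OF measurable_component_singleton[OF that(2)] meas[OF that(1)]] .
      then show "(\<lambda>x. rademacher F (\<lambda>_. 0) (\<lambda>g i. 2 * \<psi> (g (x i))) n) \<in> borel_measurable (\<Pi>\<^sub>M i\<in>{1..n}. \<mu>)"
        by (intro rademacher_measurable F borel_measurable_times) auto
      show "\<bar>rademacher F (\<lambda>_. 0) (\<lambda>g i. 2 * \<psi> (g (x i))) n\<bar> \<le> 0 + n * (2 * Max (K ` F))"
        if "x \<in> space (\<Pi>\<^sub>M i\<in>{1..n}. \<mu>)" for x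
      proof (rule rademacher_abs_le[OF F(1,2)])
        fix g i assume "g \<in> F" "i \<in> {1..n}"
        then show "\<bar>2 * \<psi> (g (x i))\<bar> \<le> 2 * Max (K ` F)"
          using bd[of g "x i"] spc[OF that] cube_lawD(3)[OF \<mu>] by auto
      qed simp
    qed
    show "rademacher F (\<lambda>_. 0) (\<lambda>g i. 2 * \<psi> (g (x i))) n \<le> ?B" if "x \<in> space (\<Pi>\<^sub>M i\<in>{1..n}. \<mu>)" for x
      by (rule net_rademacher_bound[OF spc[OF that] n neuron R a F \<psi> L]) (use spc[OF that] in auto)
  qed (rule P.integrable_const)
  also have "\<dots> = ?B" using P.prob_space by simp
  finally show ?thesis by simp
qed

section \<open>Approximation in the Barron classes\<close>

text \<open>Maurey's empirical method, derandomized one summand at a time: if \<open>S\<close> is the current sum, the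
  cross term \<open>\<integral> S (G \<theta> - E G)\<close> averages to zero over \<open>\<theta>\<close>.\<close>

lemma greedy_sampling:
  fixes G :: "'t \<Rightarrow> 'a \<Rightarrow> real" and B :: real and n :: nat
  assumes Q: "prob_space Q" and \<mu>: "prob_space \<mu>"
    and G: "case_prod G \<in> borel_measurable (Q \<Otimes>\<^sub>M \<mu>)"
    and B: "\<And>\<theta> x. \<theta> \<in> space Q \<Longrightarrow> x \<in> space \<mu> \<Longrightarrow> \<bar>G \<theta> x\<bar> \<le> B"
    and A: "AE \<theta> in Q. \<theta> \<in> A"
  shows "\<exists>\<theta>. (\<forall>i\<in>{1..n}. \<theta> i \<in> A \<inter> space Q) \<and>
    (\<integral>x. (\<Sum>i=1..n. G (\<theta> i) x - (\<integral>\<theta>. G \<theta> x \<partial>Q))\<^sup>2 \<partial>\<mu>) \<le> n * (4 * B\<^sup>2)"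
proof -
  interpret Q: prob_space Q by (rule Q)
  interpret M: prob_space \<mu> by (rule \<mu>)
  interpret QM: pair_prob_space Q \<mu> ..
  define m where "m x = (\<integral>\<theta>. G \<theta> x \<partial>Q)" for x
  note [measurable] = G
  have Gx: "G \<theta> \<in> borel_measurable \<mu>" if "\<theta> \<in> space Q" for \<theta> using that G by measurable
  have m_meas [measurable]: "m \<in> borel_measurable \<mu>" unfolding m_def
  proof (rule Q.borel_measurable_lebesgue_integral)
    show "(\<lambda>(x, \<theta>). G \<theta> x) \<in> borel_measurable (\<mu> \<Otimes>\<^sub>M Q)"
      using measurable_compose[OF measurable_pair_swap' G] by (simp add: case_prod_beta)
  qed
  have m_bd: "\<bar>m x\<bar> \<le> B" if "x \<in> space \<mu>" for x
    unfolding m_def using that B G by (intro Q.abs_expectation_le) (auto intro: measurable_Pair2')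
  have Gm: "\<bar>G \<theta> x - m x\<bar> \<le> 2 * B" if "\<theta> \<in> space Q" "x \<in> space \<mu>" for \<theta> x
    using B[OF that] m_bd[OF that(2)] by linarith
  \<comment> \<open>Averaged over \<open>\<theta>\<close>, the squared norm grows by at most 4 B^2,
    as |G - m| \<le> 2 B and the cross term has mean zero. Hence it grows by no more for some
    \<open>\<theta>\<close>, which may be taken in the full-measure set \<open>A\<close>.\<close>
  have step: "\<exists>\<theta>\<in>A \<inter> space Q. (\<integral>x. (S x + (G \<theta> x - m x))\<^sup>2 \<partial>\<mu>) \<le> (\<integral>x. (S x)\<^sup>2 \<partial>\<mu>) + 4 * B\<^sup>2"
    if S [measurable]: "S \<in> borel_measurable \<mu>" and Sb: "\<And>x. x \<in> space \<mu> \<Longrightarrow> \<bar>S x\<bar> \<le> C" for S C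
  proof (rule ccontr)
    assume no: "\<not> ?thesis"
    let ?f = "\<lambda>\<theta> x. (S x + (G \<theta> x - m x))\<^sup>2"
    let ?c = "(\<integral>x. (S x)\<^sup>2 \<partial>\<mu>) + 4 * B\<^sup>2"
    have f_meas: "case_prod ?f \<in> borel_measurable (Q \<Otimes>\<^sub>M \<mu>)" by measurable
    have f_bd: "\<bar>?f \<theta> x\<bar> \<le> (C + 2 * B)\<^sup>2" if "\<theta> \<in> space Q" "x \<in> space \<mu>" for \<theta> x
    proof -
      have "\<bar>S x + (G \<theta> x - m x)\<bar> \<le> C + 2 * B" using Sb[OF that(2)] Gm[OF that] by linarith
      then have "\<bar>S x + (G \<theta> x - m x)\<bar>\<^sup>2 \<le> (C + 2 * B)\<^sup>2" by (intro power_mono) auto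
      then show ?thesis by simp
    qed
    have int: "integrable (Q \<Otimes>\<^sub>M \<mu>) (case_prod ?f)"
      by (rule QM.P.integrable_bounded[OF f_meas, of "(C + 2 * B)\<^sup>2"])
        (simp only: space_pair_measure, erule SigmaE, simp only: prod.case, rule f_bd)
    have int1: "integrable Q (\<lambda>\<theta>. \<integral>x. ?f \<theta> x \<partial>\<mu>)" by (rule QM.integrable_fst[OF int])
    have "AE \<theta> in Q. ?c < (\<integral>x. ?f \<theta> x \<partial>\<mu>)"
      using A AE_space by eventually_elim (use no in \<open>auto simp: not_le\<close>)
    then have "?c < (\<integral>\<theta>. (\<integral>x. ?f \<theta> x \<partial>\<mu>) \<partial>Q)" by (rule Q.expectation_greater[OF int1])
    also have "\<dots> = (\<integral>x. (\<integral>\<theta>. ?f \<theta> x \<partial>Q) \<partial>\<mu>)" using QM.Fubini_integral[OF int] by simp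
    also have "\<dots> \<le> (\<integral>x. (S x)\<^sup>2 + 4 * B\<^sup>2 \<partial>\<mu>)"
    proof (rule integral_mono)
      show "integrable \<mu> (\<lambda>x. \<integral>\<theta>. ?f \<theta> x \<partial>Q)" by (rule QM.integrable_snd[OF int])
      have "(S x)\<^sup>2 \<le> C\<^sup>2" if "x \<in> space \<mu>" for x
        using power_mono[OF Sb[OF that], of 2] by simp
      then show "integrable \<mu> (\<lambda>x. (S x)\<^sup>2 + 4 * B\<^sup>2)"
        by (intro Bochner_Integration.integrable_add M.integrable_const M.integrable_bounded[of _ "C\<^sup>2"]) auto
      fix x assume x: "x \<in> space \<mu>"
      have Gi: "(\<lambda>\<theta>. G \<theta> x) \<in> borel_measurable Q" using x G by measurable
      have i1: "integrable Q (\<lambda>\<theta>. G \<theta> x)" using Gi B x by (intro Q.integrable_bounded[of _ B]) auto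
      have sq: "\<bar>(G \<theta> x - m x)\<^sup>2\<bar> \<le> 4 * B\<^sup>2" if "\<theta> \<in> space Q" for \<theta>
        using power_mono[OF Gm[OF that x], of 2] by (simp add: power_mult_distrib)
      have i2: "integrable Q (\<lambda>\<theta>. (G \<theta> x - m x)\<^sup>2)"
        using sq Gi by (intro Q.integrable_bounded[of _ "4 * B\<^sup>2"]) auto
      have "(\<integral>\<theta>. ?f \<theta> x \<partial>Q) = (\<integral>\<theta>. (S x)\<^sup>2 + 2 * S x * (G \<theta> x - m x) + (G \<theta> x - m x)\<^sup>2 \<partial>Q)"
        by (simp add: power2_sum mult.assoc add_ac)
      also have "\<dots> = (S x)\<^sup>2 + 2 * S x * (m x - m x) + (\<integral>\<theta>. (G \<theta> x - m x)\<^sup>2 \<partial>Q)"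
        using i1 i2 by (simp add: Q.prob_space m_def)
      also have "(\<integral>\<theta>. (G \<theta> x - m x)\<^sup>2 \<partial>Q) \<le> 4 * B\<^sup>2"
        using Q.abs_expectation_le[of "\<lambda>\<theta>. (G \<theta> x - m x)\<^sup>2" "4 * B\<^sup>2"] sq Gi by (auto simp: abs_le_iff)
      finally show "(\<integral>\<theta>. ?f \<theta> x \<partial>Q) \<le> (S x)\<^sup>2 + 4 * B\<^sup>2" by simp
    qed
    also have "\<dots> = ?c"
    proof -
      have "(S x)\<^sup>2 \<le> C\<^sup>2" if "x \<in> space \<mu>" for x
        using power_mono[OF Sb[OF that], of 2] by simp
      then have "integrable \<mu> (\<lambda>x. (S x)\<^sup>2)" by (intro M.integrable_bounded[of _ "C\<^sup>2"]) auto
      then show ?thesis by (simp add: M.prob_space)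
    qed
    finally show False by simp
  qed
  have "\<exists>\<theta>. (\<forall>i\<in>{1..n}. \<theta> i \<in> A \<inter> space Q) \<and> (\<integral>x. (\<Sum>i=1..n. G (\<theta> i) x - m x)\<^sup>2 \<partial>\<mu>) \<le> n * (4 * B\<^sup>2)"
  proof (induction n)
    case (Suc n)
    then obtain \<theta> where \<theta>: "\<forall>i\<in>{1..n}. \<theta> i \<in> A \<inter> space Q"
      "(\<integral>x. (\<Sum>i=1..n. G (\<theta> i) x - m x)\<^sup>2 \<partial>\<mu>) \<le> n * (4 * B\<^sup>2)" by blast
    let ?S = "\<lambda>x. \<Sum>i=1..n. G (\<theta> i) x - m x"
    have "?S \<in> borel_measurable \<mu>" using \<theta>(1) Gx by (intro borel_measurable_sum borel_measurable_diff) auto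
    moreover have "\<bar>?S x\<bar> \<le> n * (2 * B)" if "x \<in> space \<mu>" for x
    proof -
      have "\<bar>?S x\<bar> \<le> (\<Sum>i=1..n. \<bar>G (\<theta> i) x - m x\<bar>)" by (rule sum_abs)
      also have "\<dots> \<le> (\<Sum>i=1..n. 2 * B)" using \<theta>(1) Gm that by (intro sum_mono) auto
      finally show ?thesis by simp
    qed
    ultimately obtain t where t: "t \<in> A \<inter> space Q"
      "(\<integral>x. (?S x + (G t x - m x))\<^sup>2 \<partial>\<mu>) \<le> (\<integral>x. (?S x)\<^sup>2 \<partial>\<mu>) + 4 * B\<^sup>2"
      using step by blast
    have eq: "(\<Sum>i=1..Suc n. G ((\<theta>(Suc n := t)) i) x - m x) = ?S x + (G t x - m x)" for x
    proof -
      have "(\<Sum>i=1..n. G ((\<theta>(Suc n := t)) i) x - m x) = ?S x" by (rule sum.cong) auto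
      then show ?thesis by simp
    qed
    show ?case
    proof (intro exI[of _ "\<theta>(Suc n := t)"] conjI ballI)
      fix i assume "i \<in> {1..Suc n}"
      then show "(\<theta>(Suc n := t)) i \<in> A \<inter> space Q" using \<theta>(1) t(1) by (cases "i = Suc n") auto
    next
      show "(\<integral>x. (\<Sum>i=1..Suc n. G ((\<theta>(Suc n := t)) i) x - m x)\<^sup>2 \<partial>\<mu>) \<le> Suc n * (4 * B\<^sup>2)"
        unfolding eq using t(2) \<theta>(2) by (simp add: algebra_simps)
    qed
  qed simp
  then show ?thesis unfolding m_def .
qed

section \<open>Sampling ridge functions\<close>

text \<open>One number s in [-1, 1] encodes a side of the origin and the distance |s|, so that
  positive and negative arguments share one integral representation. At 0 the value is 1, not
  0.\<close>

definition half_sign :: "real \<Rightarrow> real" where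
  "half_sign s = (if s < 0 then - 1 else 1)"

text \<open>At w = 0 this is the zero vector, since 1 / 0 = 0; so \<open>inner_unit_dir\<close>
  holds without exception.\<close>

definition unit_dir :: "real ^ 'd \<Rightarrow> real ^ 'd" where
  "unit_dir w = (1 / norm1 w) *\<^sub>R w"

lemma norm1_scaleR: "norm1 (r *\<^sub>R w) = \<bar>r\<bar> * norm1 w"
  unfolding norm1_def by (simp add: abs_mult sum_distrib_left)

lemma norm1_unit_dir: "norm1 (unit_dir w) \<le> 1"
  unfolding unit_dir_def norm1_scaleR by simp

lemma norm1_eq_0: "norm1 w = 0 \<longleftrightarrow> w = 0"
  unfolding norm1_def by (simp add: sum_nonneg_eq_0_iff vec_eq_iff)

lemma inner_unit_dir: "norm1 w * (unit_dir w \<bullet> x) = w \<bullet> x"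
  unfolding unit_dir_def by (cases "norm1 w = 0") (auto simp: norm1_eq_0)

lemma norm1_measurable [measurable]: "norm1 \<in> borel_measurable borel"
  unfolding norm1_def by measurable

lemma unit_dir_measurable [measurable]: "unit_dir \<in> borel_measurable borel"
  unfolding unit_dir_def by measurable

lemma half_sign_measurable [measurable]: "half_sign \<in> borel_measurable borel"
  unfolding half_sign_def by measurable

text \<open>Frequencies are drawn with density W / S and thresholds uniformly from [-1, 1]. The
  uniform density 1 / 2 causes the factor 2 in the outer weights 2 S / n, which match the bound 2 a
  / k in the network classes. With 2 S for \<open>B\<close> in \<open>greedy_sampling\<close> the
  mean square error is 4 (2 S)^2 / n.\<close>

lemma ridge_sampling:
  fixes m :: "(real ^ 'd) measure" and \<mu> :: "(real ^ 'd) measure"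
    and W :: "real ^ 'd \<Rightarrow> real" and c :: "real ^ 'd \<Rightarrow> real \<Rightarrow> real" and n :: nat
  assumes m: "finite_measure m" "sets m = sets borel"
    and W: "W \<in> borel_measurable borel" "\<And>w. 0 \<le> W w" "integrable m W"
    and S: "S = (\<integral>w. W w \<partial>m)" "0 < S"
    and c: "case_prod c \<in> borel_measurable (borel \<Otimes>\<^sub>M borel)" "\<And>w s. \<bar>c w s\<bar> \<le> 1"
    and \<psi>: "\<psi> \<in> borel_measurable borel" "\<And>v. v \<le> 1 \<Longrightarrow> \<bar>\<psi> v\<bar> \<le> 1"
    and \<mu>: "cube_law \<mu>" and n: "n \<ge> 1"
  shows "\<exists>\<omega> r. (\<forall>i\<in>{1..n}. r i \<in> {-1..1}) \<and>
    (\<integral>x. ((\<Sum>i=1..n. 2 * S / n * c (\<omega> i) (r i) * \<psi> (half_sign (r i) * (unit_dir (\<omega> i) \<bullet> x) - \<bar>r i\<bar>))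
       - (\<integral>w. W w * (\<integral>s. indicator {-1..1} s * (c w s * \<psi> (half_sign s * (unit_dir w \<bullet> x) - \<bar>s\<bar>)) \<partial>lborel) \<partial>m))\<^sup>2 \<partial>\<mu>)
    \<le> 16 * S\<^sup>2 / n"
proof -
  interpret m: finite_measure m by (rule m)
  note [measurable_cong] = m(2)
  note [measurable] = W(1) c(1) \<psi>(1)
  have WS: "(\<lambda>w. W w / S) \<in> borel_measurable m" by measurable
  define Q1 where "Q1 = density m (\<lambda>w. ennreal (W w / S))"
  define Q2 where "Q2 = density lborel (\<lambda>s::real. ennreal (indicator {-1..1} s / 2))"
  have sets1 [measurable_cong]: "sets Q1 = sets borel" and sets2 [measurable_cong]: "sets Q2 = sets borel"
    unfolding Q1_def Q2_def using m(2) by auto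
  have prob1: "prob_space Q1"
  proof
    have "emeasure Q1 (space Q1) = (\<integral>\<^sup>+w. ennreal (W w / S) \<partial>m)"
      unfolding Q1_def by (simp add: emeasure_density cong: nn_integral_cong)
    also have "\<dots> = ennreal (\<integral>w. W w / S \<partial>m)" using W S by (intro nn_integral_eq_integral) auto
    finally show "emeasure Q1 (space Q1) = 1" using S by simp
  qed
  have prob2: "prob_space Q2"
  proof
    have "emeasure Q2 (space Q2) = (\<integral>\<^sup>+s. ennreal (1/2) * indicator {-1..1::real} s \<partial>lborel)"
    proof -
      have "(\<lambda>s::real. indicator {-1..1} s / 2 :: real) \<in> borel_measurable borel" by measurable
      then have "emeasure Q2 (space Q2) = (\<integral>\<^sup>+s. ennreal (indicator {-1..1::real} s / 2) * indicator UNIV s \<partial>lborel)"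
        unfolding Q2_def by (subst emeasure_density) auto
      also have "\<dots> = (\<integral>\<^sup>+s. ennreal (1/2) * indicator {-1..1::real} s \<partial>lborel)"
        by (rule nn_integral_cong) (simp split: split_indicator)
      finally show ?thesis .
    qed
    also have "\<dots> = ennreal (1/2) * emeasure lborel {-1..1::real}" by (rule nn_integral_cmult_indicator) simp
    also have "\<dots> = ennreal (1/2 * 2)" by (subst ennreal_mult) auto
    also have "\<dots> = 1" by simp
    finally show "emeasure Q2 (space Q2) = 1" .
  qed
  interpret Q1: prob_space Q1 by (rule prob1)
  interpret Q2: prob_space Q2 by (rule prob2)
  interpret Q: pair_prob_space Q1 Q2 ..
  define neuron where "neuron w s x = c w s * \<psi> (half_sign s * (unit_dir w \<bullet> x) - \<bar>s\<bar>)" for w s and x :: "real ^ 'd"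
  define G where "G \<theta> x = 2 * S * neuron (fst \<theta>) (snd \<theta>) x" for \<theta> x
  have cm: "(\<lambda>p. c (f p) (g p)) \<in> borel_measurable N"
    if "f \<in> borel_measurable N" "g \<in> borel_measurable N" for f g and N :: "'z measure"
    using measurable_compose[OF measurable_Pair[OF that] c(1)] by simp
  have setsmu [measurable_cong]: "sets \<mu> = sets (restrict_space borel unit_cube)" by (rule cube_lawD[OF \<mu>])
  have idm [measurable]: "(\<lambda>x. x) \<in> borel_measurable \<mu>" by (rule cube_law_measurable[OF \<mu>]) simp
  have neuron_bd: "\<bar>neuron w s x\<bar> \<le> 1" if "x \<in> unit_cube" for w s x
  proof -
    have "\<bar>unit_dir w \<bullet> x\<bar> \<le> 1" using inner_le_norm1[OF that, of "unit_dir w"] norm1_unit_dir[of w] by simp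
    then have "half_sign s * (unit_dir w \<bullet> x) - \<bar>s\<bar> \<le> 1" unfolding half_sign_def by auto
    then have "\<bar>c w s\<bar> * \<bar>\<psi> (half_sign s * (unit_dir w \<bullet> x) - \<bar>s\<bar>)\<bar> \<le> 1 * 1"
      by (intro mult_mono c \<psi>) auto
    then show ?thesis unfolding neuron_def by (simp add: abs_mult)
  qed
  have neuron_meas [measurable]: "(\<lambda>p. neuron (f p) (g p) (k p)) \<in> borel_measurable N"
    if [measurable]: "f \<in> borel_measurable N" "g \<in> borel_measurable N" "k \<in> borel_measurable N"
    for f g k and N :: "'z measure"
    unfolding neuron_def using cm[OF that(1,2)] by measurable
  have GB: "\<bar>G \<theta> x\<bar> \<le> 2 * S" if "x \<in> space \<mu>" for \<theta> x
  proof -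
    have "\<bar>neuron (fst \<theta>) (snd \<theta>) x\<bar> \<le> 1" using that cube_lawD(3)[OF \<mu>] by (intro neuron_bd) auto
    then show ?thesis unfolding G_def using S(2) by (simp add: abs_mult)
  qed
  have Gmeas: "case_prod G \<in> borel_measurable ((Q1 \<Otimes>\<^sub>M Q2) \<Otimes>\<^sub>M \<mu>)"
    unfolding G_def case_prod_beta by measurable
  \<comment> \<open>Uniform thresholds lie in [-1, 1] almost surely; \<open>greedy_sampling\<close>
    turns this into a bound on every chosen bias.\<close>
  have AE: "AE \<theta> in Q1 \<Otimes>\<^sub>M Q2. \<theta> \<in> UNIV \<times> {-1..1}"
  proof (rule Q.AE_pair_measure)
    have "AE y in Q2. y \<in> {-1..1}"
      unfolding Q2_def by (subst AE_density) (auto simp: indicator_def)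
    then show "AE x in Q1. AE y in Q2. (x, y) \<in> UNIV \<times> {-1..1}" by simp
  qed measurable
  have Gint: "(\<integral>\<theta>. G \<theta> x \<partial>(Q1 \<Otimes>\<^sub>M Q2)) =
      (\<integral>w. W w * (\<integral>s. indicator {-1..1} s * neuron w s x \<partial>lborel) \<partial>m)" if x: "x \<in> unit_cube" for x
  proof -
    have Gi: "integrable (Q1 \<Otimes>\<^sub>M Q2) (\<lambda>\<theta>. G \<theta> x)"
    proof (rule Q.P.integrable_bounded)
      show "(\<lambda>\<theta>. G \<theta> x) \<in> borel_measurable (Q1 \<Otimes>\<^sub>M Q2)" unfolding G_def by measurable
      show "\<bar>G \<theta> x\<bar> \<le> 2 * S" for \<theta> using GB[of x] x cube_lawD(3)[OF \<mu>] by auto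
    qed
    have "(\<integral>\<theta>. G \<theta> x \<partial>(Q1 \<Otimes>\<^sub>M Q2)) = (\<integral>w. (\<integral>s. G (w, s) x \<partial>Q2) \<partial>Q1)"
      using Q.integral_fst'[OF Gi] by simp
    also have "\<dots> = (\<integral>w. S * (\<integral>s. indicator {-1..1} s * neuron w s x \<partial>lborel) \<partial>Q1)"
    proof (rule Bochner_Integration.integral_cong[OF refl])
      fix w
      have "(\<integral>s. G (w, s) x \<partial>Q2) = (\<integral>s. (indicator {-1..1} s / 2) *\<^sub>R G (w, s) x \<partial>lborel)"
        unfolding Q2_def G_def by (subst integral_density) auto
      also have "\<dots> = (\<integral>s. S * (indicator {-1..1} s * neuron w s x) \<partial>lborel)" unfolding G_def by (simp add: mult_ac)
      finally show "(\<integral>s. G (w, s) x \<partial>Q2) = S * (\<integral>s. indicator {-1..1} s * neuron w s x \<partial>lborel)" by simp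
    qed
    also have "\<dots> = (\<integral>w. (W w / S) *\<^sub>R (S * (\<integral>s. indicator {-1..1} s * neuron w s x \<partial>lborel)) \<partial>m)"
      unfolding Q1_def using W(2) S(2) WS
      by (subst integral_density) (auto intro!: borel_measurable_times sigma_finite_measure.borel_measurable_lebesgue_integral[OF sigma_finite_lborel])
    also have "\<dots> = (\<integral>w. W w * (\<integral>s. indicator {-1..1} s * neuron w s x \<partial>lborel) \<partial>m)"
      using S(2) by (intro Bochner_Integration.integral_cong) auto
    finally show ?thesis .
  qed
  from greedy_sampling[OF Q.P.prob_space_axioms cube_lawD(1)[OF \<mu>] Gmeas GB AE, of n]
  obtain \<theta> where \<theta>: "\<forall>i\<in>{1..n}. \<theta> i \<in> UNIV \<times> {-1..1}"
    "(\<integral>x. (\<Sum>i=1..n. G (\<theta> i) x - (\<integral>\<theta>. G \<theta> x \<partial>(Q1 \<Otimes>\<^sub>M Q2)))\<^sup>2 \<partial>\<mu>) \<le> n * (4 * (2 * S)\<^sup>2)"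
    by blast
  have "(\<integral>x. ((\<Sum>i=1..n. 2 * S / n * neuron (fst (\<theta> i)) (snd (\<theta> i)) x)
       - (\<integral>w. W w * (\<integral>s. indicator {-1..1} s * neuron w s x \<partial>lborel) \<partial>m))\<^sup>2 \<partial>\<mu>)
    = (\<integral>x. (1 / n)\<^sup>2 * (\<Sum>i=1..n. G (\<theta> i) x - (\<integral>\<theta>. G \<theta> x \<partial>(Q1 \<Otimes>\<^sub>M Q2)))\<^sup>2 \<partial>\<mu>)"
  proof (rule Bochner_Integration.integral_cong[OF refl])
    fix x assume "x \<in> space \<mu>"
    then have x: "x \<in> unit_cube" using cube_lawD(3)[OF \<mu>] by auto
    have "(\<Sum>i=1..n. 2 * S / n * neuron (fst (\<theta> i)) (snd (\<theta> i)) x)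
       - (\<integral>w. W w * (\<integral>s. indicator {-1..1} s * neuron w s x \<partial>lborel) \<partial>m)
      = (1 / n) * (\<Sum>i=1..n. G (\<theta> i) x - (\<integral>\<theta>. G \<theta> x \<partial>(Q1 \<Otimes>\<^sub>M Q2)))"
      unfolding Gint[OF x] sum_subtractf using n by (simp add: G_def sum_distrib_left field_simps)
    then show "((\<Sum>i=1..n. 2 * S / n * neuron (fst (\<theta> i)) (snd (\<theta> i)) x)
       - (\<integral>w. W w * (\<integral>s. indicator {-1..1} s * neuron w s x \<partial>lborel) \<partial>m))\<^sup>2
      = (1 / n)\<^sup>2 * (\<Sum>i=1..n. G (\<theta> i) x - (\<integral>\<theta>. G \<theta> x \<partial>(Q1 \<Otimes>\<^sub>M Q2)))\<^sup>2"
      by (simp only: power_mult_distrib)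
  qed
  also have "\<dots> = (1 / n)\<^sup>2 * (\<integral>x. (\<Sum>i=1..n. G (\<theta> i) x - (\<integral>\<theta>. G \<theta> x \<partial>(Q1 \<Otimes>\<^sub>M Q2)))\<^sup>2 \<partial>\<mu>)" by simp
  also have "\<dots> \<le> (1 / n)\<^sup>2 * (n * (4 * (2 * S)\<^sup>2))" by (intro mult_left_mono \<theta>(2)) simp
  also have "\<dots> = 16 * S\<^sup>2 / n" using n by (simp add: power2_eq_square field_simps)
  finally have main: "(\<integral>x. ((\<Sum>i=1..n. 2 * S / n * neuron (fst (\<theta> i)) (snd (\<theta> i)) x)
       - (\<integral>w. W w * (\<integral>s. indicator {-1..1} s * neuron w s x \<partial>lborel) \<partial>m))\<^sup>2 \<partial>\<mu>) \<le> 16 * S\<^sup>2 / n" .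
  show ?thesis
    by (rule exI[of _ "\<lambda>i. fst (\<theta> i)"], rule exI[of _ "\<lambda>i. snd (\<theta> i)"], rule conjI)
      (use \<theta>(1) main in \<open>auto simp: neuron_def mult.assoc mem_Times_iff\<close>)
qed

section \<open>Waves as mixtures of neurons\<close>

text \<open>The real part of exp (i u) z: the contribution of one frequency at which the polar
  density is \<open>z\<close>. Its derivative in \<open>u\<close> is \<open>wave'\<close>.\<close>

definition wave :: "complex \<Rightarrow> real \<Rightarrow> real" where
  "wave z u = Re z * cos u - Im z * sin u"

definition wave' :: "complex \<Rightarrow> real \<Rightarrow> real" where
  "wave' z u = - Re z * sin u - Im z * cos u"

lemma wave_Re: "Re (cis u * z) = wave z u"
  unfolding wave_def by simp

lemma wave'_Re: "Re (\<i> * cis u * z) = wave' z u"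
  unfolding wave'_def by (simp add: algebra_simps)

lemma wave_abs_le: "\<bar>wave z u\<bar> \<le> cmod z" "\<bar>wave' z u\<bar> \<le> cmod z"
  using abs_Re_le_cmod[of "cis u * z"] abs_Re_le_cmod[of "\<i> * cis u * z"]
  unfolding wave_Re wave'_Re by (simp_all add: norm_mult)

lemma wave_derivs:
  "((\<lambda>s. wave z (l * s)) has_real_derivative l * wave' z (l * s)) (at s)"
  "((\<lambda>s. wave' z (l * s)) has_real_derivative - l * wave z (l * s)) (at s)"
  unfolding wave_def wave'_def by (auto intro!: derivative_eq_intros simp: algebra_simps)

lemma wave_isCont [continuous_intros]:
  "isCont (\<lambda>s. wave z (l * s)) s" "isCont (\<lambda>s. wave' z (l * s)) s"
  using wave_derivs DERIV_isCont by blast+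

lemma wave_taylor1: "\<bar>wave z u - wave z 0\<bar> \<le> \<bar>u\<bar> * cmod z"
proof -
  have "wave z u - wave z 0 = Re ((iexp u - 1) * z)"
    by (simp add: wave_def cis_conv_exp[symmetric] algebra_simps)
  also have "\<bar>\<dots>\<bar> \<le> cmod ((iexp u - 1) * z)" by (rule abs_Re_le_cmod)
  also have "\<dots> = cmod (iexp u - 1) * cmod z" by (rule norm_mult)
  also have "\<dots> \<le> \<bar>u\<bar> * cmod z"
    using iexp_approx1[of u 0] by (intro mult_right_mono) auto
  finally show ?thesis .
qed

lemma wave_taylor2: "\<bar>wave z u - wave z 0 - u * wave' z 0\<bar> \<le> u\<^sup>2 * cmod z"
proof -
  have "wave z u - wave z 0 - u * wave' z 0 = Re ((iexp u - (1 + \<i> * u)) * z)"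
    by (simp add: wave_def wave'_def cis_conv_exp[symmetric] algebra_simps)
  also have "\<bar>\<dots>\<bar> \<le> cmod ((iexp u - (1 + \<i> * u)) * z)" by (rule abs_Re_le_cmod)
  also have "\<dots> = cmod (iexp u - (1 + \<i> * u)) * cmod z" by (rule norm_mult)
  also have "\<dots> \<le> u\<^sup>2 * cmod z"
  proof (rule mult_right_mono)
    have "cmod (iexp u - (1 + \<i> * u)) \<le> \<bar>u\<bar>\<^sup>2 / 2"
      using iexp_approx1[of u 1] by (simp add: numeral_2_eq_2)
    also have "\<dots> \<le> u\<^sup>2" by simp
    finally show "cmod (iexp u - (1 + \<i> * u)) \<le> u\<^sup>2" .
  qed simp
  finally show ?thesis .
qed

text \<open>Taylor's formula with integral remainder for g(s) = wave z (l s), where g'' = - l^2 g.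
  The kernel, a - s on [0, a] or s - a on [a, 0], is in both cases the ReLU of
  \<open>half_sign s * a - \<bar>s\<bar>\<close>, which vanishes for all other s in [-1, 1].\<close>

lemma relu_layer:
  assumes a: "\<bar>a\<bar> \<le> 1"
  shows "wave z (l * a) - wave z 0 - l * a * wave' z 0 =
    (\<integral>s. indicator {-1..1} s * (- (l\<^sup>2) * wave z (l * s) * phi_R (half_sign s * a - \<bar>s\<bar>)) \<partial>lborel)"
proof -
  \<comment> \<open>This is (a - s) g'(s) + g(s), an antiderivative of (a - s) g''(s).\<close>
  let ?P = "\<lambda>s. (a - s) * l * wave' z (l * s) + wave z (l * s)"
  let ?p = "\<lambda>s. - (a - s) * l\<^sup>2 * wave z (l * s)"
  have P: "(?P has_real_derivative ?p s) (at s)" for s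
    by (rule derivative_eq_intros wave_derivs refl)+ (simp add: power2_eq_square algebra_simps)
  have cont: "isCont ?p s" for s by (intro continuous_intros)
  have lhs: "wave z (l * a) - wave z 0 - l * a * wave' z 0 = ?P a - ?P 0" by (simp add: algebra_simps)
  show ?thesis
  proof (cases "0 \<le> a")
    case True
    have "has_bochner_integral lborel (\<lambda>s. ?p s * indicator {0..a} s) (?P a - ?P 0)"
      by (rule has_bochner_integral_FTC_Icc_real[OF True]) (use P cont in auto)
    then have "?P a - ?P 0 = (\<integral>s. ?p s * indicator {0..a} s \<partial>lborel)"
      by - (drule has_bochner_integral_integral_eq, linarith)
    also have "\<dots> = (\<integral>s. indicator {-1..1} s * (- (l\<^sup>2) * wave z (l * s) * phi_R (half_sign s * a - \<bar>s\<bar>)) \<partial>lborel)"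
      using a True by (intro Bochner_Integration.integral_cong refl)
        (auto simp: phi_R_def half_sign_def indicator_def max_def algebra_simps)
    finally show ?thesis using lhs by simp
  next
    case False
    then have neg: "a \<le> 0" by simp
    have "has_bochner_integral lborel (\<lambda>s. - ?p s * indicator {a..0} s) (- ?P 0 - - ?P a)"
      by (rule has_bochner_integral_FTC_Icc_real[OF neg]) (rule DERIV_minus[OF P], rule continuous_minus[OF cont])
    then have "?P a - ?P 0 = (\<integral>s. - ?p s * indicator {a..0} s \<partial>lborel)"
      by - (drule has_bochner_integral_integral_eq, linarith)
    also have "\<dots> = (\<integral>s. indicator {-1..1} s * (- (l\<^sup>2) * wave z (l * s) * phi_R (half_sign s * a - \<bar>s\<bar>)) \<partial>lborel)"
    proof (rule integral_cong_AE)
      have m: "(\<lambda>s. wave z (l * s)) \<in> borel_measurable borel" unfolding wave_def by measurable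
      show "(\<lambda>s. - ?p s * indicator {a..0} s) \<in> borel_measurable lborel" using m by measurable
      show "(\<lambda>s. indicator {-1..1} s * (- (l\<^sup>2) * wave z (l * s) * phi_R (half_sign s * a - \<bar>s\<bar>))) \<in> borel_measurable lborel"
        using m unfolding phi_R_def by measurable
      \<comment> \<open>For a < 0 the integrands may differ at s = 0, where \<open>half_sign\<close>
        has the value 1; this null set is discarded.\<close>
      show "AE s in lborel. - ?p s * indicator {a..0} s =
        indicator {-1..1} s * (- (l\<^sup>2) * wave z (l * s) * phi_R (half_sign s * a - \<bar>s\<bar>))"
        using AE_lborel_singleton[of 0]
        by eventually_elim (use a False in \<open>auto simp: phi_R_def half_sign_def indicator_def max_def algebra_simps\<close>)
    qed
    finally show ?thesis using lhs by simp
  qed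
qed

text \<open>The same layering one order lower: the fundamental theorem of calculus, with the
  interval between 0 and \<open>a\<close> written as a step function of
  \<open>half_sign s * a - \<bar>s\<bar>\<close>. One derivative is spent instead of two, hence the
  first Fourier moment instead of the second.\<close>

lemma step_layer:
  assumes a: "\<bar>a\<bar> \<le> 1"
  shows "wave z (l * a) - wave z 0 =
    (\<integral>s. indicator {-1..1} s * (l * (half_sign s * wave' z (l * s)) * indicator {0..} (half_sign s * a - \<bar>s\<bar>)) \<partial>lborel)"
proof -
  let ?P = "\<lambda>s. wave z (l * s)"
  let ?p = "\<lambda>s. l * wave' z (l * s)"
  have P: "(?P has_real_derivative ?p s) (at s)" for s by (rule wave_derivs)
  have cont: "isCont ?p s" for s by (intro continuous_intros)
  show ?thesis
  proof (cases "0 \<le> a")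
    case True
    have "has_bochner_integral lborel (\<lambda>s. ?p s * indicator {0..a} s) (?P a - ?P 0)"
      by (rule has_bochner_integral_FTC_Icc_real[OF True]) (use P cont in auto)
    then have "?P a - ?P 0 = (\<integral>s. ?p s * indicator {0..a} s \<partial>lborel)"
      by - (drule has_bochner_integral_integral_eq, linarith)
    also have "\<dots> = (\<integral>s. indicator {-1..1} s * (l * (half_sign s * wave' z (l * s)) * indicator {0..} (half_sign s * a - \<bar>s\<bar>)) \<partial>lborel)"
      using a True by (intro Bochner_Integration.integral_cong refl) (auto simp: half_sign_def indicator_def)
    finally show ?thesis by simp
  next
    case False
    then have neg: "a \<le> 0" by simp
    have "has_bochner_integral lborel (\<lambda>s. - ?p s * indicator {a..0} s) (- ?P 0 - - ?P a)"
      by (rule has_bochner_integral_FTC_Icc_real[OF neg]) (rule DERIV_minus[OF P], rule continuous_minus[OF cont])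
    then have "?P a - ?P 0 = (\<integral>s. - ?p s * indicator {a..0} s \<partial>lborel)"
      by - (drule has_bochner_integral_integral_eq, linarith)
    also have "\<dots> = (\<integral>s. indicator {-1..1} s * (l * (half_sign s * wave' z (l * s)) * indicator {0..} (half_sign s * a - \<bar>s\<bar>)) \<partial>lborel)"
    proof (rule integral_cong_AE)
      have m: "(\<lambda>s. wave' z (l * s)) \<in> borel_measurable borel" unfolding wave'_def by measurable
      show "(\<lambda>s. - ?p s * indicator {a..0} s) \<in> borel_measurable lborel" using m by measurable
      show "(\<lambda>s. indicator {-1..1} s * (l * (half_sign s * wave' z (l * s)) * indicator {0..} (half_sign s * a - \<bar>s\<bar>))) \<in> borel_measurable lborel"
        using m by measurable
      show "AE s in lborel. - ?p s * indicator {a..0} s =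
        indicator {-1..1} s * (l * (half_sign s * wave' z (l * s)) * indicator {0..} (half_sign s * a - \<bar>s\<bar>))"
        using AE_lborel_singleton[of 0]
        by eventually_elim (use a False in \<open>auto simp: half_sign_def indicator_def\<close>)
    qed
    finally show ?thesis by simp
  qed
qed

text \<open>The error decays exponentially away from the jump on both sides; integrated over the
  threshold it becomes O(1 / T), wherever the jump lies.\<close>

lemma phi_S_step_error:
  assumes "0 < T"
  shows "\<bar>phi_S (T * v) - indicator {0..} v\<bar> \<le> exp (- T * \<bar>v\<bar>)"
proof (cases "0 \<le> v")
  case True
  have "1 - inverse (1 + e) = e / (1 + e)" if "0 < e" for e :: real using that by (simp add: field_simps)
  from this[of "exp (- T * v)"] have "1 - phi_S (T * v) = exp (- T * v) / (1 + exp (- T * v))"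
    unfolding phi_S_def by simp
  also have "\<dots> \<le> exp (- T * v) / 1" by (intro divide_left_mono) (auto simp: add_pos_pos)
  finally show ?thesis using True phi_S_bounds(2)[of "T * v"] by simp
next
  case False
  have "inverse (1 + inverse e) = e / (e + 1)" if "0 < e" for e :: real using that by (simp add: field_simps)
  from this[of "exp (T * v)"] have "phi_S (T * v) = exp (T * v) / (exp (T * v) + 1)"
    unfolding phi_S_def by (simp add: exp_minus)
  also have "\<dots> \<le> exp (T * v) / 1" by (intro divide_left_mono) (auto simp: add_pos_pos)
  finally show ?thesis using False phi_S_bounds(1)[of "T * v"] by simp
qed

lemma integral_exp_abs_le:
  assumes T: "0 < T" and a: "\<bar>a\<bar> \<le> 1"
  shows "integrable lborel (\<lambda>s. indicator {-1..1} s * exp (- T * \<bar>half_sign s * a - \<bar>s\<bar>\<bar>))"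
    "(\<integral>s. indicator {-1..1} s * exp (- T * \<bar>half_sign s * a - \<bar>s\<bar>\<bar>) \<partial>lborel) \<le> 2 / T"
proof -
  have eq: "\<bar>half_sign s * a - \<bar>s\<bar>\<bar> = \<bar>a - s\<bar>" for s unfolding half_sign_def by auto
  have 1: "has_bochner_integral lborel (\<lambda>s. exp (- T * (a - s)) * indicator {-1..a} s)
      (exp (- T * (a - a)) / T - exp (- T * (a - (-1))) / T)"
    by (rule has_bochner_integral_FTC_Icc_real)
      (use a T in \<open>auto intro!: derivative_eq_intros continuous_intros\<close>)
  have 2: "has_bochner_integral lborel (\<lambda>s. exp (- T * (s - a)) * indicator {a..1} s)
      (- exp (- T * (1 - a)) / T - - exp (- T * (a - a)) / T)"
    by (rule has_bochner_integral_FTC_Icc_real)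
      (use a T in \<open>auto intro!: derivative_eq_intros continuous_intros\<close>)
  let ?g = "\<lambda>s. exp (- T * (a - s)) * indicator {-1..a} s + exp (- T * (s - a)) * indicator {a..1} s"
  have g: "has_bochner_integral lborel ?g ((exp (- T * (a - a)) / T - exp (- T * (a - (-1))) / T) +
    (- exp (- T * (1 - a)) / T - - exp (- T * (a - a)) / T))"
    by (rule has_bochner_integral_add[OF 1 2])
  have ig: "integrable lborel ?g" using g by (rule integrable.intros)
  have le: "indicator {-1..1} s * exp (- T * \<bar>half_sign s * a - \<bar>s\<bar>\<bar>) \<le> ?g s" for s
    unfolding eq by (auto simp: indicator_def abs_real_def)
  show int: "integrable lborel (\<lambda>s. indicator {-1..1} s * exp (- T * \<bar>half_sign s * a - \<bar>s\<bar>\<bar>))"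
  proof (rule Bochner_Integration.integrable_bound[OF ig])
    show "(\<lambda>s. indicator {-1..1} s * exp (- T * \<bar>half_sign s * a - \<bar>s\<bar>\<bar>)) \<in> borel_measurable lborel" by measurable
    show "AE s in lborel. norm (indicator {-1..1} s * exp (- T * \<bar>half_sign s * a - \<bar>s\<bar>\<bar>)) \<le> norm (?g s)"
      using le by (intro AE_I2) (smt (verit) exp_gt_zero indicator_pos_le mult_nonneg_nonneg real_norm_def)
  qed
  have "(\<integral>s. indicator {-1..1} s * exp (- T * \<bar>half_sign s * a - \<bar>s\<bar>\<bar>) \<partial>lborel) \<le> (\<integral>s. ?g s \<partial>lborel)"
    by (intro integral_mono int ig le)
  also have "\<dots> = (exp (- T * (a - a)) / T - exp (- T * (a - (-1))) / T) +
    (- exp (- T * (1 - a)) / T - - exp (- T * (a - a)) / T)"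
    using g by (rule has_bochner_integral_integral_eq)
  also have "\<dots> = 2 / T - (exp (- T * (a + 1)) + exp (- T * (1 - a))) / T" by (simp add: add_divide_distrib)
  also have "\<dots> \<le> 2 / T" using T by (simp add: add_nonneg_nonneg)
  finally show "(\<integral>s. indicator {-1..1} s * exp (- T * \<bar>half_sign s * a - \<bar>s\<bar>\<bar>) \<partial>lborel) \<le> 2 / T" .
qed

section \<open>Fourier representations and approximation on the cube\<close>

text \<open>Passage to real parts. The magnitude is a finite measure because \<open>h\<close> is
  integrable and |h| = 1.\<close>

lemma fourier_repE:
  fixes f :: "real ^ 'd \<Rightarrow> real"
  assumes "fourier_rep f F"
  obtains h where "finite_measure (magnitude F)" "sets (magnitude F) = sets borel"
    "h \<in> borel_measurable borel" "\<And>w. cmod (h w) = 1"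
    "\<And>x. integrable (magnitude F) (\<lambda>w. wave (h w) (w \<bullet> x))"
    "\<And>x. f x = (\<integral>w. wave (h w) (w \<bullet> x) \<partial>magnitude F)"
proof -
  let ?m = "magnitude F"
  obtain h where h: "polar_density F h" and
    rep: "\<And>x. complex_of_real (f x) = (LINT w|?m. exp (\<i> * complex_of_real (w \<bullet> x)) * h w)"
    using assms unfolding fourier_rep_def by auto
  have sets: "sets ?m = sets borel"
    unfolding magnitude_def by (simp add: sets.sigma_sets_eq[of borel, simplified])
  have int: "integrable ?m h" and norm: "\<And>w. cmod (h w) = 1" using h unfolding polar_density_def by auto
  have h_meas: "h \<in> borel_measurable borel"
    using borel_measurable_integrable[OF int] measurable_cong_sets[OF sets refl] by blast
  have "integrable ?m (\<lambda>w. norm (h w))" using int by (rule integrable_norm)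
  then have "integrable ?m (\<lambda>w. 1 :: real)" by (simp add: norm)
  then have fin: "finite_measure ?m"
    by (intro finite_measureI) (auto simp: integrable_iff_bounded)
  have i: "integrable ?m (\<lambda>w. exp (\<i> * complex_of_real (w \<bullet> x)) * h w)" for x
  proof (rule Bochner_Integration.integrable_bound[OF int])
    show "(\<lambda>w. exp (\<i> * complex_of_real (w \<bullet> x)) * h w) \<in> borel_measurable ?m"
      unfolding measurable_cong_sets[OF sets refl]
      by (rule borel_measurable_times[OF borel_measurable_continuous_onI h_meas]) (intro continuous_intros)
  qed (auto simp: norm_mult)
  have Re: "Re (exp (\<i> * complex_of_real (w \<bullet> x)) * h w) = wave (h w) (w \<bullet> x)" for w x
    by (simp only: cis_conv_exp[symmetric] wave_Re)
  have int_wave: "integrable ?m (\<lambda>w. wave (h w) (w \<bullet> x))" for x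
    using integrable_Re[OF i[of x]] unfolding Re .
  have "f x = (\<integral>w. wave (h w) (w \<bullet> x) \<partial>?m)" for x
  proof -
    have "f x = Re (LINT w|?m. exp (\<i> * complex_of_real (w \<bullet> x)) * h w)"
      using rep[of x] by (metis Re_complex_of_real)
    then show ?thesis using integral_Re[OF i[of x]] unfolding Re by simp
  qed
  then show ?thesis using that fin sets h_meas norm int_wave by blast
qed

lemma fourier_momentE:
  assumes "sets (magnitude F) = sets borel" "fourier_moment k F \<le> ennreal c" "0 \<le> c"
  shows "integrable (magnitude F) (\<lambda>w. norm1 w ^ k)" "(\<integral>w. norm1 w ^ k \<partial>magnitude F) \<le> c"
proof -
  have "(\<lambda>w. norm1 w ^ k) \<in> borel_measurable (magnitude F)"
    unfolding measurable_cong_sets[OF assms(1) refl] by measurable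
  moreover have "(\<integral>\<^sup>+w. ennreal (norm1 w ^ k) \<partial>magnitude F) < \<infinity>"
    using assms(2) unfolding fourier_moment_def by (rule le_less_trans) simp
  ultimately show i: "integrable (magnitude F) (\<lambda>w. norm1 w ^ k)"
    by (intro integrableI_nonneg) auto
  have "ennreal (\<integral>w. norm1 w ^ k \<partial>magnitude F) = (\<integral>\<^sup>+w. ennreal (norm1 w ^ k) \<partial>magnitude F)"
    using i by (intro nn_integral_eq_integral[symmetric]) auto
  then show "(\<integral>w. norm1 w ^ k \<partial>magnitude F) \<le> c"
    using assms(2,3) unfolding fourier_moment_def by (metis ennreal_le_iff)
qed

lemma set_norm_unit_cube: "set_norm (unit_cube :: (real ^ 'd) set) = 1"
proof -
  have inf: "infnorm x = Max ((\<lambda>j. \<bar>x $ j\<bar>) ` UNIV)" for x :: "real ^ 'd"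
    unfolding infnorm_Max by (rule arg_cong[where f = Max])
      (auto simp: Basis_vec_def inner_axis image_iff)
  have le: "infnorm x \<le> 1" if "x \<in> unit_cube" for x :: "real ^ 'd"
    unfolding inf using that by (auto intro!: Max.boundedI)
  have one: "(1 :: real ^ 'd) \<in> unit_cube" "infnorm (1 :: real ^ 'd) = 1" unfolding inf by auto
  show ?thesis unfolding set_norm_def
  proof (rule antisym)
    show "(SUP x\<in>unit_cube. infnorm (x :: real ^ 'd)) \<le> 1" 
      by (rule cSUP_least) (use one(1) in blast, rule le)
    show "1 \<le> (SUP x\<in>unit_cube. infnorm (x :: real ^ 'd))"
    proof (rule cSUP_upper2[OF _ one(1)])
      show "bdd_above ((infnorm :: real ^ 'd \<Rightarrow> real) ` unit_cube)" by (rule bdd_aboveI2) (rule le)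
    qed (simp add: one(2))
  qed
qed

text \<open>The infimum defining the coefficients need not be attained, hence \<open>M < c\<close>.\<close>

lemma c_KB_leD:
  fixes f :: "real ^ 'd \<Rightarrow> real"
  assumes "c_KB f unit_cube \<le> ereal M" "M < c"
  obtains f' F G where "fourier_rep f' F" "\<And>x. x \<in> unit_cube \<Longrightarrow> f' x = f x"
    "fourier_moment 2 F \<le> ennreal c" "\<bar>f' 0\<bar> \<le> c" "GDERIV f' 0 :> G" "norm1 G \<le> c"
proof -
  have "c_KB f unit_cube < ereal c" using assms by (simp add: le_less_trans)
  then obtain b where "b < c" and b: "0 \<le> b \<and>
     (\<exists>f' F G. fourier_rep f' F \<and> (\<forall>x\<in>unit_cube. f' x = f x) \<and>
        ennreal (set_norm (unit_cube :: (real ^ 'd) set)) * fourier_moment 2 F \<le> ennreal b \<and>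
        \<bar>f' 0\<bar> \<le> b \<and> (GDERIV f' 0 :> G) \<and> norm1 G \<le> b)"
    unfolding c_KB_def Inf_less_iff by auto
  then show ?thesis using that unfolding set_norm_unit_cube
    by (smt (verit, best) ennreal_1 ennreal_leI mult_1 order_trans)
qed

lemma c_B_leD:
  fixes f :: "real ^ 'd \<Rightarrow> real"
  assumes "c_B f unit_cube \<le> ereal M" "M < c"
  obtains f' F where "fourier_rep f' F" "\<And>x. x \<in> unit_cube \<Longrightarrow> f' x = f x"
    "fourier_moment 1 F \<le> ennreal c" "\<bar>f' 0\<bar> \<le> c"
proof -
  have "c_B f unit_cube < ereal c" using assms by (simp add: le_less_trans)
  then obtain b where "b < c" and b: "0 \<le> b \<and>
     (\<exists>f' F. fourier_rep f' F \<and> (\<forall>x\<in>unit_cube. f' x = f x) \<and>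
        ennreal (set_norm (unit_cube :: (real ^ 'd) set)) * fourier_moment 1 F \<le> ennreal b \<and>
        \<bar>f' 0\<bar> \<le> b)"
    unfolding c_B_def Inf_less_iff by auto
  then show ?thesis using that unfolding set_norm_unit_cube
    by (smt (verit, best) ennreal_1 ennreal_leI mult_1 order_trans)
qed

lemma square_inner_le:
  assumes "x \<in> unit_cube"
  shows "(w \<bullet> x)\<^sup>2 \<le> norm1 w ^ 2"
  using power_mono[OF inner_le_norm1[OF assms, of w], of 2] by simp

lemma abs_inner_le_norm1_mult:
  fixes w x :: "real ^ 'd"
  shows "\<bar>w \<bullet> x\<bar> \<le> norm1 w * norm1 x"
proof -
  have comp: "\<bar>x $ j\<bar> \<le> norm1 x" for j unfolding norm1_def by (rule member_le_sum) auto
  have "\<bar>w \<bullet> x\<bar> \<le> (\<Sum>j\<in>UNIV. \<bar>w $ j * x $ j\<bar>)" unfolding inner_vec_def by (simp add: sum_abs)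
  also have "\<dots> \<le> (\<Sum>j\<in>UNIV. \<bar>w $ j\<bar> * norm1 x)"
    using comp by (intro sum_mono) (auto simp: abs_mult intro: mult_left_mono)
  finally show ?thesis unfolding norm1_def[of w] by (simp add: sum_distrib_right)
qed

text \<open>The coefficient controls the gradient \<open>G\<close>, whereas expanding under the
  integral produces the mean of (w x) wave'(h w) 0. The second moment makes the remainder along
  every line quadratic in t, so both expressions are the derivative of f (t x) at t = 0.\<close>

lemma fourier_gradient:
  fixes f :: "real ^ 'd \<Rightarrow> real" and h :: "real ^ 'd \<Rightarrow> complex"
  assumes fin: "finite_measure m" and sets: "sets m = sets borel"
    and h: "h \<in> borel_measurable borel" "\<And>w. cmod (h w) = 1"
    and int: "\<And>x. integrable m (\<lambda>w. wave (h w) (w \<bullet> x))"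
    and rep: "\<And>x. f x = (\<integral>w. wave (h w) (w \<bullet> x) \<partial>m)"
    and mom: "integrable m (\<lambda>w. norm1 w ^ 2)"
    and G: "GDERIV f 0 :> G"
  shows "integrable m (\<lambda>w. (w \<bullet> x) * wave' (h w) 0)"
    "(\<integral>w. (w \<bullet> x) * wave' (h w) 0 \<partial>m) = G \<bullet> x"
    "f x - f 0 - G \<bullet> x = (\<integral>w. wave (h w) (w \<bullet> x) - wave (h w) 0 - (w \<bullet> x) * wave' (h w) 0 \<partial>m)"
    "integrable m (\<lambda>w. wave (h w) (w \<bullet> x) - wave (h w) 0 - (w \<bullet> x) * wave' (h w) 0)"
proof -
  interpret finite_measure m by (rule fin)
  note [measurable_cong] = sets
  note [measurable] = h(1)
  have L: "integrable m (\<lambda>w. (w \<bullet> x) * wave' (h w) 0)" for x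
  proof (rule Bochner_Integration.integrable_bound)
    \<comment> \<open>The first moment is finite because the measure is finite and norm1 w \<le> 1 +
      (norm1 w)^2.\<close>
    show "integrable m (\<lambda>w. (1 + norm1 w ^ 2) * norm1 x)"
      using mom by (intro integrable_mult_left Bochner_Integration.integrable_add) auto
    show "(\<lambda>w. (w \<bullet> x) * wave' (h w) 0) \<in> borel_measurable m" unfolding wave'_def by measurable
    have "\<bar>(w \<bullet> x) * wave' (h w) 0\<bar> \<le> (1 + norm1 w ^ 2) * norm1 x" for w
    proof -
      have "\<bar>(w \<bullet> x) * wave' (h w) 0\<bar> \<le> (norm1 w * norm1 x) * 1"
        unfolding abs_mult using abs_inner_le_norm1_mult[of w x] wave_abs_le(2)[of "h w" 0] h(2) by (intro mult_mono) auto
      also have "\<dots> \<le> (1 + norm1 w ^ 2) * norm1 x"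
      proof -
        have "0 \<le> (norm1 w - 1)\<^sup>2 + norm1 w" by simp
        then have "norm1 w \<le> 1 + norm1 w ^ 2" by (simp add: power2_eq_square algebra_simps)
        then show ?thesis by (simp add: mult_right_mono)
      qed
      finally show ?thesis .
    qed
    then show "AE w in m. norm ((w \<bullet> x) * wave' (h w) 0) \<le> norm ((1 + norm1 w ^ 2) * norm1 x)" by (auto intro: order_trans)
  qed
  define l where "l x = (\<integral>w. (w \<bullet> x) * wave' (h w) 0 \<partial>m)" for x
  have int0: "integrable m (\<lambda>w. wave (h w) 0)" using int[of 0] by simp
  have I: "integrable m (\<lambda>w. wave (h w) (w \<bullet> x) - wave (h w) 0 - (w \<bullet> x) * wave' (h w) 0)" for x
    by (intro Bochner_Integration.integrable_diff int int0 L)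
  have eq: "f x - f 0 - l x = (\<integral>w. wave (h w) (w \<bullet> x) - wave (h w) 0 - (w \<bullet> x) * wave' (h w) 0 \<partial>m)" for x
    unfolding rep l_def using int[of x] int0 L[of x] by simp
  define C where "C = (\<integral>w. norm1 w ^ 2 \<partial>m) * (norm1 x)\<^sup>2"
  have lt: "l (t *\<^sub>R x) = t * l x" for t unfolding l_def by (simp add: mult.assoc)
  have quad: "\<bar>f (t *\<^sub>R x) - f 0 - t * l x\<bar> \<le> t\<^sup>2 * C" for t
  proof -
    have "f (t *\<^sub>R x) - f 0 - t * l x = (\<integral>w. wave (h w) (w \<bullet> (t *\<^sub>R x)) - wave (h w) 0 - (w \<bullet> (t *\<^sub>R x)) * wave' (h w) 0 \<partial>m)"
      using eq[of "t *\<^sub>R x"] unfolding lt .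
    then have "\<bar>f (t *\<^sub>R x) - f 0 - t * l x\<bar> \<le> (\<integral>w. \<bar>wave (h w) (w \<bullet> (t *\<^sub>R x)) - wave (h w) 0 - (w \<bullet> (t *\<^sub>R x)) * wave' (h w) 0\<bar> \<partial>m)"
      by (simp only: integral_abs_bound)
    also have "\<dots> \<le> (\<integral>w. norm1 w ^ 2 * (t\<^sup>2 * (norm1 x)\<^sup>2) \<partial>m)"
    proof (rule integral_mono)
      show "integrable m (\<lambda>w. \<bar>wave (h w) (w \<bullet> (t *\<^sub>R x)) - wave (h w) 0 - (w \<bullet> (t *\<^sub>R x)) * wave' (h w) 0\<bar>)"
        by (rule integrable_abs[OF I])
      show "integrable m (\<lambda>w. norm1 w ^ 2 * (t\<^sup>2 * (norm1 x)\<^sup>2))" using mom by simp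
      fix w
      have "\<bar>wave (h w) (w \<bullet> (t *\<^sub>R x)) - wave (h w) 0 - (w \<bullet> (t *\<^sub>R x)) * wave' (h w) 0\<bar> \<le> (w \<bullet> (t *\<^sub>R x))\<^sup>2"
        using wave_taylor2[of "h w" "w \<bullet> (t *\<^sub>R x)"] h(2) by simp
      also have "\<dots> = t\<^sup>2 * \<bar>w \<bullet> x\<bar>\<^sup>2" by (simp add: power_mult_distrib)
      also have "\<dots> \<le> t\<^sup>2 * (norm1 w * norm1 x)\<^sup>2" by (intro mult_left_mono power_mono abs_inner_le_norm1_mult) auto
      finally show "\<bar>wave (h w) (w \<bullet> (t *\<^sub>R x)) - wave (h w) 0 - (w \<bullet> (t *\<^sub>R x)) * wave' (h w) 0\<bar> \<le> norm1 w ^ 2 * (t\<^sup>2 * (norm1 x)\<^sup>2)"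
        by (simp add: power_mult_distrib mult_ac)
    qed
    also have "\<dots> = t\<^sup>2 * C" unfolding C_def by simp
    finally show ?thesis .
  qed
  have D1: "((\<lambda>t. f (t *\<^sub>R x)) has_real_derivative l x) (at 0)"
    unfolding DERIV_def
  proof (rule LIM_zero_cancel, rule Lim_null_comparison)
    show "\<forall>\<^sub>F t in at 0. norm ((f ((0 + t) *\<^sub>R x) - f (0 *\<^sub>R x)) / t - l x) \<le> \<bar>t\<bar> * C"
    proof (rule eventually_at_filter[THEN iffD2], rule always_eventually, intro allI impI)
      fix t :: real assume t: "t \<noteq> 0"
      have "(f ((0 + t) *\<^sub>R x) - f (0 *\<^sub>R x)) / t - l x = (f (t *\<^sub>R x) - f 0 - t * l x) / t" using t by (simp add: field_simps)
      then have "norm ((f ((0 + t) *\<^sub>R x) - f (0 *\<^sub>R x)) / t - l x) = \<bar>f (t *\<^sub>R x) - f 0 - t * l x\<bar> / \<bar>t\<bar>" by simp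
      also have "\<dots> \<le> t\<^sup>2 * C / \<bar>t\<bar>" by (intro divide_right_mono quad) simp
      also have "\<dots> = \<bar>t\<bar> * C" using t by (simp add: power2_eq_square abs_if)
      finally show "norm ((f ((0 + t) *\<^sub>R x) - f (0 *\<^sub>R x)) / t - l x) \<le> \<bar>t\<bar> * C" .
    qed
    show "((\<lambda>t. \<bar>t\<bar> * C) \<longlongrightarrow> 0) (at 0)" by (auto intro!: tendsto_eq_intros)
  qed
  have D2: "((\<lambda>t. f (t *\<^sub>R x)) has_real_derivative G \<bullet> x) (at 0)"
  proof -
    have "(f has_derivative (\<lambda>h. h \<bullet> G)) (at (0 *\<^sub>R x))" using G unfolding gderiv_def by simp
    then have "((\<lambda>t. f (t *\<^sub>R x)) has_derivative (\<lambda>t. (t *\<^sub>R x) \<bullet> G)) (at (0::real))"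
      by (rule has_derivative_compose[rotated]) (auto intro!: derivative_eq_intros)
    then show ?thesis unfolding has_field_derivative_def
      by (rule has_derivative_eq_rhs) (auto simp: inner_commute)
  qed
  show lG: "(\<integral>w. (w \<bullet> x) * wave' (h w) 0 \<partial>m) = G \<bullet> x"
    using DERIV_unique[OF D1 D2] unfolding l_def .
  show "integrable m (\<lambda>w. (w \<bullet> x) * wave' (h w) 0)" by (rule L)
  show "integrable m (\<lambda>w. wave (h w) (w \<bullet> x) - wave (h w) 0 - (w \<bullet> x) * wave' (h w) 0)" by (rule I)
  show "f x - f 0 - G \<bullet> x = (\<integral>w. wave (h w) (w \<bullet> x) - wave (h w) 0 - (w \<bullet> x) * wave' (h w) 0 \<partial>m)"
    using eq[of x] lG unfolding l_def by simp
qed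

lemma net_classI:
  assumes "\<And>i. i \<in> {1..k} \<Longrightarrow> norm1 (w i) \<le> a1" "\<And>i. i \<in> {1..k} \<Longrightarrow> \<bar>b i\<bar> \<le> a1"
    "\<And>i. i \<in> {1..k} \<Longrightarrow> \<bar>\<beta> i\<bar> \<le> a2" "\<bar>b0\<bar> \<le> a3" "norm1 w0 \<le> a4"
  shows "(\<lambda>x. (\<Sum>i=1..k. \<beta> i * \<phi> (w i \<bullet> x + b i)) + w0 \<bullet> x + b0) \<in> net_class k a1 a2 a3 a4 \<phi>"
  unfolding net_class_def mem_Collect_eq
  by (intro exI[of _ \<beta>] exI[of _ w] exI[of _ b] exI[of _ w0] exI[of _ b0]) (use assms in auto)

text \<open>The value and the gradient at 0 go exactly into the bias and the linear part of the
  network; only the Taylor remainder, a mixture of ReLU ridges of total weight \<open>S\<close>, is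
  sampled. Sampling costs at most 16 S^2 / n; the constant 40 is shared with the sigmoid case, which
  requires it.\<close>

lemma relu_approx:
  fixes f :: "real ^ 'd \<Rightarrow> real"
  assumes rep: "fourier_rep f F" and mom: "fourier_moment 2 F \<le> ennreal c" and f0: "\<bar>f 0\<bar> \<le> c"
    and G: "GDERIV f 0 :> G" "norm1 G \<le> c" and \<mu>: "cube_law \<mu>" and n: "n \<ge> 1"
  shows "\<exists>g\<in>net_class n 1 (2 * c / n) c c phi_R. (\<integral>x. (g x - f x)\<^sup>2 \<partial>\<mu>) \<le> 40 * c\<^sup>2 / n"
    and "x \<in> unit_cube \<Longrightarrow> \<bar>f x\<bar> \<le> 3 * c"
proof -
  have c: "0 \<le> c" using f0 by simp
  obtain h where fin: "finite_measure (magnitude F)" and sets: "sets (magnitude F) = sets borel"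
    and h: "h \<in> borel_measurable borel" "\<And>w. cmod (h w) = 1"
    and int: "\<And>x. integrable (magnitude F) (\<lambda>w. wave (h w) (w \<bullet> x))"
    and repf: "\<And>x. f x = (\<integral>w. wave (h w) (w \<bullet> x) \<partial>magnitude F)"
    by (rule fourier_repE[OF rep]) (rule that)
  define m where "m = magnitude F"
  note fin = fin[folded m_def] and sets = sets[folded m_def] and int = int[folded m_def] and repf = repf[folded m_def]
  define S where "S = (\<integral>w. norm1 w ^ 2 \<partial>m)"
  have mi: "integrable m (\<lambda>w. norm1 w ^ 2)" and S: "S \<le> c"
    using fourier_momentE[OF sets[unfolded m_def] mom c] unfolding S_def m_def by auto
  have S0: "0 \<le> S" unfolding S_def by (rule Bochner_Integration.integral_nonneg) simp
  note grad = fourier_gradient[OF fin sets h int repf mi G(1)]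
  have rem: "\<bar>f x - f 0 - G \<bullet> x\<bar> \<le> S" if x: "x \<in> unit_cube" for x
  proof -
    have "\<bar>f x - f 0 - G \<bullet> x\<bar> \<le> (\<integral>w. \<bar>wave (h w) (w \<bullet> x) - wave (h w) 0 - (w \<bullet> x) * wave' (h w) 0\<bar> \<partial>m)"
      unfolding grad(3) by (rule integral_abs_bound)
    also have "\<dots> \<le> S" unfolding S_def
    proof (rule integral_mono[OF integrable_abs[OF grad(4)] mi])
      fix w
      have "\<bar>wave (h w) (w \<bullet> x) - wave (h w) 0 - (w \<bullet> x) * wave' (h w) 0\<bar> \<le> (w \<bullet> x)\<^sup>2"
        using wave_taylor2[of "h w" "w \<bullet> x"] h(2) by simp
      also have "\<dots> \<le> norm1 w ^ 2" by (rule square_inner_le[OF x])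
      finally show "\<bar>wave (h w) (w \<bullet> x) - wave (h w) 0 - (w \<bullet> x) * wave' (h w) 0\<bar> \<le> norm1 w ^ 2" .
    qed
    finally show ?thesis .
  qed
  show "\<bar>f x\<bar> \<le> 3 * c" if x: "x \<in> unit_cube"
    using rem[OF x] inner_le_norm1[OF x, of G] f0 G(2) S by linarith
  show "\<exists>g\<in>net_class n 1 (2 * c / n) c c phi_R. (\<integral>x. (g x - f x)\<^sup>2 \<partial>\<mu>) \<le> 40 * c\<^sup>2 / n"
  proof (cases "S = 0")
    \<comment> \<open>The sampling density W / S makes no sense here, but the remainder vanishes and
      \<open>f\<close> is affine on the cube.\<close>
    case True
    let ?g = "\<lambda>x :: real ^ 'd. (\<Sum>i=1..n. 0 * phi_R (0 \<bullet> x + 0)) + G \<bullet> x + f 0"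
    have "?g \<in> net_class n 1 (2 * c / n) c c phi_R"
      by (rule net_classI) (use f0 G(2) c in \<open>auto simp: norm1_def\<close>)
    moreover have "(\<integral>x. (?g x - f x)\<^sup>2 \<partial>\<mu>) = (\<integral>x. 0 \<partial>\<mu>)"
    proof (rule Bochner_Integration.integral_cong[OF refl])
      fix x assume "x \<in> space \<mu>"
      then have "x \<in> unit_cube" using cube_lawD(3)[OF \<mu>] by auto
      from rem[OF this] have "?g x = f x" using True by simp
      then show "(?g x - f x)\<^sup>2 = 0" by simp
    qed
    ultimately show ?thesis using n by (intro bexI[of _ ?g]) auto
  next
    case False
    then have Spos: "0 < S" using S0 by simp
    let ?c = "\<lambda>w s. - wave (h w) (norm1 w * s)"
    have cm: "case_prod ?c \<in> borel_measurable (borel \<Otimes>\<^sub>M borel)"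
      unfolding wave_def case_prod_beta using h(1) by measurable
    have phi: "phi_R \<in> borel_measurable borel" unfolding phi_R_def by measurable
    have Wm: "(\<lambda>w. norm1 w ^ 2) \<in> borel_measurable borel" by measurable
    have W0: "0 \<le> norm1 w ^ 2" for w :: "real ^ 'd" by simp
    have cb: "\<bar>?c w s\<bar> \<le> 1" for w s using wave_abs_le(1)[of "h w"] h(2) by simp
    have phib: "\<bar>phi_R v\<bar> \<le> 1" if "v \<le> 1" for v using that unfolding phi_R_def by simp
    from ridge_sampling[OF fin sets Wm W0 mi S_def Spos cm cb phi phib \<mu> n]
    obtain \<omega> r where r: "\<forall>i\<in>{1..n}. r i \<in> {-1..1}" and
      err: "(\<integral>x. ((\<Sum>i=1..n. 2 * S / n * ?c (\<omega> i) (r i) * phi_R (half_sign (r i) * (unit_dir (\<omega> i) \<bullet> x) - \<bar>r i\<bar>))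
       - (\<integral>w. norm1 w ^ 2 * (\<integral>s. indicator {-1..1} s * (?c w s * phi_R (half_sign s * (unit_dir w \<bullet> x) - \<bar>s\<bar>)) \<partial>lborel) \<partial>m))\<^sup>2 \<partial>\<mu>)
      \<le> 16 * S\<^sup>2 / n"
      by blast
    have target: "(\<integral>w. norm1 w ^ 2 * (\<integral>s. indicator {-1..1} s * (?c w s * phi_R (half_sign s * (unit_dir w \<bullet> x) - \<bar>s\<bar>)) \<partial>lborel) \<partial>m)
       = f x - f 0 - G \<bullet> x" if x: "x \<in> unit_cube" for x
      unfolding grad(3)
    proof (rule Bochner_Integration.integral_cong[OF refl])
      fix w
      have a: "\<bar>unit_dir w \<bullet> x\<bar> \<le> 1" using inner_le_norm1[OF x, of "unit_dir w"] norm1_unit_dir[of w] by simp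
      have "wave (h w) (w \<bullet> x) - wave (h w) 0 - (w \<bullet> x) * wave' (h w) 0 =
        (\<integral>s. indicator {-1..1} s * (- ((norm1 w)\<^sup>2) * wave (h w) (norm1 w * s) * phi_R (half_sign s * (unit_dir w \<bullet> x) - \<bar>s\<bar>)) \<partial>lborel)"
        using relu_layer[OF a, of "h w" "norm1 w"] unfolding inner_unit_dir .
      also have "\<dots> = (\<integral>s. norm1 w ^ 2 * (indicator {-1..1} s * (?c w s * phi_R (half_sign s * (unit_dir w \<bullet> x) - \<bar>s\<bar>))) \<partial>lborel)"
        by (intro Bochner_Integration.integral_cong refl) (simp add: mult_ac)
      also have "\<dots> = norm1 w ^ 2 * (\<integral>s. indicator {-1..1} s * (?c w s * phi_R (half_sign s * (unit_dir w \<bullet> x) - \<bar>s\<bar>)) \<partial>lborel)"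
        by (rule integral_mult_right_zero)
      finally show "norm1 w ^ 2 * (\<integral>s. indicator {-1..1} s * (?c w s * phi_R (half_sign s * (unit_dir w \<bullet> x) - \<bar>s\<bar>)) \<partial>lborel)
        = wave (h w) (w \<bullet> x) - wave (h w) 0 - (w \<bullet> x) * wave' (h w) 0" ..
    qed
    let ?g = "\<lambda>x. (\<Sum>i=1..n. (2 * S / n * ?c (\<omega> i) (r i)) * phi_R ((half_sign (r i) *\<^sub>R unit_dir (\<omega> i)) \<bullet> x + - \<bar>r i\<bar>)) + G \<bullet> x + f 0"
    have "?g \<in> net_class n 1 (2 * c / n) c c phi_R"
    proof (rule net_classI)
      fix i assume i: "i \<in> {1..n}"
      show "norm1 (half_sign (r i) *\<^sub>R unit_dir (\<omega> i)) \<le> 1"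
        unfolding norm1_scaleR using norm1_unit_dir[of "\<omega> i"] by (auto simp: half_sign_def)
      show "\<bar>- \<bar>r i\<bar>\<bar> \<le> 1" using r i by (auto simp: abs_le_iff)
      have "\<bar>2 * S / n * ?c (\<omega> i) (r i)\<bar> \<le> 2 * S / n * 1"
        unfolding abs_mult using wave_abs_le(1)[of "h (\<omega> i)"] h(2) S0 by (intro mult_mono) auto
      also have "\<dots> \<le> 2 * c / n" using S by (simp add: divide_right_mono)
      finally show "\<bar>2 * S / n * ?c (\<omega> i) (r i)\<bar> \<le> 2 * c / n" .
    qed (use f0 G in auto)
    moreover have "(\<integral>x. (?g x - f x)\<^sup>2 \<partial>\<mu>) \<le> 40 * c\<^sup>2 / n"
    proof -
      have "(\<integral>x. (?g x - f x)\<^sup>2 \<partial>\<mu>) = (\<integral>x. ((\<Sum>i=1..n. 2 * S / n * ?c (\<omega> i) (r i) * phi_R (half_sign (r i) * (unit_dir (\<omega> i) \<bullet> x) - \<bar>r i\<bar>))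
       - (\<integral>w. norm1 w ^ 2 * (\<integral>s. indicator {-1..1} s * (?c w s * phi_R (half_sign s * (unit_dir w \<bullet> x) - \<bar>s\<bar>)) \<partial>lborel) \<partial>m))\<^sup>2 \<partial>\<mu>)"
      proof (rule Bochner_Integration.integral_cong[OF refl])
        fix x assume "x \<in> space \<mu>"
        then have x: "x \<in> unit_cube" using cube_lawD(3)[OF \<mu>] by auto
        show "(?g x - f x)\<^sup>2 = ((\<Sum>i=1..n. 2 * S / n * ?c (\<omega> i) (r i) * phi_R (half_sign (r i) * (unit_dir (\<omega> i) \<bullet> x) - \<bar>r i\<bar>))
       - (\<integral>w. norm1 w ^ 2 * (\<integral>s. indicator {-1..1} s * (?c w s * phi_R (half_sign s * (unit_dir w \<bullet> x) - \<bar>s\<bar>)) \<partial>lborel) \<partial>m))\<^sup>2"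
          unfolding target[OF x] inner_scaleR_left by (rule arg_cong[where f = "\<lambda>u. u\<^sup>2"]) (simp add: algebra_simps)
      qed
      also have "\<dots> \<le> 16 * S\<^sup>2 / n" by (rule err)
      also have "\<dots> \<le> 40 * c\<^sup>2 / n"
      proof -
        have "S\<^sup>2 \<le> c\<^sup>2" using S S0 by (intro power_mono) auto
        then have "16 * S\<^sup>2 \<le> 40 * c\<^sup>2" using zero_le_power2[of c] by linarith
        then show ?thesis by (intro divide_right_mono) auto
      qed
      finally show ?thesis .
    qed
    ultimately show ?thesis by (intro bexI[of _ ?g])
  qed
qed


text \<open>The steps are first smoothed to sigmoids of slope \<open>T\<close>, with uniform bias 2
  S / T, and the smoothed mixture is sampled. As n \<le> T^2, twice the squared bias plus twice the
  sampling error is at most 8 S^2 / n + 32 S^2 / n.\<close>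

lemma sigmoid_approx:
  fixes f :: "real ^ 'd \<Rightarrow> real"
  assumes rep: "fourier_rep f F" and mom: "fourier_moment 1 F \<le> ennreal c" and f0: "\<bar>f 0\<bar> \<le> c"
    and \<mu>: "cube_law \<mu>" and n: "n \<ge> 1" and T: "0 < T" "real n \<le> T\<^sup>2"
  shows "\<exists>g\<in>net_class n T (2 * c / n) c 0 phi_S. (\<integral>x. (g x - f x)\<^sup>2 \<partial>\<mu>) \<le> 40 * c\<^sup>2 / n"
    and "x \<in> unit_cube \<Longrightarrow> \<bar>f x\<bar> \<le> 3 * c"
proof -
  have c: "0 \<le> c" using f0 by simp
  obtain h where fin: "finite_measure (magnitude F)" and sets: "sets (magnitude F) = sets borel"
    and h: "h \<in> borel_measurable borel" "\<And>w. cmod (h w) = 1"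
    and int: "\<And>x. integrable (magnitude F) (\<lambda>w. wave (h w) (w \<bullet> x))"
    and repf: "\<And>x. f x = (\<integral>w. wave (h w) (w \<bullet> x) \<partial>magnitude F)"
    by (rule fourier_repE[OF rep]) (rule that)
  define m where "m = magnitude F"
  note fin = fin[folded m_def] and sets = sets[folded m_def] and int = int[folded m_def] and repf = repf[folded m_def]
  interpret finite_measure m by (rule fin)
  interpret \<mu>: prob_space \<mu> by (rule cube_lawD[OF \<mu>])
  note [measurable_cong] = sets
  note [measurable] = h(1)
  define S where "S = (\<integral>w. norm1 w \<partial>m)"
  have mi: "integrable m norm1" and S: "S \<le> c"
    using fourier_momentE[OF sets[unfolded m_def] mom c] unfolding S_def m_def by auto
  have S0: "0 \<le> S" unfolding S_def by (rule Bochner_Integration.integral_nonneg) simp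
  have diff: "f x - f 0 = (\<integral>w. wave (h w) (w \<bullet> x) - wave (h w) 0 \<partial>m)"
    and diffi: "integrable m (\<lambda>w. wave (h w) (w \<bullet> x) - wave (h w) 0)" for x
    unfolding repf using int[of x] int[of 0] by simp_all
  have rem: "\<bar>f x - f 0\<bar> \<le> S" if x: "x \<in> unit_cube" for x
  proof -
    have "\<bar>f x - f 0\<bar> \<le> (\<integral>w. \<bar>wave (h w) (w \<bullet> x) - wave (h w) 0\<bar> \<partial>m)"
      unfolding diff by (rule integral_abs_bound)
    also have "\<dots> \<le> S" unfolding S_def
    proof (rule integral_mono[OF integrable_abs[OF diffi] mi])
      fix w
      show "\<bar>wave (h w) (w \<bullet> x) - wave (h w) 0\<bar> \<le> norm1 w"
        using wave_taylor1[of "h w" "w \<bullet> x"] h(2)[of w] inner_le_norm1[OF x, of w] by simp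
    qed
    finally show ?thesis .
  qed
  show "\<bar>f x\<bar> \<le> 3 * c" if x: "x \<in> unit_cube"
    using rem[OF x] f0 S by linarith
  show "\<exists>g\<in>net_class n T (2 * c / n) c 0 phi_S. (\<integral>x. (g x - f x)\<^sup>2 \<partial>\<mu>) \<le> 40 * c\<^sup>2 / n"
  proof (cases "S = 0")
    case True
    let ?g = "\<lambda>x :: real ^ 'd. (\<Sum>i=1..n. 0 * phi_S (0 \<bullet> x + 0)) + 0 \<bullet> x + f 0"
    have "?g \<in> net_class n T (2 * c / n) c 0 phi_S"
      by (rule net_classI) (use f0 c T in \<open>auto simp: norm1_def\<close>)
    moreover have "(\<integral>x. (?g x - f x)\<^sup>2 \<partial>\<mu>) = (\<integral>x. 0 \<partial>\<mu>)"
    proof (rule Bochner_Integration.integral_cong[OF refl])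
      fix x assume "x \<in> space \<mu>"
      then have "x \<in> unit_cube" using cube_lawD(3)[OF \<mu>] by auto
      from rem[OF this] have "?g x = f x" using True by simp
      then show "(?g x - f x)\<^sup>2 = 0" by simp
    qed
    ultimately show ?thesis using n by (intro bexI[of _ ?g]) auto
  next
    case False
    then have Spos: "0 < S" using S0 by simp
    let ?c = "\<lambda>w s. half_sign s * wave' (h w) (norm1 w * s)"
    let ?\<psi> = "\<lambda>v. phi_S (T * v)"
    let ?v = "\<lambda>w s x. half_sign s * (unit_dir w \<bullet> x) - \<bar>s\<bar>"
    have cm: "case_prod ?c \<in> borel_measurable (borel \<Otimes>\<^sub>M borel)"
      unfolding wave'_def case_prod_beta by measurable
    have psi: "?\<psi> \<in> borel_measurable borel" unfolding phi_S_def by measurable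
    have cb: "\<bar>?c w s\<bar> \<le> 1" for w s using wave_abs_le(2)[of "h w"] h(2) by (auto simp: half_sign_def)
    define smooth where "smooth x = (\<integral>w. norm1 w * (\<integral>s. indicator {-1..1} s * (?c w s * ?\<psi> (?v w s x)) \<partial>lborel) \<partial>m)" for x
    have psib: "\<bar>?\<psi> v\<bar> \<le> 1" for v using phi_S_bounds[of "T * v"] by auto
    obtain \<omega> r where r: "\<forall>i\<in>{1..n}. r i \<in> {-1..1}" and
      err: "(\<integral>x. ((\<Sum>i=1..n. 2 * S / n * ?c (\<omega> i) (r i) * ?\<psi> (?v (\<omega> i) (r i) x)) - smooth x)\<^sup>2 \<partial>\<mu>)
      \<le> 16 * S\<^sup>2 / n"
      using ridge_sampling[OF fin sets norm1_measurable norm1_nonneg mi S_def Spos cm cb psi psib \<mu> n] unfolding smooth_def by blast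
    define net where "net x = (\<Sum>i=1..n. 2 * S / n * ?c (\<omega> i) (r i) * ?\<psi> (?v (\<omega> i) (r i) x))" for x
    have bias: "\<bar>smooth x - (f x - f 0)\<bar> \<le> 2 * S / T" if x: "x \<in> unit_cube" for x
    proof -
      have a: "\<bar>unit_dir w \<bullet> x\<bar> \<le> 1" for w using inner_le_norm1[OF x, of "unit_dir w"] norm1_unit_dir[of w] by simp
      let ?I = "\<lambda>w. \<integral>s. indicator {-1..1} s * (?c w s * ?\<psi> (?v w s x)) \<partial>lborel"
      let ?H = "\<lambda>w. \<integral>s. indicator {-1..1} s * (?c w s * indicator {0..} (?v w s x)) \<partial>lborel"
      have wm: "(\<lambda>s. ?c w s) \<in> borel_measurable borel" for w unfolding wave'_def by measurable
      have ib: "integrable lborel (\<lambda>s. indicator {-1..1} s * u s :: real)"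
        if "u \<in> borel_measurable borel" "\<And>s. \<bar>u s\<bar> \<le> 1" for u :: "real \<Rightarrow> real"
      proof (rule Bochner_Integration.integrable_bound)
        show "integrable lborel (\<lambda>s::real. indicator {-1..1} s :: real)" by simp
        show "(\<lambda>s. indicator {-1..1} s * u s) \<in> borel_measurable lborel" using that(1) by measurable
        show "AE s in lborel. norm (indicator {-1..1} s * u s) \<le> norm (indicator {-1..1} s :: real)"
          using that(2) by (auto simp: indicator_def)
      qed
      have i1: "integrable lborel (\<lambda>s. indicator {-1..1} s * (?c w s * ?\<psi> (?v w s x)))" for w
      proof (rule ib)
        show "(\<lambda>s. ?c w s * ?\<psi> (?v w s x)) \<in> borel_measurable borel" using wm psi by measurable
        show "\<bar>?c w s * ?\<psi> (?v w s x)\<bar> \<le> 1" for s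
          unfolding abs_mult[of "?c w s"] using mult_mono[OF cb[of s w] psib[of "?v w s x"]] by simp
      qed
      have i2: "integrable lborel (\<lambda>s. indicator {-1..1} s * (?c w s * indicator {0..} (?v w s x)))" for w
      proof (rule ib)
        show "(\<lambda>s. ?c w s * indicator {0..} (?v w s x)) \<in> borel_measurable borel" using wm by measurable
        show "\<bar>?c w s * indicator {0..} (?v w s x)\<bar> \<le> 1" for s
          using cb[of s w] by (auto simp: indicator_def)
      qed
      \<comment> \<open>The cost of smoothing at one frequency: the pointwise error exp (- T |v|)
        integrated over the thresholds.\<close>
      have IH: "\<bar>?I w - ?H w\<bar> \<le> 2 / T" for w
      proof -
        have "?I w - ?H w = (\<integral>s. indicator {-1..1} s * (?c w s * ?\<psi> (?v w s x)) -
            indicator {-1..1} s * (?c w s * indicator {0..} (?v w s x)) \<partial>lborel)"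
          by (rule Bochner_Integration.integral_diff[symmetric, OF i1 i2])
        then have "\<bar>?I w - ?H w\<bar> \<le> (\<integral>s. \<bar>indicator {-1..1} s * (?c w s * ?\<psi> (?v w s x)) -
            indicator {-1..1} s * (?c w s * indicator {0..} (?v w s x))\<bar> \<partial>lborel)"
          by (simp only: integral_abs_bound)
        also have "\<dots> \<le> (\<integral>s. indicator {-1..1} s * exp (- T * \<bar>?v w s x\<bar>) \<partial>lborel)"
        proof (rule integral_mono)
          show "integrable lborel (\<lambda>s. \<bar>indicator {-1..1} s * (?c w s * ?\<psi> (?v w s x)) -
            indicator {-1..1} s * (?c w s * indicator {0..} (?v w s x))\<bar>)"
            by (intro integrable_abs Bochner_Integration.integrable_diff i1 i2)
          show "integrable lborel (\<lambda>s. indicator {-1..1} s * exp (- T * \<bar>?v w s x\<bar>))"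
            by (rule integral_exp_abs_le(1)[OF T(1) a])
          fix s
          have "\<bar>indicator {-1..1} s * (?c w s * ?\<psi> (?v w s x)) - indicator {-1..1} s * (?c w s * indicator {0..} (?v w s x))\<bar>
            = indicator {-1..1} s * (\<bar>?c w s\<bar> * \<bar>?\<psi> (?v w s x) - indicator {0..} (?v w s x)\<bar>)"
            by (simp only: right_diff_distrib[symmetric] abs_mult) (simp add: indicator_def)
          also have "\<dots> \<le> indicator {-1..1} s * (1 * exp (- T * \<bar>?v w s x\<bar>))"
            by (intro mult_left_mono mult_mono cb phi_S_step_error T) auto
          finally show "\<bar>indicator {-1..1} s * (?c w s * ?\<psi> (?v w s x)) -
            indicator {-1..1} s * (?c w s * indicator {0..} (?v w s x))\<bar> \<le> indicator {-1..1} s * exp (- T * \<bar>?v w s x\<bar>)" by simp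
        qed
        also have "\<dots> \<le> 2 / T" by (rule integral_exp_abs_le(2)[OF T(1) a])
        finally show ?thesis .
      qed
      have H: "norm1 w * ?H w = wave (h w) (w \<bullet> x) - wave (h w) 0" for w
      proof -
        have "wave (h w) (w \<bullet> x) - wave (h w) 0 =
          (\<integral>s. indicator {-1..1} s * (norm1 w * (half_sign s * wave' (h w) (norm1 w * s)) * indicator {0..} (?v w s x)) \<partial>lborel)"
          using step_layer[OF a[of w], of "h w" "norm1 w"] unfolding inner_unit_dir .
        also have "\<dots> = (\<integral>s. norm1 w * (indicator {-1..1} s * (?c w s * indicator {0..} (?v w s x))) \<partial>lborel)"
          by (intro Bochner_Integration.integral_cong refl) (simp add: mult_ac)
        also have "\<dots> = norm1 w * ?H w" by (rule integral_mult_right_zero)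
        finally show ?thesis ..
      qed
      have Im: "(\<lambda>w. norm1 w * ?I w) \<in> borel_measurable m"
      proof (intro borel_measurable_times sigma_finite_measure.borel_measurable_lebesgue_integral[OF sigma_finite_lborel])
        show "(\<lambda>(w, s). indicator {-1..1} s * (?c w s * ?\<psi> (?v w s x))) \<in> borel_measurable (m \<Otimes>\<^sub>M lborel)"
          unfolding wave'_def phi_S_def case_prod_beta by measurable
      qed measurable
      have Ib: "\<bar>norm1 w * ?I w - (wave (h w) (w \<bullet> x) - wave (h w) 0)\<bar> \<le> norm1 w * (2 / T)" for w
      proof -
        have "\<bar>norm1 w * ?I w - (wave (h w) (w \<bullet> x) - wave (h w) 0)\<bar> = norm1 w * \<bar>?I w - ?H w\<bar>"
          unfolding H[symmetric] by (simp add: abs_mult flip: right_diff_distrib)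
        then show ?thesis using mult_left_mono[OF IH[of w] norm1_nonneg[of w]] by (simp only:)
      qed
      have Ii: "integrable m (\<lambda>w. norm1 w * ?I w - (wave (h w) (w \<bullet> x) - wave (h w) 0))"
      proof (rule Bochner_Integration.integrable_bound)
        show "integrable m (\<lambda>w. norm1 w * (2 / T))" using mi by (rule integrable_mult_left)
        show "(\<lambda>w. norm1 w * ?I w - (wave (h w) (w \<bullet> x) - wave (h w) 0)) \<in> borel_measurable m"
          by (rule borel_measurable_diff[OF Im borel_measurable_integrable[OF diffi]])
        show "AE w in m. norm (norm1 w * ?I w - (wave (h w) (w \<bullet> x) - wave (h w) 0)) \<le> norm (norm1 w * (2 / T))"
          unfolding real_norm_def by (intro AE_I2 order_trans[OF Ib abs_ge_self])
      qed
      have Ii': "integrable m (\<lambda>w. norm1 w * ?I w)"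
        using Bochner_Integration.integrable_add[OF Ii diffi[of x]] by simp
      have "smooth x - (f x - f 0) = (\<integral>w. norm1 w * ?I w - (wave (h w) (w \<bullet> x) - wave (h w) 0) \<partial>m)"
        unfolding smooth_def diff by (rule Bochner_Integration.integral_diff[symmetric, OF Ii' diffi])
      then have "\<bar>smooth x - (f x - f 0)\<bar> \<le> (\<integral>w. \<bar>norm1 w * ?I w - (wave (h w) (w \<bullet> x) - wave (h w) 0)\<bar> \<partial>m)"
        by (simp only: integral_abs_bound)
      also have "\<dots> \<le> (\<integral>w. norm1 w * (2 / T) \<partial>m)"
        by (intro integral_mono integrable_abs[OF Ii] integrable_mult_left mi Ib)
      also have "\<dots> = 2 * S / T" unfolding S_def by simp
      finally show ?thesis .
    qed
    have smooth_bd: "\<bar>smooth x\<bar> \<le> 2 * S / T + S" if x: "x \<in> unit_cube" for x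
      using bias[OF x] rem[OF x] by linarith
    let ?g = "\<lambda>x. (\<Sum>i=1..n. (2 * S / n * ?c (\<omega> i) (r i)) * phi_S (((T * half_sign (r i)) *\<^sub>R unit_dir (\<omega> i)) \<bullet> x + - (T * \<bar>r i\<bar>))) + 0 \<bullet> x + f 0"
    have "?g \<in> net_class n T (2 * c / n) c 0 phi_S"
    proof (rule net_classI)
      fix i assume i: "i \<in> {1..n}"
      have "\<bar>T * half_sign (r i)\<bar> * norm1 (unit_dir (\<omega> i)) \<le> T * 1"
        using norm1_unit_dir[of "\<omega> i"] T by (intro mult_mono) (auto simp: half_sign_def)
      then show "norm1 ((T * half_sign (r i)) *\<^sub>R unit_dir (\<omega> i)) \<le> T"
        unfolding norm1_scaleR by simp
      have "T * \<bar>r i\<bar> \<le> T * 1" using r i T by (intro mult_left_mono) (auto simp: abs_le_iff)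
      then show "\<bar>- (T * \<bar>r i\<bar>)\<bar> \<le> T" using T by (simp add: abs_mult)
      have "\<bar>2 * S / n * ?c (\<omega> i) (r i)\<bar> \<le> 2 * S / n * 1"
        unfolding abs_mult[of "2 * S / n"] using cb[of "r i" "\<omega> i"] S0 by (intro mult_mono) auto
      also have "\<dots> \<le> 2 * c / n" using S by (simp add: divide_right_mono)
      finally show "\<bar>2 * S / n * ?c (\<omega> i) (r i)\<bar> \<le> 2 * c / n" .
    qed (use f0 in \<open>auto simp: norm1_def\<close>)
    moreover have "(\<integral>x. (?g x - f x)\<^sup>2 \<partial>\<mu>) \<le> 40 * c\<^sup>2 / n"
    proof -
      have g_eq: "?g x = net x + f 0" for x
        unfolding net_def by (simp add: right_diff_distrib mult.assoc)
      have spc: "x \<in> unit_cube" if "x \<in> space \<mu>" for x using that cube_lawD(3)[OF \<mu>] by auto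
      have sm: "smooth \<in> borel_measurable \<mu>"
      proof -
        have sets\<mu> [measurable_cong]: "sets \<mu> = sets (restrict_space borel unit_cube)" by (rule cube_lawD[OF \<mu>])
        have [measurable]: "(\<lambda>x. x) \<in> borel_measurable \<mu>" by (rule cube_law_measurable[OF \<mu>]) simp
        show ?thesis unfolding smooth_def wave'_def phi_S_def
          by (intro borel_measurable_lebesgue_integral sigma_finite_measure.borel_measurable_lebesgue_integral[OF sigma_finite_lborel]) measurable
      qed
      have net_bd: "\<bar>net x\<bar> \<le> 2 * S" for x
      proof -
        have "\<bar>net x\<bar> \<le> (\<Sum>i=1..n. \<bar>2 * S / n * ?c (\<omega> i) (r i) * ?\<psi> (?v (\<omega> i) (r i) x)\<bar>)" unfolding net_def by (rule sum_abs)
        also have "\<dots> \<le> (\<Sum>i=1..n. 2 * S / n * 1 * 1)"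
        proof (rule sum_mono)
          fix i
          show "\<bar>2 * S / n * ?c (\<omega> i) (r i) * ?\<psi> (?v (\<omega> i) (r i) x)\<bar> \<le> 2 * S / n * 1 * 1"
            unfolding abs_mult[of "2 * S / n * ?c (\<omega> i) (r i)"] abs_mult[of "2 * S / n"]
            using cb[of "r i" "\<omega> i"] psib S0 by (intro mult_mono) auto
        qed
        finally show ?thesis using n by simp
      qed
      have netm: "net \<in> borel_measurable \<mu>"
        by (rule cube_law_measurable[OF \<mu>]) (unfold net_def phi_S_def, measurable)
      have i: "integrable \<mu> (\<lambda>x. (net x - smooth x)\<^sup>2)"
      proof (rule \<mu>.integrable_bounded)
        show "(\<lambda>x. (net x - smooth x)\<^sup>2) \<in> borel_measurable \<mu>" using netm sm by measurable
        show "\<bar>(net x - smooth x)\<^sup>2\<bar> \<le> (3 * S + 2 * S / T)\<^sup>2" if "x \<in> space \<mu>" for x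
        proof -
          have "\<bar>net x - smooth x\<bar> \<le> 3 * S + 2 * S / T" using net_bd[of x] smooth_bd[OF spc[OF that]] by linarith
          then have "\<bar>net x - smooth x\<bar>\<^sup>2 \<le> (3 * S + 2 * S / T)\<^sup>2" by (intro power_mono) auto
          then show ?thesis by simp
        qed
      qed
      have fm: "f \<in> borel_measurable \<mu>"
      proof (rule cube_law_measurable[OF \<mu>])
        show "f \<in> borel_measurable borel" unfolding repf[abs_def] wave_def
          by (intro borel_measurable_lebesgue_integral) measurable
      qed
      have pt: "(?g x - f x)\<^sup>2 \<le> 2 * (net x - smooth x)\<^sup>2 + 2 * (2 * S / T)\<^sup>2" if "x \<in> space \<mu>" for x
      proof -
        have "(?g x - f x)\<^sup>2 = ((net x - smooth x) + (smooth x - (f x - f 0)))\<^sup>2" unfolding g_eq by (simp add: algebra_simps)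
        also have "\<dots> \<le> 2 * (net x - smooth x)\<^sup>2 + 2 * (smooth x - (f x - f 0))\<^sup>2"
          using sum_squares_bound[of "net x - smooth x" "smooth x - (f x - f 0)"] unfolding power2_sum by linarith
        also have "(smooth x - (f x - f 0))\<^sup>2 \<le> (2 * S / T)\<^sup>2"
          using power_mono[OF bias[OF spc[OF that]], of 2] by simp
        finally show ?thesis by simp
      qed
      have "(\<integral>x. (?g x - f x)\<^sup>2 \<partial>\<mu>) \<le> (\<integral>x. 2 * (net x - smooth x)\<^sup>2 + 2 * (2 * S / T)\<^sup>2 \<partial>\<mu>)"
      proof (rule integral_mono[OF _ _ pt])
        show "integrable \<mu> (\<lambda>x. 2 * (net x - smooth x)\<^sup>2 + 2 * (2 * S / T)\<^sup>2)" using i by simp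
        then show "integrable \<mu> (\<lambda>x. (?g x - f x)\<^sup>2)"
        proof (rule Bochner_Integration.integrable_bound)
          show "(\<lambda>x. (?g x - f x)\<^sup>2) \<in> borel_measurable \<mu>" unfolding g_eq using netm fm by measurable
          show "AE x in \<mu>. norm ((?g x - f x)\<^sup>2) \<le> norm (2 * (net x - smooth x)\<^sup>2 + 2 * (2 * S / T)\<^sup>2)"
            using pt by (intro AE_I2) (auto intro: order_trans[OF _ abs_ge_self])
        qed
      qed
      also have "\<dots> = 2 * (\<integral>x. (net x - smooth x)\<^sup>2 \<partial>\<mu>) + 2 * (2 * S / T)\<^sup>2" using i by (simp add: \<mu>.prob_space)
      also have "\<dots> \<le> 2 * (16 * S\<^sup>2 / n) + 8 * S\<^sup>2 / T\<^sup>2"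
        using err unfolding net_def by (simp add: power_divide power_mult_distrib)
      also have "\<dots> \<le> 2 * (16 * S\<^sup>2 / n) + 8 * S\<^sup>2 / n"
        using T n by (intro add_left_mono divide_left_mono) auto
      also have "\<dots> = 40 * S\<^sup>2 / n" by simp
      also have "\<dots> \<le> 40 * c\<^sup>2 / n"
      proof -
        have "S\<^sup>2 \<le> c\<^sup>2" using S S0 by (intro power_mono) auto
        then show ?thesis by (intro divide_right_mono) auto
      qed
      finally show ?thesis .
    qed
    ultimately show ?thesis by (intro bexI[of _ ?g])
  qed
qed

section \<open>Shrinking networks to the prescribed size\<close>

lemma net_class_scale:
  assumes g: "g \<in> net_class k a1 a2 a3 a4 \<phi>" and r: "0 \<le> r"
  shows "(\<lambda>x. r * g x) \<in> net_class k a1 (r * a2) (r * a3) (r * a4) \<phi>"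
proof -
  from g obtain \<beta> w b w0 b0 where *: "\<forall>i\<in>{1..k}. max (norm1 (w i)) \<bar>b i\<bar> \<le> a1 \<and> \<bar>\<beta> i\<bar> \<le> a2"
    "\<bar>b0\<bar> \<le> a3" "norm1 w0 \<le> a4"
    and eq: "g = (\<lambda>x. (\<Sum>i=1..k. \<beta> i * \<phi> (w i \<bullet> x + b i)) + w0 \<bullet> x + b0)"
    unfolding net_class_def by blast
  have "(\<lambda>x. (\<Sum>i=1..k. (r * \<beta> i) * \<phi> (w i \<bullet> x + b i)) + (r *\<^sub>R w0) \<bullet> x + r * b0)
      \<in> net_class k a1 (r * a2) (r * a3) (r * a4) \<phi>"
    by (rule net_classI) (use * r in \<open>auto simp: abs_mult norm1_scaleR intro: mult_left_mono\<close>)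
  also have "(\<lambda>x. (\<Sum>i=1..k. (r * \<beta> i) * \<phi> (w i \<bullet> x + b i)) + (r *\<^sub>R w0) \<bullet> x + r * b0) = (\<lambda>x. r * g x)"
    unfolding eq by (auto simp: sum_distrib_left algebra_simps)
  finally show ?thesis .
qed

text \<open>\<open>c\<close> exceeds \<open>a\<close> only by the factor 1 + 1 / n, so multiplying
  the network by a / c adds a pointwise error of at most 3 a / n, whose square is of lower order.
  With c \<le> 2 a the constants add up to 320 + 18 \<le> 400.\<close>

lemma scaled_error:
  assumes \<mu>: "cube_law \<mu>" and f: "f \<in> borel_measurable \<mu>" and g: "continuous_on UNIV g"
    and err: "(\<integral>x. (g x - f x)\<^sup>2 \<partial>\<mu>) \<le> 40 * c\<^sup>2 / n" and n: "n \<ge> 1" and a: "0 < a"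
    and c: "c = a * (1 + 1 / real n)" and fb: "\<And>x. x \<in> unit_cube \<Longrightarrow> \<bar>f x\<bar> \<le> 3 * c"
  shows "(\<integral>x. (a / c * g x - f x)\<^sup>2 \<partial>\<mu>) \<le> 400 * a\<^sup>2 / n"
proof -
  interpret prob_space \<mu> by (rule cube_lawD[OF \<mu>])
  have cpos: "c > 0" unfolding c using a by (simp add: add_pos_nonneg)
  have ca: "c \<le> 2 * a"
  proof -
    have "1 + 1 / real n \<le> 2" using n by simp
    then have "a * (1 + 1 / real n) \<le> a * 2" using a by (intro mult_left_mono) auto
    then show ?thesis unfolding c by simp
  qed
  define r where "r = a / c"
  have "c * r = a" unfolding r_def using cpos by simp
  then have r: "0 \<le> r" "r \<le> 1" "(1 - r) * c = a / n"
    using a cpos c by (auto simp: r_def divide_le_eq algebra_simps)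
  obtain K where K: "\<And>x. x \<in> unit_cube \<Longrightarrow> \<bar>g x\<bar> \<le> K" by (rule continuous_bounded_cube[OF g]) (rule that)
  have gm: "g \<in> borel_measurable \<mu>" by (rule cube_law_measurable[OF \<mu> borel_measurable_continuous_onI[OF g]])
  have sp: "x \<in> unit_cube" if "x \<in> space \<mu>" for x using that cube_lawD(3)[OF \<mu>] by auto
  have int: "integrable \<mu> (\<lambda>x. (s * g x - f x)\<^sup>2)" if s: "0 \<le> s" for s
  proof (rule integrable_bounded)
    show "(\<lambda>x. (s * g x - f x)\<^sup>2) \<in> borel_measurable \<mu>" using gm f by measurable
    show "\<bar>(s * g x - f x)\<^sup>2\<bar> \<le> (s * K + 3 * c)\<^sup>2" if "x \<in> space \<mu>" for x
    proof -
      have "\<bar>s * g x\<bar> \<le> s * K" using K[OF sp[OF that]] s by (simp add: abs_mult mult_left_mono)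
      then have "\<bar>s * g x - f x\<bar> \<le> s * K + 3 * c" using fb[OF sp[OF that]] by linarith
      then have "\<bar>s * g x - f x\<bar>\<^sup>2 \<le> (s * K + 3 * c)\<^sup>2" by (intro power_mono) auto
      then show ?thesis by simp
    qed
  qed
  have pt: "(r * g x - f x)\<^sup>2 \<le> 2 * (g x - f x)\<^sup>2 + 18 * (a / n)\<^sup>2" if "x \<in> space \<mu>" for x
  proof -
    have "r * g x - f x = r * (g x - f x) + - ((1 - r) * f x)" by (simp add: algebra_simps)
    then have "(r * g x - f x)\<^sup>2 \<le> 2 * (r * (g x - f x))\<^sup>2 + 2 * ((1 - r) * f x)\<^sup>2"
      using sum_squares_bound[of "r * (g x - f x)" "- ((1 - r) * f x)"]
      by (simp only: power2_sum power2_minus)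
    also have "(r * (g x - f x))\<^sup>2 \<le> (g x - f x)\<^sup>2"
    proof -
      have "r\<^sup>2 \<le> 1" using r by (simp add: power_le_one)
      then show ?thesis by (simp add: power_mult_distrib mult_left_le_one_le)
    qed
    also have "((1 - r) * f x)\<^sup>2 \<le> (3 * (a / n))\<^sup>2"
    proof -
      have "\<bar>(1 - r) * f x\<bar> \<le> (1 - r) * (3 * c)"
        using r fb[OF sp[OF that]] unfolding abs_mult by (intro mult_mono) auto
      also have "\<dots> = 3 * (a / n)" using r(3) by simp
      finally have "\<bar>(1 - r) * f x\<bar>\<^sup>2 \<le> (3 * (a / n))\<^sup>2" by (intro power_mono) auto
      then show ?thesis by simp
    qed
    finally show ?thesis by (simp only: power_mult_distrib) simp
  qed
  have "(\<integral>x. (r * g x - f x)\<^sup>2 \<partial>\<mu>) \<le> (\<integral>x. 2 * (g x - f x)\<^sup>2 + 18 * (a / n)\<^sup>2 \<partial>\<mu>)"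
    by (rule integral_mono[OF int[OF r(1)] _ pt]) (use int[of 1] in auto)
  also have "\<dots> = 2 * (\<integral>x. (g x - f x)\<^sup>2 \<partial>\<mu>) + 18 * (a / n)\<^sup>2"
    using int[of 1] by (simp add: prob_space)
  also have "\<dots> \<le> 2 * (40 * c\<^sup>2 / n) + 18 * (a / n)\<^sup>2" using err by simp
  also have "\<dots> \<le> 2 * (40 * (2 * a)\<^sup>2 / n) + 18 * (a\<^sup>2 / n)"
  proof (intro add_mono mult_left_mono divide_right_mono power_mono ca)
    have "1 / real n * (1 / real n) \<le> 1 / real n * 1" using n by (intro mult_left_mono) auto
    then have "(1 / real n) * (1 / real n) * a\<^sup>2 \<le> 1 / real n * a\<^sup>2" by (intro mult_right_mono) auto
    then show "(a / n)\<^sup>2 \<le> a\<^sup>2 / n" by (simp add: power2_eq_square)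
  qed (use cpos in auto)
  also have "\<dots> \<le> 400 * a\<^sup>2 / n" by (simp add: power_mult_distrib add_divide_distrib[symmetric] divide_right_mono)
  finally show ?thesis unfolding r_def .
qed

text \<open>c = a (1 + 1 / n) lies strictly above \<open>M\<close>, so a representation exists for
  it, and it is close enough to \<open>a\<close> for \<open>scaled_error\<close>. Boundedness on the
  cube is recorded for the integrability arguments in the variational gap.\<close>

lemma relu_class_approx:
  fixes f :: "real ^ 'd \<Rightarrow> real"
  assumes "c_KB f unit_cube \<le> ereal M" "M \<le> a" "0 < a" and \<mu>: "cube_law \<mu>" and n: "n \<ge> 1"
    and f: "f \<in> borel_measurable \<mu>"
  shows "\<exists>K. \<forall>x\<in>unit_cube. \<bar>f x\<bar> \<le> K"
    "\<exists>g\<in>net_class n 1 (2 * a / n) a a phi_R. (\<integral>x. (g x - f x)\<^sup>2 \<partial>\<mu>) \<le> 400 * a\<^sup>2 / n"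
proof -
  define c where "c = a * (1 + 1 / real n)"
  have "a < c" unfolding c_def using assms(3) n by (simp add: field_simps)
  then have Mc: "M < c" using assms(2) by simp
  obtain f' F G where rep: "fourier_rep f' F" and eq: "\<And>x. x \<in> unit_cube \<Longrightarrow> f' x = f x"
    and F: "fourier_moment 2 F \<le> ennreal c" "\<bar>f' 0\<bar> \<le> c" "GDERIV f' 0 :> G" "norm1 G \<le> c"
    by (rule c_KB_leD[OF assms(1) Mc]) (rule that)
  note fb = relu_approx(2)[OF rep F \<mu> n]
  have fb': "\<bar>f x\<bar> \<le> 3 * c" if "x \<in> unit_cube" for x using fb[OF that] eq[OF that] by simp
  show "\<exists>K. \<forall>x\<in>unit_cube. \<bar>f x\<bar> \<le> K" using fb' by blast
  obtain g where g: "g \<in> net_class n 1 (2 * c / n) c c phi_R" "(\<integral>x. (g x - f' x)\<^sup>2 \<partial>\<mu>) \<le> 40 * c\<^sup>2 / n"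
    using relu_approx(1)[OF rep F \<mu> n] by blast
  have cont: "continuous_on UNIV phi_R" unfolding phi_R_def by (intro continuous_intros)
  have "(\<integral>x. (g x - f' x)\<^sup>2 \<partial>\<mu>) = (\<integral>x. (g x - f x)\<^sup>2 \<partial>\<mu>)"
    using eq cube_lawD(3)[OF \<mu>] by (intro Bochner_Integration.integral_cong) auto
  then have err: "(\<integral>x. (g x - f x)\<^sup>2 \<partial>\<mu>) \<le> 40 * c\<^sup>2 / n" using g(2) by simp
  have cpos: "c > 0" using \<open>a < c\<close> assms(3) by simp
  have "(\<lambda>x. a / c * g x) \<in> net_class n 1 (a / c * (2 * c / n)) (a / c * c) (a / c * c) phi_R"
    by (rule net_class_scale[OF g(1)]) (use assms(3) cpos in simp)
  moreover have "a / c * (2 * c / n) = 2 * a / n" "a / c * c = a" using cpos by (simp_all add: field_simps)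
  ultimately have "(\<lambda>x. a / c * g x) \<in> net_class n 1 (2 * a / n) a a phi_R" by (simp only: mult_zero_right)
  moreover have "(\<integral>x. (a / c * g x - f x)\<^sup>2 \<partial>\<mu>) \<le> 400 * a\<^sup>2 / n"
    by (rule scaled_error[OF \<mu> f net_class_borel(2)[OF cont g(1)] err n assms(3) c_def fb'])
  ultimately show "\<exists>g\<in>net_class n 1 (2 * a / n) a a phi_R. (\<integral>x. (g x - f x)\<^sup>2 \<partial>\<mu>) \<le> 400 * a\<^sup>2 / n"
    by (intro bexI[of _ "\<lambda>x. a / c * g x"])
qed

lemma phi_S_continuous: "continuous_on UNIV phi_S"
proof -
  have "1 + exp (- z) \<noteq> 0" for z :: real by (metis add_pos_pos exp_gt_zero less_numeral_extra(1,3))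
  then show ?thesis unfolding phi_S_def by (intro continuous_intros) auto
qed

lemma sigmoid_class_approx:
  fixes f :: "real ^ 'd \<Rightarrow> real"
  assumes "c_B f unit_cube \<le> ereal M" "M \<le> a" "0 < a" and \<mu>: "cube_law \<mu>" and n: "n \<ge> 1" "ln (real n) \<ge> 1"
    and f: "f \<in> borel_measurable \<mu>"
  shows "\<exists>K. \<forall>x\<in>unit_cube. \<bar>f x\<bar> \<le> K"
    "\<exists>g\<in>net_class n (sqrt (real n) * ln (real n)) (2 * a / n) a 0 phi_S. (\<integral>x. (g x - f x)\<^sup>2 \<partial>\<mu>) \<le> 400 * a\<^sup>2 / n"
proof -
  define c where "c = a * (1 + 1 / real n)"
  define T where "T = sqrt (real n) * ln (real n)"
  have T: "0 < T" unfolding T_def using n by (intro mult_pos_pos) (simp, linarith)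
  \<comment> \<open>As soon as ln n \<ge> 1, the weight bound sqrt n ln n of the class is at least
    the slope sqrt n that the smoothing bias asks for.\<close>
  have "1 \<le> (ln (real n))\<^sup>2" using n(2) power_mono[of 1 "ln (real n)" 2] by simp
  then have "real n * 1 \<le> real n * (ln (real n))\<^sup>2" by (intro mult_left_mono) auto
  then have T2: "real n \<le> T\<^sup>2" unfolding T_def by (simp add: power_mult_distrib)
  have "a < c" unfolding c_def using assms(3) n by (simp add: field_simps)
  then have Mc: "M < c" using assms(2) by simp
  obtain f' F where rep: "fourier_rep f' F" and eq: "\<And>x. x \<in> unit_cube \<Longrightarrow> f' x = f x"
    and F: "fourier_moment 1 F \<le> ennreal c" "\<bar>f' 0\<bar> \<le> c"
    by (rule c_B_leD[OF assms(1) Mc]) (rule that)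
  note fb = sigmoid_approx(2)[OF rep F \<mu> n(1) T T2]
  have fb': "\<bar>f x\<bar> \<le> 3 * c" if "x \<in> unit_cube" for x using fb[OF that] eq[OF that] by simp
  show "\<exists>K. \<forall>x\<in>unit_cube. \<bar>f x\<bar> \<le> K" using fb' by blast
  obtain g where g: "g \<in> net_class n T (2 * c / n) c 0 phi_S" "(\<integral>x. (g x - f' x)\<^sup>2 \<partial>\<mu>) \<le> 40 * c\<^sup>2 / n"
    using sigmoid_approx(1)[OF rep F \<mu> n(1) T T2] by blast
  have "(\<integral>x. (g x - f' x)\<^sup>2 \<partial>\<mu>) = (\<integral>x. (g x - f x)\<^sup>2 \<partial>\<mu>)"
    using eq cube_lawD(3)[OF \<mu>] by (intro Bochner_Integration.integral_cong) auto
  then have err: "(\<integral>x. (g x - f x)\<^sup>2 \<partial>\<mu>) \<le> 40 * c\<^sup>2 / n" using g(2) by simp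
  have cpos: "c > 0" using \<open>a < c\<close> assms(3) by simp
  have "(\<lambda>x. a / c * g x) \<in> net_class n T (a / c * (2 * c / n)) (a / c * c) (a / c * 0) phi_S"
    by (rule net_class_scale[OF g(1)]) (use assms(3) cpos in simp)
  moreover have "a / c * (2 * c / n) = 2 * a / n" "a / c * c = a" using cpos by (simp_all add: field_simps)
  ultimately have "(\<lambda>x. a / c * g x) \<in> net_class n T (2 * a / n) a 0 phi_S" by (simp only: mult_zero_right)
  moreover have "(\<integral>x. (a / c * g x - f x)\<^sup>2 \<partial>\<mu>) \<le> 400 * a\<^sup>2 / n"
    by (rule scaled_error[OF \<mu> f net_class_borel(2)[OF phi_S_continuous g(1)] err n(1) assms(3) c_def fb'])
  ultimately show "\<exists>g\<in>net_class n (sqrt (real n) * ln (real n)) (2 * a / n) a 0 phi_S. (\<integral>x. (g x - f x)\<^sup>2 \<partial>\<mu>) \<le> 400 * a\<^sup>2 / n"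
    unfolding T_def by (intro bexI[of _ "\<lambda>x. a / c * g x"])
qed

section \<open>The variational gap\<close>

definition population :: "real \<Rightarrow> ('a \<Rightarrow> real) \<Rightarrow> 'a measure \<Rightarrow> 'a measure \<Rightarrow> real" where
  "population t g \<mu> \<nu> = (\<integral>x. clip t (g x) \<partial>\<mu>) + (\<integral>y. dual_loss t (g y) \<partial>\<nu>)"

lemma density_versionD:
  assumes "(\<mu>, \<nu>) \<in> P2_H2 unit_cube" and p: "density_version unit_cube \<mu> \<nu> p"
  shows "cube_law \<mu>" "cube_law \<nu>" "p \<in> borel_measurable \<nu>" "\<mu> = density \<nu> (\<lambda>x. ennreal (p x))"
    "hellinger2 \<mu> \<nu> = (\<integral>x. (sqrt (p x) - 1)\<^sup>2 \<partial>\<nu>)" "\<And>x. x \<in> unit_cube \<Longrightarrow> 0 < p x"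
proof -
  show \<mu>: "cube_law \<mu>" and \<nu>: "cube_law \<nu>" using assms(1) unfolding P2_H2_def cube_law_def by auto
  have ac: "absolutely_continuous \<nu> \<mu>" using assms(1) unfolding P2_H2_def by auto
  interpret N: prob_space \<nu> by (rule cube_lawD[OF \<nu>])
  have sets: "sets \<mu> = sets \<nu>" using cube_lawD(2)[OF \<mu>] cube_lawD(2)[OF \<nu>] by simp
  show pm: "p \<in> borel_measurable \<nu>"
    unfolding measurable_cong_sets[OF cube_lawD(2)[OF \<nu>] refl] using p unfolding density_version_def by simp
  show pos: "\<And>x. x \<in> unit_cube \<Longrightarrow> 0 < p x" using p unfolding density_version_def by auto
  have AE: "AE x in \<nu>. RN_deriv \<nu> \<mu> x = ennreal (p x)" using p unfolding density_version_def by simp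
  have "\<mu> = density \<nu> (RN_deriv \<nu> \<mu>)" by (rule N.density_RN_deriv[OF ac sets, symmetric])
  also have "\<dots> = density \<nu> (\<lambda>x. ennreal (p x))" using AE pm by (intro density_cong) auto
  finally show "\<mu> = density \<nu> (\<lambda>x. ennreal (p x))" .
  show "hellinger2 \<mu> \<nu> = (\<integral>x. (sqrt (p x) - 1)\<^sup>2 \<partial>\<nu>)"
    unfolding hellinger2_def
  proof (rule integral_cong_AE)
    show "AE x in \<nu>. (sqrt (enn2real (RN_deriv \<nu> \<mu> x)) - 1)\<^sup>2 = (sqrt (p x) - 1)\<^sup>2"
      using AE AE_space
    proof eventually_elim
      case (elim x)
      then have "x \<in> unit_cube" using cube_lawD(3)[OF \<nu>] by auto
      from pos[OF this] elim(1) show ?case by simp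
    qed
  qed (use pm in measurable)
qed

text \<open>The gap in the variational lower bound at \<open>g\<close> is the integral of \<open>p (f - u)\<^sup>2 / (1 - u)\<close> with
  \<open>u\<close> the clipped \<open>g\<close>: it is quadratic in the approximation error.\<close>

lemma hellinger_gap:
  fixes g :: "real ^ 'd \<Rightarrow> real"
  assumes P: "(\<mu>, \<nu>) \<in> P2_H2 unit_cube" and p: "density_version unit_cube \<mu> \<nu> p"
    and M: "AE x in \<nu>. p x \<le> M" and t: "0 < t" "t \<le> M powr (- 1 / 2)" and Mpos: "0 < M"
    and K: "\<And>x. x \<in> unit_cube \<Longrightarrow> \<bar>f_H2 p x\<bar> \<le> K" and g: "continuous_on UNIV g"
  shows "population t g \<mu> \<nu> \<le> hellinger2 \<mu> \<nu>"
    "hellinger2 \<mu> \<nu> - population t g \<mu> \<nu> \<le> 1 / t * (\<integral>x. (g x - f_H2 p x)\<^sup>2 \<partial>\<mu>)"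
proof -
  note D = density_versionD[OF P p]
  note \<nu> = D(2)
  interpret N: prob_space \<nu> by (rule cube_lawD[OF \<nu>])
  have sp: "x \<in> unit_cube" if "x \<in> space \<nu>" for x using that cube_lawD(3)[OF \<nu>] by auto
  note [measurable] = D(3)
  have gm [measurable]: "g \<in> borel_measurable \<nu>" by (rule cube_law_measurable[OF \<nu> borel_measurable_continuous_onI[OF g]])
  obtain Kg where Kg: "\<And>x. x \<in> unit_cube \<Longrightarrow> \<bar>g x\<bar> \<le> Kg" by (rule continuous_bounded_cube[OF g]) (rule that)
  have cm [measurable]: "(\<lambda>x. clip t (g x)) \<in> borel_measurable \<nu>" unfolding clip_def by measurable
  have dm [measurable]: "(\<lambda>x. dual_loss t (g x)) \<in> borel_measurable \<nu>" unfolding dual_loss_def by measurable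
  have fm [measurable]: "f_H2 p \<in> borel_measurable \<nu>" unfolding f_H2_def by measurable
  have AEpos: "AE x in \<nu>. 0 < p x" using AE_space by eventually_elim (use D(6) sp in auto)
  then have AE0: "AE x in \<nu>. 0 \<le> p x" by eventually_elim auto
  have ipu: "integrable \<nu> (\<lambda>x. p x * u x)" if "u \<in> borel_measurable \<nu>" "\<And>x. x \<in> space \<nu> \<Longrightarrow> \<bar>u x\<bar> \<le> C" for u C
  proof (rule N.integrable_const_bound[of _ "M * C"])
    show "AE x in \<nu>. norm (p x * u x) \<le> M * C"
      using M AE0 AE_space
      by eventually_elim (use that(2) Mpos in \<open>auto simp: abs_mult intro!: mult_mono\<close>)
  qed (use that(1) in measurable)
  have toN: "(\<integral>x. u x \<partial>\<mu>) = (\<integral>x. p x * u x \<partial>\<nu>)" if "u \<in> borel_measurable \<nu>" for u :: "real ^ 'd \<Rightarrow> real"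
    unfolding D(4) using that AE0 by (subst integral_density) auto
  have clipb: "\<bar>clip t (g x)\<bar> \<le> Kg + \<bar>1 - t\<bar>" if "x \<in> space \<nu>" for x
    using Kg[OF sp[OF that]] unfolding clip_def by auto
  have dualb: "\<bar>dual_loss t (g x)\<bar> \<le> 1 + 1 / t" for x
    using dual_loss_bounds[OF t(1), of "g x"] t(1) by (auto simp: abs_le_iff) 
  have i1: "integrable \<nu> (\<lambda>x. p x * clip t (g x))" by (rule ipu[OF cm clipb])
  have i2: "integrable \<nu> (\<lambda>x. dual_loss t (g x))" by (rule N.integrable_bounded[OF dm dualb])
  have i3: "integrable \<nu> (\<lambda>x. (sqrt (p x) - 1)\<^sup>2)"
  proof (rule N.integrable_const_bound[of _ "M + 1"])
    show "AE x in \<nu>. norm ((sqrt (p x) - 1)\<^sup>2) \<le> M + 1"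
      using M AE0
    proof eventually_elim
      case (elim x)
      have "(sqrt (p x) - 1)\<^sup>2 = p x + 1 - 2 * sqrt (p x)" using elim by (simp add: power2_diff)
      also have "\<dots> \<le> M + 1" using elim real_sqrt_ge_zero[of "p x"] by linarith
      finally show ?case by simp
    qed
  qed measurable
  have gap: "hellinger2 \<mu> \<nu> - population t g \<mu> \<nu> =
      (\<integral>x. (sqrt (p x) - 1)\<^sup>2 - p x * clip t (g x) - dual_loss t (g x) \<partial>\<nu>)"
    unfolding D(5) population_def toN[OF cm] using i1 i2 i3 by simp
  have igap: "integrable \<nu> (\<lambda>x. (sqrt (p x) - 1)\<^sup>2 - p x * clip t (g x) - dual_loss t (g x))"
    using i1 i2 i3 by simp
  \<comment> \<open>Completing the square: with s = 1 - u and q = sqrt p the left side is q^2 s - 2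
    q + 1 / s = q^2 (s - 1 / q)^2 / s.\<close>
  have id: "(sqrt (p x) - 1)\<^sup>2 - p x * clip t (g x) - dual_loss t (g x) =
      p x * (clip t (g x) - f_H2 p x)\<^sup>2 / (1 - clip t (g x))" if "0 < p x" for x
  proof -
    define s where "s = 1 - clip t (g x)"
    define q where "q = sqrt (p x)"
    have s: "0 < s" using clip_le[of t "g x"] t(1) unfolding s_def by simp
    have q: "0 < q" "p x = q * q" using that unfolding q_def by auto
    have "- 1 / 2 = - (1 / 2 :: real)" by simp
    then have "p x powr (- 1 / 2) = 1 / q" unfolding q_def
      by (simp only: powr_minus powr_half_sqrt[OF less_imp_le[OF that]] inverse_eq_divide)
    then have f: "f_H2 p x = 1 - 1 / q" unfolding f_H2_def by simp
    have c: "clip t (g x) = 1 - s" unfolding s_def by simp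
    have "(q - 1)\<^sup>2 - q * q * (1 - s) - (1 - 1 / s) = q * q * ((1 - s) - (1 - 1 / q))\<^sup>2 / s"
      using s q(1) by (simp add: field_simps power2_eq_square)
    moreover have "sqrt (q * q) = q" "1 - (1 - s) = s" using q(1) by auto
    ultimately show ?thesis unfolding dual_loss_def f c q(2) by (simp only:)
  qed
  have "0 \<le> (\<integral>x. (sqrt (p x) - 1)\<^sup>2 - p x * clip t (g x) - dual_loss t (g x) \<partial>\<nu>)"
  proof (rule integral_nonneg_AE)
    show "AE x in \<nu>. 0 \<le> (sqrt (p x) - 1)\<^sup>2 - p x * clip t (g x) - dual_loss t (g x)"
      using AEpos
    proof eventually_elim
      case (elim x)
      then show ?case unfolding id[OF elim] using clip_le[of t "g x"] t(1) by simp
    qed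
  qed
  then show "population t g \<mu> \<nu> \<le> hellinger2 \<mu> \<nu>" using gap by simp
  have ferr: "\<bar>(g x - f_H2 p x)\<^sup>2\<bar> \<le> (Kg + K)\<^sup>2" if "x \<in> space \<nu>" for x
  proof -
    have "\<bar>g x - f_H2 p x\<bar> \<le> Kg + K" using Kg[OF sp[OF that]] K[OF sp[OF that]] by linarith
    then have "\<bar>g x - f_H2 p x\<bar>\<^sup>2 \<le> (Kg + K)\<^sup>2" by (intro power_mono) auto
    then show ?thesis by simp
  qed
  have sqm: "(\<lambda>x. (g x - f_H2 p x)\<^sup>2) \<in> borel_measurable \<nu>" by measurable
  have ierr: "integrable \<nu> (\<lambda>x. p x * (g x - f_H2 p x)\<^sup>2)" by (rule ipu[OF sqm ferr])
  have "(\<integral>x. (sqrt (p x) - 1)\<^sup>2 - p x * clip t (g x) - dual_loss t (g x) \<partial>\<nu>)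
    \<le> (\<integral>x. 1 / t * (p x * (g x - f_H2 p x)\<^sup>2) \<partial>\<nu>)"
  proof (rule integral_mono_AE[OF igap])
    show "integrable \<nu> (\<lambda>x. 1 / t * (p x * (g x - f_H2 p x)\<^sup>2))" using ierr by simp
    show "AE x in \<nu>. (sqrt (p x) - 1)\<^sup>2 - p x * clip t (g x) - dual_loss t (g x) \<le> 1 / t * (p x * (g x - f_H2 p x)\<^sup>2)"
      using AEpos M
    proof eventually_elim
      case (elim x)
      \<comment> \<open>The bound p \<le> M puts \<open>f_H2 p\<close> below the truncation level 1
        - t, so truncating \<open>g\<close> can only bring it closer; the denominator is at least
        \<open>t\<close>.\<close>
      have "M powr (- 1 / 2) \<le> p x powr (- 1 / 2)"
        using elim by (intro powr_mono2') auto
      then have f: "f_H2 p x \<le> 1 - t" using t(2) unfolding f_H2_def by simp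
      then have "\<bar>clip t (g x) - f_H2 p x\<bar> \<le> \<bar>g x - f_H2 p x\<bar>" unfolding clip_def by auto
      then have "(clip t (g x) - f_H2 p x)\<^sup>2 \<le> (g x - f_H2 p x)\<^sup>2" by (simp add: abs_le_square_iff)
      then have "p x * (clip t (g x) - f_H2 p x)\<^sup>2 / (1 - clip t (g x)) \<le> p x * (g x - f_H2 p x)\<^sup>2 / t"
        using elim clip_le[of t "g x"] t(1) by (intro frac_le mult_left_mono) auto
      then show ?case unfolding id[OF elim(1)] by simp
    qed
  qed
  \<comment> \<open>The factor \<open>p\<close> turns the integral over \<open>\<nu>\<close> into
    one over \<open>\<mu>\<close>, the law under which the networks were chosen.\<close>
  also have "\<dots> = 1 / t * (\<integral>x. (g x - f_H2 p x)\<^sup>2 \<partial>\<mu>)" unfolding toN[OF sqm] by simp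
  finally show "hellinger2 \<mu> \<nu> - population t g \<mu> \<nu> \<le> 1 / t * (\<integral>x. (g x - f_H2 p x)\<^sup>2 \<partial>\<mu>)"
    using gap by simp
qed

section \<open>Upper bounds on the risk\<close>

lemma distr_pair_snd:
  assumes P: "prob_space P" and Q: "prob_space Q"
  shows "distr (P \<Otimes>\<^sub>M Q) Q snd = Q"
proof -
  interpret P: prob_space P by (rule P)
  interpret Q: prob_space Q by (rule Q)
  show ?thesis
  proof (rule measure_eqI)
    fix S assume "S \<in> sets (distr (P \<Otimes>\<^sub>M Q) Q snd)"
    then have S: "S \<in> sets Q" by simp
    have "emeasure (distr (P \<Otimes>\<^sub>M Q) Q snd) S = emeasure (P \<Otimes>\<^sub>M Q) (space P \<times> S)"
      using S sets.sets_into_space[OF S]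
      by (auto simp: emeasure_distr space_pair_measure intro!: arg_cong[where f = "emeasure (P \<Otimes>\<^sub>M Q)"])
    also have "\<dots> = emeasure Q S" using S by (simp add: Q.emeasure_pair_measure_Times P.emeasure_space_1)
    finally show "emeasure (distr (P \<Otimes>\<^sub>M Q) Q snd) S = emeasure Q S" .
  qed simp
qed

lemma integral_pair_marginals:
  fixes A B :: "_ \<Rightarrow> real"
  assumes P: "prob_space P" and Q: "prob_space Q" and A: "integrable P A" and B: "integrable Q B"
  shows "integrable (P \<Otimes>\<^sub>M Q) (\<lambda>z. A (fst z))" "integrable (P \<Otimes>\<^sub>M Q) (\<lambda>z. B (snd z))"
    "(\<integral>z. A (fst z) \<partial>(P \<Otimes>\<^sub>M Q)) = (\<integral>x. A x \<partial>P)" "(\<integral>z. B (snd z) \<partial>(P \<Otimes>\<^sub>M Q)) = (\<integral>y. B y \<partial>Q)"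
proof -
  have d1: "distr (P \<Otimes>\<^sub>M Q) P fst = P" by (rule prob_space.distr_pair_fst[OF Q])
  have d2: "distr (P \<Otimes>\<^sub>M Q) Q snd = Q" by (rule distr_pair_snd[OF P Q])
  show "integrable (P \<Otimes>\<^sub>M Q) (\<lambda>z. A (fst z))"
    using integrable_distr[of fst "P \<Otimes>\<^sub>M Q" P A] A unfolding d1 by simp
  show "integrable (P \<Otimes>\<^sub>M Q) (\<lambda>z. B (snd z))"
    using integrable_distr[of snd "P \<Otimes>\<^sub>M Q" Q B] B unfolding d2 by simp
  show "(\<integral>z. A (fst z) \<partial>(P \<Otimes>\<^sub>M Q)) = (\<integral>x. A x \<partial>P)"
    using integral_distr[of fst "P \<Otimes>\<^sub>M Q" P A] A unfolding d1 by simp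
  show "(\<integral>z. B (snd z) \<partial>(P \<Otimes>\<^sub>M Q)) = (\<integral>y. B y \<partial>Q)"
    using integral_distr[of snd "P \<Otimes>\<^sub>M Q" Q B] B unfolding d2 by simp
qed

lemma integral_PiM_sum:
  fixes f :: "_ \<Rightarrow> real"
  assumes \<mu>: "prob_space \<mu>" and f: "integrable \<mu> f"
  shows "integrable (\<Pi>\<^sub>M i\<in>{1..n::nat}. \<mu>) (\<lambda>x. \<Sum>i=1..n. f (x i))"
    "(\<integral>x. (\<Sum>i=1..n. f (x i)) \<partial>(\<Pi>\<^sub>M i\<in>{1..n::nat}. \<mu>)) = n * (\<integral>x. f x \<partial>\<mu>)"
proof -
  have d: "distr (\<Pi>\<^sub>M i\<in>{1..n}. \<mu>) \<mu> (\<lambda>x. x i) = \<mu>" if "i \<in> {1..n}" for i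
    using that by (intro distr_PiM_component) (auto simp: \<mu>)
  have m: "(\<lambda>x. x i) \<in> measurable (\<Pi>\<^sub>M i\<in>{1..n}. \<mu>) \<mu>" if "i \<in> {1..n}" for i
    using that by (rule measurable_component_singleton)
  have i: "integrable (\<Pi>\<^sub>M i\<in>{1..n}. \<mu>) (\<lambda>x. f (x i))" if "i \<in> {1..n}" for i
    using integrable_distr[OF m[OF that], of f] f unfolding d[OF that] by simp
  have e: "(\<integral>x. f (x i) \<partial>(\<Pi>\<^sub>M i\<in>{1..n}. \<mu>)) = (\<integral>x. f x \<partial>\<mu>)" if "i \<in> {1..n}" for i
    using integral_distr[OF m[OF that], of f] f unfolding d[OF that] by simp
  show "integrable (\<Pi>\<^sub>M i\<in>{1..n::nat}. \<mu>) (\<lambda>x. \<Sum>i=1..n. f (x i))"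
    by (rule Bochner_Integration.integrable_sum) (rule i)
  have "(\<integral>x. (\<Sum>i=1..n. f (x i)) \<partial>(\<Pi>\<^sub>M i\<in>{1..n::nat}. \<mu>)) = (\<Sum>i=1..n. \<integral>x. f (x i) \<partial>(\<Pi>\<^sub>M i\<in>{1..n}. \<mu>))"
    by (rule Bochner_Integration.integral_sum) (rule i)
  also have "\<dots> = (\<Sum>i=1..n. \<integral>x. f x \<partial>\<mu>)" by (rule sum.cong[OF refl]) (rule e)
  finally show "(\<integral>x. (\<Sum>i=1..n. f (x i)) \<partial>(\<Pi>\<^sub>M i\<in>{1..n::nat}. \<mu>)) = n * (\<integral>x. f x \<partial>\<mu>)" by simp
qed

lemma continuous_integrable_cube:
  assumes "cube_law \<mu>" "continuous_on UNIV (g :: real ^ 'd \<Rightarrow> real)"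
  shows "integrable \<mu> g"
proof -
  interpret prob_space \<mu> by (rule cube_lawD[OF assms(1)])
  obtain K where K: "\<And>x. x \<in> unit_cube \<Longrightarrow> \<bar>g x\<bar> \<le> K"
    by (rule continuous_bounded_cube[OF assms(2)]) (rule that)
  show ?thesis
    by (rule integrable_bounded[OF cube_law_measurable[OF assms(1) borel_measurable_continuous_onI[OF assms(2)]], of K])
      (use K cube_lawD(3)[OF assms(1)] in auto)
qed

lemma Max_integrable:
  fixes u :: "'f \<Rightarrow> 'a \<Rightarrow> real"
  assumes F: "finite F" "F \<noteq> {}" and u: "\<And>f. f \<in> F \<Longrightarrow> integrable M (u f)"
  shows "integrable M (\<lambda>x. Max ((\<lambda>f. u f x) ` F))"
proof (rule Bochner_Integration.integrable_bound)
  show "integrable M (\<lambda>x. \<Sum>f\<in>F. \<bar>u f x\<bar>)"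
    by (intro Bochner_Integration.integrable_sum integrable_abs u)
  show "(\<lambda>x. Max ((\<lambda>f. u f x) ` F)) \<in> borel_measurable M"
    using u F by (intro borel_measurable_Max) auto
  have "\<bar>Max ((\<lambda>f. u f x) ` F)\<bar> \<le> (\<Sum>f\<in>F. \<bar>u f x\<bar>)" for x
  proof -
    have "Max ((\<lambda>f. u f x) ` F) \<in> (\<lambda>f. u f x) ` F" using F by (intro Max_in) auto
    then obtain f where f: "f \<in> F" "Max ((\<lambda>f. u f x) ` F) = u f x" by auto
    show ?thesis unfolding f(2) by (rule member_le_sum[OF f(1)]) (use F in auto)
  qed
  then show "AE x in M. norm (Max ((\<lambda>f. u f x) ` F)) \<le> norm (\<Sum>f\<in>F. \<bar>u f x\<bar>)"
    by (intro AE_I2) (auto intro: order_trans[OF _ abs_ge_self])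
qed

text \<open>The factor 1 + 1 / t^2 is the sum of the Lipschitz constants of \<open>clip\<close> and
  \<open>dual_loss\<close>; \<open>A\<close> stands for the total weight k a2 R + a3 + a4 of a
  network class.\<close>

definition deviation_rate :: "nat \<Rightarrow> nat \<Rightarrow> real \<Rightarrow> real \<Rightarrow> real" where
  "deviation_rate D n t A = 4 * (1 + 1 / t\<^sup>2) * A * halfspace_const (D + 1) / sqrt (real n)"

context
  fixes \<mu> \<nu> :: "(real ^ 'd) measure" and n k :: nat and t R a1 a2 a3 a4 :: real and \<phi> :: "real \<Rightarrow> real"
  assumes \<mu>: "cube_law \<mu>" and \<nu>: "cube_law \<nu>" and n: "n \<ge> 1" and t: "0 < t" "t \<le> 1"
    and \<phi>: "continuous_on UNIV \<phi>"
    and neuron: "\<And>(x :: nat \<Rightarrow> real ^ 'd) s w b. (\<And>i. i \<in> {1..n} \<Longrightarrow> x i \<in> unit_cube) \<Longrightarrow>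
      norm1 w \<le> a1 \<Longrightarrow> \<bar>b\<bar> \<le> a1 \<Longrightarrow>
      \<bar>\<Sum>i=1..n. s i * \<phi> (w \<bullet> x i + b)\<bar> \<le> R * halfspace_max x n s"
    and R: "0 \<le> R" and a: "0 \<le> a1" "0 \<le> a2" "0 \<le> a3" "0 \<le> a4"
begin

lemma objective_expectation:
  assumes g: "continuous_on UNIV g"
  shows "integrable (sample_law n \<mu> \<nu>) (objective n t g)"
    "(\<integral>z. objective n t g z \<partial>sample_law n \<mu> \<nu>) = population t g \<mu> \<nu>"
proof -
  let ?P = "\<Pi>\<^sub>M i\<in>{1..n}. \<mu>" and ?Q = "\<Pi>\<^sub>M i\<in>{1..n}. \<nu>"
  have P: "prob_space ?P" and Q: "prob_space ?Q" using cube_lawD(1)[OF \<mu>] cube_lawD(1)[OF \<nu>] by (auto intro: prob_space_PiM)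
  have ic: "integrable \<mu> (\<lambda>x. clip t (g x))" and id: "integrable \<nu> (\<lambda>x. dual_loss t (g x))"
    by (intro continuous_integrable_cube \<mu> \<nu> continuous_intros g t)+
  note sc = integral_PiM_sum[OF cube_lawD(1)[OF \<mu>] ic, of n]
  note sd = integral_PiM_sum[OF cube_lawD(1)[OF \<nu>] id, of n]
  note m = integral_pair_marginals[OF P Q sc(1) sd(1)]
  have eq: "objective n t g = (\<lambda>z. 1 / n * ((\<Sum>i=1..n. clip t (g (fst z i))) + (\<Sum>i=1..n. dual_loss t (g (snd z i)))))"
    unfolding objective_def by (auto simp: sum.distrib)
  show "integrable (sample_law n \<mu> \<nu>) (objective n t g)"
    unfolding eq sample_law_def by (intro integrable_mult_right Bochner_Integration.integrable_add m)
  have "(\<integral>z. objective n t g z \<partial>sample_law n \<mu> \<nu>) =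
     1 / n * (n * (\<integral>x. clip t (g x) \<partial>\<mu>) + n * (\<integral>x. dual_loss t (g x) \<partial>\<nu>))"
    unfolding eq sample_law_def integral_mult_right_zero
    by (subst Bochner_Integration.integral_add[OF m(1,2)]) (simp only: m(3,4) sc(2) sd(2))
  moreover have "1 / real n * (real n * A + real n * B) = A + B" for A B using n by (simp add: field_simps)
  ultimately show "(\<integral>z. objective n t g z \<partial>sample_law n \<mu> \<nu>) = population t g \<mu> \<nu>"
    unfolding population_def by (simp only:)
qed

text \<open>The two samples separate: the maximum of a sum is at most the sum of the maxima, each of
  which depends on one sample only and falls under \<open>uniform_deviation\<close>.\<close>

lemma finite_deviation:
  assumes F: "finite F" "F \<noteq> {}" "F \<subseteq> net_class k a1 a2 a3 a4 \<phi>"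
  shows "(\<integral>z. Max ((\<lambda>g. objective n t g z - population t g \<mu> \<nu>) ` F) \<partial>sample_law n \<mu> \<nu>)
    \<le> deviation_rate CARD('d) n t (k * a2 * R + a3 + a4)"
proof -
  let ?P = "\<Pi>\<^sub>M i\<in>{1..n}. \<mu>" and ?Q = "\<Pi>\<^sub>M i\<in>{1..n}. \<nu>"
  have P: "prob_space ?P" and Q: "prob_space ?Q" using cube_lawD(1)[OF \<mu>] cube_lawD(1)[OF \<nu>] by (auto intro: prob_space_PiM)
  interpret Z: prob_space "sample_law n \<mu> \<nu>" unfolding sample_law_def
    by (rule prob_space_pair[OF P Q])
  have g: "continuous_on UNIV g" if "g \<in> F" for g using net_class_borel(2)[OF \<phi>] F(3) that by blast
  define U where "U g x = (\<Sum>i=1..n. clip t (g (x i)) - (\<integral>z. clip t (g z) \<partial>\<mu>))" for g and x :: "nat \<Rightarrow> real ^ 'd"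
  define V where "V g y = (\<Sum>i=1..n. dual_loss t (g (y i)) - (\<integral>z. dual_loss t (g z) \<partial>\<nu>))" for g and y :: "nat \<Rightarrow> real ^ 'd"
  have iU: "integrable ?P (U g)" if "g \<in> F" for g unfolding U_def
    by (intro integral_PiM_sum cube_lawD(1)[OF \<mu>] continuous_integrable_cube \<mu> continuous_intros g that)
  have iV: "integrable ?Q (V g)" if "g \<in> F" for g unfolding V_def
    by (intro integral_PiM_sum cube_lawD(1)[OF \<nu>] continuous_integrable_cube \<nu> continuous_intros g that t)
  define A where "A x = Max ((\<lambda>g. U g x) ` F)" for x
  define B where "B y = Max ((\<lambda>g. V g y) ` F)" for y
  have iA: "integrable ?P A" unfolding A_def by (rule Max_integrable[OF F(1,2) iU])
  have iB: "integrable ?Q B" unfolding B_def by (rule Max_integrable[OF F(1,2) iV])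
  note m = integral_pair_marginals[OF P Q iA iB]
  have A: "(\<integral>x. A x \<partial>?P) \<le> 4 * 1 * (k * a2 * R + a3 + a4) * halfspace_const (CARD('d) + 1) * sqrt n"
    unfolding A_def U_def
    by (rule uniform_deviation[OF \<mu> n \<phi> neuron R a(2-4) F clip_lipschitz]) auto
  have B: "(\<integral>y. B y \<partial>?Q) \<le> 4 * (1 / t\<^sup>2) * (k * a2 * R + a3 + a4) * halfspace_const (CARD('d) + 1) * sqrt n"
    unfolding B_def V_def
    by (rule uniform_deviation[OF \<nu> n \<phi> neuron R a(2-4) F dual_loss_lipschitz[OF t(1)]]) auto
  have obj: "objective n t g z - population t g \<mu> \<nu> = 1 / n * (U g (fst z) + V g (snd z))" for g z
    unfolding objective_def population_def U_def V_def case_prod_beta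
    using n by (simp add: sum.distrib sum_subtractf field_simps)
  have "(\<integral>z. Max ((\<lambda>g. objective n t g z - population t g \<mu> \<nu>) ` F) \<partial>sample_law n \<mu> \<nu>)
    \<le> (\<integral>z. 1 / n * (A (fst z) + B (snd z)) \<partial>sample_law n \<mu> \<nu>)"
  proof (rule integral_mono)
    show "integrable (sample_law n \<mu> \<nu>) (\<lambda>z. Max ((\<lambda>g. objective n t g z - population t g \<mu> \<nu>) ` F))"
      by (intro Max_integrable F Bochner_Integration.integrable_diff objective_expectation g Z.integrable_const)
    show "integrable (sample_law n \<mu> \<nu>) (\<lambda>z. 1 / n * (A (fst z) + B (snd z)))"
      unfolding sample_law_def by (intro integrable_mult_right Bochner_Integration.integrable_add m)
    fix z
    show "Max ((\<lambda>g. objective n t g z - population t g \<mu> \<nu>) ` F) \<le> 1 / n * (A (fst z) + B (snd z))"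
    proof (rule Max.boundedI)
      fix b assume "b \<in> (\<lambda>g. objective n t g z - population t g \<mu> \<nu>) ` F"
      then obtain g where gF: "g \<in> F" "b = 1 / n * (U g (fst z) + V g (snd z))" unfolding obj by auto
      have "U g (fst z) \<le> A (fst z)" "V g (snd z) \<le> B (snd z)"
        unfolding A_def B_def using F gF by (auto intro!: Max_ge)
      then show "b \<le> 1 / n * (A (fst z) + B (snd z))"
        unfolding gF(2) by (intro mult_left_mono add_mono) auto
    qed (use F in auto)
  qed
  also have "\<dots> = 1 / n * ((\<integral>x. A x \<partial>?P) + (\<integral>y. B y \<partial>?Q))"
    unfolding sample_law_def integral_mult_right_zero
    by (subst Bochner_Integration.integral_add[OF m(1,2)]) (simp only: m(3,4))
  also have "\<dots> \<le> 1 / n * (4 * 1 * (k * a2 * R + a3 + a4) * halfspace_const (CARD('d) + 1) * sqrt n +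
      4 * (1 / t\<^sup>2) * (k * a2 * R + a3 + a4) * halfspace_const (CARD('d) + 1) * sqrt n)"
    by (intro mult_left_mono add_mono A B) auto
  also have "\<dots> = 4 * (1 + 1 / t\<^sup>2) * (k * a2 * R + a3 + a4) * halfspace_const (CARD('d) + 1) * (sqrt n / n)"
  proof -
    have "1 / m * (4 * 1 * A * h * s + 4 * q * A * h * s) = 4 * (1 + q) * A * h * (s / m)" for A h s q m :: real
      by (simp add: algebra_simps add_divide_distrib)
    then show ?thesis .
  qed
  also have "sqrt n / n = 1 / sqrt n" using n by (simp add: field_simps)
  finally show ?thesis unfolding deviation_rate_def by simp
qed

text \<open>Since \<open>\<bar>u\<bar> = 2 max 0 u - u\<close>, only the upper deviation needs a uniform bound; the mean of the
  estimator is bounded below by the population value at a single good network.\<close>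

lemma expected_error:
  assumes up: "\<And>g. g \<in> net_class k a1 a2 a3 a4 \<phi> \<Longrightarrow> population t g \<mu> \<nu> \<le> H"
    and gs: "gs \<in> net_class k a1 a2 a3 a4 \<phi>" "H - population t gs \<mu> \<nu> \<le> bias"
  shows "(\<integral>\<^sup>+z. ennreal \<bar>neural_H2 n (trunc_class t (net_class k a1 a2 a3 a4 \<phi>)) z - H\<bar> \<partial>sample_law n \<mu> \<nu>)
    \<le> ennreal (2 * deviation_rate CARD('d) n t (k * a2 * R + a3 + a4) + bias)"
proof -
  let ?P = "\<Pi>\<^sub>M i\<in>{1..n}. \<mu>" and ?Q = "\<Pi>\<^sub>M i\<in>{1..n}. \<nu>"
  let ?Z = "sample_law n \<mu> \<nu>"
  let ?N = "net_class k a1 a2 a3 a4 \<phi> :: (real ^ 'd \<Rightarrow> real) set"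
  define Dev where "Dev = deviation_rate CARD('d) n t (k * a2 * R + a3 + a4)"
  have P: "prob_space ?P" and Q: "prob_space ?Q" using cube_lawD(1)[OF \<mu>] cube_lawD(1)[OF \<nu>] by (auto intro: prob_space_PiM)
  interpret Z: prob_space ?Z unfolding sample_law_def by (rule prob_space_pair[OF P Q])
  define T where "T = neural_H2 n (trunc_class t ?N)"
  have Tm [measurable]: "T \<in> borel_measurable ?Z" unfolding T_def sample_law_def
    by (rule neural_H2_measurable[OF t(1) n \<phi> a cube_lawD(2)[OF \<mu>] cube_lawD(2)[OF \<nu>]])
  obtain e :: "nat \<Rightarrow> real ^ 'd \<Rightarrow> real" where e: "range e \<subseteq> ?N" "e 0 = (\<lambda>_. 0)"
    "\<And>z. neural_H2 n (trunc_class t ?N) z = (SUP i. objective n t (e i) z)"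
    by (rule net_class_countable_sup[OF t(1) n \<phi> a, where k = k]) (rule that)
  note e = e(1,2) e(3)[folded T_def]
  have zero: "objective n t (\<lambda>_. 0) z = 0" "population t (\<lambda>_. 0) \<mu> \<nu> = 0" for z :: "(nat \<Rightarrow> real ^ 'd) \<times> (nat \<Rightarrow> real ^ 'd)"
    using t unfolding objective_def population_def clip_def dual_loss_def by (auto simp: case_prod_beta)
  have bdd: "bdd_above ((\<lambda>g. objective n t g z) ` A)" for A z using objective_le[OF t(1) n] by (intro bdd_aboveI2)
  have Tge: "objective n t g z \<le> T z" if "g \<in> ?N" for g z
    unfolding T_def neural_H2_eq[OF t(1)] by (rule cSUP_upper[OF that bdd])
  have Tle: "T z \<le> 2" for z
    unfolding T_def neural_H2_eq[OF t(1)]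
  proof (rule cSUP_least)
    show "?N \<noteq> {}" using net_zero[OF a] by blast
    show "objective n t g z \<le> 2" for g using objective_le[OF t(1) n, of g z] t(1) by simp
  qed
  have T0: "0 \<le> T z" for z using Tge[OF net_zero[OF a], of z] zero(1) by simp
  \<comment> \<open>Maxima over initial segments of the dense sequence: integrable, increasing in
    \<open>N\<close>, and nonnegative because the zero network comes first.\<close>
  define mx where "mx N z = Max ((\<lambda>g. objective n t g z - population t g \<mu> \<nu>) ` e ` {..N})" for N z
  have mx_ge: "objective n t (e i) z - population t (e i) \<mu> \<nu> \<le> mx N z" if "i \<le> N" for i N z
    unfolding mx_def using that by (intro Max_ge) auto
  have mx0: "0 \<le> mx N z" for N z using mx_ge[of 0 N z] e(2) zero by simp
  have ge: "continuous_on UNIV (e i)" for i using e(1) by (intro net_class_borel(2)[OF \<phi>]) blast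
  have imx: "integrable ?Z (mx N)" for N
    unfolding mx_def by (intro Max_integrable Bochner_Integration.integrable_diff objective_expectation Z.integrable_const) (auto intro: ge)
  have mxm [measurable]: "mx N \<in> borel_measurable ?Z" for N using imx by auto
  have "(\<integral>z. mx N z \<partial>?Z) \<le> Dev" for N
    unfolding mx_def Dev_def by (rule finite_deviation) (use e(1) in auto)
  then have nmx: "(\<integral>\<^sup>+z. ennreal (mx N z) \<partial>?Z) \<le> ennreal Dev" for N
    using nn_integral_eq_integral[OF imx[of N]] mx0 by (simp add: ennreal_leI)
  have "(\<integral>\<^sup>+z. ennreal (T z - H) \<partial>?Z) \<le> (\<integral>\<^sup>+z. (SUP N. ennreal (mx N z)) \<partial>?Z)"
  proof (rule nn_integral_mono)
    fix z
    \<comment> \<open>\<open>ennreal\<close> cuts off at 0, so only the positive part is involved.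
      It is below the supremum of the \<open>mx N z\<close>, because every population value is at
      most \<open>H\<close>.\<close>
    show "ennreal (T z - H) \<le> (SUP N. ennreal (mx N z))"
    proof (cases "(SUP N. ennreal (mx N z))")
      case (real r)
      have "mx N z \<le> r" for N
      proof -
        have "ennreal (mx N z) \<le> (SUP N. ennreal (mx N z))" by (rule SUP_upper) simp
        then show ?thesis using real by (simp add: ennreal_le_iff)
      qed
      moreover have "population t (e i) \<mu> \<nu> \<le> H" for i using e(1) by (intro up) blast
      ultimately have "objective n t (e i) z \<le> H + r" for i
        using mx_ge[OF order_refl, of i z] by (smt (verit))
      then have "T z \<le> H + r" unfolding e(3) by (intro cSUP_least) auto
      then show ?thesis unfolding real(2) by (intro ennreal_leI) simp
    next
      case top
      show ?thesis unfolding top by (rule top_greatest)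
    qed
  qed
  also have "\<dots> = (SUP N. \<integral>\<^sup>+z. ennreal (mx N z) \<partial>?Z)"
  proof (rule nn_integral_monotone_convergence_SUP)
    show "incseq (\<lambda>N z. ennreal (mx N z))"
      unfolding incseq_def le_fun_def mx_def by (intro allI impI ennreal_leI Max_mono) auto
  qed measurable
  also have "\<dots> \<le> ennreal Dev" by (rule SUP_least) (rule nmx)
  finally have pos: "(\<integral>\<^sup>+z. ennreal (T z - H) \<partial>?Z) \<le> ennreal Dev" .
  have Dev0: "0 \<le> Dev" using nmx[of 0] \<open>\<And>N. (\<integral>z. mx N z \<partial>?Z) \<le> Dev\<close>[of 0] mx0
    by (smt (verit) Bochner_Integration.integral_nonneg)
  have i1: "integrable ?Z (\<lambda>z. max 0 (T z - H))"
    by (rule Z.integrable_bounded[of _ "2 + \<bar>H\<bar>"]) (measurable, use T0 Tle in \<open>smt (verit)\<close>)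
  have "ennreal (\<integral>z. max 0 (T z - H) \<partial>?Z) = (\<integral>\<^sup>+z. ennreal (max 0 (T z - H)) \<partial>?Z)"
    by (rule nn_integral_eq_integral[symmetric, OF i1]) auto
  also have "\<dots> = (\<integral>\<^sup>+z. ennreal (T z - H) \<partial>?Z)"
    by (intro nn_integral_cong) (auto simp: max_def ennreal_neg)
  finally have ip: "(\<integral>z. max 0 (T z - H) \<partial>?Z) \<le> Dev" using pos ennreal_le_iff[OF Dev0] by metis
  have gsc: "continuous_on UNIV gs" by (rule net_class_borel(2)[OF \<phi> gs(1)])
  note os = objective_expectation[OF gsc]
  have iabs: "integrable ?Z (\<lambda>z. \<bar>T z - H\<bar>)"
    by (rule Z.integrable_bounded[of _ "2 + \<bar>H\<bar>"]) (measurable, use T0 Tle in \<open>smt (verit)\<close>)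
  have "(\<integral>\<^sup>+z. ennreal \<bar>T z - H\<bar> \<partial>?Z) = ennreal (\<integral>z. \<bar>T z - H\<bar> \<partial>?Z)"
    by (rule nn_integral_eq_integral[OF iabs]) auto
  \<comment> \<open>In the subtracted term the estimator is replaced by the objective at
    \<open>gs\<close>, which is smaller and whose mean is known.\<close>
  also have "\<dots> \<le> ennreal (\<integral>z. 2 * max 0 (T z - H) - (objective n t gs z - H) \<partial>?Z)"
  proof (intro ennreal_leI integral_mono iabs)
    show "integrable ?Z (\<lambda>z. 2 * max 0 (T z - H) - (objective n t gs z - H))"
      by (intro Bochner_Integration.integrable_diff integrable_mult_right i1 os(1) Z.integrable_const)
    show "\<bar>T z - H\<bar> \<le> 2 * max 0 (T z - H) - (objective n t gs z - H)" for z
      using Tge[OF gs(1), of z] by (cases "H \<le> T z") (simp_all add: max_def)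
  qed
  also have "(\<integral>z. 2 * max 0 (T z - H) - (objective n t gs z - H) \<partial>?Z) =
      2 * (\<integral>z. max 0 (T z - H) \<partial>?Z) - (population t gs \<mu> \<nu> - H)"
    using i1 os by (simp add: Z.prob_space)
  also have "ennreal \<dots> \<le> ennreal (2 * Dev + bias)" using ip gs(2) by (intro ennreal_leI) linarith
  finally show ?thesis unfolding T_def Dev_def .
qed

end

section \<open>From the density bound to the risk over the classes\<close>

text \<open>A density with respect to a probability measure integrates to 1, so no essential bound
  below 1 is possible; the classes with M < 1 are therefore empty.\<close>

lemma essential_bound:
  assumes "(\<mu>, \<nu>) \<in> P2_H2 unit_cube" "density_version unit_cube \<mu> \<nu> p" "esssup \<nu> (\<lambda>x. ereal (p x)) \<le> ereal M"
  shows "AE x in \<nu>. p x \<le> M" "1 \<le> M"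
proof -
  note D = density_versionD[OF assms(1,2)]
  interpret N: prob_space \<nu> by (rule cube_lawD[OF D(2)])
  interpret M: prob_space \<mu> by (rule cube_lawD[OF D(1)])
  show AE: "AE x in \<nu>. p x \<le> M"
    using esssup_AE[of "\<lambda>x. ereal (p x)" \<nu>]
  proof eventually_elim
    case (elim x)
    then have "ereal (p x) \<le> ereal M" using assms(3) by (rule order_trans)
    then show ?case by simp
  qed
  have "ennreal 1 = emeasure \<mu> (space \<mu>)" by (simp add: M.emeasure_space_1)
  also have "\<dots> = (\<integral>\<^sup>+x. ennreal (p x) \<partial>\<nu>)"
    unfolding D(4) using D(3) by (simp add: emeasure_density cong: nn_integral_cong)
  also have "\<dots> \<le> (\<integral>\<^sup>+x. ennreal M \<partial>\<nu>)"
    using AE by (intro nn_integral_mono_AE) (auto elim!: eventually_mono intro: ennreal_leI)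
  also have "\<dots> = ennreal M" by (simp add: N.emeasure_space_1)
  finally show "1 \<le> M" by (cases "0 \<le> M") (auto simp: ennreal_neg simp flip: ennreal_1)
qed

lemma class_empty:
  assumes "M < 1"
  shows "P2_H2_KB M (unit_cube :: (real ^ 'd) set) = {}" "P2_H2_B M (unit_cube :: (real ^ 'd) set) = {}"
  using essential_bound(2)[of _ _ _ M] assms unfolding P2_H2_KB_def P2_H2_B_def by (auto simp: not_le[symmetric])

definition upper_const :: "nat \<Rightarrow> real" where
  "upper_const D = 48 * halfspace_const (D + 1) + 400"

lemma halfspace_const_nonneg: "1 \<le> D \<Longrightarrow> 0 \<le> halfspace_const D"
  unfolding halfspace_const_def by (intro add_nonneg_nonneg mult_nonneg_nonneg) auto

text \<open>The stochastic part is of order (1 + 1 / t^2) a / sqrt n and the bias of order a^2 / (t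
  n); both fit under a^2 / (t^2 sqrt n). The limit 6 a is the total weight of the ReLU class, 4 a +
  a + a; the sigmoid class has 2 a + a.\<close>

lemma rate_bound:
  assumes n: "n \<ge> 1" and t: "0 < t" "t \<le> 1" and a: "1 \<le> a" and A: "0 \<le> A" "A \<le> 6 * a"
  shows "2 * deviation_rate D n t A + 1 / t * (400 * a\<^sup>2 / n) \<le> 2 * upper_const D * (a\<^sup>2 * (1 / t)\<^sup>2) / sqrt n"
proof -
  let ?h = "halfspace_const (D + 1)"
  have h: "0 \<le> ?h" by (rule halfspace_const_nonneg) simp
  have t1: "1 \<le> 1 / t" using t by simp
  have "1 / t * 1 \<le> 1 / t * (1 / t)" using t1 t by (intro mult_left_mono) auto
  then have t2: "1 / t \<le> (1 / t)\<^sup>2" "1 \<le> (1 / t)\<^sup>2" using t1 unfolding power2_eq_square by linarith+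
  have a2: "a \<le> a\<^sup>2" using a by (simp add: power2_eq_square)
  have "(1 + 1 / t\<^sup>2) * A \<le> (2 * (1 / t)\<^sup>2) * (6 * a\<^sup>2)"
    using t2 A a2 by (intro mult_mono) (auto simp: power_one_over)
  then have "2 * (4 * ((1 + 1 / t\<^sup>2) * A) * ?h) \<le> 2 * (4 * ((2 * (1 / t)\<^sup>2) * (6 * a\<^sup>2)) * ?h)"
    using h by (intro mult_left_mono mult_right_mono) auto
  then have 1: "2 * deviation_rate D n t A \<le> 96 * ?h * (a\<^sup>2 * (1 / t)\<^sup>2) / sqrt n"
    unfolding deviation_rate_def using divide_right_mono[of _ _ "sqrt n"] by (fastforce simp: algebra_simps)
  have "sqrt n \<le> n" using n by (simp add: real_sqrt_le_iff real_le_lsqrt power2_eq_square)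
  then have "400 * a\<^sup>2 / n \<le> 400 * a\<^sup>2 / sqrt n" using n by (intro divide_left_mono) auto
  then have "1 / t * (400 * a\<^sup>2 / n) \<le> (1 / t)\<^sup>2 * (400 * a\<^sup>2 / sqrt n)"
    using t2 t by (intro mult_mono) auto
  also have "\<dots> \<le> (1 / t)\<^sup>2 * (800 * a\<^sup>2 / sqrt n)" by (intro mult_left_mono divide_right_mono) auto
  also have "\<dots> = 800 * (a\<^sup>2 * (1 / t)\<^sup>2) / sqrt n" by simp
  finally show ?thesis using 1 unfolding upper_const_def by (simp add: algebra_simps add_divide_distrib)
qed

text \<open>\<open>a\<close> and \<open>t\<close> are decoupled from \<open>M\<close>, so that one
  bound serves both the matched choice and the choice through ln n.\<close>

lemma relu_risk:
  assumes M: "0 < M" "M \<le> a" and t: "0 < t" "t \<le> M powr (- 1 / 2)" "t \<le> 1" and n: "n \<ge> 1"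
  shows "risk (P2_H2_KB M (unit_cube :: (real ^ 'd) set)) n (neural_H2 n (relu_class n t a))
    \<le> ennreal (2 * upper_const CARD('d) * (a\<^sup>2 * (1 / t)\<^sup>2) / sqrt n)"
  unfolding risk_def
proof (rule SUP_least, clarify)
  fix \<mu> \<nu> :: "(real ^ 'd) measure"
  assume "(\<mu>, \<nu>) \<in> P2_H2_KB M unit_cube"
  then obtain p where P: "(\<mu>, \<nu>) \<in> P2_H2 unit_cube" and p: "density_version unit_cube \<mu> \<nu> p"
    and c: "c_KB (f_H2 p) unit_cube \<le> ereal M" and es: "esssup \<nu> (\<lambda>x. ereal (p x)) \<le> ereal M"
    unfolding P2_H2_KB_def by auto
  note D = density_versionD[OF P p]
  note E = essential_bound[OF P p es]
  have a: "1 \<le> a" using E(2) M by simp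
  have cont: "continuous_on UNIV phi_R" unfolding phi_R_def by (intro continuous_intros)
  have fm: "f_H2 p \<in> borel_measurable \<mu>"
    unfolding f_H2_def D(4) using D(3) by measurable
  obtain K where K: "\<And>x. x \<in> unit_cube \<Longrightarrow> \<bar>f_H2 p x\<bar> \<le> K"
    using relu_class_approx(1)[OF c M(2) _ D(1) n fm] a by auto
  obtain gs where gs: "gs \<in> net_class n 1 (2 * a / n) a a phi_R" "(\<integral>x. (gs x - f_H2 p x)\<^sup>2 \<partial>\<mu>) \<le> 400 * a\<^sup>2 / n"
    using relu_class_approx(2)[OF c M(2) _ D(1) n fm] a by auto
  note gap = hellinger_gap[OF P p E(1) t(1,2) M(1) K]
  have "hellinger2 \<mu> \<nu> - population t gs \<mu> \<nu> \<le> 1 / t * (400 * a\<^sup>2 / n)"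
    using gap(2)[OF _ net_class_borel(2)[OF cont gs(1)]] mult_left_mono[OF gs(2), of "1 / t"] t(1) by fastforce
  moreover have "population t g \<mu> \<nu> \<le> hellinger2 \<mu> \<nu>" if "g \<in> net_class n 1 (2 * a / n) a a phi_R" for g
    by (rule gap(1)[OF _ net_class_borel(2)[OF cont that]])
  moreover have "0 \<le> a" "0 \<le> 2 * a / n" using a n by auto
  ultimately have "(\<integral>\<^sup>+z. ennreal \<bar>neural_H2 n (trunc_class t (net_class n 1 (2 * a / n) a a phi_R)) z - hellinger2 \<mu> \<nu>\<bar> \<partial>sample_law n \<mu> \<nu>)
    \<le> ennreal (2 * deviation_rate CARD('d) n t (n * (2 * a / n) * 2 + a + a) + 1 / t * (400 * a\<^sup>2 / n))"
    by (intro expected_error[OF D(1,2) n t(1,3) cont relu_sum_bound]) (use gs(1) in simp_all)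
  also have "\<dots> \<le> ennreal (2 * upper_const CARD('d) * (a\<^sup>2 * (1 / t)\<^sup>2) / sqrt n)"
    by (intro ennreal_leI rate_bound n t a) (use n a in auto)
  finally show "(\<integral>\<^sup>+z. ennreal \<bar>neural_H2 n (relu_class n t a) z - hellinger2 \<mu> \<nu>\<bar> \<partial>sample_law n \<mu> \<nu>)
    \<le> ennreal (2 * upper_const CARD('d) * (a\<^sup>2 * (1 / t)\<^sup>2) / sqrt n)"
    unfolding relu_class_def .
qed

lemma sigmoid_risk:
  assumes M: "0 < M" "M \<le> a" and t: "0 < t" "t \<le> M powr (- 1 / 2)" "t \<le> 1" and n: "n \<ge> 1" "1 \<le> ln (real n)"
  shows "risk (P2_H2_B M (unit_cube :: (real ^ 'd) set)) n (neural_H2 n (sigmoid_class n t a))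
    \<le> ennreal (2 * upper_const CARD('d) * (a\<^sup>2 * (1 / t)\<^sup>2) / sqrt n)"
  unfolding risk_def
proof (rule SUP_least, clarify)
  fix \<mu> \<nu> :: "(real ^ 'd) measure"
  assume "(\<mu>, \<nu>) \<in> P2_H2_B M unit_cube"
  then obtain p where P: "(\<mu>, \<nu>) \<in> P2_H2 unit_cube" and p: "density_version unit_cube \<mu> \<nu> p"
    and c: "c_B (f_H2 p) unit_cube \<le> ereal M" and es: "esssup \<nu> (\<lambda>x. ereal (p x)) \<le> ereal M"
    unfolding P2_H2_B_def by auto
  let ?N = "net_class n (sqrt (real n) * ln (real n)) (2 * a / n) a 0 phi_S :: (real ^ 'd \<Rightarrow> real) set"
  note D = density_versionD[OF P p]
  note E = essential_bound[OF P p es]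
  have a: "1 \<le> a" using E(2) M by simp
  have fm: "f_H2 p \<in> borel_measurable \<mu>"
    unfolding f_H2_def D(4) using D(3) by measurable
  obtain K where K: "\<And>x. x \<in> unit_cube \<Longrightarrow> \<bar>f_H2 p x\<bar> \<le> K"
    using sigmoid_class_approx(1)[OF c M(2) _ D(1) n fm] a by auto
  obtain gs where gs: "gs \<in> ?N" "(\<integral>x. (gs x - f_H2 p x)\<^sup>2 \<partial>\<mu>) \<le> 400 * a\<^sup>2 / n"
    using sigmoid_class_approx(2)[OF c M(2) _ D(1) n fm] a by auto
  note gap = hellinger_gap[OF P p E(1) t(1,2) M(1) K]
  have "hellinger2 \<mu> \<nu> - population t gs \<mu> \<nu> \<le> 1 / t * (400 * a\<^sup>2 / n)"
    using gap(2)[OF _ net_class_borel(2)[OF phi_S_continuous gs(1)]] mult_left_mono[OF gs(2), of "1 / t"] t(1) by fastforce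
  moreover have "population t g \<mu> \<nu> \<le> hellinger2 \<mu> \<nu>" if "g \<in> ?N" for g
    by (rule gap(1)[OF _ net_class_borel(2)[OF phi_S_continuous that]])
  moreover have "0 \<le> a" "0 \<le> 2 * a / n" "0 \<le> sqrt (real n) * ln (real n)" using a n by auto
  ultimately have "(\<integral>\<^sup>+z. ennreal \<bar>neural_H2 n (trunc_class t ?N) z - hellinger2 \<mu> \<nu>\<bar> \<partial>sample_law n \<mu> \<nu>)
    \<le> ennreal (2 * deviation_rate CARD('d) n t (n * (2 * a / n) * 1 + a + 0) + 1 / t * (400 * a\<^sup>2 / n))"
    by (intro expected_error[OF D(1,2) n(1) t(1,3) phi_S_continuous sigmoid_sum_bound]) (use gs(1) in simp_all)
  also have "\<dots> \<le> ennreal (2 * upper_const CARD('d) * (a\<^sup>2 * (1 / t)\<^sup>2) / sqrt n)"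
    by (intro ennreal_leI rate_bound n t a) (use n a in auto)
  finally show "(\<integral>\<^sup>+z. ennreal \<bar>neural_H2 n (sigmoid_class n t a) z - hellinger2 \<mu> \<nu>\<bar> \<partial>sample_law n \<mu> \<nu>)
    \<le> ennreal (2 * upper_const CARD('d) * (a\<^sup>2 * (1 / t)\<^sup>2) / sqrt n)"
    unfolding sigmoid_class_def .
qed

section \<open>The minimax lower bound\<close>

text \<open>\<open>point_measure\<close> lives on the power set of \<open>P\<close>; the
  push-forward along the identity places it on the sigma-algebra of \<open>N\<close>, as membership
  in the classes demands.\<close>

definition weighted_points :: "'a set \<Rightarrow> ('a \<Rightarrow> real) \<Rightarrow> 'a measure \<Rightarrow> 'a measure" where
  "weighted_points P w N = distr (point_measure P w) N (\<lambda>x. x)"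

lemma sets_weighted_points [simp, measurable_cong]: "sets (weighted_points P w N) = sets N"
  unfolding weighted_points_def by simp

lemma space_weighted_points [simp]: "space (weighted_points P w N) = space N"
  unfolding weighted_points_def by simp

lemma nn_integral_weighted_points:
  assumes P: "finite P" "P \<subseteq> space N" and h: "h \<in> borel_measurable N"
  shows "(\<integral>\<^sup>+x. h x \<partial>weighted_points P w N) = (\<Sum>x\<in>P. ennreal (w x) * h x)"
proof -
  have "(\<integral>\<^sup>+x. h x \<partial>weighted_points P w N) = (\<integral>\<^sup>+x. h x \<partial>point_measure P w)"
    unfolding weighted_points_def by (rule nn_integral_distr) (use P h in \<open>auto simp: measurable_point_measure_eq1\<close>)
  also have "\<dots> = (\<Sum>x\<in>P. ennreal (w x) * h x)"
    unfolding point_measure_def using P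
    by (subst nn_integral_density) (auto simp: nn_integral_count_space_finite)
  finally show ?thesis .
qed

lemma integral_weighted_points:
  fixes h :: "_ \<Rightarrow> 'b::{banach, second_countable_topology}"
  assumes P: "finite P" "P \<subseteq> space N" and w: "\<And>x. x \<in> P \<Longrightarrow> 0 \<le> w x" and h: "h \<in> borel_measurable N"
  shows "(\<integral>x. h x \<partial>weighted_points P w N) = (\<Sum>x\<in>P. w x *\<^sub>R h x)"
proof -
  have "(\<integral>x. h x \<partial>weighted_points P w N) = (\<integral>x. h x \<partial>point_measure P w)"
    unfolding weighted_points_def by (rule integral_distr) (use P h in \<open>auto simp: measurable_point_measure_eq1\<close>)
  also have "\<dots> = (\<Sum>x\<in>P. w x *\<^sub>R h x)" by (rule lebesgue_integral_point_measure_finite[OF P(1) w])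
  finally show ?thesis .
qed

lemma emeasure_weighted_points:
  assumes P: "finite P" "P \<subseteq> space N" and A: "A \<in> sets N"
  shows "emeasure (weighted_points P w N) A = (\<Sum>x\<in>P. ennreal (w x) * indicator A x)"
  using nn_integral_weighted_points[OF P, of "indicator A" w] A by simp

lemma prob_weighted_points:
  assumes P: "finite P" "P \<subseteq> space N" and w: "\<And>x. x \<in> P \<Longrightarrow> 0 \<le> w x" "(\<Sum>x\<in>P. w x) = 1"
  shows "prob_space (weighted_points P w N)"
proof
  have "emeasure (weighted_points P w N) (space N) = (\<Sum>x\<in>P. ennreal (w x) * indicator (space N) x)"
    by (rule emeasure_weighted_points[OF P]) simp
  also have "\<dots> = (\<Sum>x\<in>P. ennreal (w x))" using P by (intro sum.cong) auto
  also have "\<dots> = ennreal (\<Sum>x\<in>P. w x)" using w by (intro sum_ennreal) auto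
  finally show "emeasure (weighted_points P w N) (space (weighted_points P w N)) = 1" using w by simp
qed

lemma density_weighted_points:
  assumes P: "finite P" "P \<subseteq> space N" and w: "\<And>x. x \<in> P \<Longrightarrow> 0 \<le> w x"
    and h: "h \<in> borel_measurable N" and u: "\<And>x. x \<in> P \<Longrightarrow> u x = w x * h x"
  shows "density (weighted_points P w N) (\<lambda>x. ennreal (h x)) = weighted_points P u N"
proof (rule measure_eqI)
  fix A assume "A \<in> sets (density (weighted_points P w N) (\<lambda>x. ennreal (h x)))"
  then have A: "A \<in> sets N" by simp
  have "emeasure (density (weighted_points P w N) (\<lambda>x. ennreal (h x))) A
      = (\<integral>\<^sup>+x. ennreal (h x) * indicator A x \<partial>weighted_points P w N)"
    using A h by (intro emeasure_density) auto
  also have "\<dots> = (\<Sum>x\<in>P. ennreal (w x) * (ennreal (h x) * indicator A x))"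
    using A h by (intro nn_integral_weighted_points P) auto
  also have "\<dots> = (\<Sum>x\<in>P. ennreal (u x) * indicator A x)"
    using w u by (intro sum.cong) (auto simp: ennreal_mult' mult.assoc)
  also have "\<dots> = emeasure (weighted_points P u N) A" by (rule emeasure_weighted_points[OF P A, symmetric])
  finally show "emeasure (density (weighted_points P w N) (\<lambda>x. ennreal (h x))) A = emeasure (weighted_points P u N) A" .
qed simp

section \<open>A cosine with explicit coefficients\<close>

text \<open>A nonnegative measure is its own total variation: by countable additivity every
  partition gives the same sum.\<close>

lemma magnitude_of_measure:
  fixes m :: "(real ^ 'd) measure"
  assumes fin: "finite_measure m" and sets: "sets m = sets borel"
  defines "F \<equiv> \<lambda>A. complex_of_real (measure m A)"
  shows "complex_borel_measure F" "magnitude F = m"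
proof -
  interpret finite_measure m by (rule fin)
  show "complex_borel_measure F"
    unfolding complex_borel_measure_def F_def
    using finite_measure_UNION by (auto simp: sets intro!: sums_of_real)
  have var: "variation F A = emeasure m A" if A: "A \<in> sets borel" for A
  proof -
    have part: "(\<Sum>i. ennreal (cmod (F (E i)))) = emeasure m A"
      if E: "range E \<subseteq> sets borel" "disjoint_family E" "(\<Union>i. E i) = A" for E :: "nat \<Rightarrow> _ set"
    proof -
      have "(\<Sum>i. ennreal (cmod (F (E i)))) = (\<Sum>i. emeasure m (E i))"
        unfolding F_def by (simp add: emeasure_eq_measure)
      also have "\<dots> = emeasure m A" using suminf_emeasure[of E m] E sets by simp
      finally show ?thesis .
    qed
    let ?S = "{E :: nat \<Rightarrow> (real ^ 'd) set. range E \<subseteq> sets borel \<and> disjoint_family E \<and> (\<Union>i. E i) = A}"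
    have "(\<lambda>i::nat. if i = 0 then A else {}) \<in> ?S"
      using A by (auto simp: disjoint_family_on_def split: if_splits)
    then have ne: "?S \<noteq> {}" by blast
    have "variation F A = (SUP E\<in>?S. emeasure m A)"
      unfolding variation_def by (rule SUP_cong[OF refl], drule CollectD, elim conjE, rule part)
    also have "\<dots> = emeasure m A" using ne by (rule SUP_const)
    finally show ?thesis .
  qed
  have sp: "space m = UNIV" using sets_eq_imp_space_eq[OF sets] by simp
  have "magnitude F = measure_of UNIV (sets borel) (emeasure m)"
    unfolding magnitude_def
  proof (rule measure_of_eq)
    fix A :: "(real ^ 'd) set" assume "A \<in> sigma_sets UNIV (sets borel)"
    then have "A \<in> sets borel" using sets.sigma_sets_eq[of "borel :: (real ^ 'd) measure"] by simp
    then show "variation F A = emeasure m A" by (rule var)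
  qed simp
  also have "\<dots> = m" using measure_of_of_measure[of m] unfolding sp sets .
  finally show "magnitude F = m" .
qed

text \<open>Two atoms of mass b / 2, at distance pi on either side of the origin along axis
  \<open>j\<close>, represent the cosine. The measure is nonnegative, so its polar density is 1, and
  both atoms have l1-norm pi.\<close>

lemma cosine_fourier:
  fixes j :: "'d::finite"
  assumes b: "0 < b"
  defines "f \<equiv> \<lambda>x :: real ^ 'd. b * cos (pi * x $ j)"
  obtains F where "fourier_rep f F" "fourier_moment 1 F = ennreal (b * pi)" "fourier_moment 2 F = ennreal (b * pi\<^sup>2)"
proof -
  define v where "v = axis j pi"
  define P where "P = {v, - v}"
  define m where "m = weighted_points P (\<lambda>_. b / 2) (borel :: (real ^ 'd) measure)"
  have vj: "v $ j = pi" unfolding v_def by simp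
  have vne: "v \<noteq> - v"
  proof
    assume "v = - v"
    then have "v $ j = (- v) $ j" by (rule arg_cong)
    then show False using vj unfolding vector_uminus_component by simp
  qed
  have P: "finite P" "P \<subseteq> space (borel :: (real ^ 'd) measure)" unfolding P_def by auto
  have norm1_v: "norm1 v = pi" "norm1 (- v) = pi"
    unfolding norm1_def v_def by (simp_all add: axis_def if_distrib[of abs] cong: if_cong)
  have sets: "sets m = sets borel" unfolding m_def by simp
  have nn: "(\<integral>\<^sup>+w. ennreal (norm1 w ^ k) \<partial>m) = ennreal (b * pi ^ k)" for k
  proof -
    have "(\<integral>\<^sup>+w. ennreal (norm1 w ^ k) \<partial>m) = (\<Sum>w\<in>P. ennreal (b / 2) * ennreal (norm1 w ^ k))"
      unfolding m_def by (rule nn_integral_weighted_points[OF P]) measurable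
    also have "\<dots> = ennreal (b / 2) * ennreal (pi ^ k) + ennreal (b / 2) * ennreal (pi ^ k)"
      unfolding P_def using vne by (simp add: norm1_v)
    also have "ennreal (b / 2) * ennreal (pi ^ k) = ennreal (b / 2 * pi ^ k)"
      by (rule ennreal_mult[symmetric]) (use b in auto)
    also have "ennreal (b / 2 * pi ^ k) + ennreal (b / 2 * pi ^ k) = ennreal (b / 2 * pi ^ k + b / 2 * pi ^ k)"
      by (rule ennreal_plus[symmetric]) (use b in auto)
    finally show ?thesis by simp
  qed
  have fin: "finite_measure m"
  proof
    have "emeasure m (space m) = (\<integral>\<^sup>+w. ennreal (norm1 w ^ 0) \<partial>m)" by simp
    then show "emeasure m (space m) \<noteq> \<infinity>" unfolding nn by simp
  qed
  define F where "F A = complex_of_real (measure m A)" for A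
  note mag = magnitude_of_measure[OF fin sets, folded F_def[abs_def]]
  interpret finite_measure m by (rule fin)
  have "polar_density F (\<lambda>_. 1)"
    unfolding polar_density_def mag(2)
    using sets by (auto simp: F_def set_lebesgue_integral_def scaleR_conv_of_real sets_eq_imp_space_eq[OF sets])
  moreover have "complex_of_real (f x) = (LINT w|m. exp (\<i> * complex_of_real (w \<bullet> x)) * 1)" for x
  proof -
    have em: "(\<lambda>w. exp (\<i> * complex_of_real (w \<bullet> x)) * 1) \<in> borel_measurable (borel :: (real ^ 'd) measure)"
      by (intro borel_measurable_continuous_onI continuous_intros)
    have vx: "v \<bullet> x = pi * x $ j" unfolding v_def by (simp add: inner_axis')
    have "(LINT w|m. exp (\<i> * complex_of_real (w \<bullet> x)) * 1) = (\<Sum>w\<in>P. (b / 2) *\<^sub>R (exp (\<i> * complex_of_real (w \<bullet> x)) * 1))"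
      unfolding m_def by (rule integral_weighted_points[OF P _ em]) (use b in simp)
    also have "\<dots> = (b / 2) *\<^sub>R cis (v \<bullet> x) + (b / 2) *\<^sub>R cis (- (v \<bullet> x))"
      unfolding P_def using vne by (simp add: cis_conv_exp)
    also have "\<dots> = complex_of_real (f x)" unfolding f_def vx by (simp add: complex_eq_iff)
    finally show ?thesis ..
  qed
  ultimately have "fourier_rep f F" unfolding fourier_rep_def mag(2) using mag(1) by blast
  moreover have "fourier_moment 1 F = ennreal (b * pi)" "fourier_moment 2 F = ennreal (b * pi\<^sup>2)"
    unfolding fourier_moment_def mag(2) nn by simp_all
  ultimately show ?thesis by (rule that)
qed

text \<open>Of the quantities to be bounded, the second moment b pi^2 is the largest; the gradient
  at 0 vanishes because the cosine is critical there.\<close>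

lemma cosine_coefficients:
  fixes j :: "'d::finite" and f :: "real ^ 'd \<Rightarrow> real"
  assumes b: "0 < b" "b * pi\<^sup>2 \<le> M" and f: "\<And>x. x \<in> unit_cube \<Longrightarrow> f x = b * cos (pi * x $ j)"
  shows "c_KB f unit_cube \<le> ereal M" "c_B f unit_cube \<le> ereal M"
proof -
  let ?f = "\<lambda>x :: real ^ 'd. b * cos (pi * x $ j)"
  obtain F where F: "fourier_rep ?f F" "fourier_moment 1 F = ennreal (b * pi)" "fourier_moment 2 F = ennreal (b * pi\<^sup>2)"
    by (rule cosine_fourier[OF b(1)]) (rule that)
  have pi1: "1 \<le> pi" using pi_gt3 by simp
  have "pi * 1 \<le> pi * pi" using pi1 by (intro mult_left_mono) auto
  then have "b * pi \<le> b * pi\<^sup>2" "b * 1 \<le> b * pi" using b(1) pi1 unfolding power2_eq_square by (intro mult_left_mono; simp)+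
  then have le: "b * pi \<le> M" "b \<le> M" using b(2) by auto
  have nth: "((\<lambda>x :: real ^ 'd. x $ j) has_derivative (\<lambda>h. h $ j)) (at 0)"
    by (rule bounded_linear_imp_has_derivative[OF bounded_linear_vec_nth])
  have G: "GDERIV ?f 0 :> 0"
    unfolding gderiv_def by (auto intro!: derivative_eq_intros nth)
  have n0: "norm1 (0 :: real ^ 'd) = 0" by (simp add: norm1_def)
  have M0: "0 \<le> M" using le b by simp
  have 1: "M \<in> {c. 0 \<le> c \<and> (\<exists>f' F G. fourier_rep f' F \<and> (\<forall>x\<in>unit_cube. f' x = f x) \<and>
        ennreal (set_norm (unit_cube :: (real ^ 'd) set)) * fourier_moment 2 F \<le> ennreal c \<and>
        \<bar>f' 0\<bar> \<le> c \<and> (GDERIV f' 0 :> G) \<and> norm1 G \<le> c)}"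
    unfolding set_norm_unit_cube mem_Collect_eq
    by (intro conjI M0 exI[of _ ?f] exI[of _ F] exI[of _ 0])
      (use F f b le G M0 n0 in \<open>auto intro: ennreal_leI\<close>)
  have 2: "M \<in> {c. 0 \<le> c \<and> (\<exists>f' F. fourier_rep f' F \<and> (\<forall>x\<in>unit_cube. f' x = f x) \<and>
        ennreal (set_norm (unit_cube :: (real ^ 'd) set)) * fourier_moment 1 F \<le> ennreal c \<and>
        \<bar>f' 0\<bar> \<le> c)}"
    unfolding set_norm_unit_cube mem_Collect_eq
    by (intro conjI M0 exI[of _ ?f] exI[of _ F])
      (use F f b le M0 in \<open>auto intro: ennreal_leI\<close>)
  show "c_KB f unit_cube \<le> ereal M" unfolding c_KB_def by (rule Inf_lower, rule imageI, rule 1)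
  show "c_B f unit_cube \<le> ereal M" unfolding c_B_def by (rule Inf_lower, rule imageI, rule 2)
qed

section \<open>Likelihood ratios of samples and the two-point bound\<close>

lemma density_PiM:
  assumes I: "finite I" and N: "prob_space N" and l: "l \<in> borel_measurable N" and D: "prob_space (density N l)"
  shows "(\<Pi>\<^sub>M i\<in>I. density N l) = density (\<Pi>\<^sub>M i\<in>I. N) (\<lambda>x. \<Prod>i\<in>I. l (x i))"
proof -
  interpret N: prob_space N by (rule N)
  interpret D: prob_space "density N l" by (rule D)
  interpret PN: product_sigma_finite "\<lambda>_. N" by standard
  interpret PD: product_sigma_finite "\<lambda>_. density N l" by standard
  have lm: "(\<lambda>x. \<Prod>i\<in>I. l (x i)) \<in> borel_measurable (\<Pi>\<^sub>M i\<in>I. N)"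
    by (intro borel_measurable_prod_ennreal) (rule measurable_compose[OF measurable_component_singleton], assumption, rule l)
  show ?thesis
  proof (rule PD.PiM_eqI[OF I, symmetric])
    show "sets (density (\<Pi>\<^sub>M i\<in>I. N) (\<lambda>x. \<Prod>i\<in>I. l (x i))) = sets (\<Pi>\<^sub>M i\<in>I. density N l)"
      by (simp cong: sets_PiM_cong)
    fix A assume A: "\<And>i. i \<in> I \<Longrightarrow> A i \<in> sets (density N l)"
    then have A': "\<And>i. i \<in> I \<Longrightarrow> A i \<in> sets N" by simp
    have "emeasure (density (\<Pi>\<^sub>M i\<in>I. N) (\<lambda>x. \<Prod>i\<in>I. l (x i))) (Pi\<^sub>E I A)
        = (\<integral>\<^sup>+x. (\<Prod>i\<in>I. l (x i)) * indicator (Pi\<^sub>E I A) x \<partial>(\<Pi>\<^sub>M i\<in>I. N))"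
      using A' I by (intro emeasure_density lm sets_PiM_I_finite) auto
    also have "\<dots> = (\<integral>\<^sup>+x. (\<Prod>i\<in>I. l (x i) * indicator (A i) (x i)) \<partial>(\<Pi>\<^sub>M i\<in>I. N))"
    proof (rule nn_integral_cong)
      fix x assume x: "x \<in> space (\<Pi>\<^sub>M i\<in>I. N)"
      have "indicator (Pi\<^sub>E I A) x = (\<Prod>i\<in>I. indicator (A i) (x i) :: ennreal)"
        using x I by (auto simp: indicator_def space_PiM PiE_iff)
      then show "(\<Prod>i\<in>I. l (x i)) * indicator (Pi\<^sub>E I A) x = (\<Prod>i\<in>I. l (x i) * indicator (A i) (x i))"
        by (simp add: prod.distrib)
    qed
    also have "\<dots> = (\<Prod>i\<in>I. \<integral>\<^sup>+y. l y * indicator (A i) y \<partial>N)"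
      using A' l by (intro PN.product_nn_integral_prod[OF I]) auto
    also have "\<dots> = (\<Prod>i\<in>I. emeasure (density N l) (A i))"
      using A' l by (intro prod.cong) (auto simp: emeasure_density)
    finally show "emeasure (density (\<Pi>\<^sub>M i\<in>I. N) (\<lambda>x. \<Prod>i\<in>I. l (x i))) (Pi\<^sub>E I A) = (\<Prod>i\<in>I. emeasure (density N l) (A i))" .
  qed
qed

text \<open>Le Cam's two-point method; \<open>min 1 L \<ge> L - L\<^sup>2 / 4\<close> replaces the total variation distance.\<close>

lemma two_point_bound:
  assumes P: "prob_space P" and L: "L \<in> borel_measurable P" "\<And>z. 0 \<le> L z"
    and one: "(\<integral>\<^sup>+z. ennreal (L z) \<partial>P) = 1" and two: "(\<integral>\<^sup>+z. ennreal ((L z)\<^sup>2) \<partial>P) \<le> 2"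
    and T: "T \<in> borel_measurable P"
    and R0: "(\<integral>\<^sup>+z. ennreal \<bar>T z - \<theta>0\<bar> \<partial>P) \<le> R"
    and R1: "(\<integral>\<^sup>+z. ennreal \<bar>T z - \<theta>1\<bar> \<partial>density P (\<lambda>z. ennreal (L z))) \<le> R"
  shows "ennreal (\<bar>\<theta>1 - \<theta>0\<bar> / 4) \<le> R"
proof -
  interpret prob_space P by (rule P)
  note [measurable] = L(1) T
  have "1 \<le> (\<integral>\<^sup>+z. ennreal (min 1 (L z)) + ennreal (1 / 4) * ennreal ((L z)\<^sup>2) \<partial>P)"
    unfolding one[symmetric]
  proof (rule nn_integral_mono)
    fix z
    \<comment> \<open>The square gives L \<le> 1 + L^2 / 4. After integration, with second moment at
      most 2, the overlap of the two laws is at least 1 / 2.\<close>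
    have "0 \<le> (L z / 2 - 1)\<^sup>2" by simp
    then have "L z \<le> min 1 (L z) + 1 / 4 * (L z)\<^sup>2" by (simp add: power2_eq_square algebra_simps min_def)
    then have "ennreal (L z) \<le> ennreal (min 1 (L z) + 1 / 4 * (L z)\<^sup>2)" by (rule ennreal_leI)
    also have "\<dots> = ennreal (min 1 (L z)) + ennreal (1 / 4 * (L z)\<^sup>2)"
      using L(2)[of z] by (intro ennreal_plus) auto
    also have "ennreal (1 / 4 * (L z)\<^sup>2) = ennreal (1 / 4) * ennreal ((L z)\<^sup>2)" by (rule ennreal_mult) auto
    finally show "ennreal (L z) \<le> ennreal (min 1 (L z)) + ennreal (1 / 4) * ennreal ((L z)\<^sup>2)" .
  qed
  also have "\<dots> = (\<integral>\<^sup>+z. ennreal (min 1 (L z)) \<partial>P) + ennreal (1 / 4) * (\<integral>\<^sup>+z. ennreal ((L z)\<^sup>2) \<partial>P)"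
    by (subst nn_integral_add) (auto simp: nn_integral_cmult)
  also have "\<dots> \<le> (\<integral>\<^sup>+z. ennreal (min 1 (L z)) \<partial>P) + ennreal (1 / 4) * 2"
    by (intro add_left_mono mult_left_mono two) auto
  also have "ennreal (1 / 4) * 2 = ennreal (1 / 2)"
  proof -
    have "ennreal (1 / 4) * ennreal 2 = ennreal (1 / 4 * 2)" by (rule ennreal_mult[symmetric]) auto
    then show ?thesis by simp
  qed
  finally have aff: "1 \<le> (\<integral>\<^sup>+z. ennreal (min 1 (L z)) \<partial>P) + ennreal (1 / 2)" .
  have half: "ennreal (1 / 2) \<le> (\<integral>\<^sup>+z. ennreal (min 1 (L z)) \<partial>P)"
  proof (cases "(\<integral>\<^sup>+z. ennreal (min 1 (L z)) \<partial>P)")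
    case (real r)
    have "ennreal 1 \<le> ennreal (r + 1 / 2)" using aff unfolding real(2) using real(1) by (simp add: ennreal_plus)
    then have "1 / 2 \<le> r" using real(1) by (subst (asm) ennreal_le_iff) auto
    then show ?thesis unfolding real(2) by (rule ennreal_leI)
  qed simp
  have "ennreal (\<bar>\<theta>1 - \<theta>0\<bar> / 2) = ennreal \<bar>\<theta>1 - \<theta>0\<bar> * ennreal (1 / 2)" by (subst ennreal_mult[symmetric]) auto
  also have "\<dots> \<le> ennreal \<bar>\<theta>1 - \<theta>0\<bar> * (\<integral>\<^sup>+z. ennreal (min 1 (L z)) \<partial>P)" by (intro mult_left_mono half) auto
  also have "\<dots> = (\<integral>\<^sup>+z. ennreal \<bar>\<theta>1 - \<theta>0\<bar> * ennreal (min 1 (L z)) \<partial>P)" by (subst nn_integral_cmult) auto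
  also have "\<dots> \<le> (\<integral>\<^sup>+z. ennreal \<bar>T z - \<theta>0\<bar> + ennreal (L z) * ennreal \<bar>T z - \<theta>1\<bar> \<partial>P)"
  proof (rule nn_integral_mono)
    fix z
    \<comment> \<open>Where the laws overlap an estimate cannot be close to both values: the
      triangle inequality, weighted by min 1 L.\<close>
    have "min 1 (L z) * \<bar>\<theta>1 - \<theta>0\<bar> \<le> min 1 (L z) * (\<bar>T z - \<theta>0\<bar> + \<bar>T z - \<theta>1\<bar>)"
      using L(2)[of z] by (intro mult_left_mono) auto
    also have "\<dots> \<le> 1 * \<bar>T z - \<theta>0\<bar> + L z * \<bar>T z - \<theta>1\<bar>"
      unfolding distrib_left by (intro add_mono mult_right_mono) auto
    finally have "ennreal (\<bar>\<theta>1 - \<theta>0\<bar> * min 1 (L z)) \<le> ennreal (\<bar>T z - \<theta>0\<bar> + L z * \<bar>T z - \<theta>1\<bar>)"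
      by (intro ennreal_leI) (simp add: mult.commute)
    then show "ennreal \<bar>\<theta>1 - \<theta>0\<bar> * ennreal (min 1 (L z)) \<le> ennreal \<bar>T z - \<theta>0\<bar> + ennreal (L z) * ennreal \<bar>T z - \<theta>1\<bar>"
      using L(2)[of z] by (simp add: ennreal_mult ennreal_plus)
  qed
  also have "\<dots> = (\<integral>\<^sup>+z. ennreal \<bar>T z - \<theta>0\<bar> \<partial>P) + (\<integral>\<^sup>+z. ennreal (L z) * ennreal \<bar>T z - \<theta>1\<bar> \<partial>P)"
    by (subst nn_integral_add) auto
  also have "(\<integral>\<^sup>+z. ennreal (L z) * ennreal \<bar>T z - \<theta>1\<bar> \<partial>P) = (\<integral>\<^sup>+z. ennreal \<bar>T z - \<theta>1\<bar> \<partial>density P (\<lambda>z. ennreal (L z)))"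
    by (subst nn_integral_density) auto
  also have "(\<integral>\<^sup>+z. ennreal \<bar>T z - \<theta>0\<bar> \<partial>P) + \<dots> \<le> R + R" by (intro add_mono R0 R1)
  finally have fin: "ennreal (\<bar>\<theta>1 - \<theta>0\<bar> / 2) \<le> R + R" .
  show ?thesis
  proof (cases R)
    case (real r)
    have "ennreal (\<bar>\<theta>1 - \<theta>0\<bar> / 2) \<le> ennreal (r + r)"
      using fin unfolding real(2) ennreal_plus[OF real(1) real(1)] .
    then have "\<bar>\<theta>1 - \<theta>0\<bar> / 2 \<le> r + r" by (rule iffD1[OF ennreal_le_iff, rotated]) (use real(1) in simp)
    then have "\<bar>\<theta>1 - \<theta>0\<bar> / 4 \<le> r" by simp
    then show ?thesis unfolding real(2) by (rule ennreal_leI)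
  qed simp
qed

text \<open>One ratio \<open>l\<close> serves both marginals, so the joint ratio is a product of 2 n
  independent factors, each of second moment \<open>c\<close>.\<close>

lemma sample_law_density:
  fixes n :: nat and l :: "'a \<Rightarrow> real"
  assumes \<mu>: "prob_space \<mu>" and \<nu>: "prob_space \<nu>"
    and l: "l \<in> borel_measurable \<mu>" "l \<in> borel_measurable \<nu>" "\<And>x. 0 \<le> l x"
    and D: "prob_space (density \<mu> (\<lambda>x. ennreal (l x)))" "prob_space (density \<nu> (\<lambda>x. ennreal (l x)))"
    and two: "(\<integral>\<^sup>+x. ennreal ((l x)\<^sup>2) \<partial>\<mu>) = ennreal c" "(\<integral>\<^sup>+x. ennreal ((l x)\<^sup>2) \<partial>\<nu>) = ennreal c" and c: "0 \<le> c"
  defines "L \<equiv> \<lambda>z. (\<Prod>i=1..n. l (fst z i)) * (\<Prod>i=1..n. l (snd z i))"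
  shows "sample_law n (density \<mu> (\<lambda>x. ennreal (l x))) (density \<nu> (\<lambda>x. ennreal (l x))) =
      density (sample_law n \<mu> \<nu>) (\<lambda>z. ennreal (L z))"
    "L \<in> borel_measurable (sample_law n \<mu> \<nu>)"
    "(\<integral>\<^sup>+z. ennreal ((L z)\<^sup>2) \<partial>sample_law n \<mu> \<nu>) = ennreal (c ^ (2 * n))"
proof -
  let ?P = "\<Pi>\<^sub>M i\<in>{1..n}. \<mu>" and ?Q = "\<Pi>\<^sub>M i\<in>{1..n}. \<nu>"
  have P: "prob_space ?P" and Q: "prob_space ?Q" using \<mu> \<nu> by (auto intro: prob_space_PiM)
  interpret Q: prob_space ?Q by (rule Q)
  interpret M: prob_space \<mu> by (rule \<mu>)
  interpret N: prob_space \<nu> by (rule \<nu>)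
  interpret PM: product_sigma_finite "\<lambda>i::nat. \<mu>" by standard
  interpret PN: product_sigma_finite "\<lambda>i::nat. \<nu>" by standard
  have m1: "(\<lambda>x. \<Prod>i=1..n. l (x i)) \<in> borel_measurable ?P"
    by (intro borel_measurable_prod) (rule measurable_compose[OF measurable_component_singleton], assumption, rule l)
  have m2: "(\<lambda>x. \<Prod>i=1..n. l (x i)) \<in> borel_measurable ?Q"
    by (intro borel_measurable_prod) (rule measurable_compose[OF measurable_component_singleton], assumption, rule l)
  have dQ: "prob_space (\<Pi>\<^sub>M i\<in>{1..n}. density \<nu> (\<lambda>x. ennreal (l x)))" by (rule prob_space_PiM) (rule D(2))
  have d1: "(\<Pi>\<^sub>M i\<in>{1..n}. density \<mu> (\<lambda>x. ennreal (l x))) = density ?P (\<lambda>x. ennreal (\<Prod>i=1..n. l (x i)))"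
    using density_PiM[OF _ \<mu> _ D(1), of "{1..n}"] l by (simp add: prod_ennreal)
  have d2: "(\<Pi>\<^sub>M i\<in>{1..n}. density \<nu> (\<lambda>x. ennreal (l x))) = density ?Q (\<lambda>x. ennreal (\<Prod>i=1..n. l (x i)))"
    using density_PiM[OF _ \<nu> _ D(2), of "{1..n}"] l by (simp add: prod_ennreal)
  show "sample_law n (density \<mu> (\<lambda>x. ennreal (l x))) (density \<nu> (\<lambda>x. ennreal (l x))) =
      density (sample_law n \<mu> \<nu>) (\<lambda>z. ennreal (L z))"
  proof -
    have "sigma_finite_measure (density ?Q (\<lambda>x. ennreal (\<Prod>i=1..n. l (x i))))"
      using dQ unfolding d2 by (rule prob_space_imp_sigma_finite)
    then have "density ?P (\<lambda>x. ennreal (\<Prod>i=1..n. l (x i))) \<Otimes>\<^sub>M density ?Q (\<lambda>x. ennreal (\<Prod>i=1..n. l (x i)))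
      = density (?P \<Otimes>\<^sub>M ?Q) (\<lambda>(x, y). ennreal (\<Prod>i=1..n. l (x i)) * ennreal (\<Prod>i=1..n. l (y i)))"
      using m1 m2 by (intro pair_measure_density Q.sigma_finite_measure_axioms) auto
    then show ?thesis unfolding sample_law_def d1 d2 L_def
      by (simp add: case_prod_beta' ennreal_mult prod_nonneg l(3))
  qed
  have m1': "(\<lambda>z. \<Prod>i=1..n. l (fst z i)) \<in> borel_measurable (?P \<Otimes>\<^sub>M ?Q)" using measurable_compose[OF measurable_fst m1] .
  have m2': "(\<lambda>z. \<Prod>i=1..n. l (snd z i)) \<in> borel_measurable (?P \<Otimes>\<^sub>M ?Q)" using measurable_compose[OF measurable_snd m2] .
  show Lm: "L \<in> borel_measurable (sample_law n \<mu> \<nu>)"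
    unfolding L_def sample_law_def by (intro borel_measurable_times m1' m2')
  have sq: "(\<integral>\<^sup>+x. ennreal ((\<Prod>i=1..n. l (x i))\<^sup>2) \<partial>?P) = ennreal (c ^ n)"
    "(\<integral>\<^sup>+x. ennreal ((\<Prod>i=1..n. l (x i))\<^sup>2) \<partial>?Q) = ennreal (c ^ n)"
  proof -
    have e: "ennreal ((\<Prod>i=1..n. l (x i))\<^sup>2) = (\<Prod>i=1..n. ennreal ((l (x i))\<^sup>2))" for x
      by (simp add: prod_ennreal prod_power_distrib)
    show "(\<integral>\<^sup>+x. ennreal ((\<Prod>i=1..n. l (x i))\<^sup>2) \<partial>?P) = ennreal (c ^ n)"
      unfolding e using l c by (subst PM.product_nn_integral_prod) (auto simp: two ennreal_power)
    show "(\<integral>\<^sup>+x. ennreal ((\<Prod>i=1..n. l (x i))\<^sup>2) \<partial>?Q) = ennreal (c ^ n)"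
      unfolding e using l c by (subst PN.product_nn_integral_prod) (auto simp: two ennreal_power)
  qed
  have "(\<integral>\<^sup>+z. ennreal ((L z)\<^sup>2) \<partial>sample_law n \<mu> \<nu>) = (\<integral>\<^sup>+x. \<integral>\<^sup>+y. ennreal ((L (x, y))\<^sup>2) \<partial>?Q \<partial>?P)"
    unfolding sample_law_def using Lm[unfolded sample_law_def] by (subst Q.nn_integral_fst) auto
  also have "\<dots> = (\<integral>\<^sup>+x. \<integral>\<^sup>+y. ennreal ((\<Prod>i=1..n. l (x i))\<^sup>2) * ennreal ((\<Prod>i=1..n. l (y i))\<^sup>2) \<partial>?Q \<partial>?P)"
    unfolding L_def by (simp add: power_mult_distrib ennreal_mult)
  also have "\<dots> = (\<integral>\<^sup>+x. ennreal ((\<Prod>i=1..n. l (x i))\<^sup>2) * ennreal (c ^ n) \<partial>?P)"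
  proof (rule nn_integral_cong)
    fix x
    have "(\<lambda>y. ennreal ((\<Prod>i=1..n. l (y i))\<^sup>2)) \<in> borel_measurable ?Q" using m2 by measurable
    then show "(\<integral>\<^sup>+y. ennreal ((\<Prod>i=1..n. l (x i))\<^sup>2) * ennreal ((\<Prod>i=1..n. l (y i))\<^sup>2) \<partial>?Q) =
        ennreal ((\<Prod>i=1..n. l (x i))\<^sup>2) * ennreal (c ^ n)"
      unfolding sq(2)[symmetric] by (rule nn_integral_cmult)
  qed
  also have "\<dots> = ennreal (c ^ n) * ennreal (c ^ n)"
  proof -
    have "(\<lambda>y. ennreal ((\<Prod>i=1..n. l (y i))\<^sup>2)) \<in> borel_measurable ?P" using m1 by measurable
    from nn_integral_multc[OF this] show ?thesis unfolding sq(1) .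
  qed
  also have "\<dots> = ennreal (c ^ (2 * n))" using c by (simp add: ennreal_mult[symmetric] power_add[symmetric] mult_2)
  finally show "(\<integral>\<^sup>+z. ennreal ((L z)\<^sup>2) \<partial>sample_law n \<mu> \<nu>) = ennreal (c ^ (2 * n))" .
qed

lemma exp_half_le_2: "exp (1 / 2 :: real) \<le> 2"
proof (rule power2_le_imp_le)
  have "(exp (1 / 2 :: real))\<^sup>2 = exp 1" by (simp add: exp_double[symmetric])
  then show "(exp (1 / 2 :: real))\<^sup>2 \<le> 2\<^sup>2" using exp_le by simp
qed simp

text \<open>Both hypotheses share one density \<open>p\<close>, hence one function \<open>f_H2 p\<close>; only the mass \<open>\<lambda>\<close> that \<open>\<nu>\<close> puts
  outside the point where \<open>p = 1\<close> varies, and the squared Hellinger distance is linear in it.\<close>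

lemma minimax_lower_bound:
  assumes M: "1 < M"
  obtains \<kappa> where "0 < \<kappa>"
    "\<And>n. n \<ge> 1 \<Longrightarrow> ennreal (\<kappa> / sqrt (real n)) \<le> minimax_risk unit_cube (P2_H2_KB M (unit_cube :: (real ^ 'd) set)) n"
    "\<And>n. n \<ge> 1 \<Longrightarrow> ennreal (\<kappa> / sqrt (real n)) \<le> minimax_risk unit_cube (P2_H2_B M (unit_cube :: (real ^ 'd) set)) n"
proof -
  fix j :: 'd
  define R where "R = restrict_space borel (unit_cube :: (real ^ 'd) set)"
  \<comment> \<open>At these three points of one edge of the cube, cos (pi x_j) takes the values 1,
    0 and -1.\<close>
  define x0 :: "real ^ 'd" where "x0 = 0"
  define xm :: "real ^ 'd" where "xm = axis j (1 / 2)"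
  define x1 :: "real ^ 'd" where "x1 = axis j 1"
  define P where "P = {x0, xm, x1}"
  \<comment> \<open>The bound 1 / 20 keeps b pi^2 below 1, hence below \<open>M\<close>; the bound 1
    - 1 / sqrt M keeps \<open>p\<close> at most \<open>M\<close>.\<close>
  define b where "b = min (1 / 20) (1 - 1 / sqrt M)"
  define f :: "real ^ 'd \<Rightarrow> real" where "f x = b * cos (pi * x $ j)" for x
  \<comment> \<open>Obtained by solving \<open>f_H2 p\<close> = f for the density.\<close>
  define p where "p x = 1 / (1 - f x)\<^sup>2" for x
  \<comment> \<open>The solution of (1 - q) / (1 - b)^2 + q / (1 + b)^2 = 1, which gives
    \<open>\<mu>\<close> mass 1 for every share \<open>l\<close>.\<close>
  define q where "q = 1 / 2 + (3 * b - b ^ 3) / 4"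
  define W where "W l x = (if x = xm then 1 - l else if x = x0 then l * (1 - q) else l * q)" for l x
  define \<nu> where "\<nu> l = weighted_points P (W l) R" for l
  define \<mu> where "\<mu> l = weighted_points P (\<lambda>x. W l x * p x) R" for l
  have comp: "x0 $ j = 0" "xm $ j = 1 / 2" "x1 $ j = 1" unfolding x0_def xm_def x1_def by simp_all
  have dist: "x0 \<noteq> xm" "x0 \<noteq> x1" "xm \<noteq> x1" using comp by auto
  have spR: "space R = unit_cube" unfolding R_def by (simp add: space_restrict_space)
  have P: "finite P" "P \<subseteq> space R" unfolding spR P_def x0_def xm_def x1_def by (auto simp: axis_def)
  have sumP: "(\<Sum>x\<in>P. g x) = g x0 + g xm + g x1" for g :: "real ^ 'd \<Rightarrow> real" unfolding P_def using dist by simp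
  have sM: "1 < sqrt M" using M by simp
  have b: "0 < b" "b \<le> 1 / 20" "b \<le> 1 - 1 / sqrt M" 
    unfolding b_def using sM by (simp, simp only: min.cobounded1, simp only: min.cobounded2)
  have fb: "\<bar>f x\<bar> \<le> b" for x
    using b(1) abs_cos_le_one[of "pi * x $ j"] unfolding f_def abs_mult by (simp add: mult_left_le)
  have f1: "0 < 1 - f x" for x using fb[of x] b(2) by (auto simp: abs_le_iff)
  have fP: "f x0 = b" "f xm = 0" "f x1 = - b" unfolding f_def comp by (simp_all)
  have pP: "p x0 = 1 / (1 - b)\<^sup>2" "p xm = 1" "p x1 = 1 / (1 + b)\<^sup>2" unfolding p_def fP by simp_all
  have ppos: "0 < p x" for x unfolding p_def using f1[of x] by simp
  have pM: "p x \<le> M" for x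
  proof -
    have "1 / sqrt M \<le> 1 - f x" using fb[of x] b(3) by (auto simp: abs_le_iff)
    then have "(1 / sqrt M)\<^sup>2 \<le> (1 - f x)\<^sup>2" using sM by (intro power_mono) auto
    then have "1 / M \<le> (1 - f x)\<^sup>2" using M by (simp add: power_divide)
    then show ?thesis unfolding p_def using M f1[of x] by (simp add: field_simps)
  qed
  have fH: "f_H2 p x = f x" for x
  proof -
    have "p x powr (- 1 / 2) = (1 - f x)"
    proof -
      have "p x = (1 - f x) powr (- 2)" unfolding p_def using f1[of x] by (simp add: powr_minus powr_numeral inverse_eq_divide)
      then show ?thesis using f1[of x] by (simp add: powr_powr)
    qed
    then show ?thesis unfolding f_H2_def by simp
  qed
  have b3: "0 < b ^ 3" "b ^ 3 \<le> b" using b by (simp, simp add: power3_eq_cube mult_le_one mult_left_le)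
  have q: "0 < q" "q < 1"
  proof -
    have "4 * q = 2 + (3 * b - b ^ 3)" unfolding q_def by simp
    then show "0 < q" "q < 1" using b(1,2) b3 by linarith+
  qed
  have qid: "(1 - q) * p x0 + q * p x1 = 1"
  proof -
    have ne: "(1 - b)\<^sup>2 \<noteq> 0" "(1 + b)\<^sup>2 \<noteq> 0" using b by auto
    have "(1 - q) * (1 + b)\<^sup>2 + q * (1 - b)\<^sup>2 = (1 - b)\<^sup>2 * (1 + b)\<^sup>2"
    proof -
      have q4: "4 * q = 2 + 3 * b - b ^ 3" unfolding q_def by simp
      have "(1 - q) * (1 + b)\<^sup>2 + q * (1 - b)\<^sup>2 = (1 + b)\<^sup>2 - b * (4 * q)"
        by (simp add: power2_eq_square algebra_simps)
      also have "\<dots> = (1 - b)\<^sup>2 * (1 + b)\<^sup>2"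
        unfolding q4 by (simp add: power2_eq_square power3_eq_cube algebra_simps)
      finally show ?thesis .
    qed
    then show ?thesis unfolding pP using ne by (simp add: field_simps)
  qed
  have W0: "0 \<le> W l x" if "0 \<le> l" "l \<le> 1" for l x unfolding W_def using that q by auto
  have Wsum: "(\<Sum>x\<in>P. W l x) = 1" for l unfolding sumP W_def using dist by (simp add: algebra_simps)
  have Wpsum: "(\<Sum>x\<in>P. W l x * p x) = 1" for l
  proof -
    have "(\<Sum>x\<in>P. W l x * p x) = l * ((1 - q) * p x0 + q * p x1) + (1 - l) * p xm"
      unfolding sumP W_def using dist by (simp add: algebra_simps)
    then show ?thesis unfolding qid by (simp add: pP(2))
  qed
  have fcont: "continuous_on UNIV f" unfolding f_def by (intro continuous_intros)
  have "continuous_on UNIV p" unfolding p_def by (intro continuous_intros fcont) (use f1 in \<open>metis less_irrefl power_not_zero\<close>)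
  then have pm: "p \<in> borel_measurable R" unfolding R_def
    by (intro measurable_restrict_space1 borel_measurable_continuous_onI)
  have prob\<nu>: "prob_space (\<nu> l)" if "0 \<le> l" "l \<le> 1" for l
    unfolding \<nu>_def by (rule prob_weighted_points[OF P W0[OF that] Wsum])
  have prob\<mu>: "prob_space (\<mu> l)" if "0 \<le> l" "l \<le> 1" for l
    unfolding \<mu>_def by (rule prob_weighted_points[OF P _ Wpsum]) (use W0[OF that] ppos in \<open>simp add: less_imp_le\<close>)
  have dens: "\<mu> l = density (\<nu> l) (\<lambda>x. ennreal (p x))" if "0 \<le> l" "l \<le> 1" for l
    unfolding \<mu>_def \<nu>_def by (rule density_weighted_points[OF P W0[OF that] pm, symmetric]) simp
  have pm\<nu>: "p \<in> borel_measurable (\<nu> l)" for l unfolding \<nu>_def using pm by simp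
  have inP: "(\<mu> l, \<nu> l) \<in> P2_H2 unit_cube" and dv: "density_version unit_cube (\<mu> l) (\<nu> l) p" if l: "0 \<le> l" "l \<le> 1" for l
  proof -
    have "absolutely_continuous (\<nu> l) (\<mu> l)"
      unfolding dens[OF l] using pm\<nu> by (intro absolutely_continuousI_density) auto
    then show "(\<mu> l, \<nu> l) \<in> P2_H2 unit_cube"
      unfolding P2_H2_def borel_prob_on_def using prob\<mu>[OF l] prob\<nu>[OF l] by (auto simp: \<mu>_def \<nu>_def R_def)
    interpret prob_space "\<nu> l" by (rule prob\<nu>[OF l])
    have "AE x in \<nu> l. ennreal (p x) = RN_deriv (\<nu> l) (\<mu> l) x"
      by (rule RN_deriv_unique) (use pm\<nu> dens[OF l] in auto)
    then show "density_version unit_cube (\<mu> l) (\<nu> l) p"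
      unfolding density_version_def using pm ppos by (auto simp: R_def elim!: eventually_mono)
  qed
  have pi2: "b * pi\<^sup>2 \<le> M"
  proof -
    have "pi\<^sup>2 \<le> 4\<^sup>2" using pi_less_4 pi_ge_zero by (intro power_mono) auto
    then have "b * pi\<^sup>2 \<le> 1 / 20 * 4\<^sup>2" using b by (intro mult_mono) auto
    then show ?thesis using M by simp
  qed
  have coef: "c_KB (f_H2 p) (unit_cube :: (real ^ 'd) set) \<le> ereal M" "c_B (f_H2 p) (unit_cube :: (real ^ 'd) set) \<le> ereal M"
    using cosine_coefficients[OF b(1) pi2, of "f_H2 p" j] by (simp_all add: fH f_def)
  have ess: "esssup (\<nu> l) (\<lambda>x. ereal (p x)) \<le> ereal M" for l
    by (rule esssup_I) (use pm\<nu> pM in auto)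
  have mem: "(\<mu> l, \<nu> l) \<in> P2_H2_KB M unit_cube" "(\<mu> l, \<nu> l) \<in> P2_H2_B M unit_cube" if "0 \<le> l" "l \<le> 1" for l
    unfolding P2_H2_KB_def P2_H2_B_def using inP[OF that] dv[OF that] coef ess by (auto simp: max_def)
  define h where "h = (1 - q) * (sqrt (p x0) - 1)\<^sup>2 + q * (sqrt (p x1) - 1)\<^sup>2"
  have hell: "hellinger2 (\<mu> l) (\<nu> l) = l * h" if l: "0 \<le> l" "l \<le> 1" for l
  proof -
    have "hellinger2 (\<mu> l) (\<nu> l) = (\<integral>x. (sqrt (p x) - 1)\<^sup>2 \<partial>\<nu> l)"
      by (rule density_versionD(5)[OF inP[OF l] dv[OF l]])
    also have "\<dots> = (\<Sum>x\<in>P. W l x *\<^sub>R (sqrt (p x) - 1)\<^sup>2)"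
      unfolding \<nu>_def
      by (intro integral_weighted_points[OF P W0[OF l]] borel_measurable_power borel_measurable_diff
          borel_measurable_const measurable_compose[OF pm borel_measurable_sqrt])
    also have "\<dots> = l * h" unfolding h_def sumP W_def using dist pP(2) by (simp add: algebra_simps)
    finally show ?thesis .
  qed
  have h: "0 < h"
  proof -
    have "p x0 \<noteq> 1"
    proof
      assume "p x0 = 1"
      then have "(1 - b)\<^sup>2 = 1" unfolding pP using b by (simp add: field_simps)
      then show False using b by (simp add: power2_eq_1_iff)
    qed
    then have "sqrt (p x0) - 1 \<noteq> 0" by simp
    then show ?thesis unfolding h_def using q by (intro add_pos_nonneg mult_pos_pos) auto
  qed
  have bound: "ennreal (h / 16 / sqrt (real n)) \<le> minimax_risk unit_cube Q n"
    if n: "n \<ge> 1" and Q: "\<And>l. 0 \<le> l \<Longrightarrow> l \<le> 1 \<Longrightarrow> (\<mu> l, \<nu> l) \<in> Q" for n :: nat and Q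
    unfolding minimax_risk_def
  proof (rule INF_greatest)
    fix T assume T: "T \<in> estimators (unit_cube :: (real ^ 'd) set) n"
    \<comment> \<open>With this shift the second moment of the likelihood ratio stays bounded: (1 +
      4 d^2)^(2 n) \<le> exp (8 n d^2) = exp (1 / 2) \<le> 2.\<close>
    define d where "d = 1 / (4 * sqrt (real n))"
    have d: "0 < d" "d \<le> 1 / 4" "4 * d\<^sup>2 = 1 / (4 * real n)"
      unfolding d_def using n by (auto simp: power_divide power_mult_distrib field_simps)
    \<comment> \<open>The ratio of the weights for the shares 1 / 2 + d and 1 / 2. It is the same
      for \<open>\<mu>\<close> and \<open>\<nu>\<close>, since the common factor \<open>p\<close>
      cancels.\<close>
    define r where "r x = (if x = xm then 1 - 2 * d else 1 + 2 * d)" for x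
    define \<mu>0 where "\<mu>0 = \<mu> (1 / 2)"
    define \<nu>0 where "\<nu>0 = \<nu> (1 / 2)"
    define \<mu>1 where "\<mu>1 = \<mu> (1 / 2 + d)"
    define \<nu>1 where "\<nu>1 = \<nu> (1 / 2 + d)"
    have half: "0 \<le> (1 / 2 :: real)" "1 / 2 \<le> (1 :: real)" "0 \<le> 1 / 2 + d" "1 / 2 + d \<le> 1" using d by auto
    have r0: "0 \<le> r x" for x unfolding r_def using d by auto
    have rm: "r \<in> borel_measurable R" unfolding R_def r_def
      by (intro measurable_restrict_space1) measurable
    have W1: "W (1 / 2 + d) x = W (1 / 2) x * r x" for x unfolding W_def r_def by (simp add: field_simps)
    have dens\<nu>: "density \<nu>0 (\<lambda>x. ennreal (r x)) = \<nu>1"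
      unfolding \<nu>0_def \<nu>1_def \<nu>_def by (rule density_weighted_points[OF P W0[OF half(1,2)] rm]) (rule W1)
    have dens\<mu>: "density \<mu>0 (\<lambda>x. ennreal (r x)) = \<mu>1"
      unfolding \<mu>0_def \<mu>1_def \<mu>_def
      by (rule density_weighted_points[OF P _ rm]) (use W0[OF half(1,2)] ppos in \<open>auto simp: W1 less_imp_le\<close>)
    have pr: "prob_space \<mu>0" "prob_space \<nu>0" "prob_space \<mu>1" "prob_space \<nu>1"
      unfolding \<mu>0_def \<nu>0_def \<mu>1_def \<nu>1_def using prob\<mu> prob\<nu> half by auto
    \<comment> \<open>Applies to \<open>\<nu>\<close> and to \<open>\<mu>\<close>: as p = 1 at
      \<open>xm\<close>, both give this point mass 1 / 2, and the mean of (1 + 2 d)^2 and (1 - 2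
      d)^2 is 1 + 4 d^2.\<close>
    have sq: "(\<integral>\<^sup>+x. ennreal ((r x)\<^sup>2) \<partial>weighted_points P u R) = ennreal (1 + 4 * d\<^sup>2)"
      if u: "\<And>x. 0 \<le> u x" "(\<Sum>x\<in>P. u x) = 1" "u xm = 1 / 2" for u
    proof -
      have "(\<integral>\<^sup>+x. ennreal ((r x)\<^sup>2) \<partial>weighted_points P u R) = (\<Sum>x\<in>P. ennreal (u x) * ennreal ((r x)\<^sup>2))"
        using rm by (intro nn_integral_weighted_points[OF P]) measurable
      also have "\<dots> = ennreal (\<Sum>x\<in>P. u x * (r x)\<^sup>2)"
        using u(1) by (subst sum_ennreal[symmetric]) (auto simp: ennreal_mult)
      also have "(\<Sum>x\<in>P. u x * (r x)\<^sup>2) = 1 + 4 * d\<^sup>2"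
      proof -
        have "u x0 + u x1 = 1 / 2" using u(2,3) unfolding sumP by simp
        have rP: "r x0 = 1 + 2 * d" "r xm = 1 - 2 * d" "r x1 = 1 + 2 * d" unfolding r_def using dist by auto
        have "(\<Sum>x\<in>P. u x * (r x)\<^sup>2) = (u x0 + u x1) * (1 + 2 * d)\<^sup>2 + 1 / 2 * (1 - 2 * d)\<^sup>2"
          unfolding sumP rP u(3) by (simp only: distrib_right add_ac)
        then show ?thesis unfolding \<open>u x0 + u x1 = 1 / 2\<close> by (simp add: power2_eq_square algebra_simps)
      qed
      finally show ?thesis .
    qed
    have sq\<nu>: "(\<integral>\<^sup>+x. ennreal ((r x)\<^sup>2) \<partial>\<nu>0) = ennreal (1 + 4 * d\<^sup>2)"
      unfolding \<nu>0_def \<nu>_def by (rule sq[OF W0[OF half(1,2)] Wsum]) (simp add: W_def)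
    have sq\<mu>: "(\<integral>\<^sup>+x. ennreal ((r x)\<^sup>2) \<partial>\<mu>0) = ennreal (1 + 4 * d\<^sup>2)"
      unfolding \<mu>0_def \<mu>_def
      by (rule sq[OF _ Wpsum]) (use W0[OF half(1,2)] ppos in \<open>auto simp: W_def pP less_imp_le\<close>)
    have rm0: "r \<in> borel_measurable \<mu>0" "r \<in> borel_measurable \<nu>0"
      unfolding \<mu>0_def \<nu>0_def \<mu>_def \<nu>_def using rm by simp_all
    define L where "L z = (\<Prod>i=1..n. r (fst z i)) * (\<Prod>i=1..n. r (snd z i))" for z
    have c0: "0 \<le> 1 + 4 * d\<^sup>2" by (intro add_nonneg_nonneg) auto
    note SL = sample_law_density[OF pr(1,2) rm0 r0 pr(3,4)[folded dens\<mu> dens\<nu>] sq\<mu> sq\<nu> c0, where n = n, folded L_def, unfolded dens\<mu> dens\<nu>]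
    have PP: "prob_space (sample_law n a c)" if "prob_space a" "prob_space c" for a c :: "(real ^ 'd) measure"
      unfolding sample_law_def using that by (intro prob_space_pair prob_space_PiM)
    interpret P1: prob_space "sample_law n \<mu>1 \<nu>1" by (rule PP[OF pr(3,4)])
    have one: "(\<integral>\<^sup>+z. ennreal (L z) \<partial>sample_law n \<mu>0 \<nu>0) = 1"
    proof -
      have "1 = emeasure (sample_law n \<mu>1 \<nu>1) (space (sample_law n \<mu>1 \<nu>1))" by (simp add: P1.emeasure_space_1)
      also have "\<dots> = (\<integral>\<^sup>+z. ennreal (L z) \<partial>sample_law n \<mu>0 \<nu>0)"
        unfolding SL(1) using SL(2) by (simp add: emeasure_density cong: nn_integral_cong)
      finally show ?thesis ..
    qed
    have two: "(\<integral>\<^sup>+z. ennreal ((L z)\<^sup>2) \<partial>sample_law n \<mu>0 \<nu>0) \<le> 2"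
    proof -
      have "(1 + 4 * d\<^sup>2) ^ (2 * n) \<le> exp (4 * d\<^sup>2) ^ (2 * n)"
        using c0 exp_ge_add_one_self[of "4 * d\<^sup>2"] by (intro power_mono) auto
      also have "\<dots> = exp (real (2 * n) * (4 * d\<^sup>2))" by (simp only: exp_of_nat_mult)
      also have "real (2 * n) * (4 * d\<^sup>2) = 1 / 2" unfolding d(3) using n by simp
      also have "exp (1 / 2 :: real) \<le> 2" by (rule exp_half_le_2)
      finally have "ennreal ((1 + 4 * d\<^sup>2) ^ (2 * n)) \<le> ennreal 2" by (rule ennreal_leI)
      then show ?thesis unfolding SL(3) by simp
    qed
    have "sets (\<Pi>\<^sub>M i\<in>{1..n}. \<mu>0) = sets (\<Pi>\<^sub>M i\<in>{1..n}. R)" "sets (\<Pi>\<^sub>M i\<in>{1..n}. \<nu>0) = sets (\<Pi>\<^sub>M i\<in>{1..n}. R)"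
      by (intro sets_PiM_cong refl; simp add: \<mu>0_def \<nu>0_def \<mu>_def \<nu>_def)+
    then have sets0: "sets (sample_law n \<mu>0 \<nu>0) = sets ((\<Pi>\<^sub>M i\<in>{1..n}. R) \<Otimes>\<^sub>M (\<Pi>\<^sub>M i\<in>{1..n}. R))"
      unfolding sample_law_def by (intro sets_pair_measure_cong)
    have Tm: "T \<in> borel_measurable (sample_law n \<mu>0 \<nu>0)"
      unfolding measurable_cong_sets[OF sets0 refl] using T unfolding estimators_def R_def .
    have R0: "(\<integral>\<^sup>+z. ennreal \<bar>T z - 1 / 2 * h\<bar> \<partial>sample_law n \<mu>0 \<nu>0) \<le> risk Q n T"
      unfolding risk_def using Q[OF half(1,2)] hell[OF half(1,2)]
      by (intro SUP_upper2[of "(\<mu>0, \<nu>0)"]) (auto simp: \<mu>0_def \<nu>0_def)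
    have R1: "(\<integral>\<^sup>+z. ennreal \<bar>T z - (1 / 2 + d) * h\<bar> \<partial>density (sample_law n \<mu>0 \<nu>0) (\<lambda>z. ennreal (L z))) \<le> risk Q n T"
      unfolding risk_def SL(1)[symmetric] using Q[OF half(3,4)] hell[OF half(3,4)]
      by (intro SUP_upper2[of "(\<mu>1, \<nu>1)"]) (auto simp: \<mu>1_def \<nu>1_def)
    have L0: "0 \<le> L z" for z unfolding L_def using r0 by (intro mult_nonneg_nonneg prod_nonneg) auto
    have "ennreal (\<bar>(1 / 2 + d) * h - 1 / 2 * h\<bar> / 4) \<le> risk Q n T"
      by (rule two_point_bound[OF PP[OF pr(1,2)] SL(2) L0 one two Tm R0 R1])
    \<comment> \<open>The distances differ by d h = h / (4 sqrt n), and the two-point bound takes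
      another factor 1 / 4.\<close>
    moreover have "\<bar>(1 / 2 + d) * h - 1 / 2 * h\<bar> / 4 = h / 16 / sqrt (real n)"
      using h d(1) n by (simp add: algebra_simps abs_mult) (simp add: d_def field_simps)
    ultimately show "ennreal (h / 16 / sqrt (real n)) \<le> risk Q n T" by simp
  qed
  show ?thesis
    by (rule that[of "h / 16"]) (use h bound mem in auto)
qed

section \<open>Orders of growth and rate optimality\<close>

lemma root_rate_eq: "n \<ge> 1 \<Longrightarrow> root_rate n = ennreal (1 / sqrt (real n))"
proof -
  assume n: "n \<ge> 1"
  have e: "- 1 / 2 = - (1 / 2 :: real)" by simp
  show "root_rate n = ennreal (1 / sqrt (real n))"
    unfolding root_rate_def e powr_minus by (simp add: powr_half_sqrt inverse_eq_divide)
qed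

lemma risk_empty: "risk {} n T = 0"
  unfolding risk_def by (simp add: bot_ennreal)

lemma order_leI_root_rate:
  assumes "\<forall>\<^sub>F n in sequentially. r n \<le> ennreal (C / sqrt (real n))"
  shows "order_le r root_rate"
  unfolding order_le_def
proof (rule exI[of _ "max 0 C"])
  show "\<forall>\<^sub>F n in sequentially. r n \<le> ennreal (max 0 C) * root_rate n"
    using assms eventually_ge_at_top[of 1]
  proof eventually_elim
    case (elim n)
    have "ennreal (C / sqrt n) \<le> ennreal (max 0 C * (1 / sqrt n))"
      by (intro ennreal_leI) (simp add: divide_right_mono)
    also have "\<dots> = ennreal (max 0 C) * root_rate n" unfolding root_rate_eq[OF elim(2)] by (rule ennreal_mult) auto
    finally show ?case using elim(1) by (rule order_trans[rotated])
  qed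
qed

lemma order_leI_lower:
  assumes k: "0 < \<kappa>" and r: "\<And>n. n \<ge> 1 \<Longrightarrow> ennreal (\<kappa> / sqrt (real n)) \<le> r n"
  shows "order_le root_rate r"
  unfolding order_le_def
proof (rule exI[of _ "1 / \<kappa>"])
  show "\<forall>\<^sub>F n in sequentially. root_rate n \<le> ennreal (1 / \<kappa>) * r n"
    using eventually_ge_at_top[of 1]
  proof eventually_elim
    case (elim n)
    have "root_rate n = ennreal (1 / \<kappa> * (\<kappa> / sqrt n))" unfolding root_rate_eq[OF elim] using k by simp
    also have "\<dots> = ennreal (1 / \<kappa>) * ennreal (\<kappa> / sqrt n)" using k by (intro ennreal_mult) auto
    also have "\<dots> \<le> ennreal (1 / \<kappa>) * r n" by (intro mult_left_mono r elim) auto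
    finally show ?case .
  qed
qed

text \<open>Constants in \<open>order_le\<close> may be negative and are then read as 0 by
  \<open>ennreal\<close>; taking maxima with 0 makes them multiply correctly.\<close>

lemma order_le_trans:
  assumes "order_le r s" "order_le s u"
  shows "order_le r u"
proof -
  obtain C D where C: "\<forall>\<^sub>F n in sequentially. r n \<le> ennreal C * s n" and D: "\<forall>\<^sub>F n in sequentially. s n \<le> ennreal D * u n"
    using assms unfolding order_le_def by auto
  have "\<forall>\<^sub>F n in sequentially. r n \<le> ennreal (max 0 C * max 0 D) * u n"
    using C D
  proof eventually_elim
    case (elim n)
    have "r n \<le> ennreal (max 0 C) * (ennreal (max 0 D) * u n)"
      by (rule order_trans[OF elim(1)], rule mult_mono, simp add: ennreal_leI, rule order_trans[OF elim(2)], rule mult_right_mono)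
        (auto intro: ennreal_leI)
    then show ?case by (simp add: ennreal_mult mult.assoc)
  qed
  then show ?thesis unfolding order_le_def by blast
qed

lemma minimax_le_risk: "T \<in> estimators X n \<Longrightarrow> minimax_risk X Q n \<le> risk Q n T"
  unfolding minimax_risk_def by (rule INF_lower)

text \<open>The case \<open>M < 1\<close> is degenerate (the class is empty); for \<open>M = 1\<close> it only contains pairs with
  \<open>\<mu> = \<nu>\<close>.\<close>

lemma rate_optimality:
  fixes M C :: real
  assumes meas: "\<forall>\<^sub>F n in sequentially. T n \<in> estimators X n"
    and empty: "M < 1 \<Longrightarrow> Q = {}"
    and upper: "1 \<le> M \<Longrightarrow> \<forall>\<^sub>F n in sequentially. risk Q n (T n) \<le> ennreal (C / sqrt (real n))"
    and lower: "1 < M \<Longrightarrow> order_le root_rate (minimax_risk X Q)"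
  shows "M \<noteq> 1 \<longrightarrow> minimax_rate_optimal X Q T" "M > 1 \<longrightarrow> same_order (minimax_risk X Q) root_rate"
    "achieves_O X Q T root_rate"
proof -
  \<comment> \<open>A measurable estimator competes in the infimum, so this half of the comparison
    holds for every \<open>M\<close>.\<close>
  have mr: "order_le (minimax_risk X Q) (\<lambda>n. risk Q n (T n))"
    unfolding order_le_def
    by (rule exI[of _ 1], rule eventually_mono[OF meas]) (simp add: minimax_le_risk)
  have zero: "order_le (\<lambda>n. risk Q n (T n)) s" if "M < 1" for s
    unfolding order_le_def empty[OF that] risk_empty by simp
  have up: "order_le (\<lambda>n. risk Q n (T n)) root_rate"
  proof (cases "M < 1")
    case False
    then show ?thesis by (intro order_leI_root_rate[OF upper]) simp
  qed (rule zero)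
  show "M \<noteq> 1 \<longrightarrow> minimax_rate_optimal X Q T"
    unfolding minimax_rate_optimal_def same_order_def
    using meas mr zero order_le_trans[OF up lower] by (cases "M < 1") auto
  show "M > 1 \<longrightarrow> same_order (minimax_risk X Q) root_rate"
    unfolding same_order_def using order_le_trans[OF mr up] lower by simp
  show "achieves_O X Q T root_rate" unfolding achieves_O_def using meas up by simp
qed

lemma relu_estimator:
  assumes "0 < t" "0 \<le> a" "n \<ge> 1"
  shows "neural_H2 n (relu_class n t a) \<in> estimators (X :: (real ^ 'd) set) n"
  unfolding estimators_def relu_class_def
proof (rule neural_H2_measurable)
  show "continuous_on UNIV phi_R" unfolding phi_R_def by (intro continuous_intros)
qed (use assms in auto)

lemma sigmoid_estimator:
  assumes "0 < t" "0 \<le> a" "n \<ge> 1"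
  shows "neural_H2 n (sigmoid_class n t a) \<in> estimators (X :: (real ^ 'd) set) n"
  unfolding estimators_def sigmoid_class_def
  by (rule neural_H2_measurable) (use assms phi_S_continuous in auto)

lemma ln_eventually_ge: "\<forall>\<^sub>F n in sequentially. c \<le> ln (real n)"
proof -
  have "filterlim (\<lambda>n. ln (real n)) at_top sequentially"
    by (rule filterlim_compose[OF ln_at_top filterlim_real_sequentially])
  then show ?thesis unfolding filterlim_at_top by blast
qed

text \<open>From the moment when ln n exceeds 1, \<open>M\<close> and sqrt M, the logarithmic
  choices satisfy the hypotheses of the risk bounds.\<close>

lemma log_parameters:
  fixes M l :: real
  assumes M: "0 < M" and l: "max 1 (max M (M powr (1 / 2))) \<le> l"
  shows "M \<le> l" "0 < inverse l" "inverse l \<le> M powr (- 1 / 2)" "inverse l \<le> 1" "1 \<le> l"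
proof -
  show "M \<le> l" "0 < inverse l" "inverse l \<le> 1" "1 \<le> l" using l by (auto simp: inverse_le_1_iff)
  have e: "- 1 / 2 = - (1 / 2 :: real)" by simp
  show "inverse l \<le> M powr (- 1 / 2)"
    unfolding e powr_minus using l M by (intro le_imp_inverse_le) auto
qed

text \<open>The power is (ln n)^4: two factors from the size of the network and two from the
  truncation level.\<close>

lemma order_le_logI:
  assumes "\<forall>\<^sub>F n in sequentially. r n \<le> ennreal (C * ((ln (real n))\<^sup>2 * (1 / inverse (ln (real n)))\<^sup>2) / sqrt (real n))"
  shows "order_le_log r root_rate"
  unfolding order_le_log_def
proof (rule exI[of _ C], rule exI[of _ 4])
  show "\<forall>\<^sub>F n in sequentially. r n \<le> ennreal (C * ln (real n) ^ 4) * root_rate n"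
    using assms eventually_ge_at_top[of 1]
  proof eventually_elim
    case (elim n)
    have "C * ((ln (real n))\<^sup>2 * (1 / inverse (ln (real n)))\<^sup>2) / sqrt (real n) = C * ln (real n) ^ 4 * (1 / sqrt n)"
      by (simp add: power_add[symmetric] inverse_eq_divide)
    also have "ennreal \<dots> = ennreal (C * ln (real n) ^ 4) * root_rate n"
      unfolding root_rate_eq[OF elim(2)] by (rule ennreal_mult'') simp
    finally show ?case using elim(1) by simp
  qed
qed

text \<open>At M = 1 every pair has distance 0, so the zero estimator has zero risk, and an
  estimator with positive risk cannot be of the same order; there only the rate is claimed. For M <
  1 all risks are 0, which is consistent with optimality but not with a minimax risk of exact order
  n^(-1/2).\<close>

theorem corollary29:
  fixes X :: "(real ^ 'd) set" and M :: real
  assumes X: "X = {x. \<forall>j. 0 \<le> x $ j \<and> x $ j \<le> 1}"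
    and M: "M > 0"
  shows
    "(M \<noteq> 1 \<longrightarrow> minimax_rate_optimal X (P2_H2_KB M X)
        (\<lambda>n. neural_H2 n (relu_class n (M powr (- 1 / 2)) M))) \<and>
     (M > 1 \<longrightarrow> same_order (minimax_risk X (P2_H2_KB M X)) root_rate) \<and>
     achieves_O X (P2_H2_KB M X)
        (\<lambda>n. neural_H2 n (relu_class n (M powr (- 1 / 2)) M)) root_rate \<and>
     (M \<noteq> 1 \<longrightarrow> minimax_rate_optimal X (P2_H2_B M X)
        (\<lambda>n. neural_H2 n (sigmoid_class n (M powr (- 1 / 2)) M))) \<and>
     (M > 1 \<longrightarrow> same_order (minimax_risk X (P2_H2_B M X)) root_rate) \<and>
     achieves_O X (P2_H2_B M X)
        (\<lambda>n. neural_H2 n (sigmoid_class n (M powr (- 1 / 2)) M)) root_rate \<and>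
     achieves_O_log X (P2_H2_KB M X)
        (\<lambda>n. neural_H2 n (relu_class n (inverse (ln (real n))) (ln (real n)))) root_rate \<and>
     achieves_O_log X (P2_H2_B M X)
        (\<lambda>n. neural_H2 n (sigmoid_class n (inverse (ln (real n))) (ln (real n)))) root_rate"
proof -
  let ?t = "M powr (- 1 / 2)"
  let ?l = "\<lambda>n::nat. ln (real n)"
  let ?C = "2 * upper_const CARD('d) * (M\<^sup>2 * (1 / ?t)\<^sup>2)"
  have t: "0 < ?t" using M by simp
  have t1: "?t \<le> 1" if "1 \<le> M"
    using powr_mono2'[of "- 1 / 2" 1 M] that by simp
  have big: "\<forall>\<^sub>F n in sequentially. 1 \<le> n \<and> max 1 (max M (M powr (1 / 2))) \<le> ?l n"
    using eventually_ge_at_top[of 1] ln_eventually_ge by (rule eventually_conj)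
  have lowKB: "order_le root_rate (minimax_risk X (P2_H2_KB M X))" and
    lowB: "order_le root_rate (minimax_risk X (P2_H2_B M X))" if M1: "1 < M"
  proof -
    obtain \<kappa> where \<kappa>: "0 < \<kappa>"
      "\<And>n. n \<ge> 1 \<Longrightarrow> ennreal (\<kappa> / sqrt (real n)) \<le> minimax_risk unit_cube (P2_H2_KB M (unit_cube :: (real ^ 'd) set)) n"
      "\<And>n. n \<ge> 1 \<Longrightarrow> ennreal (\<kappa> / sqrt (real n)) \<le> minimax_risk unit_cube (P2_H2_B M (unit_cube :: (real ^ 'd) set)) n"
      by (rule minimax_lower_bound[OF M1]) (rule that)
    show "order_le root_rate (minimax_risk X (P2_H2_KB M X))"
      unfolding X by (rule order_leI_lower[OF \<kappa>(1,2)])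
    show "order_le root_rate (minimax_risk X (P2_H2_B M X))"
      unfolding X by (rule order_leI_lower[OF \<kappa>(1,3)])
  qed
  have empty: "P2_H2_KB M X = {}" "P2_H2_B M X = {}" if "M < 1"
    unfolding X by (rule class_empty[OF that])+
  have measR: "\<forall>\<^sub>F n in sequentially. neural_H2 n (relu_class n ?t M) \<in> estimators X n"
    using eventually_ge_at_top[of 1] by eventually_elim (use M t in \<open>auto intro: relu_estimator\<close>)
  have measS: "\<forall>\<^sub>F n in sequentially. neural_H2 n (sigmoid_class n ?t M) \<in> estimators X n"
    using eventually_ge_at_top[of 1] by eventually_elim (use M t in \<open>auto intro: sigmoid_estimator\<close>)
  have upR: "\<forall>\<^sub>F n in sequentially. risk (P2_H2_KB M X) n (neural_H2 n (relu_class n ?t M)) \<le> ennreal (?C / sqrt (real n))"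
    if "1 \<le> M"
    using eventually_ge_at_top[of 1] unfolding X
    by eventually_elim (rule relu_risk[OF M order_refl t order_refl t1[OF that]])
  have upS: "\<forall>\<^sub>F n in sequentially. risk (P2_H2_B M X) n (neural_H2 n (sigmoid_class n ?t M)) \<le> ennreal (?C / sqrt (real n))"
    if "1 \<le> M"
    using big unfolding X
    by eventually_elim (rule sigmoid_risk[OF M order_refl t order_refl t1[OF that]], auto)
  note R = rate_optimality[where Q = "P2_H2_KB M X" and T = "\<lambda>n. neural_H2 n (relu_class n ?t M)",
      OF measR empty(1) upR lowKB]
  note S = rate_optimality[where Q = "P2_H2_B M X" and T = "\<lambda>n. neural_H2 n (sigmoid_class n ?t M)",
      OF measS empty(2) upS lowB]
  have logR: "achieves_O_log X (P2_H2_KB M X)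
        (\<lambda>n. neural_H2 n (relu_class n (inverse (?l n)) (?l n))) root_rate"
    unfolding achieves_O_log_def
  proof (intro conjI order_le_logI[of _ "2 * upper_const CARD('d)"])
    show "\<forall>\<^sub>F n in sequentially. neural_H2 n (relu_class n (inverse (?l n)) (?l n)) \<in> estimators X n"
      using big
    proof eventually_elim
      case (elim n)
      note p = log_parameters[OF M conjunct2[OF elim]]
      show ?case by (rule relu_estimator) (use p elim in auto)
    qed
    show "\<forall>\<^sub>F n in sequentially. risk (P2_H2_KB M X) n (neural_H2 n (relu_class n (inverse (?l n)) (?l n)))
      \<le> ennreal (2 * upper_const CARD('d) * ((?l n)\<^sup>2 * (1 / inverse (?l n))\<^sup>2) / sqrt (real n))"
      using big
    proof eventually_elim
      case (elim n)
      note p = log_parameters[OF M conjunct2[OF elim]]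
      show ?case unfolding X by (rule relu_risk[OF M p(1-4) conjunct1[OF elim]])
    qed
  qed
  have logS: "achieves_O_log X (P2_H2_B M X)
        (\<lambda>n. neural_H2 n (sigmoid_class n (inverse (?l n)) (?l n))) root_rate"
    unfolding achieves_O_log_def
  proof (intro conjI order_le_logI[of _ "2 * upper_const CARD('d)"])
    show "\<forall>\<^sub>F n in sequentially. neural_H2 n (sigmoid_class n (inverse (?l n)) (?l n)) \<in> estimators X n"
      using big
    proof eventually_elim
      case (elim n)
      note p = log_parameters[OF M conjunct2[OF elim]]
      show ?case by (rule sigmoid_estimator) (use p elim in auto)
    qed
    show "\<forall>\<^sub>F n in sequentially. risk (P2_H2_B M X) n (neural_H2 n (sigmoid_class n (inverse (?l n)) (?l n)))
      \<le> ennreal (2 * upper_const CARD('d) * ((?l n)\<^sup>2 * (1 / inverse (?l n))\<^sup>2) / sqrt (real n))"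
      using big
    proof eventually_elim
      case (elim n)
      note p = log_parameters[OF M conjunct2[OF elim]]
      show ?case unfolding X by (rule sigmoid_risk[OF M p(1-4) conjunct1[OF elim] p(5)])
    qed
  qed
  show ?thesis by (intro conjI R S logR logS)
qed

end
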